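(* We have $\mathcal S^{\pm}=\mathring{\mathcal S}^{\pm}$ as subspaces of $\mathcal V^{\pm}$; thus $\widetilde\Upsilon^{\pm}$ induces isomorphisms of $\mathbb K$-algebras $$\Upsilon^{\pm}:\mathbf U^{\pm}\xrightarrow{\ \sim\ }\mathcal S^{\pm}.$$ Moreover, the pairings $\widetilde{\mathbf U}^+\otimes\mathcal V^-\to\mathbb K$ and $\mathcal V^+\otimes\widetilde{\mathbf U}^-\to\mathbb K$ descend to pairings $$\mathbf U^+\otimes\mathcal S^-\xrightarrow{\langle\cdot,\cdot\rangle}\mathbb K,\qquad \mathcal S^+\otimes\mathbf U^-\xrightarrow{\langle\cdot,\cdot\rangle}\mathbb K,$$ which are non-degenerate in both arguments, and which coincide under the isomorphisms $\Upsilon^\pm$, i.e. $\langle\phi,\Upsilon^-(\psi)\rangle=\langle\Upsilon^+(\phi),\psi\rangle$ for all $\phi\in\mathbf U^+$, $\psi\in\mathbf U^-$.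
   Context: Notation: $\mathbb N=\{0,1,2,\dots\}$; $\mathbb K$ is a field of characteristic $0$; $I$ is a finite set; $\delta_{ij}$ is the Kronecker delta; $\varsigma^i\in\mathbb N^I$ has entry $1$ in position $i$ and $0$ elsewhere; for $\mathbf n=(n_i)_{i\in I}\in\mathbb N^I$, $|\mathbf n|=\sum_i n_i$ and $\mathbf n!=\prod_i n_i!$. Fix non-zero Laurent polynomials $\zeta_{ij}(x)\in\mathbb K[x^{\pm1}]$ for $i\ne j$ in $I$ and non-zero rational functions $\zeta_{ii}(x)\in\frac{1}{1-x}\mathbb K[x^{\pm1}]$ for $i\in I$. Quadratic quantum loop groups. $\widetilde{\mathbf U}^+$ is the $\mathbb K$-algebra generated by $\{e_{i,d}\}_{i\in I,d\in\mathbb Z}$ modulo $e_i(z)e_j(w)\zeta_{ji}(w/z)=e_j(w)e_i(z)\zeta_{ij}(z/w)$ for all $i,j\in I$, where $e_i(z)=\sum_{d\in\mathbb Z}e_{i,d}z^{-d}$ and the relation means equality of all coefficients of monomials $z^aw^b$ (if $i=j$, one first clears the denominators $z-w$). $\widetilde{\mathbf U}^-$ is the $\mathbb K$-algebra generated by $\{f_{i,d}\}_{i\in I,d\in\mathbb Z}$ modulo $f_i(z)f_j(w)\zeta_{ij}(z/w)=f_j(w)f_i(z)\zeta_{ji}(w/z)$, with the same conventions, $f_i(z)=\sum_d f_{i,d}z^{-d}$. Big shuffle algebras. As vector spaces $\mathcal V^+=\mathcal V^-=\bigoplus_{\mathbf n\in\mathbb N^I}\mathbb K[z_{i1}^{\pm1},\dots,z_{in_i}^{\pm1}]_{i\in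 I}^{\mathrm{sym}}$, where sym (resp. Sym) means symmetric (resp. symmetrization, i.e. sum over $\prod_i S(n_i)$) in $z_{i1},z_{i2},\dots$ for each $i\in I$ separately; the $\mathbf n$-th summand is denoted $\mathcal V_{\mathbf n}$ in $\mathcal V^+$ and $\mathcal V_{-\mathbf n}$ in $\mathcal V^-$. The product of $R\in\mathcal V_{\mathbf n}$, $R'\in\mathcal V_{\mathbf n'}$ in $\mathcal V^+$ is $$R*R'=\mathrm{Sym}\Big[\tfrac{R(\dots,z_{i1},\dots,z_{in_i},\dots)R'(\dots,z_{i,n_i+1},\dots,z_{i,n_i+n_i'},\dots)}{\mathbf n!\,\mathbf n'!}\prod_{i,j\in I}\ \prod_{1\le a\le n_i,\ n_j<b\le n_j+n'_j}\zeta_{ij}\big(\tfrac{z_{ia}}{z_{jb}}\big)\Big];$$ in $\mathcal V^-$ one replaces $\zeta_{ij}(z_{ia}/z_{jb})$ by $\zeta_{ji}(z_{jb}/z_{ia})$. There are $\mathbb K$-algebra homomorphisms $\widetilde\Upsilon^\pm:\widetilde{\mathbf U}^\pm\to\mathcal V^\pm$ with $e_{i,d}\mapsto z_{i1}^d$ and $f_{i,d}\mapsto z_{i1}^d$ respectively. Put $K^\pm=\operatorname{Ker}\widetilde\Upsilon^\pm$, $\mathbf U^\pm=\widetilde{\mathbf U}^\pm/K^\pm$ (quantum loop groups), $\mathring{\mathcal S}^\pm=\operatorname{Im}\widetilde\Upsilon^\pm$. Pairings. For a rational function $F$, $\int_{|z_1|\gg\dots\gg|z_n|}F\prod_aDz_a$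 denotes the constant term of the expansion of $F$ in the region $|z_1|\gg\dots\gg|z_n|$ (i.e. as a Laurent series in $z_2/z_1,\dots,z_n/z_{n-1}$); similarly for $\ll$. There are well-defined bilinear pairings $\widetilde{\mathbf U}^+\otimes\mathcal V^-\to\mathbb K$ and $\mathcal V^+\otimes\widetilde{\mathbf U}^-\to\mathbb K$ given, for $R^\pm\in\mathcal V_{\pm\mathbf n}$, by $$\langle e_{i_1,d_1}\cdots e_{i_n,d_n},R^-\rangle=\int_{|z_1|\gg\dots\gg|z_n|}\frac{z_1^{d_1}\cdots z_n^{d_n}R^-(z_1,\dots,z_n)}{\prod_{a<b}\zeta_{i_bi_a}(z_b/z_a)}\prod_aDz_a,$$ $$\langle R^+,f_{i_1,-d_1}\cdots f_{i_n,-d_n}\rangle=\int_{|z_1|\ll\dots\ll|z_n|}\frac{z_1^{-d_1}\cdots z_n^{-d_n}R^+(z_1,\dots,z_n)}{\prod_{a<b}\zeta_{i_ai_b}(z_a/z_b)}\prod_aDz_a$$ if $\varsigma^{i_1}+\dots+\varsigma^{i_n}=\mathbf n$, and $0$ otherwise; here $z_a$ is identified with a variable $z_{i_a\bullet_a}$ of $R^\pm$, with the $\bullet_a\in\{1,\dots,n_{i_a}\}$ chosen so that distinct $a$ give distinct variables. Shuffle algebras: $\mathcal S^-=\{R\in\mathcal V^-:\langle K^+,R\rangle=0\}$ and $\mathcal S^+=\{R\in\mathcal V^+:\langle R,K^-\rangle=0\}$. *)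

theory Defs
  imports
    "HOL-Library.Poly_Mapping"
    "HOL-Library.Countable"
    "HOL-Computational_Algebra.Fraction_Field"
    "HOL-Combinatorics.Permutations"
    "HOL-Algebra.QuotRing"
    "HOL-Algebra.Module"
    "HOL-Algebra.Algebraic_Closure_Type"
begin

section \<open>Laurent polynomials and rational functions in the variables \<open>z\<^sub>i\<^sub>a\<close>\<close>

text \<open>\<open>ZVar i a\<close> is the variable \<open>z\<^sub>i\<^sub>a\<close>, with \<open>a\<close> counted from \<open>1\<close>.\<close>

datatype 'i var = ZVar 'i nat

text \<open>
  The order on variables is a technical device without mathematical meaning: it triggers the
  library proof that Laurent polynomials form an integral domain, so that their field of fractions
  can be formed.
\<close>

fun var_code :: "'i::countable var \<Rightarrow> nat" where
  "var_code (ZVar i a) = prod_encode (to_nat i, a)"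

lemma var_code_inject: "var_code x = var_code y \<longleftrightarrow> x = y"
  by (cases x; cases y) (auto simp: prod_encode_eq)

instantiation var :: (countable) linorder
begin

definition less_eq_var :: "'a var \<Rightarrow> 'a var \<Rightarrow> bool" where
  "x \<le> y \<longleftrightarrow> var_code x \<le> var_code y"

definition less_var :: "'a var \<Rightarrow> 'a var \<Rightarrow> bool" where
  "x < y \<longleftrightarrow> var_code x < var_code y"

instance
  by standard (auto simp: less_eq_var_def less_var_def var_code_inject)

end

text \<open>
  The Laurent polynomial ring is the group ring of the free abelian group of monomials; the
  exponent of \<open>v\<close> in the monomial \<open>m\<close> is \<open>lookup m v\<close>.
\<close>

type_synonym ('v, 'k) laurent = "('v \<Rightarrow>\<^sub>0 int) \<Rightarrow>\<^sub>0 'k"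
type_synonym ('v, 'k) ratfun = "('v, 'k) laurent fract"

definition to_ratfun :: "('v::linorder, 'k::field) laurent \<Rightarrow> ('v, 'k) ratfun" where
  "to_ratfun P = Fraction_Field.Fract P 1"

definition rat_const :: "'k::field \<Rightarrow> ('v::linorder, 'k) ratfun" where
  "rat_const c = to_ratfun (Poly_Mapping.single 0 c)"

definition rat_var :: "'v::linorder \<Rightarrow> ('v, 'k::field) ratfun" where
  "rat_var v = to_ratfun (Poly_Mapping.single (Poly_Mapping.single v 1) 1)"

text \<open>The Laurent polynomial that a rational function happens to be.\<close>

definition laurent_of :: "('v::linorder, 'k::field) ratfun \<Rightarrow> ('v, 'k) laurent" where
  "laurent_of r = (THE P. to_ratfun P = r)"

definition laurent_subst ::
  "('v::linorder, 'k::field) laurent \<Rightarrow> ('v \<Rightarrow> ('v, 'k) ratfun) \<Rightarrow> ('v, 'k) ratfun" where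
  "laurent_subst P x =
    (\<Sum>m\<in>Poly_Mapping.keys P. rat_const (Poly_Mapping.lookup P m) *
       (\<Prod>v\<in>Poly_Mapping.keys m. x v powi Poly_Mapping.lookup m v))"


section \<open>The functions \<open>\<zeta>\<^sub>i\<^sub>j\<close>\<close>

text \<open>
  The data \<open>\<zeta>\<^sub>i\<^sub>j\<close> are given by their numerators \<open>p i j\<close>, which are elements of
  \<open>K[x, 1/x]\<close> (finitely supported functions of the exponent):
  \<open>\<zeta>\<^sub>i\<^sub>j(x) = p i j (x)\<close> for \<open>i \<noteq> j\<close>, and \<open>\<zeta>\<^sub>i\<^sub>i(x) = p i i (x) / (1 - x)\<close>. Non-zero
  numerators correspond to non-zero \<open>\<zeta>\<^sub>i\<^sub>j\<close>, and every admissible \<open>\<zeta>\<^sub>i\<^sub>j\<close> has exactly one numerator.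
\<close>

type_synonym ('i, 'k) zeta_data = "'i \<Rightarrow> 'i \<Rightarrow> (int \<Rightarrow>\<^sub>0 'k)"

definition zeta ::
  "('i, 'k::field) zeta_data \<Rightarrow> 'i \<Rightarrow> 'i \<Rightarrow> ('v::linorder, 'k) ratfun \<Rightarrow> ('v, 'k) ratfun" where
  "zeta p i j x =
    (\<Sum>k\<in>Poly_Mapping.keys (p i j). rat_const (Poly_Mapping.lookup (p i j) k) * x powi k)
      / (if i = j then 1 - x else 1)"

text \<open>The superscripts \<open>+\<close> and \<open>-\<close>.\<close>

datatype half = Positive | Negative

fun opposite :: "half \<Rightarrow> half" where
  "opposite Positive = Negative"
| "opposite Negative = Positive"


section \<open>Algebras over a field given by a type\<close>

text \<open>
  The locale \<open>algebra\<close> of the library is restricted to commutative algebras.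
\<close>

definition is_algebra :: "('k::field, 'a, 'm) module_scheme \<Rightarrow> bool" where
  "is_algebra A \<longleftrightarrow>
     ring A \<and> module (ring_of_type_algebra :: 'k ring) A \<and>
     (\<forall>c. \<forall>x\<in>carrier A. \<forall>y\<in>carrier A.
        (c \<odot>\<^bsub>A\<^esub> x) \<otimes>\<^bsub>A\<^esub> y = c \<odot>\<^bsub>A\<^esub> (x \<otimes>\<^bsub>A\<^esub> y) \<and>
        x \<otimes>\<^bsub>A\<^esub> (c \<odot>\<^bsub>A\<^esub> y) = c \<odot>\<^bsub>A\<^esub> (x \<otimes>\<^bsub>A\<^esub> y))"

definition algebra_iso ::
  "('k::field, 'a, 'm) module_scheme \<Rightarrow> ('k, 'b, 'n) module_scheme \<Rightarrow> ('a \<Rightarrow> 'b) set" where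
  "algebra_iso A B =
     {h. is_algebra A \<and> is_algebra B \<and> h \<in> ring_iso A B \<and>
         (\<forall>c. \<forall>x\<in>carrier A. h (c \<odot>\<^bsub>A\<^esub> x) = c \<odot>\<^bsub>B\<^esub> h x)}"

definition quotient_algebra ::
  "('k::field, 'a, 'm) module_scheme \<Rightarrow> 'a set \<Rightarrow> ('k, 'a set) module" where
  "quotient_algebra A J =
     ring.extend (A Quot J) (module.fields (\<lambda>c Y. \<Union>x\<in>Y. J +>\<^bsub>A\<^esub> (c \<odot>\<^bsub>A\<^esub> x)))"

definition bilinear_pairing ::
  "('k::field, 'a, 'm) module_scheme \<Rightarrow> ('k, 'b, 'n) module_scheme \<Rightarrow> ('a \<Rightarrow> 'b \<Rightarrow> 'k) \<Rightarrow> bool" where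
  "bilinear_pairing A B f \<longleftrightarrow>
     (\<forall>x\<in>carrier A. \<forall>x'\<in>carrier A. \<forall>y\<in>carrier B. f (x \<oplus>\<^bsub>A\<^esub> x') y = f x y + f x' y) \<and>
     (\<forall>x\<in>carrier A. \<forall>y\<in>carrier B. \<forall>y'\<in>carrier B. f x (y \<oplus>\<^bsub>B\<^esub> y') = f x y + f x y') \<and>
     (\<forall>c. \<forall>x\<in>carrier A. \<forall>y\<in>carrier B.
        f (c \<odot>\<^bsub>A\<^esub> x) y = c * f x y \<and> f x (c \<odot>\<^bsub>B\<^esub> y) = c * f x y)"

definition nondegenerate_pairing ::
  "('k::field, 'a, 'm) module_scheme \<Rightarrow> ('k, 'b, 'n) module_scheme \<Rightarrow> ('a \<Rightarrow> 'b \<Rightarrow> 'k) \<Rightarrow> bool" where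
  "nondegenerate_pairing A B f \<longleftrightarrow>
     (\<forall>x\<in>carrier A. (\<forall>y\<in>carrier B. f x y = 0) \<longrightarrow> x = \<zero>\<^bsub>A\<^esub>) \<and>
     (\<forall>y\<in>carrier B. (\<forall>x\<in>carrier A. f x y = 0) \<longrightarrow> y = \<zero>\<^bsub>B\<^esub>)"


section \<open>Quadratic quantum loop groups\<close>

datatype 'a fword = FWord (letters: "'a list")

instantiation fword :: (type) monoid_add
begin

definition zero_fword :: "'a fword" where
  "0 = FWord []"

definition plus_fword :: "'a fword \<Rightarrow> 'a fword \<Rightarrow> 'a fword" where
  "u + v = FWord (letters u @ letters v)"

instance
  by standard (auto simp: zero_fword_def plus_fword_def)

end

text \<open>
  The free algebra on the letters \<open>(i, d)\<close> is the monoid algebra of the free monoid.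
  The letter \<open>(i, d)\<close> stands for \<open>e\<^sub>i\<^sub>,\<^sub>d\<close> or for \<open>f\<^sub>i\<^sub>,\<^sub>d\<close>, depending on the half.
\<close>

type_synonym ('i, 'k) free = "('i \<times> int) fword \<Rightarrow>\<^sub>0 'k"

definition free_algebra :: "('k::field, ('i, 'k) free) module" where
  "free_algebra =
     \<lparr>carrier = UNIV, monoid.mult = (*), one = 1, ring.zero = 0, add = (+),
      module.smult = (\<lambda>c u. Poly_Mapping.single 0 c * u)\<rparr>"

text \<open>
  The difference of the coefficients of \<open>z\<^sup>-\<^sup>a w\<^sup>-\<^sup>b\<close> in the two sides of the relation
  \<open>e\<^sub>i(z) e\<^sub>j(w) \<zeta>\<^sub>j\<^sub>i(w/z) = e\<^sub>j(w) e\<^sub>i(z) \<zeta>\<^sub>i\<^sub>j(z/w)\<close>, respectively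
  \<open>f\<^sub>i(z) f\<^sub>j(w) \<zeta>\<^sub>i\<^sub>j(z/w) = f\<^sub>j(w) f\<^sub>i(z) \<zeta>\<^sub>j\<^sub>i(w/z)\<close>.
  For \<open>i = j\<close> the relation has first been multiplied by \<open>z - w\<close>, respectively \<open>w - z\<close>: with
  \<open>p = p i i\<close> it becomes
  \<open>e\<^sub>i(z) e\<^sub>i(w) p(w/z) z = - e\<^sub>i(w) e\<^sub>i(z) p(z/w) w\<close>, respectively
  \<open>f\<^sub>i(z) f\<^sub>i(w) p(z/w) w = - f\<^sub>i(w) f\<^sub>i(z) p(w/z) z\<close>. The extra factors \<open>z\<close>, \<open>w\<close> and the sign
  account for \<open>\<delta>\<close> and \<open>\<epsilon>\<close>.
\<close>

fun quadratic_relation ::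
  "('i, 'k::field) zeta_data \<Rightarrow> half \<Rightarrow> 'i \<Rightarrow> 'i \<Rightarrow> int \<Rightarrow> int \<Rightarrow> ('i, 'k) free" where
  "quadratic_relation p Positive i j a b =
     (let \<delta> = (if i = j then 1 else 0); \<epsilon> = (if i = j then -1 else 1) in
       (\<Sum>k\<in>Poly_Mapping.keys (p j i).
          Poly_Mapping.single (FWord [(i, a + \<delta> - k), (j, b + k)]) (Poly_Mapping.lookup (p j i) k)) -
       (\<Sum>k\<in>Poly_Mapping.keys (p i j).
          Poly_Mapping.single (FWord [(j, b + \<delta> - k), (i, a + k)]) (\<epsilon> * Poly_Mapping.lookup (p i j) k)))"
| "quadratic_relation p Negative i j a b =
     (let \<delta> = (if i = j then 1 else 0); \<epsilon> = (if i = j then -1 else 1) in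
       (\<Sum>k\<in>Poly_Mapping.keys (p i j).
          Poly_Mapping.single (FWord [(i, a + k), (j, b + \<delta> - k)]) (Poly_Mapping.lookup (p i j) k)) -
       (\<Sum>k\<in>Poly_Mapping.keys (p j i).
          Poly_Mapping.single (FWord [(j, b + k), (i, a + \<delta> - k)]) (\<epsilon> * Poly_Mapping.lookup (p j i) k)))"

definition quadratic_ideal :: "('i, 'k::field) zeta_data \<Rightarrow> half \<Rightarrow> ('i, 'k) free set" where
  "quadratic_ideal p s = genideal free_algebra {quadratic_relation p s i j a b | i j a b. True}"

definition qloop_tilde :: "('i, 'k::field) zeta_data \<Rightarrow> half \<Rightarrow> ('k, ('i, 'k) free set) module" where
  "qloop_tilde p s = quotient_algebra free_algebra (quadratic_ideal p s)"


section \<open>Big shuffle algebras\<close>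

definition color_perms :: "('i \<Rightarrow> nat) \<Rightarrow> ('i \<Rightarrow> nat \<Rightarrow> nat) set" where
  "color_perms n = {\<sigma>. \<forall>i. \<sigma> i permutes {1..n i}}"

definition V_graded :: "('i::finite \<Rightarrow> nat) \<Rightarrow> ('i var, 'k::field) laurent set" where
  "V_graded n =
     {R. (\<forall>m\<in>Poly_Mapping.keys R. Poly_Mapping.keys m \<subseteq> {ZVar i a | i a. a \<in> {1..n i}}) \<and>
         (\<forall>\<sigma>\<in>color_perms n. laurent_subst R (case_var (\<lambda>i a. rat_var (ZVar i (\<sigma> i a)))) = to_ratfun R)}"

fun shuffle_factor ::
  "('i, 'k::field) zeta_data \<Rightarrow> half \<Rightarrow> 'i \<Rightarrow> 'i \<Rightarrow>
     ('v::linorder, 'k) ratfun \<Rightarrow> ('v, 'k) ratfun \<Rightarrow> ('v, 'k) ratfun" where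
  "shuffle_factor p Positive i j x y = zeta p i j (x / y)"
| "shuffle_factor p Negative i j x y = zeta p j i (y / x)"

text \<open>
  The product of the homogeneous elements \<open>R\<close> of degree \<open>n\<close> and \<open>R'\<close> of degree \<open>n'\<close>. The sum is
  computed in the field of rational functions; its poles cancel.
\<close>

definition shuffle_product ::
  "('i::finite, 'k::field_char_0) zeta_data \<Rightarrow> half \<Rightarrow> ('i \<Rightarrow> nat) \<Rightarrow> ('i \<Rightarrow> nat) \<Rightarrow>
     ('i var, 'k) laurent \<Rightarrow> ('i var, 'k) laurent \<Rightarrow> ('i var, 'k) laurent" where
  "shuffle_product p s n n' R R' =
     laurent_of (\<Sum>\<sigma>\<in>color_perms (\<lambda>i. n i + n' i).
       let z = (\<lambda>i a. rat_var (ZVar i (\<sigma> i a))) in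
         laurent_subst R (case_var (\<lambda>i a. z i a)) * laurent_subst R' (case_var (\<lambda>i a. z i (n i + a)))
           / of_nat ((\<Prod>i\<in>UNIV. fact (n i)) * (\<Prod>i\<in>UNIV. fact (n' i)))
           * (\<Prod>i\<in>UNIV. \<Prod>j\<in>UNIV. \<Prod>a\<in>{1..n i}. \<Prod>b\<in>{n j<..n j + n' j}.
                shuffle_factor p s i j (z i a) (z j b)))"

text \<open>An element of the direct sum is the finitely supported family of its components.\<close>

type_synonym ('i, 'k) shuffle = "('i \<Rightarrow> nat) \<Rightarrow>\<^sub>0 ('i var, 'k) laurent"

definition big_shuffle :: "('i::finite, 'k::field_char_0) zeta_data \<Rightarrow> half \<Rightarrow> ('k, ('i, 'k) shuffle) module" where
  "big_shuffle p s =
     \<lparr>carrier = {F. \<forall>n. Poly_Mapping.lookup F n \<in> V_graded n},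
      monoid.mult = (\<lambda>F G. \<Sum>n\<in>Poly_Mapping.keys F. \<Sum>n'\<in>Poly_Mapping.keys G.
        Poly_Mapping.single (\<lambda>i. n i + n' i)
          (shuffle_product p s n n' (Poly_Mapping.lookup F n) (Poly_Mapping.lookup G n'))),
      one = Poly_Mapping.single (\<lambda>_. 0) 1,
      ring.zero = 0,
      add = (+),
      module.smult = (\<lambda>c. Poly_Mapping.map (\<lambda>P. Poly_Mapping.single 0 c * P))\<rparr>"


section \<open>The homomorphisms from the quadratic quantum loop groups to the big shuffle algebras\<close>

text \<open>The element \<open>z\<^sub>i\<^sub>1\<^sup>d\<close> of degree \<open>\<varsigma>\<^sup>i\<close>.\<close>

definition shuffle_gen :: "'i \<Rightarrow> int \<Rightarrow> ('i::finite, 'k::field_char_0) shuffle" where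
  "shuffle_gen i d =
     Poly_Mapping.single (\<lambda>j. if j = i then 1 else 0)
       (Poly_Mapping.single (Poly_Mapping.single (ZVar i 1) d) 1)"

definition Upsilon_free ::
  "('i::finite, 'k::field_char_0) zeta_data \<Rightarrow> half \<Rightarrow> ('i, 'k) free \<Rightarrow> ('i, 'k) shuffle" where
  "Upsilon_free p s u =
     (\<Sum>w\<in>Poly_Mapping.keys u. Poly_Mapping.lookup u w \<odot>\<^bsub>big_shuffle p s\<^esub>
        foldr (\<lambda>(i, d) F. shuffle_gen i d \<otimes>\<^bsub>big_shuffle p s\<^esub> F) (letters w) \<one>\<^bsub>big_shuffle p s\<^esub>)"

text \<open>
  Functions on quotients are given by their common value on the representatives of a class, in the
  style of the library's first isomorphism theorem (\<open>ring_hom_ring.FactRing_iso_set\<close>).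
\<close>

definition Upsilon_tilde ::
  "('i::finite, 'k::field_char_0) zeta_data \<Rightarrow> half \<Rightarrow> ('i, 'k) free set \<Rightarrow> ('i, 'k) shuffle" where
  "Upsilon_tilde p s Y = the_elem (Upsilon_free p s ` Y)"

definition Upsilon_kernel ::
  "('i::finite, 'k::field_char_0) zeta_data \<Rightarrow> half \<Rightarrow> ('i, 'k) free set set" where
  "Upsilon_kernel p s = a_kernel (qloop_tilde p s) (big_shuffle p s) (Upsilon_tilde p s)"

definition qloop ::
  "('i::finite, 'k::field_char_0) zeta_data \<Rightarrow> half \<Rightarrow> ('k, ('i, 'k) free set set) module" where
  "qloop p s = quotient_algebra (qloop_tilde p s) (Upsilon_kernel p s)"

definition qloop_class ::
  "('i::finite, 'k::field_char_0) zeta_data \<Rightarrow> half \<Rightarrow> ('i, 'k) free set \<Rightarrow> ('i, 'k) free set set" where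
  "qloop_class p s x = Upsilon_kernel p s +>\<^bsub>qloop_tilde p s\<^esub> x"

definition Upsilon ::
  "('i::finite, 'k::field_char_0) zeta_data \<Rightarrow> half \<Rightarrow> ('i, 'k) free set set \<Rightarrow> ('i, 'k) shuffle" where
  "Upsilon p s Y = the_elem (Upsilon_tilde p s ` Y)"

definition shuffle_image ::
  "('i::finite, 'k::field_char_0) zeta_data \<Rightarrow> half \<Rightarrow> ('i, 'k) shuffle set" where
  "shuffle_image p s = Upsilon_tilde p s ` carrier (qloop_tilde p s)"


section \<open>Expansions of rational functions\<close>

text \<open>
  For \<open>vs = [v\<^sub>1, \<dots>, v\<^sub>n]\<close> the region is \<open>|v\<^sub>1| \<gg> \<dots> \<gg> |v\<^sub>n|\<close>. The set \<open>expansion_cone vs\<close> consists of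
  the exponents of the monomials in \<open>v\<^sub>2/v\<^sub>1, \<dots>, v\<^sub>n/v\<^sub>n\<^sub>-\<^sub>1\<close> with exponents in the natural numbers.
  A formal series, given by its coefficients, is admissible in the region if it is a finite sum of
  Laurent monomials times power series in \<open>v\<^sub>2/v\<^sub>1, \<dots>, v\<^sub>n/v\<^sub>n\<^sub>-\<^sub>1\<close>. These monomials are not assumed
  to be of total degree \<open>0\<close>, as the integrands below are not.
\<close>

definition expansion_cone :: "'v list \<Rightarrow> ('v \<Rightarrow>\<^sub>0 int) set" where
  "expansion_cone vs =
     {\<Sum>k<length vs - 1. Poly_Mapping.single (vs ! Suc k) (int (c k)) -
                          Poly_Mapping.single (vs ! k) (int (c k)) | c :: nat \<Rightarrow> nat. True}"

definition admissible_series :: "'v list \<Rightarrow> (('v \<Rightarrow>\<^sub>0 int) \<Rightarrow> 'k::field) \<Rightarrow> bool" where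
  "admissible_series vs c \<longleftrightarrow>
     (\<exists>M. finite M \<and> (\<forall>m. c m \<noteq> 0 \<longrightarrow> (\<exists>m0\<in>M. m - m0 \<in> expansion_cone vs)))"

text \<open>
  An admissible series \<open>c\<close> is the expansion of \<open>F = N / D\<close> if \<open>D \<cdot> c = N\<close>. Admissible series are
  torsion-free over Laurent polynomials when the entries of \<open>vs\<close> are distinct, so this determines
  \<open>c\<close> and does not depend on the choice of \<open>N\<close> and \<open>D\<close>.
\<close>

definition is_expansion ::
  "'v::linorder list \<Rightarrow> ('v, 'k::field) ratfun \<Rightarrow> (('v \<Rightarrow>\<^sub>0 int) \<Rightarrow> 'k) \<Rightarrow> bool" where
  "is_expansion vs F c \<longleftrightarrow>
     admissible_series vs c \<and>
     (\<exists>N D. D \<noteq> 0 \<and> F = Fraction_Field.Fract N D \<and>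
        (\<forall>m. (\<Sum>l\<in>Poly_Mapping.keys D. Poly_Mapping.lookup D l * c (m - l)) = Poly_Mapping.lookup N m))"

definition constant_term :: "'v::linorder list \<Rightarrow> ('v, 'k::field) ratfun \<Rightarrow> 'k" where
  "constant_term vs F = (THE x. \<exists>c. is_expansion vs F c \<and> x = c 0)"


section \<open>Pairings and shuffle algebras\<close>

definition word_weight :: "('i \<times> int) list \<Rightarrow> 'i \<Rightarrow> nat" where
  "word_weight w i = count_list (map fst w) i"

text \<open>
  The variable of \<open>R\<close> that is identified with the \<open>a\<close>-th integration variable (\<open>a\<close> counted from \<open>0\<close>):
  the letters of color \<open>i\<close> receive \<open>z\<^sub>i\<^sub>1, z\<^sub>i\<^sub>2, \<dots>\<close> from left to right.
\<close>

definition word_var :: "('i \<times> int) list \<Rightarrow> nat \<Rightarrow> 'i var" where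
  "word_var w a = ZVar (fst (w ! a)) (card {b. b \<le> a \<and> fst (w ! b) = fst (w ! a)})"

text \<open>
  The pairing of the word \<open>e\<^sub>i\<^sub>1\<^sub>,\<^sub>d\<^sub>1 \<dots> e\<^sub>i\<^sub>n\<^sub>,\<^sub>d\<^sub>n\<close> (first equation), respectively \<open>f\<^sub>i\<^sub>1\<^sub>,\<^sub>d\<^sub>1 \<dots> f\<^sub>i\<^sub>n\<^sub>,\<^sub>d\<^sub>n\<close>
  (second equation), with an \<open>R\<close> of degree \<open>word_weight w\<close> in the opposite big shuffle algebra.
\<close>

fun word_pairing ::
  "('i::finite, 'k::field_char_0) zeta_data \<Rightarrow> half \<Rightarrow> ('i \<times> int) list \<Rightarrow> ('i var, 'k) laurent \<Rightarrow> 'k" where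
  "word_pairing p Positive w R =
     (let z = (\<lambda>a. rat_var (word_var w a)); i = (\<lambda>a. fst (w ! a)); d = (\<lambda>a. snd (w ! a)) in
        constant_term (map (word_var w) [0..<length w])
          ((\<Prod>a<length w. z a powi d a) * to_ratfun R
             / (\<Prod>b<length w. \<Prod>a<b. zeta p (i b) (i a) (z b / z a))))"
| "word_pairing p Negative w R =
     (let z = (\<lambda>a. rat_var (word_var w a)); i = (\<lambda>a. fst (w ! a)); d = (\<lambda>a. snd (w ! a)) in
        constant_term (rev (map (word_var w) [0..<length w]))
          ((\<Prod>a<length w. z a powi d a) * to_ratfun R
             / (\<Prod>b<length w. \<Prod>a<b. zeta p (i a) (i b) (z a / z b))))"

definition free_pairing ::
  "('i::finite, 'k::field_char_0) zeta_data \<Rightarrow> half \<Rightarrow> ('i, 'k) free \<Rightarrow> ('i, 'k) shuffle \<Rightarrow> 'k" where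
  "free_pairing p s u R =
     (\<Sum>w\<in>Poly_Mapping.keys u. Poly_Mapping.lookup u w *
        word_pairing p s (letters w) (Poly_Mapping.lookup R (word_weight (letters w))))"

text \<open>
  In the following pairings the quantum loop group is always the first argument:
  \<open>pairing_tilde p Positive x R\<close> is \<open>\<langle>x, R\<rangle>\<close> with \<open>R\<close> in \<open>big_shuffle p Negative\<close>, while
  \<open>pairing_tilde p Negative y R\<close> is \<open>\<langle>R, y\<rangle>\<close> with \<open>R\<close> in \<open>big_shuffle p Positive\<close>.
\<close>

definition pairing_tilde ::
  "('i::finite, 'k::field_char_0) zeta_data \<Rightarrow> half \<Rightarrow> ('i, 'k) free set \<Rightarrow> ('i, 'k) shuffle \<Rightarrow> 'k" where
  "pairing_tilde p s Y R = the_elem ((\<lambda>u. free_pairing p s u R) ` Y)"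

definition pairing ::
  "('i::finite, 'k::field_char_0) zeta_data \<Rightarrow> half \<Rightarrow> ('i, 'k) free set set \<Rightarrow> ('i, 'k) shuffle \<Rightarrow> 'k" where
  "pairing p s Y R = the_elem ((\<lambda>x. pairing_tilde p s x R) ` Y)"

definition shuffle_space :: "('i::finite, 'k::field_char_0) zeta_data \<Rightarrow> half \<Rightarrow> ('i, 'k) shuffle set" where
  "shuffle_space p s = {R \<in> carrier (big_shuffle p s). \<forall>x\<in>Upsilon_kernel p (opposite s). pairing_tilde p (opposite s) x R = 0}"

definition shuffle_algebra ::
  "('i::finite, 'k::field_char_0) zeta_data \<Rightarrow> half \<Rightarrow> ('k, ('i, 'k) shuffle) module" where
  "shuffle_algebra p s = (big_shuffle p s)\<lparr>carrier := shuffle_space p s\<rparr>"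

end

theory Submission
  imports Defs "HOL-Computational_Algebra.Formal_Laurent_Series"
begin

text \<open>
  Everything is governed by one bilinear form. For elements \<open>u\<close> and \<open>v\<close> of the free algebras of
  opposite halves let \<open>gram s u v\<close> be the pairing of \<open>u\<close> with the image of \<open>v\<close>. The image of a word is
  the symmetrization of its monomial times the product of the \<open>\<zeta>\<close>-factors over all pairs of its
  variables. Inserted into the constant term, each summand of the symmetrization leaves a quotient of
  two such products, for two orders of the same variables. Only the pairs that the orders invert
  survive in it, so that it has the same expansion in both regions, and renaming the variables shows
  that \<open>gram\<close> is symmetric (\<open>word_pairing_adjoint\<close>, \<open>gram_sym\<close>). A Laurent polynomial is determined
  by its pairings with words (\<open>word_pairing_nondegenerate\<close>). Hence the kernel of \<open>\<Upsilon>\<close> is the radical of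
  \<open>gram\<close>; the quadratic relations belong to it, since multiplication with them removes the only factor
  that distinguishes the two orders of adjacent variables (\<open>relation_pairing\<close>). The isomorphism, the
  non-degeneracy of the descended pairings and their coincidence are then formal, once the shuffle
  space is known to be the image.

  The image lies in the shuffle space by symmetry. Conversely, let \<open>R\<close> be orthogonal to the radical. It
  has to be shown that the linear form \<open>u \<mapsto> \<langle>u, R\<rangle>\<close> is \<open>gram y\<close> for some \<open>y\<close>. The words of a
  given length \<open>n\<close> and height \<open>d\<close> (the sum of the exponents, with the sign of the half) are infinite
  in number, but expansions have supports that are bounded on one side, so the form vanishes on all
  words that have a prefix of very low height. Thus it suffices to prove
  (\<open>represents_exists\<close>): if \<open>\<pi>\<close> is a sufficiently convex path from \<open>\<pi> 0 = 0\<close> to \<open>\<pi> n = d\<close>, then each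
  linear form that vanishes on the radical and on the words with an inner prefix below \<open>\<pi>\<close> is of the
  form \<open>gram y\<close>, where \<open>y\<close> is orthogonal to those words. By duality (\<open>splits_imp_represents\<close>) this
  follows from two facts.

  The first is that the elements orthogonal to the words below \<open>\<pi>\<close> form a space of finite dimension
  modulo the radical (\<open>finite_detection\<close>): every variable can be put first in the order of expansion,
  so the exponents of the images of these elements are bounded, and dual bases exist
  (\<open>finite_rank_decomposition\<close>).

  The second is that each element is the sum of an element orthogonal to the words below \<open>\<pi>\<close> and of a
  combination of words below \<open>\<pi>\<close>. For this \<open>\<pi>\<close> is first lowered until the given element is orthogonal
  to the words below the path, and then raised again, one unit at one place \<open>k\<close> at a time
  (\<open>raise_path\<close>). At such a step only the words whose prefix of length \<open>k\<close> has height exactly \<open>\<pi> k\<close> are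
  new, and on them the form is a bilinear form in the two parts of the word. By induction on the
  length it is represented by a combination of products \<open>a * b\<close>, whose terms are words
  that lie below the raised path, and this combination is subtracted. That products behave so well is due to
  convexity (\<open>low_mult\<close>): a shuffle of two words that moves \<open>m\<close> variables past \<open>b\<close> others may lower the
  height of a prefix by at most a constant times \<open>m * b\<close> (\<open>tcoeff_bound\<close>), and a convex path leaves
  more room than this (\<open>curved_conv\<close>), so that at the lowest admissible height of the prefix
  only the trivial shuffles contribute.
\<close>

abbreviation "lookup \<equiv> Poly_Mapping.lookup"
abbreviation "keys \<equiv> Poly_Mapping.keys"
abbreviation "single \<equiv> Poly_Mapping.single"

section \<open>Additive maps on finitely supported functions\<close>

lemma pm_induct [case_names zero single add]:
  assumes "P 0" "\<And>k c. P (single k c)" "\<And>f g. P f \<Longrightarrow> P g \<Longrightarrow> P (f + g)"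
  shows "P (f :: 'a \<Rightarrow>\<^sub>0 'b::comm_monoid_add)"
proof (induction f rule: Poly_Mapping.update_induct)
  case const
  show ?case by (rule assms(1))
next
  case (update f a b)
  have "Poly_Mapping.update a b f = single a b + f"
    using update(1) by (intro poly_mapping_eqI)
      (auto simp: lookup_update lookup_add lookup_single in_keys_iff when_def)
  then show ?case using assms(2,3) update by simp
qed

text \<open>
  The additive map on finitely supported functions with given values \<open>g k c\<close> on \<open>single k c\<close>.
\<close>

definition pext :: "('a \<Rightarrow> 'b \<Rightarrow> 'c) \<Rightarrow> ('a \<Rightarrow>\<^sub>0 'b::zero) \<Rightarrow> 'c::comm_monoid_add" where
  "pext g P = (\<Sum>k\<in>keys P. g k (lookup P k))"

lemma pext_zero [simp]: "pext g 0 = 0"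
  by (simp add: pext_def)

lemma pext_single: "g k 0 = 0 \<Longrightarrow> pext g (single k c) = g k c"
  by (simp add: pext_def)

lemma pext_superset:
  "finite A \<Longrightarrow> keys P \<subseteq> A \<Longrightarrow> (\<And>k. g k 0 = 0) \<Longrightarrow> pext g P = (\<Sum>k\<in>A. g k (lookup P k))"
  unfolding pext_def by (rule sum.mono_neutral_left) (auto simp: in_keys_iff)

lemma pext_add:
  "(\<And>k. g k 0 = 0) \<Longrightarrow> (\<And>k a b. g k (a + b) = g k a + g k b) \<Longrightarrow> pext g (P + Q) = pext g P + pext g Q"
  unfolding pext_def by (rule setsum_keys_plus_distrib) auto

lemma pext_diff:
  fixes g :: "'a \<Rightarrow> 'b::ab_group_add \<Rightarrow> 'c::ab_group_add"
  assumes "\<And>k. g k 0 = 0" "\<And>k a b. g k (a + b) = g k a + g k b"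
  shows "pext g (P - Q) = pext g P - pext g Q"
proof -
  have "pext g (P - Q) + pext g Q = pext g P"
    by (simp flip: pext_add add: assms)
  then show ?thesis by (simp add: algebra_simps)
qed

lemma pext_mult:
  fixes g :: "'a::monoid_add \<Rightarrow> 'b::semiring_0 \<Rightarrow> 'c::semiring_0"
  assumes z: "\<And>k. g k 0 = 0" and a: "\<And>k a b. g k (a + b) = g k a + g k b"
    and m: "\<And>k l a b. g (k + l) (a * b) = g k a * g l b"
  shows "pext g (P * Q) = pext g P * pext g Q"
proof (induction P rule: pm_induct)
  case (single k c)
  show ?case
    by (induction Q rule: pm_induct)
      (auto simp: z pext_single mult_single m distrib_left pext_add[where g=g, OF z a])
qed (auto simp: distrib_right pext_add[where g=g, OF z a])

lemma pm_sum_single: "P = (\<Sum>k\<in>keys P. single k (lookup P k))"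
proof (rule poly_mapping_eqI)
  fix k
  show "lookup P k = lookup (\<Sum>k\<in>keys P. single k (lookup P k)) k"
    by (simp add: lookup_sum lookup_single when_def in_keys_iff)
qed

lemma lookup_mult_single:
  fixes Q :: "'a::ab_group_add \<Rightarrow>\<^sub>0 'k::semiring_0"
  shows "lookup (single l a * Q) m = a * lookup Q (m - l)"
proof (induction Q rule: pm_induct)
  case (single k c)
  then show ?case by (auto simp: mult_single lookup_single when_def algebra_simps)
qed (auto simp: distrib_left lookup_add)

section \<open>Substitution of variables\<close>

definition ren_mon :: "('v \<Rightarrow> 'w) \<Rightarrow> ('v \<Rightarrow>\<^sub>0 int) \<Rightarrow> ('w \<Rightarrow>\<^sub>0 int)" where
  "ren_mon f = frag_extend (\<lambda>v. frag_of (f v))"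

lemma ren_mon_simps [simp]:
  "ren_mon f 0 = 0" "ren_mon f (a + b) = ren_mon f a + ren_mon f b"
  "ren_mon f (a - b) = ren_mon f a - ren_mon f b" "ren_mon f (- a) = - ren_mon f a"
  by (auto simp: ren_mon_def frag_extend_add frag_extend_diff frag_extend_minus)

lemma ren_mon_sum: "ren_mon f (\<Sum>x\<in>A. P x) = (\<Sum>x\<in>A. ren_mon f (P x))"
  by (induction A rule: infinite_finite_induct) auto

lemma single_int: "single v (k::int) = frag_cmul k (frag_of v)"
  by (rule poly_mapping_eqI) (auto simp: lookup_single when_def)

lemma ren_mon_single [simp]: "ren_mon f (single v k) = single (f v) k"
  unfolding ren_mon_def single_int[of v k] single_int[of "f v" k] frag_extend_cmul frag_extend_of ..

lemma ren_mon_cong: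
  assumes "\<And>v. v \<in> keys m \<Longrightarrow> f v = g v" shows "ren_mon f m = ren_mon g m"
  unfolding ren_mon_def by (rule frag_extend_eq) (auto simp: assms)

lemma ren_mon_comp: "ren_mon f (ren_mon g m) = ren_mon (f \<circ> g) m"
  by (induction m rule: pm_induct) auto

lemma ren_mon_id: "ren_mon id m = m" "ren_mon (\<lambda>x. x) m = m"
  by (induction m rule: pm_induct) auto

lemma lookup_ren_mon: "inj f \<Longrightarrow> lookup (ren_mon f m) (f v) = lookup m v"
  by (induction m rule: pm_induct) (auto simp: lookup_add lookup_single when_def inj_eq)

lemma keys_ren_mon: "keys (ren_mon f m) \<subseteq> f ` keys m"
proof -
  have "keys (ren_mon f m) \<subseteq> (\<Union>x\<in>keys m. keys (frag_of (f x)))"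
    unfolding ren_mon_def by (rule keys_frag_extend)
  then show ?thesis by auto
qed

lemma inj_ren_mon: "inj f \<Longrightarrow> inj (ren_mon f)"
  by (metis injI lookup_ren_mon poly_mapping_eqI)

definition ren_laurent :: "('v \<Rightarrow> 'w) \<Rightarrow> ('v, 'k::field) laurent \<Rightarrow> ('w, 'k) laurent" where
  "ren_laurent f = pext (\<lambda>m c. single (ren_mon f m) c)"

lemma ren_laurent_single [simp]: "ren_laurent f (single m c) = single (ren_mon f m) c"
  by (simp add: ren_laurent_def pext_single)

lemma ren_laurent_hom [simp]:
  "ren_laurent f 0 = 0" "ren_laurent f (P + Q) = ren_laurent f P + ren_laurent f Q"
  "ren_laurent f (P - Q) = ren_laurent f P - ren_laurent f Q"
  "ren_laurent f (P * Q) = ren_laurent f P * ren_laurent f Q"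
  "ren_laurent f 1 = 1"
  using pext_single[of "\<lambda>m c. single (ren_mon f m) c" 0 "1::'k::field"]
  by (auto simp: ren_laurent_def pext_add pext_diff pext_mult single_add mult_single)

lemma ren_laurent_uminus [simp]: "ren_laurent f (- P) = - ren_laurent f P"
  using ren_laurent_hom(3)[of f 0 P] by simp

lemma ren_laurent_prod: "ren_laurent f (\<Prod>x\<in>A. P x) = (\<Prod>x\<in>A. ren_laurent f (P x))"
  by (induction A rule: infinite_finite_induct) auto

lemma ren_laurent_comp: "ren_laurent f (ren_laurent g P) = ren_laurent (f \<circ> g) P"
  by (induction P rule: pm_induct) (auto simp: ren_mon_comp simp del: o_apply)

lemma ren_laurent_id: "ren_laurent id P = P" "ren_laurent (\<lambda>x. x) P = P"
  by (induction P rule: pm_induct) (auto simp: ren_mon_id)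

lemma ren_laurent_cong:
  assumes "\<And>m v. m \<in> keys P \<Longrightarrow> v \<in> keys m \<Longrightarrow> f v = g v"
  shows "ren_laurent f P = ren_laurent g P"
  unfolding ren_laurent_def pext_def
  by (rule sum.cong) (auto intro!: ren_mon_cong assms arg_cong2[where f=single])

lemma lookup_ren_laurent:
  assumes "inj f" shows "lookup (ren_laurent f P) (ren_mon f m) = lookup P m"
  by (induction P rule: pm_induct)
    (auto simp: lookup_add lookup_single when_def inj_eq[OF inj_ren_mon[OF assms]])

lemma keys_ren_laurent:
  assumes "inj f" shows "keys (ren_laurent f P) = ren_mon f ` keys P"
proof -
  have "keys (ren_laurent f P) \<subseteq> ren_mon f ` keys P"
    unfolding ren_laurent_def pext_def
    by (rule order_trans[OF keys_sum]) (auto simp: in_keys_iff)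
  then show ?thesis
    using lookup_ren_laurent[OF assms, of P] by (auto simp: in_keys_iff)
qed

lemma ren_laurent_eq_0: "inj f \<Longrightarrow> ren_laurent f P = 0 \<longleftrightarrow> P = 0"
  by (metis keys_ren_laurent image_is_empty keys_eq_empty keys_zero ren_laurent_hom(1))

section \<open>Laurent polynomials inside rational functions\<close>

lemma to_ratfun_hom [simp]:
  "to_ratfun 0 = 0" "to_ratfun 1 = 1" "to_ratfun (P + Q) = to_ratfun P + to_ratfun Q"
  "to_ratfun (P * Q) = to_ratfun P * to_ratfun Q" "to_ratfun (P - Q) = to_ratfun P - to_ratfun Q"
  "to_ratfun (- P) = - to_ratfun P"
  by (auto simp: to_ratfun_def Zero_fract_def One_fract_def)

lemma to_ratfun_eq_iff [simp]: "to_ratfun P = to_ratfun Q \<longleftrightarrow> P = Q"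
  by (simp add: to_ratfun_def eq_fract)

lemma to_ratfun_eq_0 [simp]: "to_ratfun P = 0 \<longleftrightarrow> P = 0"
  using to_ratfun_eq_iff[of P 0] by (simp del: to_ratfun_eq_iff)

lemma to_ratfun_sum: "to_ratfun (\<Sum>x\<in>A. P x) = (\<Sum>x\<in>A. to_ratfun (P x))"
  by (induction A rule: infinite_finite_induct) auto

lemma to_ratfun_prod: "to_ratfun (\<Prod>x\<in>A. P x) = (\<Prod>x\<in>A. to_ratfun (P x))"
  by (induction A rule: infinite_finite_induct) auto

lemma laurent_of_to_ratfun [simp]: "laurent_of (to_ratfun P) = P"
  by (simp add: laurent_of_def)

lemma Fract_eq: "b \<noteq> 0 \<Longrightarrow> Fraction_Field.Fract a b = to_ratfun a / to_ratfun b"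
  by (simp add: to_ratfun_def)

lemma ratfun_cases:
  obtains N D where "D \<noteq> 0" "F = to_ratfun N / to_ratfun D"
  by (cases F) (auto simp: Fract_eq)

abbreviation zmon :: "('v::linorder \<Rightarrow>\<^sub>0 int) \<Rightarrow> ('v, 'k::field) ratfun" where
  "zmon m \<equiv> to_ratfun (single m 1)"

lemma single_eq_0 [simp]: "single m c = 0 \<longleftrightarrow> c = 0"
  by (metis lookup_single_eq lookup_zero single_zero)

lemma zmon_add: "zmon (a + b) = zmon a * zmon b"
  by (simp flip: to_ratfun_hom(4) add: mult_single)

lemma zmon_uminus: "zmon (- a) = inverse (zmon a)"
proof -
  have "zmon (- a) * zmon a = 1" unfolding zmon_add[symmetric] by simp
  then show ?thesis by (metis inverse_unique mult.commute)
qed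

lemma zmon_diff: "zmon (a - b) = zmon a / zmon b"
  using zmon_add[of a "- b"] by (simp add: zmon_uminus divide_inverse)

lemma zmon_sum: "zmon (\<Sum>x\<in>A. m x) = (\<Prod>x\<in>A. zmon (m x))"
  by (induction A rule: infinite_finite_induct) (auto simp: zmon_add simp del: to_ratfun_eq_iff)

lemma rat_var_zmon: "rat_var v = zmon (single v 1)"
  by (simp add: rat_var_def)

lemma rat_var_powi: "(rat_var v :: ('v::linorder, 'k::field) ratfun) powi k = zmon (single v k)"
proof -
  have p: "rat_var v ^ n = (zmon (single v (int n)) :: ('v, 'k) ratfun)" for n
    by (induction n) (auto simp: rat_var_zmon zmon_add[symmetric] single_add[symmetric])
  show ?thesis
  proof (cases "k \<ge> 0")
    case True
    then show ?thesis using p[of "nat k"] by (simp add: power_int_def)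
  next
    case False
    then show ?thesis
      using p[of "nat (- k)"] zmon_uminus[where ?'b = 'k, of "single v (- k)"]
      by (simp add: power_int_def power_inverse single_uminus)
  qed
qed

lemma zmon_powi: "(zmon m :: ('v::linorder, 'k::field) ratfun) powi k = zmon (frag_cmul k m)"
proof -
  have p: "zmon m ^ n = (zmon (frag_cmul (int n) m) :: ('v, 'k) ratfun)" for n
    by (induction n) (auto simp: zmon_add[symmetric] frag_cmul_distrib)
  show ?thesis
  proof (cases "k \<ge> 0")
    case True
    then show ?thesis using p[of "nat k"] by (simp add: power_int_def)
  next
    case False
    then show ?thesis
      using p[of "nat (- k)"] zmon_uminus[where ?'b = 'k, of "frag_cmul (- k) m"]
      by (simp add: power_int_def power_inverse)
  qed
qed

lemma rat_const_simps: "rat_const c * zmon m = to_ratfun (single m c)"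
  by (simp add: rat_const_def mult_single flip: to_ratfun_hom(4))

lemma laurent_subst_ren: "laurent_subst P (\<lambda>v. rat_var (f v)) = to_ratfun (ren_laurent f P)"
proof -
  have "(\<Prod>v\<in>keys m. rat_var (f v) powi lookup m v) = (zmon (ren_mon f m) :: ('a, 'b) ratfun)"
    for m :: "'a \<Rightarrow>\<^sub>0 int"
  proof -
    have "ren_mon f m = (\<Sum>v\<in>keys m. single (f v) (lookup m v))"
      by (subst pm_sum_single[of m]) (simp add: ren_mon_sum)
    then show ?thesis by (simp add: rat_var_powi zmon_sum del: to_ratfun_eq_iff)
  qed
  then show ?thesis
    by (simp add: laurent_subst_def ren_laurent_def pext_def to_ratfun_sum rat_const_simps)
qed

text \<open>
  The field homomorphism induced by an injective substitution of variables. Numerator and denominator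
  are chosen; \<open>ren_divide\<close> shows that the choice does not matter.
\<close>

definition ren :: "('v::linorder \<Rightarrow> 'w::linorder) \<Rightarrow> ('v, 'k::field) ratfun \<Rightarrow> ('w, 'k) ratfun" where
  "ren f F = (SOME G. \<exists>N D. D \<noteq> 0 \<and> F = to_ratfun N / to_ratfun D \<and>
      G = to_ratfun (ren_laurent f N) / to_ratfun (ren_laurent f D))"

lemma ren_divide:
  assumes f: "inj f" and D: "D \<noteq> 0"
  shows "ren f (to_ratfun N / to_ratfun D) = to_ratfun (ren_laurent f N) / to_ratfun (ren_laurent f D)"
proof -
  let ?F = "to_ratfun N / to_ratfun D"
  have "\<exists>N' D'. D' \<noteq> 0 \<and> ?F = to_ratfun N' / to_ratfun D' \<and>
      ren f ?F = to_ratfun (ren_laurent f N') / to_ratfun (ren_laurent f D')"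
    unfolding ren_def by (rule someI_ex) (use D in blast)
  then obtain N' D' where *: "D' \<noteq> 0" "?F = to_ratfun N' / to_ratfun D'"
    "ren f ?F = to_ratfun (ren_laurent f N') / to_ratfun (ren_laurent f D')" by blast
  have "to_ratfun (N * D') = to_ratfun (N' * D)"
    using *(1,2) D by (simp add: field_simps)
  then have "N * D' = N' * D" by (simp only: to_ratfun_eq_iff)
  then have "ren_laurent f (N * D') = ren_laurent f (N' * D)" by (rule arg_cong)
  then have "to_ratfun (ren_laurent f N) * to_ratfun (ren_laurent f D') =
      to_ratfun (ren_laurent f N') * to_ratfun (ren_laurent f D)"
    by (simp flip: to_ratfun_hom(4))
  then show ?thesis
    using * D by (simp add: ren_laurent_eq_0[OF f] frac_eq_eq)
qed

context
  fixes f :: "'v::linorder \<Rightarrow> 'w::linorder"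
  assumes f: "inj f"
begin

lemma ren_to_ratfun: "ren f (to_ratfun P) = to_ratfun (ren_laurent f P)"
  using ren_divide[OF f, of 1 P] by simp

lemma ren_add: "ren f (F + G) = ren f F + ren f G"
proof -
  obtain N D where F: "D \<noteq> 0" "F = to_ratfun N / to_ratfun D" by (rule ratfun_cases)
  obtain M E where G: "E \<noteq> 0" "G = to_ratfun M / to_ratfun E" by (rule ratfun_cases)
  have "F + G = to_ratfun (N * E + M * D) / to_ratfun (D * E)"
    using F G by (simp add: add_frac_eq)
  then have "ren f (F + G) = to_ratfun (ren_laurent f (N * E + M * D)) / to_ratfun (ren_laurent f (D * E))"
    using F G by (simp add: ren_divide[OF f] del: to_ratfun_hom ren_laurent_hom)
  then show ?thesis using F G by (simp add: ren_divide[OF f] add_frac_eq ren_laurent_eq_0[OF f])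
qed

lemma ren_mult: "ren f (F * G) = ren f F * ren f G"
proof -
  obtain N D where F: "D \<noteq> 0" "F = to_ratfun N / to_ratfun D" by (rule ratfun_cases)
  obtain M E where G: "E \<noteq> 0" "G = to_ratfun M / to_ratfun E" by (rule ratfun_cases)
  have "F * G = to_ratfun (N * M) / to_ratfun (D * E)"
    using F G by simp
  then have "ren f (F * G) = to_ratfun (ren_laurent f (N * M)) / to_ratfun (ren_laurent f (D * E))"
    using F G by (simp add: ren_divide[OF f] del: to_ratfun_hom ren_laurent_hom)
  then show ?thesis using F G by (simp add: ren_divide[OF f])
qed

lemma ren_0 [simp]: "ren f 0 = 0"
  using ren_to_ratfun[of 0] by simp

lemma ren_1 [simp]: "ren f 1 = 1"
  using ren_to_ratfun[of 1] by simp

lemma ren_uminus: "ren f (- F) = - ren f F"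
  using ren_add[of F "- F"] by (simp add: eq_neg_iff_add_eq_0 add.commute)

lemma ren_diff: "ren f (F - G) = ren f F - ren f G"
  using ren_add[of F "- G"] by (simp add: ren_uminus)

lemma ren_inverse: "ren f (inverse F) = inverse (ren f F)"
proof (cases "F = 0")
  case False
  then show ?thesis using ren_mult[of F "inverse F"] by (metis inverse_unique ren_1 right_inverse)
qed auto

lemma ren_div: "ren f (F / G) = ren f F / ren f G"
  by (simp add: divide_inverse ren_mult ren_inverse)

lemma ren_sum: "ren f (\<Sum>x\<in>A. F x) = (\<Sum>x\<in>A. ren f (F x))"
  by (induction A rule: infinite_finite_induct) (auto simp: ren_add)

lemma ren_prod: "ren f (\<Prod>x\<in>A. F x) = (\<Prod>x\<in>A. ren f (F x))"
  by (induction A rule: infinite_finite_induct) (auto simp: ren_mult)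

lemma ren_of_nat: "ren f (of_nat n) = of_nat n"
  by (induction n) (auto simp: ren_add)

lemma ren_power: "ren f (F ^ n) = ren f F ^ n"
  by (induction n) (auto simp: ren_mult)

lemma ren_powi: "ren f (F powi k) = ren f F powi k"
  by (simp add: power_int_def ren_power ren_inverse)

lemma ren_rat_var: "ren f (rat_var v) = rat_var (f v)"
  by (simp add: rat_var_def ren_to_ratfun)

lemma ren_rat_const: "ren f (rat_const c) = rat_const c"
  by (simp add: rat_const_def ren_to_ratfun)

lemma ren_zeta: "ren f (zeta p i j F) = zeta p i j (ren f F)"
  by (simp add: zeta_def ren_div ren_sum ren_mult ren_rat_const ren_powi ren_diff)

lemma ren_shuffle_factor:
  "ren f (shuffle_factor p s i j x y) = shuffle_factor p s i j (ren f x) (ren f y)"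
  by (cases s) (auto simp: ren_zeta ren_div)

end

lemma ren_comp:
  assumes "inj f" "inj g" shows "ren f (ren g F) = ren (f \<circ> g) F"
  by (rule ratfun_cases[of F])
    (auto simp: ren_divide assms ren_laurent_eq_0 inj_compose ren_laurent_comp)

lemma ren_id: "ren id F = F"
  by (rule ratfun_cases[of F]) (auto simp: ren_divide ren_laurent_id)

section \<open>Formal series with an action of Laurent polynomials\<close>

text \<open>
  Laurent polynomials act on all formal series, without any condition on the support; \<open>series_of F c\<close>
  below means that \<open>c\<close> is some series for \<open>F\<close>, in no specified region. It becomes the expansion
  only together with a condition on the support.
\<close>

definition lact :: "('v, 'k::field) laurent \<Rightarrow> (('v \<Rightarrow>\<^sub>0 int) \<Rightarrow> 'k) \<Rightarrow> ('v \<Rightarrow>\<^sub>0 int) \<Rightarrow> 'k" where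
  "lact D c m = pext (\<lambda>l a. a * c (m - l)) D"

lemma lact_simps [simp]:
  "lact 0 c m = 0" "lact (P + Q) c m = lact P c m + lact Q c m"
  "lact (single l a) c m = a * c (m - l)"
  by (auto simp: lact_def pext_add pext_single distrib_right)

lemma lact_mult: "lact (P * Q) c m = lact P (lact Q c) m"
proof (induction P rule: pm_induct)
  case (single k a)
  show ?case
    by (induction Q arbitrary: m rule: pm_induct) (auto simp: mult_single distrib_left algebra_simps)
qed (auto simp: distrib_right)

lemma lact_lookup: "lact P (lookup Q) m = lookup (P * Q) m"
  by (induction P rule: pm_induct) (auto simp: lookup_mult_single distrib_right lookup_add)

lemma lact_add_right: "lact P (\<lambda>m. c m + d m) m = lact P c m + lact P d m"
  by (induction P rule: pm_induct) (auto simp: algebra_simps)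

lemma lact_diff_right: "lact P (\<lambda>m. c m - d m) m = lact P c m - lact P d m"
  using lact_add_right[of P "\<lambda>m. c m - d m" d m] by simp

lemma lact_one [simp]: "lact 1 c m = c m"
  using lact_simps(3)[of 0 1 c m] by simp

definition series_of :: "('v::linorder, 'k::field) ratfun \<Rightarrow> (('v \<Rightarrow>\<^sub>0 int) \<Rightarrow> 'k) \<Rightarrow> bool" where
  "series_of F c \<longleftrightarrow>
    (\<exists>N D. D \<noteq> 0 \<and> F = to_ratfun N / to_ratfun D \<and> (\<forall>m. lact D c m = lookup N m))"

lemma is_expansion_iff: "is_expansion vs F c \<longleftrightarrow> admissible_series vs c \<and> series_of F c"
  unfolding is_expansion_def series_of_def lact_def pext_def by (simp add: Fract_eq cong: conj_cong)

lemma series_of_cong: "series_of F c \<Longrightarrow> (\<And>m. c m = d m) \<Longrightarrow> series_of F d"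
  by (metis ext)

lemma series_of_to_ratfun: "series_of (to_ratfun P) (lookup P)"
  unfolding series_of_def by (rule exI[of _ P], rule exI[of _ 1]) auto

lemma series_of_lact:
  assumes "series_of F c" shows "series_of (to_ratfun P * F) (lact P c)"
proof -
  obtain N D where *: "D \<noteq> 0" "F = to_ratfun N / to_ratfun D" "\<And>m. lact D c m = lookup N m"
    using assms unfolding series_of_def by blast
  have c: "lact D c = lookup N" using * by auto
  have "lact D (lact P c) m = lookup (P * N) m" for m
  proof -
    have "lact D (lact P c) m = lact P (lact D c) m" by (simp flip: lact_mult add: mult.commute)
    then show ?thesis by (simp add: c lact_lookup)
  qed
  then show ?thesis
    unfolding series_of_def using * by (intro exI[of _ "P * N"] exI[of _ D]) auto
qed

lemma series_of_zmon: "series_of F c \<Longrightarrow> series_of (zmon l * F) (\<lambda>m. c (m - l))"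
  by (rule series_of_cong[OF series_of_lact]) auto

lemma series_of_zero: "series_of 0 (\<lambda>_. 0)"
  by (rule series_of_cong[of 0 "lookup 0"]) (use series_of_to_ratfun[of 0] in simp_all)

lemma series_of_add:
  assumes "series_of F c" "series_of G d"
  shows "series_of (F + G) (\<lambda>m. c m + d m)"
proof -
  obtain N D where *: "D \<noteq> 0" "F = to_ratfun N / to_ratfun D" "\<And>m. lact D c m = lookup N m"
    using assms unfolding series_of_def by blast
  obtain M E where **: "E \<noteq> 0" "G = to_ratfun M / to_ratfun E" "\<And>m. lact E d m = lookup M m"
    using assms unfolding series_of_def by blast
  have c: "lact D c = lookup N" and d: "lact E d = lookup M" using * ** by auto
  have "lact (D * E) (\<lambda>m. c m + d m) m = lookup (E * N + D * M) m" for m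
  proof -
    have "lact (D * E) c m = lookup (E * N) m"
      by (simp add: mult.commute[of D] lact_mult c lact_lookup)
    moreover have "lact (D * E) d m = lookup (D * M) m"
      by (simp add: lact_mult d lact_lookup)
    ultimately show ?thesis by (simp add: lact_add_right lookup_add)
  qed
  then show ?thesis
    unfolding series_of_def using * **
    by (intro exI[of _ "E * N + D * M"] exI[of _ "D * E"]) (auto simp: add_frac_eq algebra_simps)
qed

definition ren_series :: "('v \<Rightarrow> 'w) \<Rightarrow> (('v \<Rightarrow>\<^sub>0 int) \<Rightarrow> 'k) \<Rightarrow> ('w \<Rightarrow>\<^sub>0 int) \<Rightarrow> 'k::zero" where
  "ren_series f c m = (if m \<in> range (ren_mon f) then c (inv_into UNIV (ren_mon f) m) else 0)"

lemma ren_series_ren_mon [simp]: "inj f \<Longrightarrow> ren_series f c (ren_mon f m) = c m"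
  by (simp add: ren_series_def inj_ren_mon)

lemma ren_series_nonzero: "inj f \<Longrightarrow> ren_series f c m \<noteq> 0 \<longleftrightarrow> (\<exists>m'. m = ren_mon f m' \<and> c m' \<noteq> 0)"
  by (metis rangeE ren_series_def ren_series_ren_mon)

lemma series_of_ren:
  assumes f: "inj f" and s: "series_of F c"
  shows "series_of (ren f F) (ren_series f c)"
proof -
  obtain N D where *: "D \<noteq> 0" "F = to_ratfun N / to_ratfun D" "\<And>m. lact D c m = lookup N m"
    using s unfolding series_of_def by blast
  have 1: "lact (ren_laurent f D) (ren_series f c) (ren_mon f m) = lact D c m" for m
    by (induction D rule: pm_induct) (auto simp: f simp flip: ren_mon_simps)
  have 2: "lact (ren_laurent f D) (ren_series f c) m = 0" if "m \<notin> range (ren_mon f)" for m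
  proof (induction D rule: pm_induct)
    case (single k a)
    have "m - ren_mon f k \<notin> range (ren_mon f)"
    proof
      assume "m - ren_mon f k \<in> range (ren_mon f)"
      then obtain l where "m - ren_mon f k = ren_mon f l" by auto
      then have "m = ren_mon f (l + k)" by (simp add: algebra_simps)
      then show False using that by blast
    qed
    then show ?case by (simp add: ren_series_def)
  qed auto
  have "lact (ren_laurent f D) (ren_series f c) m = lookup (ren_laurent f N) m" for m
  proof (cases "m \<in> range (ren_mon f)")
    case True
    then show ?thesis using 1 *(3) by (auto simp: lookup_ren_laurent[OF f])
  next
    case False
    then have "m \<notin> keys (ren_laurent f N)" by (auto simp: keys_ren_laurent[OF f])
    then show ?thesis using 2[OF False] by (simp add: in_keys_iff)
  qed
  then show ?thesis
    unfolding series_of_def using *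
    by (intro exI[of _ "ren_laurent f N"] exI[of _ "ren_laurent f D"])
      (auto simp: ren_laurent_eq_0[OF f] ren_divide[OF f])
qed

definition conv :: "('a::ab_group_add \<Rightarrow> 'k::field) \<Rightarrow> ('a \<Rightarrow> 'k) \<Rightarrow> 'a \<Rightarrow> 'k" where
  "conv c d m = (\<Sum>a | c a \<noteq> 0 \<and> d (m - a) \<noteq> 0. c a * d (m - a))"

definition convolvable :: "('a::ab_group_add \<Rightarrow> 'k::field) \<Rightarrow> ('a \<Rightarrow> 'k) \<Rightarrow> bool" where
  "convolvable c d \<longleftrightarrow> (\<forall>m. finite {a. c a \<noteq> 0 \<and> d (m - a) \<noteq> 0})"

lemma conv_superset:
  "finite U \<Longrightarrow> {a. c a \<noteq> 0 \<and> d (m - a) \<noteq> 0} \<subseteq> U \<Longrightarrow> conv c d m = (\<Sum>a\<in>U. c a * d (m - a))"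
  unfolding conv_def by (rule sum.mono_neutral_left) auto

lemma conv_nonzero: "conv c d m \<noteq> 0 \<Longrightarrow> \<exists>a b. m = a + b \<and> c a \<noteq> 0 \<and> d b \<noteq> 0"
proof -
  assume "conv c d m \<noteq> 0"
  then obtain a where "c a \<noteq> 0 \<and> d (m - a) \<noteq> 0"
    unfolding conv_def by (auto elim: sum.not_neutral_contains_not_neutral)
  then show ?thesis by (intro exI[of _ a] exI[of _ "m - a"]) auto
qed

text \<open>
  The action of a Laurent polynomial on a product of series is its action on the first factor, because
  each coefficient is a finite sum. Products of expansions are expansions for this reason
  (\<open>series_of_conv\<close>).
\<close>

lemma lact_conv:
  assumes "convolvable c d"
  shows "lact D (conv c d) m = conv (lact D c) d m"
proof -
  define A where "A l = {a. c a \<noteq> 0 \<and> d (m - l - a) \<noteq> 0}" for l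
  define U where "U = (\<Union>l\<in>keys D. (\<lambda>a. a + l) ` A l)"
  have fA: "finite (A l)" for l using assms by (auto simp: convolvable_def A_def)
  then have fU: "finite U" by (auto simp: U_def)
  have sub: "{a. lact D c a \<noteq> 0 \<and> d (m - a) \<noteq> 0} \<subseteq> U"
  proof
    fix a assume "a \<in> {a. lact D c a \<noteq> 0 \<and> d (m - a) \<noteq> 0}"
    then have a: "lact D c a \<noteq> 0" "d (m - a) \<noteq> 0" by auto
    then obtain l where "l \<in> keys D" "c (a - l) \<noteq> 0"
      unfolding lact_def pext_def by (auto elim!: sum.not_neutral_contains_not_neutral)
    then have "a - l \<in> A l" using a by (auto simp: A_def)
    then show "a \<in> U" using \<open>l \<in> keys D\<close> unfolding U_def
      by (intro UN_I[of l]) (auto intro!: image_eqI[of _ _ "a - l"])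
  qed
  have "conv (lact D c) d m = (\<Sum>a\<in>U. \<Sum>l\<in>keys D. lookup D l * c (a - l) * d (m - a))"
    by (simp add: conv_superset[OF fU sub] lact_def pext_def sum_distrib_right)
  also have "\<dots> = (\<Sum>l\<in>keys D. \<Sum>a\<in>U. lookup D l * c (a - l) * d (m - a))"
    by (rule sum.swap)
  also have "\<dots> = (\<Sum>l\<in>keys D. lookup D l * conv c d (m - l))"
  proof (rule sum.cong)
    fix l assume l: "l \<in> keys D"
    have "(\<Sum>a\<in>U. lookup D l * c (a - l) * d (m - a)) =
        (\<Sum>a\<in>(\<lambda>a. a + l) ` A l. lookup D l * c (a - l) * d (m - a))"
    proof (rule sum.mono_neutral_right[OF fU])
      show "\<forall>a\<in>U - (\<lambda>a. a + l) ` A l. lookup D l * c (a - l) * d (m - a) = 0"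
      proof
        fix a assume a: "a \<in> U - (\<lambda>a. a + l) ` A l"
        then have "a - l \<notin> A l" by (force intro!: image_eqI[of _ _ "a - l"])
        then show "lookup D l * c (a - l) * d (m - a) = 0" by (auto simp: A_def)
      qed
    qed (use l in \<open>auto simp: U_def\<close>)
    also have "\<dots> = (\<Sum>a\<in>A l. lookup D l * (c a * d (m - l - a)))"
      by (subst sum.reindex) (auto simp: inj_on_def algebra_simps)
    also have "\<dots> = lookup D l * conv c d (m - l)"
      by (simp add: conv_def A_def sum_distrib_left)
    finally show "(\<Sum>a\<in>U. lookup D l * c (a - l) * d (m - a)) = lookup D l * conv c d (m - l)" .
  qed simp
  finally show ?thesis by (simp add: lact_def pext_def)
qed

lemma conv_lookup: "conv (lookup N) d m = lact N d m"
proof -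
  have "conv (lookup N) d m = (\<Sum>a\<in>keys N. lookup N a * d (m - a))"
    by (rule conv_superset) (auto simp: in_keys_iff)
  then show ?thesis by (simp add: lact_def pext_def)
qed

lemma series_of_conv:
  assumes "series_of F c" "series_of G d" "convolvable c d"
  shows "series_of (F * G) (conv c d)"
proof -
  obtain N D where *: "D \<noteq> 0" "F = to_ratfun N / to_ratfun D" "\<And>m. lact D c m = lookup N m"
    using assms(1) unfolding series_of_def by blast
  obtain M E where **: "E \<noteq> 0" "G = to_ratfun M / to_ratfun E" "\<And>m. lact E d m = lookup M m"
    using assms(2) unfolding series_of_def by blast
  have c: "lact D c = lookup N" and d: "lact E d = lookup M" using * ** by auto
  have "lact (D * E) (conv c d) m = lookup (N * M) m" for m
  proof -
    have "lact D (conv c d) = lact N d"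
      by (rule ext) (simp add: lact_conv[OF assms(3)] c conv_lookup)
    then have "lact (D * E) (conv c d) m = lact E (lact N d) m"
      by (simp add: mult.commute[of D] lact_mult)
    also have "\<dots> = lact N (lact E d) m" by (simp flip: lact_mult add: mult.commute)
    finally show ?thesis by (simp add: d lact_lookup)
  qed
  then show ?thesis
    unfolding series_of_def using * **
    by (intro exI[of _ "N * M"] exI[of _ "D * E"]) auto
qed

section \<open>Series with bounded support\<close>

definition pre :: "'v set \<Rightarrow> ('v \<Rightarrow>\<^sub>0 int) \<Rightarrow> int" where
  "pre P m = (\<Sum>v\<in>P. lookup m v)"

lemma pre_simps [simp]:
  "pre P 0 = 0" "pre P (a + b) = pre P a + pre P b" "pre P (a - b) = pre P a - pre P b"
  "pre P (- a) = - pre P a" "pre {} m = 0"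
  by (auto simp: pre_def lookup_add lookup_minus sum.distrib sum_subtractf sum_negf)

lemma pre_sum: "pre P (\<Sum>x\<in>A. f x) = (\<Sum>x\<in>A. pre P (f x))"
  by (induction A rule: infinite_finite_induct) auto

lemma pre_single [simp]: "finite P \<Longrightarrow> pre P (single v k) = (if v \<in> P then k else 0)"
  by (simp add: pre_def lookup_single when_def)

lemma pre_ren_mon:
  assumes f: "inj f" shows "pre (f ` P) (ren_mon f m) = pre P m"
  unfolding pre_def by (subst sum.reindex[OF inj_on_subset[OF f]]) (simp_all add: lookup_ren_mon[OF f])

lemma pre_insert: "finite P \<Longrightarrow> v \<notin> P \<Longrightarrow> pre (insert v P) m = lookup m v + pre P m"
  by (simp add: pre_def)

lemma set_take_Suc: "i < length vs \<Longrightarrow> set (take (Suc i) vs) = insert (vs ! i) (set (take i vs))"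
  by (simp add: take_Suc_conv_app_nth)

lemma nth_notin_take: "distinct vs \<Longrightarrow> i < length vs \<Longrightarrow> vs ! i \<notin> set (take i vs)"
  by (metis distinct_take id_take_nth_drop distinct_append disjoint_iff list.set_intros(1))

lemma lookup_eq_pre:
  assumes "distinct vs" "i < length vs"
  shows "lookup m (vs ! i) = pre (set (take (Suc i) vs)) m - pre (set (take i vs)) m"
  using assms by (simp add: set_take_Suc pre_insert nth_notin_take)

text \<open>
  In the region \<open>|v\<^sub>1| \<gg> \<dots> \<gg> |v\<^sub>n|\<close> the partial sums of the exponents along \<open>vs\<close> are bounded above, and
  the total degree is bounded on both sides. Unlike the cones of \<open>admissible_series\<close>, this condition is
  visibly closed under products, and it gives bounds for the heights of prefixes of words.
\<close>

definition bsup :: "'v list \<Rightarrow> (('v \<Rightarrow>\<^sub>0 int) \<Rightarrow> 'k::zero) \<Rightarrow> bool" where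
  "bsup vs c \<longleftrightarrow> (\<exists>B. \<forall>m. c m \<noteq> 0 \<longrightarrow> keys m \<subseteq> set vs \<and>
     (\<forall>k. pre (set (take k vs)) m \<le> B) \<and> - B \<le> pre (set vs) m)"

lemma bsup_keys: "bsup vs c \<Longrightarrow> c m \<noteq> 0 \<Longrightarrow> keys m \<subseteq> set vs"
  by (auto simp: bsup_def)

lemma bsup_binop:
  assumes "bsup vs c" "bsup vs d"
    and "\<And>m. e m \<noteq> 0 \<Longrightarrow> c m \<noteq> 0 \<or> d m \<noteq> 0"
  shows "bsup vs e"
proof -
  from assms(1) obtain B where B: "\<And>m. c m \<noteq> 0 \<Longrightarrow> keys m \<subseteq> set vs \<and>
     (\<forall>k. pre (set (take k vs)) m \<le> B) \<and> - B \<le> pre (set vs) m" by (auto simp: bsup_def)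
  from assms(2) obtain C where C: "\<And>m. d m \<noteq> 0 \<Longrightarrow> keys m \<subseteq> set vs \<and>
     (\<forall>k. pre (set (take k vs)) m \<le> C) \<and> - C \<le> pre (set vs) m" by (auto simp: bsup_def)
  have "keys m \<subseteq> set vs \<and> (\<forall>k. pre (set (take k vs)) m \<le> max B C) \<and> - max B C \<le> pre (set vs) m"
    if "e m \<noteq> 0" for m
    using assms(3)[OF that] B[of m] C[of m] by (fastforce simp: le_max_iff_disj)
  then show ?thesis unfolding bsup_def by blast
qed

lemma bsup_zero [simp]: "bsup vs (\<lambda>_. 0)"
  by (auto simp: bsup_def)

lemma bsup_add: "bsup vs c \<Longrightarrow> bsup vs d \<Longrightarrow> bsup vs (\<lambda>m. c m + d m :: 'k::field)"
  by (rule bsup_binop[of vs c d]) auto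

lemma bsup_sum: "(\<And>x. x \<in> A \<Longrightarrow> bsup vs (c x)) \<Longrightarrow> bsup vs (\<lambda>m. \<Sum>x\<in>A. c x m :: 'k::field)"
  by (induction A rule: infinite_finite_induct) (auto intro: bsup_add)

lemma bsup_conv:
  assumes "bsup vs c" "bsup vs d"
  shows "bsup vs (conv c d)"
proof -
  from assms(1) obtain B where B: "\<And>m. c m \<noteq> 0 \<Longrightarrow> keys m \<subseteq> set vs \<and>
     (\<forall>k. pre (set (take k vs)) m \<le> B) \<and> - B \<le> pre (set vs) m" by (auto simp: bsup_def)
  from assms(2) obtain C where C: "\<And>m. d m \<noteq> 0 \<Longrightarrow> keys m \<subseteq> set vs \<and>
     (\<forall>k. pre (set (take k vs)) m \<le> C) \<and> - C \<le> pre (set vs) m" by (auto simp: bsup_def)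
  have "keys m \<subseteq> set vs \<and> (\<forall>k. pre (set (take k vs)) m \<le> B + C) \<and> - (B + C) \<le> pre (set vs) m"
    if nz: "conv c d m \<noteq> 0" for m
  proof -
    obtain a b where ab: "m = a + b" "c a \<noteq> 0" "d b \<noteq> 0" using conv_nonzero[OF nz] by blast
    show ?thesis using B[OF ab(2)] C[OF ab(3)] Poly_Mapping.keys_add[of a b]
      unfolding ab(1) by (auto intro: add_mono)
  qed
  then show ?thesis unfolding bsup_def by blast
qed

lemma pre_determines:
  assumes "distinct vs" "keys a \<subseteq> set vs" "keys b \<subseteq> set vs"
    and "\<And>k. k \<le> length vs \<Longrightarrow> pre (set (take k vs)) a = pre (set (take k vs)) b"
  shows "a = b"
proof (rule poly_mapping_eqI)
  fix v
  show "lookup a v = lookup b v"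
  proof (cases "v \<in> set vs")
    case True
    then obtain i where "i < length vs" "v = vs ! i" by (auto simp: in_set_conv_nth)
    then show ?thesis using assms by (simp add: lookup_eq_pre)
  next
    case False
    then show ?thesis using assms(2,3) by (metis in_keys_iff subsetD)
  qed
qed

lemma finite_pre_box:
  assumes "distinct vs"
  shows "finite {a. keys a \<subseteq> set vs \<and> (\<forall>k\<le>length vs. l k \<le> pre (set (take k vs)) a \<and>
    pre (set (take k vs)) a \<le> (u k :: int))}" (is "finite ?S")
proof (rule finite_imageD)
  let ?f = "\<lambda>a. restrict (\<lambda>k. pre (set (take k vs)) a) {..length vs}"
  have "?f ` ?S \<subseteq> PiE {..length vs} (\<lambda>k. {l k..u k})" by (auto simp: PiE_def)
  then show "finite (?f ` ?S)" by (rule finite_subset) (auto intro: finite_PiE)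
  show "inj_on ?f ?S"
  proof (rule inj_onI)
    fix a b assume ab: "a \<in> ?S" "b \<in> ?S" "?f a = ?f b"
    have "pre (set (take k vs)) a = pre (set (take k vs)) b" if "k \<le> length vs" for k
      using fun_cong[OF ab(3), of k] that by simp
    then show "a = b" using ab assms by (intro pre_determines[of vs]) auto
  qed
qed

text \<open>
  The partial sums of \<open>a\<close> are bounded above by the condition on \<open>c\<close>, and below by the condition on \<open>d\<close>
  at \<open>m - a\<close>, which leaves finitely many \<open>a\<close>.
\<close>

lemma bsup_convolvable:
  assumes "distinct vs" "bsup vs c" "bsup vs d"
  shows "convolvable c d"
  unfolding convolvable_def
proof
  fix m
  from assms(2) obtain B where B: "\<And>m. c m \<noteq> 0 \<Longrightarrow> keys m \<subseteq> set vs \<and>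
     (\<forall>k. pre (set (take k vs)) m \<le> B)" by (auto simp: bsup_def)
  from assms(3) obtain C where C: "\<And>m. d m \<noteq> 0 \<Longrightarrow>
     (\<forall>k. pre (set (take k vs)) m \<le> C)" by (auto simp: bsup_def)
  have "{a. c a \<noteq> 0 \<and> d (m - a) \<noteq> 0} \<subseteq> {a. keys a \<subseteq> set vs \<and>
     (\<forall>k\<le>length vs. pre (set (take k vs)) m - C \<le> pre (set (take k vs)) a \<and> pre (set (take k vs)) a \<le> B)}"
    using B C by (auto simp: algebra_simps) (metis diff_le_eq pre_simps(3))
  then show "finite {a. c a \<noteq> 0 \<and> d (m - a) \<noteq> 0}"
    using finite_pre_box[OF assms(1), of "\<lambda>k. pre (set (take k vs)) m - C" "\<lambda>k. B"]
    by (rule finite_subset)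
qed

lemma bsup_shift:
  assumes "bsup vs c" "keys l \<subseteq> set vs"
  shows "bsup vs (\<lambda>m. c (m - l))"
proof -
  from assms(1) obtain B where B: "\<And>m. c m \<noteq> 0 \<Longrightarrow> keys m \<subseteq> set vs \<and>
     (\<forall>k. pre (set (take k vs)) m \<le> B) \<and> - B \<le> pre (set vs) m" by (auto simp: bsup_def)
  define C where "C = (\<Sum>k\<le>length vs. \<bar>pre (set (take k vs)) l\<bar>)"
  have C': "\<bar>pre (set (take k vs)) l\<bar> \<le> C" if "k \<le> length vs" for k
    unfolding C_def by (rule member_le_sum) (use that in auto)
  have C: "\<bar>pre (set (take k vs)) l\<bar> \<le> C" for k
    using C'[of k] C'[of "length vs"] by (cases "k \<le> length vs") auto
  have "keys m \<subseteq> set vs \<and> (\<forall>k. pre (set (take k vs)) m \<le> B + C) \<and> - (B + C) \<le> pre (set vs) m"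
    if "c (m - l) \<noteq> 0" for m
  proof -
    have "keys m \<subseteq> keys (m - l) \<union> keys l" using Poly_Mapping.keys_add[of "m - l" l] by simp
    moreover have "pre (set (take k vs)) m \<le> B + C" for k
      using B[OF that] C[of k] by (auto simp: abs_le_iff dest!: spec[of _ k])
    moreover have "- (B + C) \<le> pre (set vs) m"
      using B[OF that] C[of "length vs"] by auto
    ultimately show ?thesis using B[OF that] assms(2) by blast
  qed
  then show ?thesis unfolding bsup_def by blast
qed

lemma bsup_lookup:
  assumes "\<And>m. m \<in> keys P \<Longrightarrow> keys m \<subseteq> set vs"
  shows "bsup vs (lookup (P :: ('v, 'k::field) laurent))"
proof -
  have "bsup vs (\<lambda>m. \<Sum>l\<in>keys P. (lookup P l when m = l))"
  proof (rule bsup_sum)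
    fix l assume l: "l \<in> keys P"
    have "bsup vs (\<lambda>m. lookup P l when m = (0 :: 'v \<Rightarrow>\<^sub>0 int))"
      unfolding bsup_def by (rule exI[of _ 0]) (auto simp: when_def)
    from bsup_shift[OF this assms[OF l]]
    show "bsup vs (\<lambda>m. lookup P l when m = l)" by simp
  qed
  moreover have "(\<Sum>l\<in>keys P. (lookup P l when m = l)) = lookup P m" for m
    by (simp add: when_def in_keys_iff)
  ultimately show ?thesis by simp
qed

lemma bsup_lact:
  assumes "distinct vs" "\<And>m. m \<in> keys P \<Longrightarrow> keys m \<subseteq> set vs" "bsup vs c"
  shows "bsup vs (lact P c)"
  using bsup_conv[OF bsup_lookup[of P vs] assms(3)] assms(2) by (simp add: conv_lookup[abs_def])

lemma bsup_ren:
  assumes "inj f" "bsup vs c"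
  shows "bsup (map f vs) (ren_series f c)"
proof -
  from assms(2) obtain B where B: "\<And>m. c m \<noteq> 0 \<Longrightarrow> keys m \<subseteq> set vs \<and>
     (\<forall>k. pre (set (take k vs)) m \<le> B) \<and> - B \<le> pre (set vs) m" by (auto simp: bsup_def)
  have "keys m \<subseteq> set (map f vs) \<and> (\<forall>k. pre (set (take k (map f vs))) m \<le> B) \<and> - B \<le> pre (set (map f vs)) m"
    if nz: "ren_series f c m \<noteq> 0" for m
  proof -
    from nz obtain m' where m': "m = ren_mon f m'" "c m' \<noteq> 0"
      using ren_series_nonzero[OF assms(1)] by metis
    have "keys m \<subseteq> f ` keys m'" unfolding m' by (rule keys_ren_mon)
    then have "keys m \<subseteq> set (map f vs)" using B[OF m'(2)] by auto
    moreover have "pre (set (take k (map f vs))) m = pre (set (take k vs)) m'" for k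
      unfolding m' take_map set_map by (rule pre_ren_mon[OF assms(1)])
    moreover have "pre (set (map f vs)) m = pre (set vs) m'"
      unfolding m' set_map by (rule pre_ren_mon[OF assms(1)])
    ultimately show ?thesis using B[OF m'(2)] by auto
  qed
  then show ?thesis unfolding bsup_def by blast
qed

lemma root_decomposition:
  assumes d: "distinct vs" and k: "keys x \<subseteq> set vs" and t: "pre (set vs) x = 0"
  shows "x = (\<Sum>k<length vs - 1. single (vs ! Suc k) (- pre (set (take (Suc k) vs)) x) -
                          single (vs ! k) (- pre (set (take (Suc k) vs)) x))" (is "x = ?R")
proof (rule pre_determines[OF d k])
  have "keys ?R \<subseteq> (\<Union>k<length vs - 1. {vs ! Suc k, vs ! k})"
    by (rule order_trans[OF keys_sum])
      (fastforce simp: in_keys_iff lookup_minus lookup_single when_def split: if_splits)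
  also have "\<dots> \<subseteq> set vs" by auto
  finally show "keys ?R \<subseteq> set vs" .
  fix j assume j: "j \<le> length vs"
  have inT: "vs ! i \<in> set (take j vs) \<longleftrightarrow> i < j" if "i < length vs" for i
    using d that j by (auto simp: in_set_conv_nth nth_eq_iff_index_eq)
  have "pre (set (take j vs)) ?R = (\<Sum>k<length vs - 1.
      (if Suc k = j then pre (set (take (Suc k) vs)) x else 0))"
    by (subst pre_sum, rule sum.cong) (auto simp: inT)
  also have "\<dots> = pre (set (take j vs)) x"
  proof (cases "0 < j \<and> j < length vs")
    case True
    then have "(\<Sum>k<length vs - 1. (if Suc k = j then pre (set (take (Suc k) vs)) x else 0)) =
       (\<Sum>k<length vs - 1. (if k = j - 1 then pre (set (take j vs)) x else 0))"
      by (intro sum.cong) auto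
    moreover have "j - 1 < length vs - 1" using True by auto
    ultimately show ?thesis by simp
  next
    case False
    then have "j = 0 \<or> j = length vs" using j by auto
    then show ?thesis using t by (auto intro!: sum.neutral)
  qed
  finally show "pre (set (take j vs)) x = pre (set (take j vs)) ?R" ..
qed

text \<open>
  The coefficients of a monomial of degree \<open>0\<close> in terms of \<open>v\<^sub>2/v\<^sub>1, \<dots>, v\<^sub>n/v\<^sub>n\<^sub>-\<^sub>1\<close> are its negative partial
  sums (\<open>root_decomposition\<close>), so a bound for the partial sums moves the support into finitely many
  translates of the cone.
\<close>

lemma bsup_admissible:
  assumes d: "distinct vs" and "bsup vs c"
  shows "admissible_series vs c"
proof (cases "vs = []")
  case True
  with assms(2) show ?thesis
    by (auto simp: bsup_def admissible_series_def expansion_cone_def intro!: exI[of _ "{0}"])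
next
  case False
  from assms(2) obtain B where B: "\<And>m. c m \<noteq> 0 \<Longrightarrow> keys m \<subseteq> set vs \<and>
     (\<forall>k. pre (set (take k vs)) m \<le> B) \<and> - B \<le> pre (set vs) m" by (auto simp: bsup_def)
  define n where "n = length vs"
  have n: "n > 0" using False by (auto simp: n_def)
  define m0 where "m0 t = single (vs ! 0) B + single (vs ! (n - 1)) (t - B)" for t :: int
  have inT: "vs ! i \<in> set (take j vs) \<longleftrightarrow> i < j" if "i < length vs" "j \<le> length vs" for i j
    using d that by (auto simp: in_set_conv_nth nth_eq_iff_index_eq)
  show ?thesis unfolding admissible_series_def
  proof (intro exI conjI allI impI)
    show "finite (m0 ` {-B..B})" by simp
    fix m assume m: "c m \<noteq> 0"
    define t where "t = pre (set vs) m"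
    have "t \<in> {-B..B}" using B[OF m] by (auto simp: t_def dest: spec[of _ "length vs"])
    define x where "x = m - m0 t"
    have kx: "keys x \<subseteq> set vs"
    proof -
      have "keys x \<subseteq> keys m \<union> keys (m0 t)" unfolding x_def by (rule keys_diff)
      moreover have "keys (m0 t) \<subseteq> {vs ! 0, vs ! (n - 1)}"
        unfolding m0_def by (rule order_trans[OF Poly_Mapping.keys_add]) auto
      moreover have "{vs ! 0, vs ! (n - 1)} \<subseteq> set vs" using n by (auto simp: n_def)
      ultimately show ?thesis using B[OF m] by blast
    qed
    have tx: "pre (set vs) x = 0"
      using n by (auto simp: x_def m0_def t_def n_def)
    have px: "pre (set (take (Suc k) vs)) x \<le> 0" if "k < n - 1" for k
      using B[OF m] n that by (auto simp: x_def m0_def n_def inT dest: spec[of _ "Suc k"])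
    have "x \<in> expansion_cone vs"
      unfolding expansion_cone_def
      apply (rule CollectI)
      apply (rule exI[of _ "\<lambda>k. nat (- pre (set (take (Suc k) vs)) x)"])
      apply (rule conjI[OF _ TrueI])
      apply (subst root_decomposition[OF d kx tx])
      apply (rule sum.cong)
      using px by (auto simp: n_def)
    then show "\<exists>m0\<in>m0 ` {-B..B}. m - m0 \<in> expansion_cone vs"
      using \<open>t \<in> {-B..B}\<close> by (auto simp: x_def)
  qed
qed

section \<open>Uniqueness of expansions\<close>

text \<open>
  The degree in which each \<open>v\<^sub>k\<^sub>+\<^sub>1/v\<^sub>k\<close> has degree \<open>1\<close>. On a cone it is non-negative with finite
  fibres, so admissible series have lowest parts.
\<close>

definition height :: "'v list \<Rightarrow> ('v \<Rightarrow>\<^sub>0 int) \<Rightarrow> int" where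
  "height vs m = (\<Sum>i<length vs. int i * lookup m (vs ! i))"

lemma height_simps [simp]:
  "height vs (a + b) = height vs a + height vs b" "height vs (a - b) = height vs a - height vs b"
  "height vs 0 = 0"
  by (auto simp: height_def lookup_add lookup_minus algebra_simps sum.distrib sum_subtractf)

lemma height_sum: "height vs (\<Sum>x\<in>A. f x) = (\<Sum>x\<in>A. height vs (f x))"
  by (induction A rule: infinite_finite_induct) auto

lemma height_single: "distinct vs \<Longrightarrow> i < length vs \<Longrightarrow> height vs (single (vs ! i) k) = int i * k"
proof -
  assume *: "distinct vs" "i < length vs"
  then have "height vs (single (vs ! i) k) = (\<Sum>j<length vs. if j = i then int i * k else 0)"
    unfolding height_def by (intro sum.cong) (auto simp: lookup_single when_def nth_eq_iff_index_eq)
  then show ?thesis using * by simp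
qed

lemma height_cone:
  assumes "distinct vs"
  shows "height vs (\<Sum>k<length vs - 1. single (vs ! Suc k) (int (c k)) - single (vs ! k) (int (c k))) =
    (\<Sum>k<length vs - 1. int (c k))"
  using assms by (subst height_sum, intro sum.cong) (auto simp: height_single algebra_simps)

lemma finite_cone_height:
  assumes "distinct vs"
  shows "finite {x \<in> expansion_cone vs. height vs x = t}"
proof -
  let ?g = "\<lambda>c. \<Sum>k<length vs - 1. single (vs ! Suc k) (int (c k)) - single (vs ! k) (int (c k))"
  have "{x \<in> expansion_cone vs. height vs x = t} \<subseteq> ?g ` PiE {..<length vs - 1} (\<lambda>_. {..nat t})"
  proof
    fix x assume "x \<in> {x \<in> expansion_cone vs. height vs x = t}"
    then obtain c where c: "x = ?g c" "height vs x = t" by (auto simp: expansion_cone_def)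
    then have s: "(\<Sum>k<length vs - 1. int (c k)) = t" unfolding c(1) height_cone[OF assms] by simp
    have "c k \<le> nat t" if "k < length vs - 1" for k
    proof -
      have "int (c k) \<le> (\<Sum>k<length vs - 1. int (c k))"
        by (rule member_le_sum) (use that in auto)
      then show ?thesis using s by simp
    qed
    then have "restrict c {..<length vs - 1} \<in> PiE {..<length vs - 1} (\<lambda>_. {..nat t})" by auto
    moreover have "x = ?g (restrict c {..<length vs - 1})"
      unfolding c(1) by (rule sum.cong) auto
    ultimately show "x \<in> ?g ` PiE {..<length vs - 1} (\<lambda>_. {..nat t})" by blast
  qed
  then show ?thesis by (rule finite_subset) (auto intro: finite_PiE)
qed

text \<open>
  Torsion-freeness: the product of the parts of lowest height of \<open>D\<close> and of \<open>c\<close> cannot cancel, as both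
  are Laurent polynomials and these have no zero divisors.
\<close>

lemma admissible_lact_eq_0:
  fixes c :: "('v::linorder \<Rightarrow>\<^sub>0 int) \<Rightarrow> 'k::field"
  assumes d: "distinct vs" and a: "admissible_series vs c" and D: "D \<noteq> 0"
    and z: "\<And>m. lact D c m = 0"
  shows "c m = 0"
proof (rule ccontr)
  assume m: "c m \<noteq> 0"
  obtain M where M: "finite M" "\<And>m. c m \<noteq> 0 \<Longrightarrow> \<exists>m0\<in>M. m - m0 \<in> expansion_cone vs"
    using a by (auto simp: admissible_series_def)
  have hc: "height vs x \<ge> 0" if x: "x \<in> expansion_cone vs" for x
  proof -
    obtain e where e: "x = (\<Sum>k<length vs - 1. single (vs ! Suc k) (int (e k)) - single (vs ! k) (int (e k)))"
      using x unfolding expansion_cone_def by blast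
    show ?thesis unfolding e height_cone[OF d] by (simp add: sum_nonneg)
  qed
  have hM: "height vs x \<ge> Min (height vs ` M)" if nz: "c x \<noteq> 0" for x
  proof -
    obtain m0 where "m0 \<in> M" "x - m0 \<in> expansion_cone vs" using M nz by blast
    then have "height vs m0 \<le> height vs x" "Min (height vs ` M) \<le> height vs m0"
      using hc[of "x - m0"] M(1) by auto
    then show ?thesis by simp
  qed
  define L where "L = Min (height vs ` M)"
  obtain m1 where m1: "c m1 \<noteq> 0" "\<And>x. c x \<noteq> 0 \<Longrightarrow> nat (height vs m1 - L) \<le> nat (height vs x - L)"
    using ex_has_least_nat[of "\<lambda>x. c x \<noteq> 0" m "\<lambda>x. nat (height vs x - L)"] m by blast
  define t where "t = height vs m1"
  have t: "t \<le> height vs x" if "c x \<noteq> 0" for x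
    using m1(2)[OF that] hM[OF that] hM[OF m1(1)] by (auto simp: t_def L_def)
  define s where "s = Min (height vs ` keys D)"
  have s: "s \<le> height vs l" if "l \<in> keys D" for l using that by (simp add: s_def)
  have "s \<in> height vs ` keys D" unfolding s_def using D by (intro Min_in) auto
  then obtain l1 where l1: "l1 \<in> keys D" "height vs l1 = s" by auto
  have "finite {x. (if height vs x = t then c x else 0) \<noteq> 0}"
  proof (rule finite_subset)
    show "{x. (if height vs x = t then c x else 0) \<noteq> 0} \<subseteq>
      (\<Union>m0\<in>M. (\<lambda>y. y + m0) ` {y \<in> expansion_cone vs. height vs y = t - height vs m0})"
    proof
      fix x assume "x \<in> {x. (if height vs x = t then c x else 0) \<noteq> 0}"
      then have x: "height vs x = t" "c x \<noteq> 0" by (auto split: if_splits)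
      then obtain m0 where "m0 \<in> M" "x - m0 \<in> expansion_cone vs" using M by blast
      then show "x \<in> (\<Union>m0\<in>M. (\<lambda>y. y + m0) ` {y \<in> expansion_cone vs. height vs y = t - height vs m0})"
        using x by (intro UN_I[of m0] image_eqI[of _ _ "x - m0"]) auto
    qed
  qed (use M(1) finite_cone_height[OF d] in auto)
  then have P: "lookup (Abs_poly_mapping (\<lambda>x. if height vs x = t then c x else 0)) x =
      (if height vs x = t then c x else 0)" for x by simp
  define P where "P = Abs_poly_mapping (\<lambda>x. if height vs x = t then c x else 0)"
  define Q where "Q = Abs_poly_mapping (\<lambda>x. if height vs x = s then lookup D x else 0)"
  have "finite {x. (if height vs x = s then lookup D x else 0) \<noteq> 0}"
    by (rule finite_subset[of _ "keys D"]) (auto simp: in_keys_iff split: if_splits)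
  then have Q: "lookup Q x = (if height vs x = s then lookup D x else 0)" for x
    by (simp add: Q_def)
  have P: "lookup P x = (if height vs x = t then c x else 0)" for x using P by (simp add: P_def)
  have "P \<noteq> 0" using P[of m1] m1(1) by (auto simp: t_def)
  moreover have "Q \<noteq> 0" using Q[of l1] l1 by (auto simp: in_keys_iff)
  ultimately have "Q * P \<noteq> 0" by simp
  then obtain x where x: "lookup (Q * P) x \<noteq> 0" by (metis lookup_zero poly_mapping_eqI)
  have LQ: "lookup (Q * P) x = (\<Sum>l\<in>keys D. lookup Q l * lookup P (x - l))"
  proof -
    have "lookup (Q * P) x = pext (\<lambda>l a. a * lookup P (x - l)) Q"
      by (simp flip: lact_lookup add: lact_def)
    also have "\<dots> = (\<Sum>l\<in>keys D. lookup Q l * lookup P (x - l))"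
      by (rule pext_superset) (auto simp: in_keys_iff Q split: if_splits)
    finally show ?thesis .
  qed
  with x obtain l where "lookup Q l * lookup P (x - l) \<noteq> 0"
    by (metis (no_types, lifting) sum.neutral)
  then have hx: "height vs x = s + t" by (auto simp: P Q split: if_splits)
  have "lact D c x = (\<Sum>l\<in>keys D. lookup Q l * lookup P (x - l))"
    unfolding lact_def pext_def
  proof (rule sum.cong)
    fix l assume l: "l \<in> keys D"
    show "lookup D l * c (x - l) = lookup Q l * lookup P (x - l)"
      using s[OF l] t[of "x - l"] hx by (auto simp: P Q)
  qed simp
  with LQ x z show False by simp
qed

lemma admissible_diff:
  assumes "admissible_series vs c" "admissible_series vs d"
  shows "admissible_series vs (\<lambda>m. c m - d m)"
proof -
  obtain M N where "finite M" "\<And>m. c m \<noteq> 0 \<Longrightarrow> \<exists>m0\<in>M. m - m0 \<in> expansion_cone vs"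
    "finite N" "\<And>m. d m \<noteq> 0 \<Longrightarrow> \<exists>m0\<in>N. m - m0 \<in> expansion_cone vs"
    using assms unfolding admissible_series_def by metis
  then show ?thesis
    unfolding admissible_series_def by (intro exI[of _ "M \<union> N"]) (metis Un_iff diff_0_right finite_UnI)
qed

text \<open>
  Two expansions of the same function differ by a series that is annihilated by a product of
  denominators, so torsion-freeness applies.
\<close>

lemma expansion_unique:
  assumes d: "distinct vs" and "is_expansion vs F c" "is_expansion vs F e"
  shows "c m = e m"
proof -
  obtain N D where *: "D \<noteq> 0" "F = to_ratfun N / to_ratfun D" "\<And>m. lact D c m = lookup N m"
    using assms(2) unfolding is_expansion_iff series_of_def by blast
  obtain M E where **: "E \<noteq> 0" "F = to_ratfun M / to_ratfun E" "\<And>m. lact E e m = lookup M m"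
    using assms(3) unfolding is_expansion_iff series_of_def by blast
  have "to_ratfun (E * N) = to_ratfun (D * M)"
    using * ** by (simp add: field_simps)
  then have EN: "E * N = D * M" by (simp only: to_ratfun_eq_iff)
  have c: "lact D c = lookup N" and e: "lact E e = lookup M" using * ** by auto
  have "lact (D * E) (\<lambda>m. c m - e m) m = 0" for m
  proof -
    have "lact (D * E) c m = lookup (E * N) m" by (simp add: mult.commute[of D] lact_mult c lact_lookup)
    moreover have "lact (D * E) e m = lookup (D * M) m" by (simp add: lact_mult e lact_lookup)
    ultimately show ?thesis by (simp add: lact_diff_right EN)
  qed
  moreover have "admissible_series vs (\<lambda>m. c m - e m)"
    using assms(2,3) by (auto simp: is_expansion_iff intro: admissible_diff)
  ultimately have "c m - e m = 0"
    using *(1) **(1) by (intro admissible_lact_eq_0[OF d, where D = "D * E" and c = "\<lambda>m. c m - e m"]) simp_all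
  then show ?thesis by simp
qed

lemma constant_term_eq:
  assumes "distinct vs" "series_of F c" "bsup vs c"
  shows "constant_term vs F = c 0"
proof -
  have "is_expansion vs F c" using assms by (simp add: is_expansion_iff bsup_admissible)
  then show ?thesis unfolding constant_term_def
    using expansion_unique[OF assms(1)] by (intro the_equality) blast+
qed

section \<open>Rational functions of a ratio of two variables\<close>

text \<open>
  The exponent of \<open>(y/x)\<^sup>k\<close>.
\<close>

definition vroot :: "'v \<Rightarrow> 'v \<Rightarrow> int \<Rightarrow> ('v \<Rightarrow>\<^sub>0 int)" where
  "vroot x y k = single y k - single x k"

lemma root_simps: "vroot x y (k + l) = vroot x y k + vroot x y l" "vroot x y (k - l) = vroot x y k - vroot x y l"
  "vroot x y 0 = 0" "vroot x y (- k) = - vroot x y k"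
  by (auto simp: vroot_def single_add single_diff single_uminus)

lemma root_swap: "vroot x y k = vroot y x (- k)"
  by (simp add: vroot_def single_uminus)

lemma lookup_root: "x \<noteq> y \<Longrightarrow> lookup (vroot x y k) y = k"
  by (simp add: vroot_def lookup_minus lookup_single)

lemma root_inject [simp]: "x \<noteq> y \<Longrightarrow> vroot x y k = vroot x y l \<longleftrightarrow> k = l"
  by (metis lookup_root)

text \<open>\<open>in_ratio x y B\<close> is the one-variable Laurent polynomial \<open>B\<close> at \<open>y/x\<close>.\<close>

definition in_ratio :: "'v \<Rightarrow> 'v \<Rightarrow> (int \<Rightarrow>\<^sub>0 'k::field) \<Rightarrow> ('v, 'k) laurent" where
  "in_ratio x y = pext (\<lambda>k b. single (vroot x y k) b)"

lemma in_ratio_simps [simp]: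
  "in_ratio x y 0 = 0" "in_ratio x y (A + B) = in_ratio x y A + in_ratio x y B"
  "in_ratio x y (A - B) = in_ratio x y A - in_ratio x y B"
  "in_ratio x y (single k b) = single (vroot x y k) b"
  "in_ratio x y (A * B) = in_ratio x y A * in_ratio x y B"
  "in_ratio x y 1 = 1"
  using pext_single[of "\<lambda>k b. single (vroot x y k) b" 0 "1::'k::field"]
  by (auto simp: in_ratio_def pext_add pext_diff pext_single single_add single_diff pext_mult mult_single root_simps)

lemma lookup_in_ratio: "x \<noteq> y \<Longrightarrow> lookup (in_ratio x y A) (vroot x y k) = lookup A k"
  by (induction A rule: pm_induct) (auto simp: lookup_add lookup_single when_def)

lemma in_ratio_eq_0 [simp]: "x \<noteq> y \<Longrightarrow> in_ratio x y A = 0 \<longleftrightarrow> A = 0"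
  by (metis in_ratio_simps(1) lookup_in_ratio lookup_zero poly_mapping_eqI)

lemma lookup_in_ratio_0: "m \<notin> range (vroot x y) \<Longrightarrow> lookup (in_ratio x y A) m = 0"
  by (induction A rule: pm_induct) (auto simp: lookup_add lookup_single when_def)

lemma lact_in_ratio: "lact (in_ratio x y B) c m = pext (\<lambda>k b. b * c (m - vroot x y k)) B"
  by (induction B rule: pm_induct) (auto simp: pext_single pext_add distrib_right)

text \<open>
  One-variable quotients are expanded in the field of formal Laurent series.
\<close>

lemma fls_quotient:
  fixes A B :: "int \<Rightarrow>\<^sub>0 'k::field"
  assumes "B \<noteq> 0"
  obtains a :: "int \<Rightarrow> 'k" and N :: int
  where "\<And>n. pext (\<lambda>k b. b * a (n - k)) B = lookup A n" "N \<ge> 0" "\<And>n. a n \<noteq> 0 \<Longrightarrow> n \<ge> - N"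
proof -
  define F :: "(int \<Rightarrow>\<^sub>0 'k) \<Rightarrow> 'k fls" where
    "F = pext (\<lambda>k b. fls_shift (- k) (fls_const b))"
  have F: "fls_nth (F P * g) n = pext (\<lambda>k b. b * fls_nth g (n - k)) P" for P g n
  proof (induction P rule: pm_induct)
    case (single k c)
    have "fls_nth (fls_shift (- k) (fls_const c) * g) n = c * fls_nth g (n - k)"
      by (simp add: fls_shifted_times_simps)
    then show ?case by (simp add: F_def pext_single)
  next
    case (add P Q)
    have "F (P + Q) = F P + F Q"
      unfolding F_def by (rule pext_add) (auto intro: fls_eqI)
    with add show ?case by (simp add: distrib_right pext_add)
  qed (simp add: F_def)
  have F1: "fls_nth (F P) n = lookup P n" for P n
  proof -
    have "pext (\<lambda>k b. b * fls_nth 1 (n - k)) P = lookup P n"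
      by (induction P rule: pm_induct)
        (auto simp: pext_single pext_add distrib_right lookup_add lookup_single when_def)
    then show ?thesis using F[of P 1 n] by simp
  qed
  have "F B \<noteq> 0"
    using assms F1[of B] by (metis fls_zero_nth lookup_zero poly_mapping_eqI)
  then have "F B * (F A / F B) = F A" by simp
  then have "pext (\<lambda>k b. b * fls_nth (F A / F B) (n - k)) B = lookup A n" for n
    using F[of B "F A / F B" n] F1[of A n] by simp
  moreover have "n \<ge> - max 0 (- fls_subdegree (F A / F B))" if "fls_nth (F A / F B) n \<noteq> 0" for n
    using that fls_eq0_below_subdegree[of n "F A / F B"] by fastforce
  ultimately show ?thesis by (intro that[of "fls_nth (F A / F B)" "max 0 (- fls_subdegree (F A / F B))"]) auto
qed

lemma ratio_series:
  fixes A B :: "int \<Rightarrow>\<^sub>0 'k::field"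
  assumes "B \<noteq> 0"
  obtains N :: int where "N \<ge> 0" "\<And>x y :: 'v::linorder. x \<noteq> y \<Longrightarrow>
    \<exists>c. series_of (to_ratfun (in_ratio x y A) / to_ratfun (in_ratio x y B)) c \<and>
        (\<forall>m. c m \<noteq> 0 \<longrightarrow> (\<exists>k\<ge>- N. m = vroot x y k))"
proof -
  obtain a :: "int \<Rightarrow> 'k" and N :: int
  where a: "\<And>n. pext (\<lambda>k b. b * a (n - k)) B = lookup A n" "N \<ge> 0" "\<And>n. a n \<noteq> 0 \<Longrightarrow> n \<ge> - N"
    by (rule fls_quotient[OF assms, where A = A]) blast
  show ?thesis
  proof (rule that[OF a(2)])
    fix x y :: 'v assume xy: "x \<noteq> y"
    define c where "c m = (if m \<in> range (vroot x y) then a (lookup m y) else 0)" for m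
    have "lact (in_ratio x y B) c m = lookup (in_ratio x y A) m" for m
    proof (cases "m \<in> range (vroot x y)")
      case True
      then obtain j where j: "m = vroot x y j" by auto
      have "c (m - vroot x y k) = a (j - k)" for k
        using xy by (auto simp: c_def j lookup_root simp flip: root_simps)
      then show ?thesis using a(1)[of j] by (simp add: lact_in_ratio j lookup_in_ratio[OF xy])
    next
      case False
      have "m - vroot x y k \<notin> range (vroot x y)" for k
      proof
        assume "m - vroot x y k \<in> range (vroot x y)"
        then obtain l where "m - vroot x y k = vroot x y l" by auto
        then have "m = vroot x y (l + k)" by (simp add: root_simps algebra_simps)
        then show False using False by blast
      qed
      then have "c (m - vroot x y k) = 0" for k by (simp add: c_def)
      then show ?thesis using False by (simp add: lact_in_ratio lookup_in_ratio_0 pext_def)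
    qed
    then have "series_of (to_ratfun (in_ratio x y A) / to_ratfun (in_ratio x y B)) c"
      unfolding series_of_def using assms xy
      by (intro exI[of _ "in_ratio x y A"] exI[of _ "in_ratio x y B"]) auto
    moreover have "\<exists>k\<ge>- N. m = vroot x y k" if "c m \<noteq> 0" for m
      using that a(3) xy by (auto simp: c_def lookup_root split: if_splits)
    ultimately show "\<exists>c. series_of (to_ratfun (in_ratio x y A) / to_ratfun (in_ratio x y B)) c \<and>
        (\<forall>m. c m \<noteq> 0 \<longrightarrow> (\<exists>k\<ge>- N. m = vroot x y k))" by blast
  qed
qed

lemma pre_root: "finite P \<Longrightarrow> pre P (vroot x y k) = (if y \<in> P then k else 0) - (if x \<in> P then k else 0)"
  by (simp add: vroot_def)

lemma bsup_root:
  assumes d: "distinct vs" and ij: "i < j" "j < length vs"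
    and c: "\<And>m. c m \<noteq> 0 \<Longrightarrow> \<exists>k\<ge>- N. m = vroot (vs ! i) (vs ! j) k"
  shows "bsup vs c"
proof -
  have inT: "vs ! i \<in> set (take k vs) \<longleftrightarrow> i < k" if "i < length vs" for i k
    using d that by (auto simp: in_set_conv_nth nth_eq_iff_index_eq)
  have "keys m \<subseteq> set vs \<and> (\<forall>k. pre (set (take k vs)) m \<le> max 0 N) \<and> - max 0 N \<le> pre (set vs) m"
    if nz: "c m \<noteq> 0" for m
  proof -
    obtain k where k: "k \<ge> - N" "m = vroot (vs ! i) (vs ! j) k" using c[OF nz] by blast
    have "keys m \<subseteq> {vs ! i, vs ! j}"
      unfolding k vroot_def by (rule order_trans[OF keys_diff]) auto
    then show ?thesis using ij k(1) unfolding k(2) by (auto simp: pre_root inT)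
  qed
  then show ?thesis unfolding bsup_def by blast
qed

text \<open>
  One series can serve several regions at once, which is what the symmetry of the pairing needs.
\<close>

lemma series_of_prod:
  fixes F :: "'j \<Rightarrow> ('v::linorder, 'k::field) ratfun"
  assumes "finite J" "VS \<noteq> {}" "\<And>vs. vs \<in> VS \<Longrightarrow> distinct vs"
    and "\<And>j. j \<in> J \<Longrightarrow> series_of (F j) (c j)"
    and "\<And>j vs. j \<in> J \<Longrightarrow> vs \<in> VS \<Longrightarrow> bsup vs (c j)"
  shows "\<exists>d. series_of (\<Prod>j\<in>J. F j) d \<and> (\<forall>vs\<in>VS. bsup vs d) \<and>
    (\<forall>m. d m \<noteq> 0 \<longrightarrow> (\<exists>a. m = (\<Sum>j\<in>J. a j) \<and> (\<forall>j\<in>J. c j (a j) \<noteq> 0)))"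
  using assms(1,4,5)
proof (induction J rule: finite_induct)
  case empty
  have "bsup vs (lookup (1 :: ('v, 'k) laurent))" for vs :: "'v list"
    by (rule bsup_lookup) auto
  moreover have "m = 0" if "lookup (1 :: ('v, 'k) laurent) m \<noteq> 0" for m
    using that by (auto simp: lookup_one when_def split: if_splits)
  ultimately show ?case
    using series_of_to_ratfun[of 1] by (intro exI[of _ "lookup 1"] conjI) auto
next
  case (insert j J)
  then obtain d where d: "series_of (\<Prod>j\<in>J. F j) d" "\<And>vs. vs \<in> VS \<Longrightarrow> bsup vs d"
    "\<And>m. d m \<noteq> 0 \<Longrightarrow> \<exists>a. m = (\<Sum>j\<in>J. a j) \<and> (\<forall>j\<in>J. c j (a j) \<noteq> 0)" by blast
  obtain vs where vs: "vs \<in> VS" using assms(2) by blast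
  have "convolvable (c j) d"
    using bsup_convolvable[OF assms(3)[OF vs] insert(5)[OF insertI1 vs] d(2)[OF vs]] .
  then have "series_of (\<Prod>j\<in>insert j J. F j) (conv (c j) d)"
    using series_of_conv[OF insert(4)[of j] d(1)] insert(1,2) by simp
  moreover have "\<exists>a. m = (\<Sum>j\<in>insert j J. a j) \<and> (\<forall>j\<in>insert j J. c j (a j) \<noteq> 0)"
    if nz: "conv (c j) d m \<noteq> 0" for m
  proof -
    obtain x y where xy: "m = x + y" "c j x \<noteq> 0" "d y \<noteq> 0" using conv_nonzero[OF nz] by blast
    from d(3)[OF xy(3)] obtain a where a: "y = (\<Sum>j\<in>J. a j)" "\<forall>j\<in>J. c j (a j) \<noteq> 0" by blast
    have "(\<Sum>i\<in>J. (a(j := x)) i) = (\<Sum>i\<in>J. a i)" using insert(2) by (intro sum.cong) auto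
    then show ?thesis using xy a insert(1,2) by (intro exI[of _ "a(j := x)"]) auto
  qed
  ultimately show ?case using insert(5) d(2) by (intro exI[of _ "conv (c j) d"]) (auto intro: bsup_conv)
qed

section \<open>The kernels of the shuffle products\<close>

fun col :: "'i var \<Rightarrow> 'i" where "col (ZVar i a) = i"

text \<open>
  The factor of the pair \<open>(x, y)\<close> in the shuffle product of the half \<open>s\<close>, when \<open>x\<close> belongs to the first
  and \<open>y\<close> to the second argument. Passing to the opposite half exchanges the two variables
  (\<open>kap_opposite\<close>), which lets one argument treat both halves.
\<close>

definition kap :: "('i::finite, 'k::field) zeta_data \<Rightarrow> half \<Rightarrow> 'i var \<Rightarrow> 'i var \<Rightarrow> ('i var, 'k) ratfun" where
  "kap p s x y = shuffle_factor p s (col x) (col y) (rat_var x) (rat_var y)"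

lemma opposite_opposite [simp]: "opposite (opposite s) = s"
  by (cases s) auto

lemma kap_opposite: "kap p (opposite s) x y = kap p s y x"
  by (cases s) (auto simp: kap_def)

lemma ren_kap:
  "inj f \<Longrightarrow> col (f x) = col x \<Longrightarrow> col (f y) = col y \<Longrightarrow> ren f (kap p s x y) = kap p s (f x) (f y)"
  by (simp add: kap_def ren_shuffle_factor ren_rat_var)

definition flip :: "(int \<Rightarrow>\<^sub>0 'k::field) \<Rightarrow> (int \<Rightarrow>\<^sub>0 'k)" where
  "flip = pext (\<lambda>k b. single (- k) b)"

lemma flip_simps [simp]: "flip 0 = 0" "flip (A + B) = flip A + flip B" "flip (single k b) = single (- k) b"
  by (auto simp: flip_def pext_add pext_single single_add)

lemma flip_flip [simp]: "flip (flip A) = A"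
  by (induction A rule: pm_induct) auto

lemma flip_eq_0 [simp]: "flip A = 0 \<longleftrightarrow> A = 0"
  by (metis flip_flip flip_simps(1))

lemma in_ratio_flip: "in_ratio y x A = in_ratio x y (flip A)"
  by (induction A rule: pm_induct) (auto simp: root_swap[of y x])

definition zeta_den :: "'i \<Rightarrow> 'i \<Rightarrow> (int \<Rightarrow>\<^sub>0 'k::field)" where
  "zeta_den i j = (if i = j then 1 - single 1 1 else 1)"

lemma zeta_den_nonzero: "(zeta_den i j :: int \<Rightarrow>\<^sub>0 'k::field) \<noteq> 0"
proof -
  have "lookup (zeta_den i j :: int \<Rightarrow>\<^sub>0 'k) 0 = 1"
    by (simp add: zeta_den_def lookup_minus lookup_one lookup_single when_def)
  then show ?thesis by (metis lookup_zero zero_neq_one)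
qed

lemma rat_var_ratio: "rat_var x / rat_var y = zmon (vroot y x 1)"
  by (simp add: rat_var_zmon vroot_def zmon_diff)

lemma frag_cmul_vroot: "frag_cmul k (vroot y x 1) = vroot y x k"
  by (rule poly_mapping_eqI) (auto simp: vroot_def lookup_minus lookup_single when_def)

lemma zeta_ratio:
  fixes p :: "('i, 'k::field) zeta_data" and x y :: "'v::linorder"
  shows "zeta p i j (rat_var x / rat_var y) =
    to_ratfun (in_ratio y x (p i j)) / to_ratfun (in_ratio y x (zeta_den i j))"
proof -
  have "(\<Sum>k\<in>keys (p i j). rat_const (lookup (p i j) k) * (rat_var x / rat_var y) powi k) =
      to_ratfun (in_ratio y x (p i j))"
    by (simp add: rat_var_ratio zmon_powi frag_cmul_vroot rat_const_simps in_ratio_def pext_def to_ratfun_sum)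
  moreover have "1 - rat_var x / rat_var y = (to_ratfun (in_ratio y x (1 - single 1 1)) :: ('v, 'k) ratfun)"
    by (simp add: rat_var_ratio)
  ultimately show ?thesis by (simp add: zeta_def zeta_den_def)
qed

fun kap_num :: "('i, 'k::field) zeta_data \<Rightarrow> half \<Rightarrow> 'i \<Rightarrow> 'i \<Rightarrow> (int \<Rightarrow>\<^sub>0 'k)" where
  "kap_num p Positive i j = flip (p i j)"
| "kap_num p Negative i j = p j i"

fun kap_den :: "half \<Rightarrow> 'i \<Rightarrow> 'i \<Rightarrow> (int \<Rightarrow>\<^sub>0 'k::field)" where
  "kap_den Positive i j = flip (zeta_den i j)"
| "kap_den Negative i j = zeta_den j i"

lemma kap_quotient:
  "kap p s x y = to_ratfun (in_ratio x y (kap_num p s (col x) (col y))) /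
     to_ratfun (in_ratio x y (kap_den s (col x) (col y)))"
  by (cases s) (auto simp: kap_def zeta_ratio in_ratio_flip[of y x])

lemma kap_den_nonzero [simp]: "kap_den s i j \<noteq> 0"
  by (cases s) (auto simp: zeta_den_nonzero)

text \<open>
  Expansion in the region \<open>|x| \<gg> |y|\<close> with a pole of order at most \<open>N\<close>.
\<close>

definition ratio_bounded :: "int \<Rightarrow> 'v \<Rightarrow> 'v \<Rightarrow> ('v::linorder, 'k::field) ratfun \<Rightarrow> bool" where
  "ratio_bounded N x y F \<longleftrightarrow>
    (\<exists>c. series_of F c \<and> (\<forall>m. c m \<noteq> 0 \<longrightarrow> (\<exists>k\<ge>- N. m = vroot x y k)))"

lemma ratio_bounded_mono:
  assumes "ratio_bounded N x y F" "N \<le> M" shows "ratio_bounded M x y F"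
proof -
  obtain c where c: "series_of F c" "\<And>m. c m \<noteq> 0 \<Longrightarrow> \<exists>k\<ge>- N. m = vroot x y k"
    using assms(1) unfolding ratio_bounded_def by blast
  have "\<exists>k\<ge>- M. m = vroot x y k" if nz: "c m \<noteq> 0" for m
    using c(2)[OF nz] assms(2) by (metis neg_le_iff_le order_trans)
  then show ?thesis unfolding ratio_bounded_def using c(1) by blast
qed

lemma ratio_bounded_both:
  fixes A B :: "int \<Rightarrow>\<^sub>0 'k::field"
  assumes "B \<noteq> 0"
  shows "\<exists>N\<ge>0. \<forall>x y :: 'v::linorder. x \<noteq> y \<longrightarrow>
    ratio_bounded N x y (to_ratfun (in_ratio x y A) / to_ratfun (in_ratio x y B)) \<and>
    ratio_bounded N y x (to_ratfun (in_ratio x y A) / to_ratfun (in_ratio x y B))"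
proof -
  obtain N :: int where N: "N \<ge> 0" "\<And>x y :: 'v. x \<noteq> y \<Longrightarrow>
      ratio_bounded N x y (to_ratfun (in_ratio x y A) / to_ratfun (in_ratio x y B))"
    using ratio_series[OF assms, of A, where 'v = 'v] unfolding ratio_bounded_def by blast
  have "flip B \<noteq> 0" using assms by simp
  then obtain M :: int where M: "M \<ge> 0" "\<And>x y :: 'v. x \<noteq> y \<Longrightarrow>
      ratio_bounded M x y (to_ratfun (in_ratio x y (flip A)) / to_ratfun (in_ratio x y (flip B)))"
    using ratio_series[of "flip B" "flip A", where 'v = 'v] unfolding ratio_bounded_def by blast
  show ?thesis
  proof (intro exI[of _ "max N M"] conjI allI impI)
    fix x y :: 'v assume xy: "x \<noteq> y"
    show "ratio_bounded (max N M) x y (to_ratfun (in_ratio x y A) / to_ratfun (in_ratio x y B))"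
      by (rule ratio_bounded_mono[OF N(2)[OF xy]]) simp
    show "ratio_bounded (max N M) y x (to_ratfun (in_ratio x y A) / to_ratfun (in_ratio x y B))"
      using ratio_bounded_mono[OF M(2)[OF xy[symmetric]], of "max N M"]
      by (simp flip: in_ratio_flip)
  qed (use N in simp)
qed

lemma finite_half [simp]: "finite (UNIV :: half set)"
proof -
  have "(UNIV :: half set) \<subseteq> {Positive, Negative}" using half.exhaust by blast
  then show ?thesis by (rule finite_subset) simp
qed

locale zeta =
  fixes p :: "('i::finite, 'k::field_char_0) zeta_data"
  assumes p_nonzero: "p i j \<noteq> 0"
begin

lemma kap_num_nonzero [simp]: "kap_num p s i j \<noteq> 0"
  by (cases s) (auto simp: p_nonzero)

lemma kap_nonzero: "x \<noteq> y \<Longrightarrow> kap p s x y \<noteq> 0"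
  by (simp add: kap_quotient)

text \<open>
  There are finitely many colours, and for each pair of colours the functions in question are fixed
  one-variable functions of \<open>y/x\<close>, so their orders at \<open>0\<close> and at \<open>\<infinity>\<close> are bounded uniformly. This
  constant determines how convex the paths have to be.
\<close>

lemma kap_bound_exists:
  "\<exists>N\<ge>0. \<forall>s x y. x \<noteq> y \<longrightarrow>
    ratio_bounded N x y (1 / kap p s x y) \<and> ratio_bounded N y x (1 / kap p s x y) \<and>
    ratio_bounded N x y (kap p s y x / kap p s x y) \<and> ratio_bounded N y x (kap p s y x / kap p s x y)"
proof -
  define A where "A s i j = kap_den s i j * flip (kap_num p s j i)" for s i j
  define B where "B s i j = kap_num p s i j * flip (kap_den s j i :: int \<Rightarrow>\<^sub>0 'k)" for s i j
  define P where "P N C D \<longleftrightarrow> N \<ge> 0 \<and> (\<forall>x y :: 'i var. x \<noteq> y \<longrightarrow>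
    ratio_bounded N x y (to_ratfun (in_ratio x y C) / to_ratfun (in_ratio x y D)) \<and>
    ratio_bounded N y x (to_ratfun (in_ratio x y C) / to_ratfun (in_ratio x y D)))" for N and C D :: "int \<Rightarrow>\<^sub>0 'k"
  have P: "\<exists>N. P N C D" if "D \<noteq> 0" for C D
    using ratio_bounded_both[OF that, of C, where 'v = "'i var"] unfolding P_def by blast
  define N where "N s i j = (SOME N. P N (kap_den s i j) (kap_num p s i j))" for s i j
  have N': "P (N s i j) (kap_den s i j) (kap_num p s i j)" for s i j
    unfolding N_def by (rule someI_ex, rule P) simp
  define M where "M s i j = (SOME N. P N (A s i j) (B s i j))" for s i j
  have M': "P (M s i j) (A s i j) (B s i j)" for s i j
    unfolding M_def by (rule someI_ex, rule P) (simp add: B_def)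
  have N: "N s i j \<ge> 0" "\<And>x y :: 'i var. x \<noteq> y \<Longrightarrow>
    ratio_bounded (N s i j) x y (to_ratfun (in_ratio x y (kap_den s i j)) / to_ratfun (in_ratio x y (kap_num p s i j))) \<and>
    ratio_bounded (N s i j) y x (to_ratfun (in_ratio x y (kap_den s i j)) / to_ratfun (in_ratio x y (kap_num p s i j)))"
    for s i j using N'[of s i j] unfolding P_def by auto
  have M: "M s i j \<ge> 0" "\<And>x y :: 'i var. x \<noteq> y \<Longrightarrow>
    ratio_bounded (M s i j) x y (to_ratfun (in_ratio x y (A s i j)) / to_ratfun (in_ratio x y (B s i j))) \<and>
    ratio_bounded (M s i j) y x (to_ratfun (in_ratio x y (A s i j)) / to_ratfun (in_ratio x y (B s i j)))"
    for s i j using M'[of s i j] unfolding P_def by auto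
  define L where "L = (\<Sum>s\<in>UNIV. \<Sum>i\<in>UNIV. \<Sum>j\<in>UNIV. N s i j + M s i j)"
  have NM: "0 \<le> N s i j + M s i j" for s i j using N(1) M(1) by simp
  have L: "N s i j + M s i j \<le> L" for s i j
  proof -
    have "N s i j + M s i j \<le> (\<Sum>j\<in>UNIV. N s i j + M s i j)"
      by (rule member_le_sum) (auto simp: NM)
    also have "\<dots> \<le> (\<Sum>i\<in>UNIV. \<Sum>j\<in>UNIV. N s i j + M s i j)"
      by (rule member_le_sum[of i UNIV "\<lambda>i. \<Sum>j\<in>UNIV. N s i j + M s i j"]) (auto simp: NM sum_nonneg)
    also have "\<dots> \<le> L" unfolding L_def
      by (rule member_le_sum[of s UNIV "\<lambda>s. \<Sum>i\<in>UNIV. \<Sum>j\<in>UNIV. N s i j + M s i j"]) (auto simp: NM sum_nonneg)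
    finally show ?thesis .
  qed
  show ?thesis
  proof (intro exI[of _ L] conjI allI impI)
    show "0 \<le> L" unfolding L_def by (intro sum_nonneg NM)
    fix s and x y :: "'i var" assume xy: "x \<noteq> y"
    define i j where "i = col x" and "j = col y"
    have k: "1 / kap p s x y = to_ratfun (in_ratio x y (kap_den s i j)) / to_ratfun (in_ratio x y (kap_num p s i j))"
      by (simp add: kap_quotient i_def j_def)
    have r: "kap p s y x / kap p s x y = to_ratfun (in_ratio x y (A s i j)) / to_ratfun (in_ratio x y (B s i j))"
      by (simp add: kap_quotient i_def j_def A_def B_def in_ratio_flip[of y x] mult_ac)
    have NL: "N s i j \<le> L" "M s i j \<le> L" using L[of s i j] N(1)[of s i j] M(1)[of s i j] by linarith+
    show "ratio_bounded L x y (1 / kap p s x y)" "ratio_bounded L y x (1 / kap p s x y)"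
      "ratio_bounded L x y (kap p s y x / kap p s x y)" "ratio_bounded L y x (kap p s y x / kap p s x y)"
      unfolding k r using ratio_bounded_mono[OF _ NL(1)] ratio_bounded_mono[OF _ NL(2)] N(2)[OF xy] M(2)[OF xy]
      by blast+
  qed
qed

definition kbound :: int where
  "kbound = (SOME N. N \<ge> 0 \<and> (\<forall>s x y. x \<noteq> y \<longrightarrow>
    ratio_bounded N x y (1 / kap p s x y) \<and> ratio_bounded N y x (1 / kap p s x y) \<and>
    ratio_bounded N x y (kap p s y x / kap p s x y) \<and> ratio_bounded N y x (kap p s y x / kap p s x y)))"

lemma kbound: "kbound \<ge> 0" "x \<noteq> y \<Longrightarrow> ratio_bounded kbound x y (1 / kap p s x y)"
  "x \<noteq> y \<Longrightarrow> ratio_bounded kbound y x (1 / kap p s x y)"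
  "x \<noteq> y \<Longrightarrow> ratio_bounded kbound x y (kap p s y x / kap p s x y)"
  "x \<noteq> y \<Longrightarrow> ratio_bounded kbound y x (kap p s y x / kap p s x y)"
  using someI_ex[OF kap_bound_exists] unfolding kbound_def[symmetric] by blast+

end

section \<open>Ordered lists of variables\<close>

text \<open>
  The pairs of entries in the order in which they occur.
\<close>

fun Bef :: "'a list \<Rightarrow> ('a \<times> 'a) set" where
  "Bef [] = {}"
| "Bef (x # xs) = {x} \<times> set xs \<union> Bef xs"

lemma finite_Bef [simp]: "finite (Bef xs)"
  by (induction xs) auto

lemma Bef_subset: "Bef xs \<subseteq> set xs \<times> set xs"
  by (induction xs) auto

lemma Bef_append: "Bef (xs @ ys) = Bef xs \<union> Bef ys \<union> set xs \<times> set ys"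
  by (induction xs) auto

lemma Bef_map: "Bef (map f xs) = map_prod f f ` Bef xs"
  by (induction xs) (auto simp: image_Un image_iff)

lemma Bef_rev: "Bef (rev xs) = (Bef xs)\<inverse>"
  by (induction xs) (auto simp: Bef_append)

lemma Bef_filter: "Bef (filter P xs) = {(x, y) \<in> Bef xs. P x \<and> P y}"
  by (induction xs) auto

lemma Bef_neq: "distinct xs \<Longrightarrow> (x, y) \<in> Bef xs \<Longrightarrow> x \<noteq> y"
  using Bef_subset by (induction xs) auto

lemma Bef_total: "distinct xs \<Longrightarrow> x \<in> set xs \<Longrightarrow> y \<in> set xs \<Longrightarrow> x \<noteq> y \<Longrightarrow> (x, y) \<in> Bef xs \<or> (y, x) \<in> Bef xs"
  by (induction xs) auto

lemma Bef_asym: "distinct xs \<Longrightarrow> (x, y) \<in> Bef xs \<Longrightarrow> (y, x) \<notin> Bef xs"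
  using Bef_subset by (induction xs) fastforce+

lemma Bef_nth: "(x, y) \<in> Bef xs \<longleftrightarrow> (\<exists>i j. i < j \<and> j < length xs \<and> xs ! i = x \<and> xs ! j = y)"
proof (induction xs)
  case (Cons z xs)
  show ?case
  proof
    assume "(x, y) \<in> Bef (z # xs)"
    then consider "x = z" "y \<in> set xs" | "(x, y) \<in> Bef xs" by auto
    then show "\<exists>i j. i < j \<and> j < length (z # xs) \<and> (z # xs) ! i = x \<and> (z # xs) ! j = y"
    proof cases
      case 1
      then obtain j where "j < length xs" "xs ! j = y" by (auto simp: in_set_conv_nth)
      then show ?thesis using 1 by (intro exI[of _ 0] exI[of _ "Suc j"]) auto
    next
      case 2
      then obtain i j where "i < j \<and> j < length xs \<and> xs ! i = x \<and> xs ! j = y" using Cons by blast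
      then show ?thesis by (intro exI[of _ "Suc i"] exI[of _ "Suc j"]) auto
    qed
  next
    assume "\<exists>i j. i < j \<and> j < length (z # xs) \<and> (z # xs) ! i = x \<and> (z # xs) ! j = y"
    then obtain i j where ij: "i < j" "j < length (z # xs)" "(z # xs) ! i = x" "(z # xs) ! j = y" by blast
    obtain j' where j': "j = Suc j'" using ij by (cases j) auto
    show "(x, y) \<in> Bef (z # xs)"
      using ij Cons j' by (cases i) auto
  qed
qed auto

lemma bsup_Bef:
  assumes "distinct vs" "(x, y) \<in> Bef vs" "\<And>m. c m \<noteq> 0 \<Longrightarrow> \<exists>k\<ge>- N. m = vroot x y k"
  shows "bsup vs c"
proof -
  obtain i j where "i < j" "j < length vs" "vs ! i = x" "vs ! j = y" using assms(2) by (auto simp: Bef_nth)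
  then show ?thesis using bsup_root[OF assms(1), of i j c N] assms(3) by simp
qed

lemma prod_set_nth: "distinct xs \<Longrightarrow> (\<Prod>a<length xs. f (xs ! a)) = (\<Prod>x\<in>set xs. f x)"
  by (rule prod.reindex_bij_betw[OF bij_betw_nth]) auto

lemma prod_Bef:
  "distinct xs \<Longrightarrow> (\<Prod>b<length xs. \<Prod>a<b. g (xs ! a) (xs ! b)) = (\<Prod>(x, y)\<in>Bef xs. g x y :: 'c::comm_monoid_mult)"
proof (induction xs rule: rev_induct)
  case (snoc y xs)
  have "(\<Prod>b<length (xs @ [y]). \<Prod>a<b. g ((xs @ [y]) ! a) ((xs @ [y]) ! b)) =
      (\<Prod>b<length xs. \<Prod>a<b. g (xs ! a) (xs ! b)) * (\<Prod>a<length xs. g (xs ! a) y)"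
    by (auto simp: nth_append intro!: arg_cong2[where f="(*)"] prod.cong)
  also have "\<dots> = (\<Prod>(x, y)\<in>Bef xs. g x y) * (\<Prod>x\<in>set xs. g x y)"
    using snoc prod_set_nth[of xs "\<lambda>x. g x y"] by simp
  also have "(\<Prod>x\<in>set xs. g x y) = (\<Prod>(x, y)\<in>set xs \<times> {y}. g x y)"
    by (simp flip: prod.cartesian_product)
  also have "(\<Prod>(x, y)\<in>Bef xs. g x y) * \<dots> = (\<Prod>(x, y)\<in>Bef xs \<union> set xs \<times> {y}. g x y)"
    using snoc(2) Bef_subset[of xs] by (intro prod.union_disjoint[symmetric]) auto
  also have "Bef xs \<union> set xs \<times> {y} = Bef (xs @ [y])" by (simp add: Bef_append)
  finally show ?case .
qed auto

text \<open>
  The product \<open>\<Prod>\<^sub>a\<^sub><\<^sub>b \<zeta>(v\<^sub>a/v\<^sub>b)\<close>; it is the numerator of the image of a word, and for the opposite half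
  the denominator in the pairing with words.
\<close>

definition om :: "('i::finite, 'k::field) zeta_data \<Rightarrow> half \<Rightarrow> 'i var list \<Rightarrow> ('i var, 'k) ratfun" where
  "om p s vs = (\<Prod>(x, y)\<in>Bef vs. kap p s x y)"

lemma ren_om:
  assumes f: "inj f" "\<And>x. x \<in> set vs \<Longrightarrow> col (f x) = col x"
  shows "ren f (om p s vs) = om p s (map f vs)"
proof -
  have i: "inj_on (map_prod f f) (Bef vs)"
    using f(1) by (meson inj_on_subset prod.inj_map subset_UNIV)
  have "ren f (om p s vs) = (\<Prod>(x, y)\<in>Bef vs. kap p s (f x) (f y))"
    unfolding om_def ren_prod[OF f(1)]
    by (rule prod.cong) (use f Bef_subset in \<open>force simp: ren_kap\<close>)+
  also have "\<dots> = om p s (map f vs)"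
    unfolding om_def Bef_map by (subst prod.reindex[OF i]) (auto intro!: prod.cong)
  finally show ?thesis .
qed

lemma om_append:
  assumes "distinct (xs @ ys)"
  shows "om p s (xs @ ys) = om p s xs * om p s ys * (\<Prod>x\<in>set xs. \<Prod>y\<in>set ys. kap p s x y)"
proof -
  have "om p s (xs @ ys) = (\<Prod>(x, y)\<in>Bef xs \<union> Bef ys. kap p s x y) * (\<Prod>(x, y)\<in>set xs \<times> set ys. kap p s x y)"
    unfolding om_def Bef_append using assms Bef_subset[of xs] Bef_subset[of ys]
    by (intro prod.union_disjoint) auto
  also have "(\<Prod>(x, y)\<in>Bef xs \<union> Bef ys. kap p s x y) = om p s xs * om p s ys"
    unfolding om_def using assms Bef_subset[of xs] Bef_subset[of ys]
    by (intro prod.union_disjoint) auto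
  finally show ?thesis by (simp add: prod.cartesian_product)
qed

section \<open>The variables of a word\<close>

definition Vset :: "('i \<Rightarrow> nat) \<Rightarrow> 'i var set" where
  "Vset n = {ZVar i a | i a. a \<in> {1..n i}}"

lemma ZVar_Vset [simp]: "ZVar i a \<in> Vset n \<longleftrightarrow> 1 \<le> a \<and> a \<le> n i"
  by (auto simp: Vset_def)

lemma finite_Vset [simp]: "finite (Vset (n :: 'i::finite \<Rightarrow> nat))"
proof -
  have "Vset n = (\<Union>i. ZVar i ` {1..n i})" by (auto simp: Vset_def image_iff)
  then show ?thesis by simp
qed

definition wv :: "('i \<times> int) list \<Rightarrow> 'i var list" where
  "wv w = map (word_var w) [0..<length w]"

lemma length_wv [simp]: "length (wv w) = length w"
  by (simp add: wv_def)

lemma wv_nth [simp]: "a < length w \<Longrightarrow> wv w ! a = word_var w a"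
  by (simp add: wv_def)

lemma wv_Nil [simp]: "wv [] = []"
  by (simp add: wv_def)

lemma col_word_var [simp]: "col (word_var w a) = fst (w ! a)"
  by (simp add: word_var_def)

lemma map_col_wv: "map col (wv w) = map fst w"
  by (rule nth_equalityI) auto

lemma word_weight_append: "word_weight (u @ w) = (\<lambda>i. word_weight u i + word_weight w i)"
  by (auto simp: word_weight_def)

lemma word_weight_simps [simp]: "word_weight [] = (\<lambda>_. 0)"
  "word_weight (x # w) = (\<lambda>i. (if i = fst x then 1 else 0) + word_weight w i)"
  by (auto simp: word_weight_def)

lemma wv_snoc: "wv (w @ [l]) = wv w @ [ZVar (fst l) (Suc (word_weight w (fst l)))]"
proof -
  have 1: "word_var (w @ [l]) a = word_var w a" if "a < length w" for a
  proof -
    have "{b. b \<le> a \<and> fst ((w @ [l]) ! b) = fst ((w @ [l]) ! a)} = {b. b \<le> a \<and> fst (w ! b) = fst (w ! a)}"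
      using that by (auto simp: nth_append)
    then show ?thesis using that by (simp add: word_var_def nth_append)
  qed
  have "{b. b \<le> length w \<and> fst ((w @ [l]) ! b) = fst l} =
      insert (length w) {b. b < length w \<and> fst l = map fst w ! b}"
    by (auto simp: nth_append)
  then have "card {b. b \<le> length w \<and> fst ((w @ [l]) ! b) = fst l} = Suc (word_weight w (fst l))"
    by (simp add: word_weight_def count_list_eq_length_filter length_filter_conv_card eq_commute)
  then have 2: "word_var (w @ [l]) (length w) = ZVar (fst l) (Suc (word_weight w (fst l)))"
    by (simp add: word_var_def)
  show ?thesis unfolding wv_def using 1 2 by simp
qed

lemma set_wv: "set (wv w) = Vset (word_weight w)"
proof (induction w rule: rev_induct)
  case (snoc l w)
  have "v \<in> Vset (word_weight (w @ [l])) \<longleftrightarrow> v = ZVar (fst l) (Suc (word_weight w (fst l))) \<or> v \<in> Vset (word_weight w)" for v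
    by (cases v) (auto simp: word_weight_append)
  with snoc show ?case by (auto simp: wv_snoc)
qed (auto simp: Vset_def)

lemma distinct_wv: "distinct (wv w)"
  by (induction w rule: rev_induct) (auto simp: wv_snoc set_wv)

lemma wv_cong: "map fst u = map fst w \<Longrightarrow> wv u = wv w"
proof (induction u arbitrary: w rule: rev_induct)
  case (snoc l u)
  then obtain l' w' where w: "w = w' @ [l']"
    by (cases w rule: rev_cases) auto
  have "word_weight u = word_weight w'" using snoc(2) by (auto simp: word_weight_def w)
  then show ?case using snoc by (auto simp: wv_snoc w)
qed auto

lemma word_weight_cong: "map fst u = map fst w \<Longrightarrow> word_weight u = word_weight w"
  by (auto simp: word_weight_def)

fun shv :: "('i \<Rightarrow> nat) \<Rightarrow> 'i var \<Rightarrow> 'i var" where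
  "shv n (ZVar i a) = ZVar i (n i + a)"

lemma inj_shv: "inj (shv n)"
proof (rule injI)
  fix x y show "shv n x = shv n y \<Longrightarrow> x = y" by (cases x; cases y) auto
qed

lemma col_shv [simp]: "col (shv n x) = col x"
  by (cases x) auto

lemma wv_append: "wv (u @ w) = wv u @ map (shv (word_weight u)) (wv w)"
proof (induction w rule: rev_induct)
  case (snoc l w)
  have "wv (u @ w @ [l]) = wv ((u @ w) @ [l])" by simp
  then show ?case using snoc unfolding wv_snoc by (simp add: word_weight_append wv_snoc)
qed auto

definition wmon :: "('i \<times> int) list \<Rightarrow> ('i var \<Rightarrow>\<^sub>0 int)" where
  "wmon w = (\<Sum>a<length w. single (wv w ! a) (snd (w ! a)))"

lemma wmon_Nil [simp]: "wmon [] = 0"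
  by (simp add: wmon_def)

lemma wmon_snoc: "wmon (w @ [l]) = wmon w + single (ZVar (fst l) (Suc (word_weight w (fst l)))) (snd l)"
proof -
  have "(\<Sum>a<length w. single (wv (w @ [l]) ! a) (snd ((w @ [l]) ! a))) = wmon w"
    unfolding wmon_def wv_snoc by (rule sum.cong) (auto simp: nth_append)
  moreover have "wv (w @ [l]) ! length w = ZVar (fst l) (Suc (word_weight w (fst l)))"
    unfolding wv_snoc by (simp add: nth_append)
  ultimately show ?thesis by (simp add: wmon_def[of "w @ [l]"] del: wv_nth)
qed

lemma wmon_append: "wmon (u @ w) = wmon u + ren_mon (shv (word_weight u)) (wmon w)"
proof (induction w rule: rev_induct)
  case (snoc l w)
  have "wmon (u @ w @ [l]) = wmon ((u @ w) @ [l])" by simp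
  then show ?case using snoc unfolding wmon_snoc by (simp add: word_weight_append add.assoc)
qed auto

lemma lookup_wmon: "a < length w \<Longrightarrow> lookup (wmon w) (wv w ! a) = snd (w ! a)"
proof -
  assume a: "a < length w"
  have "lookup (wmon w) (wv w ! a) = (\<Sum>b<length w. if b = a then snd (w ! b) else 0)"
    unfolding wmon_def lookup_sum using a distinct_wv[of w]
    by (intro sum.cong) (auto simp: lookup_single when_def nth_eq_iff_index_eq simp flip: wv_nth)
  then show ?thesis using a by simp
qed

lemma keys_wmon: "keys (wmon w) \<subseteq> Vset (word_weight w)"
  unfolding wmon_def set_wv[symmetric]
  by (rule order_trans[OF keys_sum]) (auto simp: in_set_conv_nth simp del: wv_nth split: if_splits)

text \<open>The inverse of \<open>wmon\<close>, once the colours are given.\<close>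

definition word_of :: "'i list \<Rightarrow> ('i var \<Rightarrow>\<^sub>0 int) \<Rightarrow> ('i \<times> int) list" where
  "word_of is m = zip is (map (lookup m) (wv (map (\<lambda>i. (i, 0)) is)))"

lemma word_of:
  assumes "map fst w = is" "keys m \<subseteq> Vset (word_weight w)"
  shows "map fst (word_of is m) = is" "wmon (word_of is m) = m"
proof -
  have w0: "wv (map (\<lambda>i. (i, 0)) is) = wv w" by (rule wv_cong) (simp add: assms(1)[symmetric] comp_def)
  show f: "map fst (word_of is m) = is" by (simp add: word_of_def)
  then have v: "wv (word_of is m) = wv w" using assms(1) by (intro wv_cong) simp
  have l: "length (word_of is m) = length w" using arg_cong[OF assms(1), of length] by (simp add: word_of_def)
  show "wmon (word_of is m) = m"
  proof (rule poly_mapping_eqI)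
    fix x
    show "lookup (wmon (word_of is m)) x = lookup m x"
    proof (cases "x \<in> set (wv w)")
      case True
      then obtain a where a: "a < length w" "x = wv w ! a" by (auto simp: in_set_conv_nth)
      have "lookup (wmon (word_of is m)) x = snd (word_of is m ! a)"
        using lookup_wmon[of a "word_of is m"] a l v by simp
      also have "\<dots> = lookup m x"
        using a arg_cong[OF assms(1), of length] by (simp add: word_of_def w0)
      finally show ?thesis .
    next
      case False
      then have "x \<notin> keys (wmon (word_of is m))" "x \<notin> keys m"
        using keys_wmon[of "word_of is m"] assms(2) unfolding set_wv[symmetric] v by auto
      then show ?thesis by (simp add: in_keys_iff)
    qed
  qed
qed

section \<open>Symmetry under permutations of the variables\<close>

fun pv :: "('i \<Rightarrow> nat \<Rightarrow> nat) \<Rightarrow> 'i var \<Rightarrow> 'i var" where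
  "pv \<sigma> (ZVar i a) = ZVar i (\<sigma> i a)"

lemma col_pv [simp]: "col (pv \<sigma> x) = col x"
  by (cases x) auto

lemma inj_pv: "\<sigma> \<in> color_perms n \<Longrightarrow> inj (pv \<sigma>)"
proof (rule injI)
  fix x y assume "\<sigma> \<in> color_perms n" "pv \<sigma> x = pv \<sigma> y"
  then show "x = y" by (cases x; cases y) (auto simp: color_perms_def dest: permutes_inj injD)
qed

lemma pv_Vset: "\<sigma> \<in> color_perms n \<Longrightarrow> pv \<sigma> x \<in> Vset n \<longleftrightarrow> x \<in> Vset n"
proof (cases x)
  case (ZVar i a)
  assume "\<sigma> \<in> color_perms n"
  then have "\<sigma> i permutes {1..n i}" by (auto simp: color_perms_def)
  from permutes_in_image[OF this, of a] show ?thesis by (simp add: ZVar)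
qed

lemma pv_image_Vset:
  fixes n :: "'i::finite \<Rightarrow> nat"
  assumes "\<sigma> \<in> color_perms n" shows "pv \<sigma> ` Vset n = Vset n"
proof (rule endo_inj_surj)
  show "pv \<sigma> ` Vset n \<subseteq> Vset n" using pv_Vset[OF assms] by auto
  show "inj_on (pv \<sigma>) (Vset n)" using inj_pv[OF assms] by (rule inj_on_subset) simp
qed simp

lemma V_graded_iff:
  fixes R :: "('i::finite var, 'k::field) laurent"
  shows "R \<in> V_graded n \<longleftrightarrow> (\<forall>m\<in>keys R. keys m \<subseteq> Vset n) \<and> (\<forall>\<sigma>\<in>color_perms n. ren_laurent (pv \<sigma>) R = R)"
proof -
  have "laurent_subst R (case_var (\<lambda>i a. rat_var (ZVar i (\<sigma> i a)))) = to_ratfun (ren_laurent (pv \<sigma>) R)" for \<sigma>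
  proof -
    have "case_var (\<lambda>i a. rat_var (ZVar i (\<sigma> i a))) =
        (\<lambda>v. rat_var (pv \<sigma> v) :: ('i var, 'k) ratfun)"
      by (auto split: var.splits)
    then show ?thesis by (simp add: laurent_subst_ren)
  qed
  then show ?thesis unfolding V_graded_def Vset_def by simp
qed

text \<open>
  Two relabellings with the same image differ by a permutation within the colours.
\<close>

lemma V_graded_relabel:
  fixes R :: "('i::finite var, 'k::field) laurent"
  assumes R: "R \<in> V_graded n" and c: "\<And>x. x \<in> Vset n \<Longrightarrow> col (g x) = col x" "\<And>x. x \<in> Vset n \<Longrightarrow> col (h x) = col x"
    and i: "inj_on g (Vset n)" "inj_on h (Vset n)" and e: "g ` Vset n = h ` Vset n"
  shows "ren_laurent g R = ren_laurent h R"
proof -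
  define k where "k x = the_inv_into (Vset n) h (g x)" for x
  have bij: "bij_betw k (Vset n) (Vset n)"
  proof -
    have "bij_betw (the_inv_into (Vset n) h) (g ` Vset n) (Vset n)"
      unfolding e using i(2) by (simp add: bij_betw_the_inv_into inj_on_imp_bij_betw)
    moreover have "bij_betw g (Vset n) (g ` Vset n)" using i(1) by (simp add: inj_on_imp_bij_betw)
    ultimately have "bij_betw (the_inv_into (Vset n) h \<circ> g) (Vset n) (Vset n)" by (rule bij_betw_trans[rotated])
    then show ?thesis by (simp add: k_def[abs_def] comp_def)
  qed
  have hk: "h (k x) = g x" if "x \<in> Vset n" for x
    unfolding k_def using that e i(2) by (intro f_the_inv_into_f) auto
  have kV: "k x \<in> Vset n" if "x \<in> Vset n" for x using bij that by (auto simp: bij_betw_def)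
  have ck: "col (k x) = col x" if "x \<in> Vset n" for x
    using c(1)[OF that] c(2)[OF kV[OF that]] hk[OF that] by simp
  define \<sigma> where "\<sigma> i a = (if a \<in> {1..n i} then (case k (ZVar i a) of ZVar _ b \<Rightarrow> b) else a)" for i a
  have pk: "pv \<sigma> x = k x" if x: "x \<in> Vset n" for x
  proof (cases x)
    case (ZVar i a)
    then show ?thesis using ck[OF x] x by (cases "k x") (auto simp: \<sigma>_def)
  qed
  have "\<sigma> i permutes {1..n i}" for i
  proof (rule bij_imp_permutes)
    show "bij_betw (\<sigma> i) {1..n i} {1..n i}"
    proof -
      have s: "ZVar i (\<sigma> i a) = k (ZVar i a)" if "a \<in> {1..n i}" for a
        using pk[of "ZVar i a"] that by simp
      have "inj_on (\<sigma> i) {1..n i}"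
      proof (rule inj_onI)
        fix a b assume ab: "a \<in> {1..n i}" "b \<in> {1..n i}" "\<sigma> i a = \<sigma> i b"
        then have "k (ZVar i a) = k (ZVar i b)" using s by metis
        then show "a = b" using bij ab by (auto simp: bij_betw_def dest!: inj_onD)
      qed
      moreover have "\<sigma> i ` {1..n i} \<subseteq> {1..n i}"
      proof
        fix b assume "b \<in> \<sigma> i ` {1..n i}"
        then obtain a where a: "a \<in> {1..n i}" "b = \<sigma> i a" by auto
        then have "ZVar i b \<in> Vset n" using s[OF a(1)] kV[of "ZVar i a"] by simp
        then show "b \<in> {1..n i}" by simp
      qed
      ultimately show ?thesis by (simp add: bij_betw_def endo_inj_surj)
    qed
  qed (auto simp: \<sigma>_def)
  then have "\<sigma> \<in> color_perms n" by (simp add: color_perms_def)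
  then have "ren_laurent (pv \<sigma>) R = R" using R by (simp add: V_graded_iff)
  then have "ren_laurent h R = ren_laurent (h \<circ> pv \<sigma>) R" by (metis ren_laurent_comp)
  also have "\<dots> = ren_laurent g R"
  proof (rule ren_laurent_cong)
    fix m v assume "m \<in> keys R" "v \<in> keys m"
    then have "v \<in> Vset n" using R by (auto simp: V_graded_iff)
    then show "(h \<circ> pv \<sigma>) v = g v" by (simp add: pk hk)
  qed
  finally show ?thesis ..
qed

lemma extend_inj:
  assumes S: "finite S" and h: "inj_on h (S :: 'a set)"
  obtains f :: "'a \<Rightarrow> 'a" where "inj f" "\<And>x. x \<in> S \<Longrightarrow> f x = h x"
proof -
  define U where "U = S \<union> h ` S"
  have "card (U - S) = card (U - h ` S)"
    using S card_image[OF h] by (simp add: U_def card_Diff_subset)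
  then obtain g where g: "bij_betw g (U - S) (U - h ` S)"
    using S finite_same_card_bij[of "U - S" "U - h ` S"] by (auto simp: U_def)
  define f where "f x = (if x \<in> S then h x else if x \<in> U then g x else x)" for x
  have gU: "g x \<in> U - h ` S" if "x \<in> U" "x \<notin> S" for x using g that by (auto simp: bij_betw_def)
  have "inj_on f S" using h by (auto simp: f_def inj_on_def)
  moreover have "inj_on f (U - S)" using g by (auto simp: f_def inj_on_def bij_betw_def)
  moreover have "inj_on f (- U)" by (auto simp: f_def inj_on_def U_def)
  moreover have "f ` S \<subseteq> h ` S" "f ` (U - S) \<subseteq> U - h ` S" "f ` (- U) \<subseteq> - U"
    using gU by (auto simp: f_def U_def)
  moreover have "h ` S \<subseteq> U" by (auto simp: U_def)
  ultimately have "inj_on f (S \<union> ((U - S) \<union> - U))" unfolding inj_on_Un by blast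
  moreover have "S \<union> ((U - S) \<union> - U) = UNIV" by blast
  ultimately have "inj f" by simp
  then show ?thesis by (rule that) (simp add: f_def)
qed

section \<open>The pairing of a word with a Laurent polynomial\<close>

text \<open>
  The region of expansion of the two halves: the first variable of a word is the largest one for the
  positive and the smallest one for the negative half.
\<close>

fun ord_list :: "half \<Rightarrow> 'a list \<Rightarrow> 'a list" where
  "ord_list Positive vs = vs"
| "ord_list Negative vs = rev vs"

lemma ord_list_simps [simp]: "set (ord_list s vs) = set vs" "distinct (ord_list s vs) = distinct vs"
  "ord_list s (map f vs) = map f (ord_list s vs)"
  by (cases s; simp add: rev_map)+

lemma word_pairing_eq:
  fixes p :: "('i::finite, 'k::field_char_0) zeta_data"
  shows "word_pairing p s w R = constant_term (ord_list s (wv w))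
     (zmon (wmon w) * to_ratfun R / om p (opposite s) (wv w))"
proof -
  have z: "(\<Prod>a<length w. rat_var (word_var w a) powi snd (w ! a)) = (zmon (wmon w) :: ('i var, 'k) ratfun)"
    by (simp add: rat_var_powi wmon_def zmon_sum)
  have o: "om p s' (wv w) = (\<Prod>b<length w. \<Prod>a<b. kap p s' (word_var w a) (word_var w b))" for s'
    unfolding om_def prod_Bef[OF distinct_wv, symmetric] by simp
  show ?thesis
    by (cases s) (auto simp: z o Let_def kap_def simp flip: wv_def)
qed

context zeta
begin

lemma om_nonzero: "distinct vs \<Longrightarrow> om p s vs \<noteq> 0"
  using Bef_neq[of vs] kap_nonzero by (auto simp: om_def)

lemma inverse_om_series:
  assumes d: "distinct vs"
  shows "\<exists>c. series_of (1 / om p t vs) c \<and> bsup (ord_list s vs) c"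
proof -
  have "\<exists>c. series_of (1 / kap p t x y) c \<and> bsup (ord_list s vs) c" if xy: "(x, y) \<in> Bef vs" for x y
  proof -
    have "x \<noteq> y" using Bef_neq[OF d xy] .
    show ?thesis
    proof (cases s)
      case Positive
      obtain c where "series_of (1 / kap p t x y) c" "\<And>m. c m \<noteq> 0 \<Longrightarrow> \<exists>k\<ge>- kbound. m = vroot x y k"
        using kbound(2)[OF \<open>x \<noteq> y\<close>, of t] unfolding ratio_bounded_def by blast
      then show ?thesis using Positive bsup_Bef[OF d xy, of c] by auto
    next
      case Negative
      obtain c where "series_of (1 / kap p t x y) c" "\<And>m. c m \<noteq> 0 \<Longrightarrow> \<exists>k\<ge>- kbound. m = vroot y x k"
        using kbound(3)[OF \<open>x \<noteq> y\<close>, of t] unfolding ratio_bounded_def by blast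
      then show ?thesis using Negative bsup_Bef[of "rev vs" y x c] d xy by (auto simp: Bef_rev)
    qed
  qed
  then obtain c where c: "\<And>x y. (x, y) \<in> Bef vs \<Longrightarrow> series_of (1 / kap p t x y) (c x y) \<and> bsup (ord_list s vs) (c x y)"
    by metis
  have "\<exists>e. series_of (\<Prod>(x, y)\<in>Bef vs. 1 / kap p t x y) e \<and> (\<forall>us\<in>{ord_list s vs}. bsup us e) \<and>
    (\<forall>m. e m \<noteq> 0 \<longrightarrow> (\<exists>a. m = (\<Sum>j\<in>Bef vs. a j) \<and> (\<forall>j\<in>Bef vs. case_prod c j (a j) \<noteq> 0)))"
    by (rule series_of_prod) (use c d in \<open>auto\<close>)
  moreover have "(\<Prod>(x, y)\<in>Bef vs. 1 / kap p t x y) = 1 / om p t vs"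
    by (simp add: om_def case_prod_unfold prod_dividef)
  ultimately show ?thesis by auto
qed

lemma quotient_om_series:
  assumes d: "distinct vs" and R: "\<And>m. m \<in> keys R \<Longrightarrow> keys m \<subseteq> set vs"
  shows "\<exists>c. series_of (to_ratfun R / om p t vs) c \<and> bsup (ord_list s vs) c"
proof -
  obtain c where c: "series_of (1 / om p t vs) c" "bsup (ord_list s vs) c"
    using inverse_om_series[OF d] by blast
  have "series_of (to_ratfun R * (1 / om p t vs)) (lact R c)" by (rule series_of_lact[OF c(1)])
  moreover have "bsup (ord_list s vs) (lact R c)" by (rule bsup_lact) (use d R c in auto)
  ultimately show ?thesis by auto
qed

text \<open>
  All pairings of \<open>R\<close> with words of a given sequence of colours are coefficients of one series,
  and the variables of \<open>R\<close> may be identified with any other variables of the same colours.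
\<close>

lemma word_pairing_series:
  fixes R :: "('i var, 'k) laurent"
  assumes R: "R \<in> V_graded (word_weight w)"
  obtains c where "series_of (to_ratfun R / om p (opposite s) (wv w)) c" "bsup (ord_list s (wv w)) c"
    "\<And>u. map fst u = map fst w \<Longrightarrow> word_pairing p s u R = c (- wmon u)"
proof -
  obtain c where c: "series_of (to_ratfun R / om p (opposite s) (wv w)) c" "bsup (ord_list s (wv w)) c"
    using quotient_om_series[OF distinct_wv[of w], where R = R and t = "opposite s" and s = s] R
    unfolding V_graded_iff set_wv by blast
  have "word_pairing p s u R = c (- wmon u)" if u: "map fst u = map fst w" for u
  proof -
    have v: "wv u = wv w" "word_weight u = word_weight w"
      using u by (auto intro: wv_cong word_weight_cong)
    have "series_of (zmon (wmon u) * (to_ratfun R / om p (opposite s) (wv w))) (\<lambda>m. c (m - wmon u))"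
      by (rule series_of_zmon[OF c(1)])
    moreover have "bsup (ord_list s (wv w)) (\<lambda>m. c (m - wmon u))"
      by (rule bsup_shift[OF c(2)]) (use keys_wmon[of u] v in \<open>auto simp: set_wv\<close>)
    ultimately have "constant_term (ord_list s (wv w)) (zmon (wmon u) * (to_ratfun R / om p (opposite s) (wv w))) = c (0 - wmon u)"
      by (intro constant_term_eq) (auto simp: distinct_wv)
    then show ?thesis by (simp add: word_pairing_eq v)
  qed
  with c show ?thesis by (rule that)
qed

lemma relabelled_series:
  fixes R :: "('i var, 'k) laurent"
  assumes R: "R \<in> V_graded (word_weight w)" and vs: "distinct vs" "map col vs = map fst w"
    and g: "inj_on g (Vset (word_weight w))" "\<And>x. x \<in> Vset (word_weight w) \<Longrightarrow> col (g x) = col x"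
      "g ` Vset (word_weight w) = set vs"
  obtains c where "series_of (to_ratfun (ren_laurent g R) / om p (opposite s) vs) c" "bsup (ord_list s vs) c"
    "\<And>u m. map fst u = map fst w \<Longrightarrow> (\<And>a. a < length vs \<Longrightarrow> lookup m (vs ! a) = snd (u ! a)) \<Longrightarrow>
        keys m \<subseteq> set vs \<Longrightarrow> c (- m) = word_pairing p s u R"
proof -
  let ?V = "Vset (word_weight w)"
  have lw: "length vs = length w" using arg_cong[OF vs(2), of length] by simp
  obtain c where c: "series_of (to_ratfun R / om p (opposite s) (wv w)) c" "bsup (ord_list s (wv w)) c"
    "\<And>u. map fst u = map fst w \<Longrightarrow> word_pairing p s u R = c (- wmon u)"
    by (rule word_pairing_series[OF R, of s]) blast
  define h where "h x = vs ! (THE a. a < length w \<and> wv w ! a = x)" for x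
  have h: "h (wv w ! a) = vs ! a" if "a < length w" for a
  proof -
    have "(THE b. b < length w \<and> wv w ! b = wv w ! a) = a"
      using that distinct_wv[of w] by (intro the_equality) (auto simp: nth_eq_iff_index_eq simp del: wv_nth)
    then show ?thesis by (simp add: h_def del: wv_nth)
  qed
  have V: "?V = (\<lambda>a. wv w ! a) ` {..<length w}" by (auto simp: set_wv[symmetric] in_set_conv_nth simp del: wv_nth)
  have ih: "inj_on h ?V"
    unfolding V using h vs(1) lw by (auto intro!: inj_onI simp: nth_eq_iff_index_eq simp del: wv_nth)
  obtain f where f: "inj f" "\<And>x. x \<in> ?V \<Longrightarrow> f x = h x"
    by (rule extend_inj[OF finite_Vset ih]) blast
  have fw: "f (wv w ! a) = vs ! a" if "a < length w" for a
    using that f(2)[of "wv w ! a"] h by (simp add: V del: wv_nth)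
  have mf: "map f (wv w) = vs" using lw fw by (intro nth_equalityI) (auto simp del: wv_nth)
  have cf: "col (f x) = col x" if x: "x \<in> ?V" for x
  proof -
    obtain a where a: "a < length w" "x = wv w ! a" using x by (auto simp: V)
    have "col (vs ! a) = map col vs ! a" "col (wv w ! a) = map col (wv w) ! a" using a lw by auto
    then show ?thesis using fw[OF a(1)] a(2) vs(2) map_col_wv[of w] by simp
  qed
  have "ren_laurent f R = ren_laurent g R"
  proof (rule V_graded_relabel[OF R cf g(2) _ g(1)])
    show "inj_on f ?V" using f(1) by (rule inj_on_subset) simp
    show "f ` ?V = g ` ?V" using arg_cong[OF mf, of set] g(3) by (simp add: set_wv)
  qed
  moreover have "series_of (ren f (to_ratfun R / om p (opposite s) (wv w))) (ren_series f c)"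
    by (rule series_of_ren[OF f(1) c(1)])
  ultimately have 1: "series_of (to_ratfun (ren_laurent g R) / om p (opposite s) vs) (ren_series f c)"
    using ren_om[OF f(1), of "wv w" p "opposite s"] cf by (simp add: ren_div[OF f(1)] ren_to_ratfun[OF f(1)] mf set_wv)
  have 2: "bsup (ord_list s vs) (ren_series f c)"
    using bsup_ren[OF f(1) c(2)] by (simp add: mf[symmetric])
  have 3: "ren_series f c (- m) = word_pairing p s u R"
    if u: "map fst u = map fst w" and m: "\<And>a. a < length vs \<Longrightarrow> lookup m (vs ! a) = snd (u ! a)" and k: "keys m \<subseteq> set vs" for u m
  proof -
    have lu: "length u = length w" using arg_cong[OF u, of length] by simp
    have vu: "wv u = wv w" "word_weight u = word_weight w" using u by (auto intro: wv_cong word_weight_cong)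
    have "m = ren_mon f (wmon u)"
    proof (rule poly_mapping_eqI)
      fix x
      show "lookup m x = lookup (ren_mon f (wmon u)) x"
      proof (cases "x \<in> set vs")
        case True
        then obtain a where a: "a < length w" "x = vs ! a" by (auto simp: in_set_conv_nth lw)
        have "lookup (ren_mon f (wmon u)) x = lookup (ren_mon f (wmon u)) (f (wv u ! a))" using a fw vu by simp
        also have "\<dots> = snd (u ! a)" unfolding lookup_ren_mon[OF f(1)] using a lu by (intro lookup_wmon) simp
        finally show ?thesis using m[of a] a lw by simp
      next
        case False
        have "keys (ren_mon f (wmon u)) \<subseteq> f ` ?V"
          using keys_ren_mon[of f "wmon u"] keys_wmon[of u] vu by auto
        also have "\<dots> = set vs" using arg_cong[OF mf, of set] by (simp add: set_wv)
        finally show ?thesis using False k by (metis in_keys_iff subsetD)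
      qed
    qed
    then show ?thesis using c(3)[OF u] f(1) by (simp flip: ren_mon_simps)
  qed
  show ?thesis by (rule that[OF 1 2 3])
qed

text \<open>The pairings with the words of one sequence of colours are all the coefficients of the expansion
  of \<open>R\<close> divided by the kernel, and a function with zero expansion is zero.\<close>

lemma word_pairing_nondegenerate:
  fixes R :: "('i var, 'k) laurent"
  assumes R: "R \<in> V_graded (word_weight w)"
    and z: "\<And>u. map fst u = map fst w \<Longrightarrow> word_pairing p s u R = 0"
  shows "R = 0"
proof -
  obtain c where c: "series_of (to_ratfun R / om p (opposite s) (wv w)) c" "bsup (ord_list s (wv w)) c"
    "\<And>u. map fst u = map fst w \<Longrightarrow> word_pairing p s u R = c (- wmon u)"
    by (rule word_pairing_series[OF R, of s]) blast
  have "c m = 0" for m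
  proof (rule ccontr)
    assume nz: "c m \<noteq> 0"
    then have "keys m \<subseteq> Vset (word_weight w)" using bsup_keys[OF c(2)] by (simp add: set_wv)
    then have k: "keys (- m) \<subseteq> Vset (word_weight w)" by simp
    show False using c(3)[OF word_of(1)[OF refl k]] z[OF word_of(1)[OF refl k]] word_of(2)[OF refl k] nz by simp
  qed
  then have c0: "c = (\<lambda>_. 0)" by auto
  obtain N D where *: "D \<noteq> 0" "to_ratfun R / om p (opposite s) (wv w) = to_ratfun N / to_ratfun D"
    "\<And>m. lact D c m = lookup N m"
    using c(1) unfolding series_of_def by blast
  have "lookup N m = 0" for m using *(3)[of m] by (simp add: c0 lact_def pext_def)
  then have "N = 0" by (intro poly_mapping_eqI) simp
  then have "to_ratfun R / om p (opposite s) (wv w) = 0" using *(2) by simp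
  then show ?thesis using om_nonzero[OF distinct_wv] by simp
qed

end

section \<open>Symmetric rational functions with simple poles\<close>

definition vdiff :: "'v \<Rightarrow> 'v \<Rightarrow> ('v, 'k::field) laurent" where
  "vdiff x y = single (single x 1) 1 - single (single y 1) 1"

definition collapse :: "'v \<Rightarrow> 'v \<Rightarrow> 'v \<Rightarrow> 'v" where
  "collapse x y v = (if v = x then y else v)"

lemma ren_vdiff [simp]: "ren_laurent f (vdiff x y) = vdiff (f x) (f y)"
  by (simp add: vdiff_def)

lemma vdiff_swap: "vdiff y x = - vdiff x y"
  by (simp add: vdiff_def)

lemma vdiff_eq_0 [simp]: "vdiff x y = 0 \<longleftrightarrow> x = y"
proof
  assume "vdiff x y = (0 :: ('a, 'b) laurent)"
  then have "lookup (vdiff x y :: ('a, 'b) laurent) (single x 1) = 0" by simp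
  then have "single y 1 = single x (1 :: int)"
    by (simp add: vdiff_def lookup_minus lookup_single when_def split: if_splits)
  then have "lookup (single y (1 :: int)) x = lookup (single x 1) x" by simp
  then show "x = y" by (simp add: lookup_single when_def split: if_splits)
qed (simp add: vdiff_def)

lemma vdiff_dvd_power:
  "vdiff x y dvd (single (single x k) 1 - single (single y k) 1 :: ('v, 'k::field) laurent)"
proof (induction k rule: int_induct[where k = 0])
  case (step1 k)
  have "(single (single x (k + 1)) 1 - single (single y (k + 1)) 1 :: ('v, 'k) laurent) =
    single (single x 1) 1 * (single (single x k) 1 - single (single y k) 1) + single (single y k) 1 * vdiff x y"
    by (simp add: vdiff_def right_diff_distrib mult_single single_add add.commute)
  with step1 show ?case by simp
next
  case (step2 k)
  have x: "single x (1 :: int) + (single x (- 1) + r) = r" for r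
    by (simp add: add.assoc[symmetric] single_add[symmetric])
  have "(single (single x (k - 1)) 1 - single (single y (k - 1)) 1 :: ('v, 'k) laurent) =
    single (single x (-1)) 1 * (single (single x k) 1 - single (single y k) 1) -
    single (single x (-1) + single y (k - 1)) 1 * vdiff x y"
    by (simp add: vdiff_def right_diff_distrib mult_single single_add[symmetric] add.assoc)
      (simp add: x add.commute add.left_commute single_add[symmetric])
  with step2 show ?case by simp
qed simp

lemma vdiff_dvd_collapse: "vdiff x y dvd P - ren_laurent (collapse x y) (P :: ('v, 'k::field) laurent)"
proof (induction P rule: pm_induct)
  case (single m c)
  define k where "k = lookup m x"
  define m' where "m' = m - single x k"
  have m: "m = single x k + m'" by (simp add: m'_def)
  have "ren_mon (collapse x y) m' = ren_mon (\<lambda>v. v) m'"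
    by (rule ren_mon_cong) (auto simp: collapse_def m'_def k_def in_keys_iff lookup_minus)
  then have "ren_mon (collapse x y) m = single y k + m'"
    by (simp add: m ren_mon_id) (simp add: collapse_def)
  then have "single m c - ren_laurent (collapse x y) (single m c) =
      single m' c * (single (single x k) 1 - single (single y k) 1)"
    by (simp add: m right_diff_distrib mult_single add.commute)
  then show ?case using vdiff_dvd_power[of x y k] by (metis dvd_mult)
next
  case (add f g)
  have "f + g - ren_laurent (collapse x y) (f + g) =
    (f - ren_laurent (collapse x y) f) + (g - ren_laurent (collapse x y) g)" by simp
  then show ?case using add by (metis dvd_add)
qed simp

lemma vdiff_dvd: "ren_laurent (collapse x y) P = 0 \<Longrightarrow> vdiff x y dvd (P :: ('v, 'k::field) laurent)"
  using vdiff_dvd_collapse[of x y P] by simp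

text \<open>A function symmetric in \<open>x\<close> and \<open>y\<close> has no simple pole along \<open>x = y\<close>, since its residue
  would change sign under the exchange.\<close>

lemma symmetric_no_simple_pole:
  fixes G :: "('v::linorder, 'k::field_char_0) ratfun"
  assumes xy: "x \<noteq> y" and D: "ren_laurent (collapse x y) D \<noteq> 0"
    and N: "G * to_ratfun (vdiff x y * D) = to_ratfun N"
    and G: "ren (transpose x y) G = G"
  obtains N' D' where "ren_laurent (collapse x y) D' \<noteq> 0" "G * to_ratfun D' = to_ratfun N'"
proof -
  let ?\<tau> = "transpose x y" and ?f = "collapse x y"
  have it: "inj ?\<tau>" by (rule bij_is_inj) simp
  have ft: "?f \<circ> ?\<tau> = ?f" by (auto simp: fun_eq_iff collapse_def transpose_def)
  define D' where "D' = D * ren_laurent ?\<tau> D"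
  define M where "M = N * ren_laurent ?\<tau> D"
  have tt: "ren_laurent ?\<tau> (ren_laurent ?\<tau> D) = D"
    by (simp add: ren_laurent_comp ren_laurent_id)
  have M: "to_ratfun M = G * to_ratfun (vdiff x y * D')"
    using N by (simp add: M_def D'_def flip: N)
  have "to_ratfun (ren_laurent ?\<tau> M) = G * to_ratfun (vdiff y x * (ren_laurent ?\<tau> D * D))"
    using arg_cong[OF M, of "ren ?\<tau>"]
    by (simp add: ren_to_ratfun[OF it] ren_mult[OF it] G D'_def tt del: to_ratfun_hom)
  also have "\<dots> = to_ratfun (- M)"
    unfolding to_ratfun_hom(6) M vdiff_swap[of y x] D'_def by (simp add: mult.commute)
  finally have "ren_laurent ?\<tau> M = - M" by (simp only: to_ratfun_eq_iff)
  then have "ren_laurent ?f M = - ren_laurent ?f M"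
    using ren_laurent_comp[of ?f ?\<tau> M] by (simp add: ft)
  then have "ren_laurent ?f M + ren_laurent ?f M = 0" by (simp add: eq_neg_iff_add_eq_0)
  then have "of_nat 2 * ren_laurent ?f M = 0" by simp
  then have "ren_laurent ?f M = 0"
    using of_nat_eq_0_iff[of 2, where ?'a = "('v, 'k) laurent"] by (metis mult_eq_0_iff zero_neq_numeral of_nat_numeral)
  then obtain N' where N': "M = vdiff x y * N'" using vdiff_dvd by (metis dvdE)
  have "to_ratfun (vdiff x y :: ('v, 'k) laurent) \<noteq> 0" using xy by simp
  moreover have "to_ratfun (vdiff x y) * to_ratfun N' = to_ratfun (vdiff x y) * (G * to_ratfun D')"
    using M by (simp add: N' mult_ac)
  ultimately have "G * to_ratfun D' = to_ratfun N'" by simp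
  moreover have "ren_laurent ?f D' \<noteq> 0" using D by (simp add: D'_def ren_laurent_comp ft)
  ultimately show ?thesis by (rule that[rotated])
qed

text \<open>
  The simple poles along the diagonals \<open>x = y\<close> are removed one at a time: a Laurent polynomial that
  vanishes on the diagonal is divisible by \<open>x - y\<close>, and the other denominators do not vanish there.
\<close>

lemma symmetric_laurent:
  fixes G :: "('v::linorder, 'k::field_char_0) ratfun"
  assumes fin: "finite Q" and neq: "\<And>x y. (x, y) \<in> Q \<Longrightarrow> x \<noteq> y" and asym: "\<And>x y. (x, y) \<in> Q \<Longrightarrow> (y, x) \<notin> Q"
    and N: "G * to_ratfun (\<Prod>(x, y)\<in>Q. vdiff x y) = to_ratfun N"
    and G: "\<And>x y. (x, y) \<in> Q \<Longrightarrow> ren (transpose x y) G = G"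
  shows "\<exists>P. G = to_ratfun P"
proof -
  have loc: "\<exists>N' D'. ren_laurent (collapse x y) D' \<noteq> 0 \<and> G * to_ratfun D' = to_ratfun N'"
    if xy: "(x, y) \<in> Q" for x y
  proof -
    define D where "D = (\<Prod>(a, b)\<in>Q - {(x, y)}. vdiff a b :: ('v, 'k) laurent)"
    have "(\<Prod>(x, y)\<in>Q. vdiff x y) = vdiff x y * D"
      unfolding D_def using fin xy by (subst prod.remove[OF fin xy]) auto
    then have 1: "G * to_ratfun (vdiff x y * D) = to_ratfun N" using N by simp
    have "collapse x y a \<noteq> collapse x y b" if "(a, b) \<in> Q" "(a, b) \<noteq> (x, y)" for a b
      using neq[OF that(1)] asym[OF xy] that neq[OF xy] by (auto simp: collapse_def)
    then have "ren_laurent (collapse x y) (case q of (a, b) \<Rightarrow> vdiff a b) \<noteq> (0 :: ('v, 'k) laurent)"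
      if "q \<in> Q - {(x, y)}" for q using that by (cases q) auto
    then have 2: "ren_laurent (collapse x y) D \<noteq> 0"
      unfolding D_def ren_laurent_prod using fin by (simp add: prod_zero_iff)
    show ?thesis by (rule symmetric_no_simple_pole[OF neq[OF xy] 2 1 G[OF xy]]) blast
  qed
  have "\<exists>P. G = to_ratfun P" if "S \<subseteq> Q" "G * to_ratfun (\<Prod>(x, y)\<in>S. vdiff x y) = to_ratfun M" for S M
    using finite_subset[OF that(1) fin] that
  proof (induction S arbitrary: M rule: finite_induct)
    case (insert q S)
    obtain x y where q: "q = (x, y)" by fastforce
    then have xy: "(x, y) \<in> Q" using insert by auto
    obtain N' D' where ND: "ren_laurent (collapse x y) D' \<noteq> 0" "G * to_ratfun D' = to_ratfun N'"
      using loc[OF xy] by blast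
    let ?S = "\<Prod>(x, y)\<in>S. vdiff x y :: ('v, 'k) laurent"
    have M: "G * to_ratfun (vdiff x y * ?S) = to_ratfun M" using insert by (simp add: q)
    have "to_ratfun (M * D') = to_ratfun (N' * (vdiff x y * ?S))"
      unfolding to_ratfun_hom(4)[of M] to_ratfun_hom(4)[of N'] M[symmetric] ND(2)[symmetric] by (simp only: mult_ac)
    then have "M * D' = N' * (vdiff x y * ?S)" by (simp only: to_ratfun_eq_iff)
    then have "ren_laurent (collapse x y) M * ren_laurent (collapse x y) D' = 0"
      by (simp flip: ren_laurent_hom(4)) (simp add: collapse_def)
    then have "ren_laurent (collapse x y) M = 0" using ND by simp
    then obtain M' where M': "M = vdiff x y * M'" using vdiff_dvd by (metis dvdE)
    have "to_ratfun (vdiff x y) * (G * to_ratfun ?S) = to_ratfun (vdiff x y) * to_ratfun M'"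
      using M by (simp add: M' mult_ac)
    then have "G * to_ratfun ?S = to_ratfun M'" using neq[OF xy] by simp
    then show ?case using insert by blast
  qed auto
  then show ?thesis using N by blast
qed

lemma prod_vdiff_orientation:
  assumes "finite A" "finite B" "\<And>x y. (x, y) \<in> A \<Longrightarrow> (y, x) \<notin> A" "\<And>x y. (x, y) \<in> B \<Longrightarrow> (y, x) \<notin> B"
    and "A \<union> A\<inverse> = B \<union> B\<inverse>"
  shows "\<exists>e :: ('v, 'k::field) laurent. (\<Prod>(x, y)\<in>B. vdiff x y) = e * (\<Prod>(x, y)\<in>A. vdiff x y)"
proof -
  let ?v = "\<lambda>(x, y). vdiff x y :: ('v, 'k) laurent"
  have BA: "B - A = (A - B)\<inverse>"
    using assms(3-5) by (auto simp: set_eq_iff)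
  have "prod ?v B = prod ?v (A \<inter> B) * prod ?v (B - A)"
    using assms(2) by (metis (no_types) Int_commute prod.Int_Diff)
  also have "prod ?v (B - A) = (\<Prod>q\<in>A - B. - ?v q)"
  proof -
    have "B - A = prod.swap ` (A - B)" unfolding BA by (auto simp: pair_in_swap_image)
    then have "prod ?v (B - A) = prod ?v (prod.swap ` (A - B))" by (rule arg_cong)
    also have "\<dots> = (\<Prod>q\<in>A - B. ?v (prod.swap q))"
      by (subst prod.reindex) (auto simp: inj_on_def)
    finally have "prod ?v (B - A) = (\<Prod>q\<in>A - B. ?v (prod.swap q))" .
    then show ?thesis by (simp add: case_prod_unfold vdiff_swap[symmetric])
  qed
  also have "\<dots> = (\<Prod>q\<in>A - B. - 1) * prod ?v (A - B)"
    unfolding prod.distrib[symmetric] by simp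
  also have "prod ?v (A \<inter> B) * ((\<Prod>q\<in>A - B. - 1) * prod ?v (A - B)) = (\<Prod>q\<in>A - B. - 1) * prod ?v A"
    using assms(1) prod.Int_Diff[of A ?v B] by (simp add: mult_ac)
  finally show ?thesis by blast
qed

lemma rat_const_of_nat: "rat_const (of_nat c) = (of_nat c :: ('v::linorder, 'k::field) ratfun)"
  by (induction c) (auto simp: rat_const_def single_add)

lemma rat_const_mult: "rat_const (c * d) = rat_const c * (rat_const d :: ('v::linorder, 'k::field) ratfun)"
  by (simp add: rat_const_def mult_single flip: to_ratfun_hom(4))

lemma rat_const_inverse:
  assumes "c \<noteq> 0"
  shows "rat_const (1 / of_nat c) * of_nat c = (1 :: ('v::linorder, 'k::field_char_0) ratfun)"
  unfolding rat_const_of_nat[symmetric] rat_const_mult[symmetric] using assms by (simp add: rat_const_def)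

lemma divide_of_nat:
  assumes "c \<noteq> 0" shows "F / of_nat c = rat_const (1 / of_nat c) * (F :: ('v::linorder, 'k::field_char_0) ratfun)"
proof -
  have "of_nat c \<noteq> (0 :: ('v, 'k) ratfun)" using rat_const_inverse[OF assms, where 'v = 'v and 'k = 'k] by auto
  moreover have "rat_const (1 / of_nat c) * F * of_nat c = (rat_const (1 / of_nat c) * of_nat c) * F" by (simp only: mult_ac)
  ultimately show ?thesis unfolding rat_const_inverse[OF assms] by (simp add: field_simps)
qed

section \<open>The group of colour permutations\<close>

definition ccomp :: "('i \<Rightarrow> nat \<Rightarrow> nat) \<Rightarrow> ('i \<Rightarrow> nat \<Rightarrow> nat) \<Rightarrow> 'i \<Rightarrow> nat \<Rightarrow> nat" where
  "ccomp \<rho> \<sigma> = (\<lambda>i. \<rho> i \<circ> \<sigma> i)"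

definition cinv :: "('i \<Rightarrow> nat \<Rightarrow> nat) \<Rightarrow> 'i \<Rightarrow> nat \<Rightarrow> nat" where
  "cinv \<rho> = (\<lambda>i. inv_into UNIV (\<rho> i))"

lemma color_perms_eq: "color_perms n = PiE UNIV (\<lambda>i. {p. p permutes {1..n i}})"
  by (auto simp: color_perms_def PiE_def Pi_def)

lemma finite_color_perms [simp]: "finite (color_perms (n :: 'i::finite \<Rightarrow> nat))"
  unfolding color_perms_eq by (rule finite_PiE) (auto intro: finite_permutations)

lemma card_color_perms: "card (color_perms (n :: 'i::finite \<Rightarrow> nat)) = (\<Prod>i\<in>UNIV. fact (n i))"
proof -
  have "card {p. p permutes {1..n i}} = fact (n i)" for i
    by (rule card_permutations) auto
  then show ?thesis unfolding color_perms_eq by (subst card_PiE) auto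
qed

lemma ccomp_in: "\<rho> \<in> color_perms n \<Longrightarrow> \<sigma> \<in> color_perms n \<Longrightarrow> ccomp \<rho> \<sigma> \<in> color_perms n"
  by (auto simp: color_perms_def ccomp_def intro: permutes_compose)

lemma cinv_in: "\<rho> \<in> color_perms n \<Longrightarrow> cinv \<rho> \<in> color_perms n"
  by (auto simp: color_perms_def cinv_def intro: permutes_inv)

lemma ccomp_cinv:
  assumes "\<rho> \<in> color_perms n"
  shows "ccomp \<rho> (ccomp (cinv \<rho>) \<sigma>) = \<sigma>" "ccomp (cinv \<rho>) (ccomp \<rho> \<sigma>) = \<sigma>"
    "ccomp (ccomp \<sigma> \<rho>) (cinv \<rho>) = \<sigma>" "ccomp (ccomp \<sigma> (cinv \<rho>)) \<rho> = \<sigma>"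
proof -
  have "\<rho> i (inv_into UNIV (\<rho> i) a) = a" "inv_into UNIV (\<rho> i) (\<rho> i a) = a" for i a
    using assms permutes_inverses[of "\<rho> i" "{1..n i}"] by (auto simp: color_perms_def)
  then show "ccomp \<rho> (ccomp (cinv \<rho>) \<sigma>) = \<sigma>" "ccomp (cinv \<rho>) (ccomp \<rho> \<sigma>) = \<sigma>"
    "ccomp (ccomp \<sigma> \<rho>) (cinv \<rho>) = \<sigma>" "ccomp (ccomp \<sigma> (cinv \<rho>)) \<rho> = \<sigma>"
    by (auto simp: ccomp_def cinv_def fun_eq_iff)
qed

lemma pv_ccomp: "pv \<rho> \<circ> pv \<sigma> = pv (ccomp \<rho> \<sigma>)"
proof
  fix x show "(pv \<rho> \<circ> pv \<sigma>) x = pv (ccomp \<rho> \<sigma>) x" by (cases x) (auto simp: ccomp_def)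
qed

lemma ren_pv_pv:
  "\<rho> \<in> color_perms n \<Longrightarrow> \<sigma> \<in> color_perms n \<Longrightarrow> ren (pv \<rho>) (ren (pv \<sigma>) F) = ren (pv (ccomp \<rho> \<sigma>)) F"
  by (simp add: ren_comp inj_pv pv_ccomp)

definition symz :: "('i::finite \<Rightarrow> nat) \<Rightarrow> ('i var, 'k::field) ratfun \<Rightarrow> ('i var, 'k) ratfun" where
  "symz n F = (\<Sum>\<sigma>\<in>color_perms n. ren (pv \<sigma>) F)"

lemma symz_invariant:
  assumes "\<rho> \<in> color_perms n"
  shows "ren (pv \<rho>) (symz n F) = symz n F" "symz n (ren (pv \<rho>) F) = symz n F"
proof -
  have "ren (pv \<rho>) (symz n F) = (\<Sum>\<sigma>\<in>color_perms n. ren (pv (ccomp \<rho> \<sigma>)) F)"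
    using assms by (simp add: symz_def ren_sum inj_pv ren_pv_pv)
  also have "\<dots> = symz n F"
    unfolding symz_def
    by (rule sum.reindex_bij_witness[of _ "ccomp (cinv \<rho>)" "ccomp \<rho>"])
      (auto simp: ccomp_cinv[OF assms] intro: ccomp_in assms cinv_in)
  finally show "ren (pv \<rho>) (symz n F) = symz n F" .
  have "symz n (ren (pv \<rho>) F) = (\<Sum>\<sigma>\<in>color_perms n. ren (pv (ccomp \<sigma> \<rho>)) F)"
    using assms by (simp add: symz_def ren_pv_pv)
  also have "\<dots> = symz n F"
    unfolding symz_def
    by (rule sum.reindex_bij_witness[of _ "\<lambda>\<sigma>. ccomp \<sigma> (cinv \<rho>)" "\<lambda>\<sigma>. ccomp \<sigma> \<rho>"])
      (auto simp: ccomp_cinv[OF assms] intro: ccomp_in assms cinv_in)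
  finally show "symz n (ren (pv \<rho>) F) = symz n F" .
qed

lemma symz_simps: "symz n (F + G) = symz n F + symz n G" "symz n 0 = 0"
  by (simp_all add: symz_def ren_add inj_pv sum.distrib)

lemma symz_sum: "symz n (\<Sum>x\<in>A. F x) = (\<Sum>x\<in>A. symz n (F x))"
  by (induction A rule: infinite_finite_induct) (auto simp: symz_simps)

lemma symz_const: "symz n (rat_const c * F) = rat_const c * symz n F"
  by (simp add: symz_def ren_mult ren_rat_const inj_pv sum_distrib_left)

lemma transpose_pv:
  fixes n :: "'i \<Rightarrow> nat"
  assumes "x \<in> Vset n" "y \<in> Vset n" "col x = col y"
  obtains \<rho> where "\<rho> \<in> color_perms n" "pv \<rho> = transpose x y"
proof -
  obtain i a b where xy: "x = ZVar i a" "y = ZVar i b" using assms(3) by (cases x; cases y) auto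
  define \<rho> where "\<rho> j = (if j = i then transpose a b else id)" for j
  have "pv \<rho> v = transpose x y v" for v
    by (cases v) (auto simp: xy \<rho>_def transpose_def)
  moreover have "\<rho> \<in> color_perms n"
    using assms(1,2) by (auto simp: color_perms_def \<rho>_def xy intro: permutes_swap_id permutes_id)
  ultimately show ?thesis using that[of \<rho>] by blast
qed

section \<open>The symmetrization of a word\<close>

definition wterm :: "('i::finite, 'k::field) zeta_data \<Rightarrow> half \<Rightarrow> ('i \<times> int) list \<Rightarrow> ('i var, 'k) ratfun" where
  "wterm p s w = zmon (wmon w) * om p s (wv w)"

lemma ren_wterm:
  assumes f: "inj f" "\<And>x. x \<in> Vset (word_weight w) \<Longrightarrow> col (f x) = col x"
  shows "ren f (wterm p s w) = zmon (ren_mon f (wmon w)) * om p s (map f (wv w))"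
  using ren_om[OF f(1), of "wv w" p s] f(2) by (simp add: wterm_def ren_mult f(1) ren_to_ratfun set_wv)

lemma ren_wterm_cong:
  assumes "inj f" "inj g" "\<And>x. x \<in> Vset (word_weight w) \<Longrightarrow> col (f x) = col x"
    and e: "\<And>x. x \<in> Vset (word_weight w) \<Longrightarrow> f x = g x"
  shows "ren f (wterm p s w) = ren g (wterm p s w)"
proof -
  have "ren_mon f (wmon w) = ren_mon g (wmon w)"
    by (rule ren_mon_cong) (use keys_wmon[of w] e in auto)
  moreover have "map f (wv w) = map g (wv w)" using e by (auto simp: set_wv)
  moreover have "col (g x) = col x" if "x \<in> Vset (word_weight w)" for x using assms(3)[OF that] e[OF that] by simp
  ultimately show ?thesis using assms by (simp add: ren_wterm del: map_eq_conv)
qed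

definition Kfac :: "('i::finite, 'k::field) zeta_data \<Rightarrow> half \<Rightarrow> ('i \<Rightarrow> nat) \<Rightarrow> ('i \<Rightarrow> nat) \<Rightarrow> ('i var, 'k) ratfun" where
  "Kfac p s n n' = (\<Prod>x\<in>Vset n. \<Prod>y\<in>shv n ` Vset n'. kap p s x y)"

lemma wterm_append:
  "wterm p s (u @ w) = wterm p s u * ren (shv (word_weight u)) (wterm p s w) * Kfac p s (word_weight u) (word_weight w)"
proof -
  have "distinct (wv u @ map (shv (word_weight u)) (wv w))" by (metis distinct_wv wv_append)
  from om_append[OF this, of p s]
  have "om p s (wv (u @ w)) = om p s (wv u) * om p s (map (shv (word_weight u)) (wv w)) * Kfac p s (word_weight u) (word_weight w)"
    by (simp add: wv_append Kfac_def set_wv)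
  moreover have "ren (shv (word_weight u)) (wterm p s w) =
      zmon (ren_mon (shv (word_weight u)) (wmon w)) * om p s (map (shv (word_weight u)) (wv w))"
    by (rule ren_wterm) (auto intro: inj_shv)
  ultimately show ?thesis by (simp add: wterm_def wmon_append zmon_add mult_ac)
qed

lemma flip_diff_one:
  fixes A B :: "int \<Rightarrow>\<^sub>0 'k::field"
  shows "flip (A - B) = flip A - flip B" "flip (1 :: int \<Rightarrow>\<^sub>0 'k) = 1"
  using pext_single[of "\<lambda>k b. single (- k) b" "0 :: int" "1 :: 'k"]
  by (auto simp: flip_def pext_diff single_add)

lemma kap_times_vdiff: "col x = col y \<Longrightarrow> \<exists>P. kap p s x y * to_ratfun (vdiff x y) = to_ratfun P"
proof (cases "x = y")
  case False
  assume c: "col x = col y"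
  obtain u where u: "vdiff x y = u * in_ratio x y (kap_den s (col x) (col y) :: int \<Rightarrow>\<^sub>0 'b)"
  proof (cases s)
    case Positive
    show ?thesis
      by (rule that[of "single (single y 1) (- 1)"])
        (simp add: Positive c zeta_den_def vdiff_def flip_diff_one right_diff_distrib mult_single vroot_def single_uminus)
  next
    case Negative
    show ?thesis
      by (rule that[of "single (single x 1) 1"])
        (simp add: Negative c zeta_den_def vdiff_def right_diff_distrib mult_single vroot_def)
  qed
  have "in_ratio x y (kap_den s (col x) (col y) :: int \<Rightarrow>\<^sub>0 'b) \<noteq> 0" using False by simp
  then have "kap p s x y * to_ratfun (vdiff x y) = to_ratfun (in_ratio x y (kap_num p s (col x) (col y)) * u)"
    by (simp add: kap_quotient u)
  then show ?thesis by blast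
qed (auto simp: vdiff_def)

context zeta
begin

text \<open>
  The only poles are simple ones along the diagonals of variables of equal colour, and they disappear
  under symmetrization.
\<close>

lemma symz_wterm_laurent: "\<exists>P. symz (word_weight w) (wterm p s w) = to_ratfun P"
proof -
  let ?n = "word_weight w" and ?B = "Bef (wv w)"
  define Q where "Q = {(x, y) \<in> ?B. col x = col y}"
  let ?\<Delta> = "\<Prod>(x, y)\<in>Q. vdiff x y :: ('i var, 'k) laurent"
  have Q: "finite Q" unfolding Q_def by (rule finite_subset[of _ ?B]) auto
  have neq: "x \<noteq> y" if "(x, y) \<in> Q" for x y using that Bef_neq[OF distinct_wv] by (auto simp: Q_def)
  have asym: "(y, x) \<notin> Q" if "(x, y) \<in> Q" for x y using that Bef_asym[OF distinct_wv] by (auto simp: Q_def)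
  have G: "ren (transpose x y) (symz ?n (wterm p s w)) = symz ?n (wterm p s w)" if "(x, y) \<in> Q" for x y
  proof -
    have "x \<in> Vset ?n" "y \<in> Vset ?n" "col x = col y" using that Bef_subset[of "wv w"] by (auto simp: Q_def set_wv)
    then show ?thesis using transpose_pv[of x ?n y] symz_invariant(1) by metis
  qed
  have "\<exists>P. wterm p s w * to_ratfun ?\<Delta> = to_ratfun P"
  proof -
    have "\<exists>P. kap p s x y * (if col x = col y then to_ratfun (vdiff x y) else 1) = to_ratfun P" if "(x, y) \<in> ?B" for x y
    proof (cases "col x = col y")
      case False
      then have "kap_den s (col x) (col y) = (1 :: int \<Rightarrow>\<^sub>0 'k)"
        by (cases s) (auto simp: zeta_den_def flip_def pext_single simp flip: single_one)
      then show ?thesis using False by (auto simp: kap_quotient)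
    qed (use kap_times_vdiff in auto)
    then obtain P where P: "\<And>x y. (x, y) \<in> ?B \<Longrightarrow>
        kap p s x y * (if col x = col y then to_ratfun (vdiff x y) else 1) = to_ratfun (P x y)" by metis
    have "to_ratfun ?\<Delta> = (\<Prod>(x, y)\<in>?B. if col x = col y then to_ratfun (vdiff x y) else 1 :: ('i var, 'k) ratfun)"
      unfolding Q_def to_ratfun_prod
      by (rule prod.mono_neutral_cong_left) (auto simp: case_prod_unfold)
    then have "wterm p s w * to_ratfun ?\<Delta> = zmon (wmon w) *
        (\<Prod>(x, y)\<in>?B. kap p s x y * (if col x = col y then to_ratfun (vdiff x y) else 1))"
      by (simp add: wterm_def om_def case_prod_unfold prod.distrib mult_ac)
    also have "\<dots> = to_ratfun (single (wmon w) 1 * (\<Prod>(x, y)\<in>?B. P x y))"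
      using P by (simp add: to_ratfun_prod case_prod_unfold cong: prod.cong)
    finally show ?thesis by blast
  qed
  then obtain P where P: "wterm p s w * to_ratfun ?\<Delta> = to_ratfun P" by blast
  have "\<exists>M. ren (pv \<sigma>) (wterm p s w) * to_ratfun ?\<Delta> = to_ratfun M" if \<sigma>: "\<sigma> \<in> color_perms ?n" for \<sigma>
  proof -
    have i: "inj (pv \<sigma>)" using \<sigma> by (rule inj_pv)
    let ?A = "map_prod (pv \<sigma>) (pv \<sigma>) ` Q"
    have ii: "inj_on (map_prod (pv \<sigma>) (pv \<sigma>)) Q"
      using i by (meson inj_on_subset prod.inj_map subset_UNIV)
    have A: "(\<Prod>(x, y)\<in>?A. vdiff x y) = ren_laurent (pv \<sigma>) ?\<Delta>"
      unfolding ren_laurent_prod by (subst prod.reindex[OF ii]) (auto intro!: prod.cong)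
    have QV: "(x, y) \<in> Q \<union> Q\<inverse> \<longleftrightarrow> x \<in> Vset ?n \<and> y \<in> Vset ?n \<and> x \<noteq> y \<and> col x = col y" for x y
      using Bef_total[OF distinct_wv[of w], of x y] Bef_subset[of "wv w"] Bef_neq[OF distinct_wv[of w]]
      by (auto simp: Q_def set_wv)
    have "?A \<union> ?A\<inverse> = map_prod (pv \<sigma>) (pv \<sigma>) ` (Q \<union> Q\<inverse>)" by (force simp: image_iff)
    also have "\<dots> = Q \<union> Q\<inverse>"
    proof (rule Set.set_eqI)
      fix q :: "'i var \<times> 'i var"
      obtain x y where q: "q = (x, y)" by fastforce
      show "q \<in> map_prod (pv \<sigma>) (pv \<sigma>) ` (Q \<union> Q\<inverse>) \<longleftrightarrow> q \<in> Q \<union> Q\<inverse>"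
      proof
        assume "q \<in> map_prod (pv \<sigma>) (pv \<sigma>) ` (Q \<union> Q\<inverse>)"
        then obtain a b where ab: "(a, b) \<in> Q \<union> Q\<inverse>" and qe: "q = (pv \<sigma> a, pv \<sigma> b)" by auto
        from ab have "pv \<sigma> a \<in> Vset ?n \<and> pv \<sigma> b \<in> Vset ?n \<and> pv \<sigma> a \<noteq> pv \<sigma> b \<and> col (pv \<sigma> a) = col (pv \<sigma> b)"
          unfolding QV using \<sigma> i by (simp add: pv_Vset inj_eq)
        then show "q \<in> Q \<union> Q\<inverse>" unfolding qe QV .
      next
        assume "q \<in> Q \<union> Q\<inverse>"
        then have xy: "x \<in> Vset ?n" "y \<in> Vset ?n" "x \<noteq> y" "col x = col y" unfolding q QV by auto
        then obtain a b where "a \<in> Vset ?n" "b \<in> Vset ?n" "x = pv \<sigma> a" "y = pv \<sigma> b"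
          using pv_image_Vset[OF \<sigma>] by (metis imageE)
        then have "(a, b) \<in> Q \<union> Q\<inverse>" unfolding QV using xy by auto
        then show "q \<in> map_prod (pv \<sigma>) (pv \<sigma>) ` (Q \<union> Q\<inverse>)"
          using \<open>x = _\<close> \<open>y = _\<close> by (auto simp: q image_iff intro: rev_bexI)
      qed
    qed
    finally have sym: "?A \<union> ?A\<inverse> = Q \<union> Q\<inverse>" .
    have asymA: "(y, x) \<notin> ?A" if "(x, y) \<in> ?A" for x y
      using that asym i by (auto simp: inj_eq)
    obtain e :: "('i var, 'k) laurent" where e: "?\<Delta> = e * (\<Prod>(x, y)\<in>?A. vdiff x y)"
      using prod_vdiff_orientation[of ?A Q] Q asymA asym sym by blast
    have t: "to_ratfun ?\<Delta> = to_ratfun e * ren (pv \<sigma>) (to_ratfun ?\<Delta>)"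
    proof -
      have "to_ratfun ?\<Delta> = to_ratfun (e * ren_laurent (pv \<sigma>) ?\<Delta>)" by (rule arg_cong[OF e[unfolded A]])
      also have "\<dots> = to_ratfun e * ren (pv \<sigma>) (to_ratfun ?\<Delta>)" by (simp only: to_ratfun_hom ren_to_ratfun[OF i])
      finally show ?thesis .
    qed
    have "ren (pv \<sigma>) (wterm p s w) * to_ratfun ?\<Delta> =
        ren (pv \<sigma>) (wterm p s w) * (to_ratfun e * ren (pv \<sigma>) (to_ratfun ?\<Delta>))"
      by (rule arg_cong[OF t])
    also have "\<dots> = to_ratfun e * ren (pv \<sigma>) (wterm p s w * to_ratfun ?\<Delta>)"
      unfolding ren_mult[OF i] by (simp only: mult_ac)
    also have "\<dots> = to_ratfun (e * ren_laurent (pv \<sigma>) P)" by (simp add: P ren_to_ratfun[OF i])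
    finally show ?thesis by blast
  qed
  then obtain M where M: "\<And>\<sigma>. \<sigma> \<in> color_perms ?n \<Longrightarrow> ren (pv \<sigma>) (wterm p s w) * to_ratfun ?\<Delta> = to_ratfun (M \<sigma>)"
    by metis
  have N: "symz ?n (wterm p s w) * to_ratfun ?\<Delta> = to_ratfun (\<Sum>\<sigma>\<in>color_perms ?n. M \<sigma>)"
    unfolding symz_def sum_distrib_right to_ratfun_sum by (rule sum.cong) (auto simp: M)
  show ?thesis by (rule symmetric_laurent[OF Q neq asym N G])
qed

text \<open>
  The image of the word \<open>w\<close> in the big shuffle algebra.
\<close>

definition E :: "half \<Rightarrow> ('i \<times> int) list \<Rightarrow> ('i var, 'k) laurent" where
  "E s w = laurent_of (symz (word_weight w) (wterm p s w))"

lemma to_ratfun_E: "to_ratfun (E s w) = symz (word_weight w) (wterm p s w)"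
  using symz_wterm_laurent[of w s] by (auto simp: E_def)

lemma E_V_graded: "E s w \<in> V_graded (word_weight w)"
  unfolding V_graded_iff
proof (intro conjI ballI)
  let ?n = "word_weight w"
  fix \<sigma> assume "\<sigma> \<in> color_perms ?n"
  then have "to_ratfun (ren_laurent (pv \<sigma>) (E s w)) = to_ratfun (E s w)"
    using symz_invariant(1)[of \<sigma> ?n] by (simp add: to_ratfun_E inj_pv flip: ren_to_ratfun del: to_ratfun_eq_iff)
  then show "ren_laurent (pv \<sigma>) (E s w) = E s w" by simp
next
  let ?n = "word_weight w"
  fix m assume m: "m \<in> keys (E s w)"
  show "keys m \<subseteq> Vset ?n"
  proof (rule ccontr)
    assume "\<not> keys m \<subseteq> Vset ?n"
    then obtain v where v: "v \<in> keys m" "v \<notin> Vset ?n" by blast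
    define U where "U = Vset ?n \<union> (\<Union>m\<in>keys (E s w). keys m)"
    have "finite U" by (auto simp: U_def)
    moreover have "infinite (range (ZVar (col v)))"
      by (intro range_inj_infinite) (auto simp: inj_on_def)
    ultimately obtain v' where v': "v' \<notin> U"
      by (meson finite_subset subsetI)
    let ?f = "transpose v v'"
    have f: "inj ?f" by (rule bij_is_inj) simp
    have fV: "?f x = x" if "x \<in> Vset ?n" for x
      using that v v' by (auto simp: transpose_def U_def)
    have "ren ?f (ren (pv \<sigma>) (wterm p s w)) = ren (pv \<sigma>) (wterm p s w)" if "\<sigma> \<in> color_perms ?n" for \<sigma>
      unfolding ren_comp[OF f inj_pv[OF that]]
      by (rule ren_wterm_cong) (use f that fV in \<open>auto simp: inj_compose inj_pv pv_Vset\<close>)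
    then have "ren ?f (to_ratfun (E s w)) = to_ratfun (E s w)"
      by (simp add: to_ratfun_E symz_def ren_sum[OF f])
    then have "ren_laurent ?f (E s w) = E s w" by (simp add: ren_to_ratfun[OF f])
    then have "ren_mon ?f m \<in> keys (E s w)" using m keys_ren_laurent[OF f, of "E s w"] by auto
    moreover have "v' \<in> keys (ren_mon ?f m)"
      using lookup_ren_mon[OF f, of m v] v(1) by (simp add: in_keys_iff)
    ultimately show False using v' by (auto simp: U_def)
  qed
qed

lemma color_perms_small:
  assumes "\<And>i. n i \<le> 1" shows "color_perms n = {\<lambda>i. id}"
proof -
  have "q permutes {1..n i} \<longleftrightarrow> q = id" for q i
    using assms[of i] by (cases "n i = 0") (auto simp: permutes_empty permutes_sing le_Suc_eq)
  then show ?thesis by (auto simp: color_perms_def)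
qed

lemma symz_small:
  fixes n :: "'i \<Rightarrow> nat"
  assumes "\<And>i. n i \<le> 1" shows "symz n F = F"
proof -
  from assms have "symz n F = ren (pv (\<lambda>i a. a)) F" by (simp add: symz_def color_perms_small id_def)
  moreover have "pv (\<lambda>i a. a) = (id :: 'i var \<Rightarrow> 'i var)" by (rule ext, case_tac x) auto
  ultimately show ?thesis by (simp add: ren_id)
qed

lemma E_Nil [simp]: "E s [] = 1"
proof -
  have "to_ratfun (E s []) = to_ratfun 1" unfolding to_ratfun_E by (subst symz_small) (auto simp: wterm_def om_def)
  then show ?thesis by (simp only: to_ratfun_eq_iff)
qed

lemma E_single: "E s [(i, d)] = single (single (ZVar i 1) d) 1"
proof -
  have "wv [(i, d)] = [ZVar i 1]" using wv_snoc[of "[]" "(i, d)"] by simp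
  moreover have "wmon [(i, d)] = single (ZVar i 1) d" using wmon_snoc[of "[]" "(i, d)"] by simp
  ultimately have "to_ratfun (E s [(i, d)]) = zmon (single (ZVar i 1) d)"
    unfolding to_ratfun_E by (subst symz_small) (auto simp: wterm_def om_def)
  then show ?thesis by (simp only: to_ratfun_eq_iff)
qed

section \<open>The shuffle product\<close>

definition shuffle_sum :: "half \<Rightarrow> ('i \<Rightarrow> nat) \<Rightarrow> ('i \<Rightarrow> nat) \<Rightarrow> ('i var, 'k) laurent \<Rightarrow> ('i var, 'k) laurent \<Rightarrow> ('i var, 'k) ratfun" where
  "shuffle_sum s n n' R R' = symz (\<lambda>i. n i + n' i)
     (to_ratfun R * ren (shv n) (to_ratfun R') / of_nat (card (color_perms n) * card (color_perms n')) * Kfac p s n n')"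

lemma prod_Vset: "(\<Prod>x\<in>Vset n. f x) = (\<Prod>i\<in>UNIV. \<Prod>a\<in>{1..n i}. f (ZVar i a))" for n :: "'i \<Rightarrow> nat"
proof -
  have "Vset n = (\<lambda>(i, a). ZVar i a) ` (SIGMA i:UNIV. {1..n i})" by (auto simp: Vset_def image_iff)
  then have "(\<Prod>x\<in>Vset n. f x) = (\<Prod>q\<in>(SIGMA i:UNIV. {1..n i}). f (case q of (i, a) \<Rightarrow> ZVar i a))"
    by (simp add: prod.reindex inj_on_def)
  then show ?thesis by (simp add: prod.Sigma case_prod_unfold)
qed

lemma shuffle_product_eq: "shuffle_product p s n n' R R' = laurent_of (shuffle_sum s n n' R R')"
proof -
  have K: "(\<Prod>i\<in>UNIV. \<Prod>j\<in>UNIV. \<Prod>a\<in>{1..n i}. \<Prod>b\<in>{n j<..n j + n' j}. kap p s (ZVar i a) (ZVar j b)) = Kfac p s n n'"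
  proof -
    have 1: "(\<Prod>b\<in>{n j<..n j + n' j}. g b) = (\<Prod>b\<in>{1..n' j}. g (n j + b))" for j and g :: "nat \<Rightarrow> ('i var, 'k) ratfun"
      by (rule prod.reindex_bij_witness[of _ "\<lambda>b. n j + b" "\<lambda>b. b - n j"]) auto
    have "Kfac p s n n' = (\<Prod>x\<in>Vset n. \<Prod>y\<in>Vset n'. kap p s x (shv n y))"
      unfolding Kfac_def by (subst prod.reindex) (auto intro: inj_on_subset[OF inj_shv])
    also have "\<dots> = (\<Prod>i\<in>UNIV. \<Prod>a\<in>{1..n i}. \<Prod>j\<in>UNIV. \<Prod>b\<in>{1..n' j}. kap p s (ZVar i a) (ZVar j (n j + b)))"
      by (simp add: prod_Vset)
    also have "\<dots> = (\<Prod>i\<in>UNIV. \<Prod>j\<in>UNIV. \<Prod>a\<in>{1..n i}. \<Prod>b\<in>{n j<..n j + n' j}. kap p s (ZVar i a) (ZVar j b))"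
      unfolding 1 by (intro prod.cong refl prod.swap)
    finally show ?thesis ..
  qed
  have z: "case_var (\<lambda>i a. rat_var (ZVar i (\<sigma> i a))) = (\<lambda>v. rat_var (pv \<sigma> v) :: ('i var, 'k) ratfun)" for \<sigma>
    by (auto split: var.splits)
  have zs: "pv (\<lambda>i a. \<sigma> i (n i + a)) = pv \<sigma> \<circ> shv n" for \<sigma>
    by (rule ext, case_tac x) auto
  show ?thesis
    unfolding shuffle_product_def shuffle_sum_def symz_def Let_def z laurent_subst_ren zs
  proof (intro arg_cong[of _ _ laurent_of] sum.cong refl)
    fix \<sigma> assume "\<sigma> \<in> color_perms (\<lambda>i. n i + n' i)"
    then have i: "inj (pv \<sigma>)" by (rule inj_pv)
    have "ren (pv \<sigma>) (Kfac p s n n') = (\<Prod>i\<in>UNIV. \<Prod>j\<in>UNIV. \<Prod>a\<in>{1..n i}. \<Prod>b\<in>{n j<..n j + n' j}.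
        shuffle_factor p s i j (rat_var (ZVar i (\<sigma> i a))) (rat_var (ZVar j (\<sigma> j b))))"
      unfolding K[symmetric] ren_prod[OF i] by (simp add: ren_kap[OF i]) (simp add: kap_def)
    then show "to_ratfun (ren_laurent (pv \<sigma>) R) * to_ratfun (ren_laurent (pv \<sigma> \<circ> shv n) R') /
        of_nat ((\<Prod>i\<in>UNIV. fact (n i)) * (\<Prod>i\<in>UNIV. fact (n' i))) *
        (\<Prod>i\<in>UNIV. \<Prod>j\<in>UNIV. \<Prod>a\<in>{1..n i}. \<Prod>b\<in>{n j<..n j + n' j}.
        shuffle_factor p s i j (rat_var (ZVar i (\<sigma> i a))) (rat_var (ZVar j (\<sigma> j b)))) =
      ren (pv \<sigma>) (to_ratfun R * ren (shv n) (to_ratfun R') /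
        of_nat (card (color_perms n) * card (color_perms n')) * Kfac p s n n')"
      by (simp add: ren_mult[OF i] ren_div[OF i] ren_of_nat[OF i] ren_to_ratfun[OF i] ren_to_ratfun[OF inj_shv]
          ren_laurent_comp card_color_perms del: of_nat_mult)
  qed
qed

lemma shuffle_sum_linear:
  "shuffle_sum s n n' (\<Sum>x\<in>A. single 0 (a x) * F x) (\<Sum>y\<in>B. single 0 (b y) * G y) =
    (\<Sum>x\<in>A. \<Sum>y\<in>B. rat_const (a x * b y) * shuffle_sum s n n' (F x) (G y))"
proof -
  have F: "to_ratfun (\<Sum>x\<in>A. single 0 (a x) * F x) = (\<Sum>x\<in>A. rat_const (a x) * to_ratfun (F x))"
    by (simp add: to_ratfun_sum rat_const_def)
  have G: "ren (shv n) (to_ratfun (\<Sum>y\<in>B. single 0 (b y) * G y)) =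
      (\<Sum>y\<in>B. rat_const (b y) * ren (shv n) (to_ratfun (G y)))"
    by (simp add: to_ratfun_sum ren_sum[OF inj_shv] ren_mult[OF inj_shv] ren_rat_const[OF inj_shv] flip: rat_const_def)
  have "to_ratfun (\<Sum>x\<in>A. single 0 (a x) * F x) * ren (shv n) (to_ratfun (\<Sum>y\<in>B. single 0 (b y) * G y)) / C * K =
    (\<Sum>x\<in>A. \<Sum>y\<in>B. rat_const (a x * b y) * (to_ratfun (F x) * ren (shv n) (to_ratfun (G y)) / C * K))" for C K
    unfolding F G unfolding sum_product unfolding sum_divide_distrib sum_distrib_right rat_const_mult
    by (intro sum.cong refl) (simp add: mult_ac)
  then show ?thesis unfolding shuffle_sum_def by (simp only: symz_sum symz_const)
qed

lemma shuffle_product_0 [simp]: "shuffle_product p s n n' 0 R = 0" "shuffle_product p s n n' R 0 = 0"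
  using laurent_of_to_ratfun[of 0] by (simp_all add: shuffle_product_eq shuffle_sum_def symz_simps ren_0[OF inj_shv])

definition oplus :: "('i \<Rightarrow> nat) \<Rightarrow> ('i \<Rightarrow> nat \<Rightarrow> nat) \<Rightarrow> ('i \<Rightarrow> nat \<Rightarrow> nat) \<Rightarrow> 'i \<Rightarrow> nat \<Rightarrow> nat" where
  "oplus n \<tau> \<tau>' i a = (if a \<le> n i then \<tau> i a else n i + \<tau>' i (a - n i))"

lemma oplus_in:
  assumes t: "\<tau> \<in> color_perms n" and t': "\<tau>' \<in> color_perms n'"
  shows "oplus n \<tau> \<tau>' \<in> color_perms (\<lambda>i. n i + n' i)"
  unfolding color_perms_def
proof (rule CollectI, rule allI, rule bij_imp_permutes)
  fix i
  have p: "\<tau> i permutes {1..n i}" "\<tau>' i permutes {1..n' i}" using assms by (auto simp: color_perms_def)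
  have in1: "1 \<le> oplus n \<tau> \<tau>' i a \<and> oplus n \<tau> \<tau>' i a \<le> n i" if "1 \<le> a" "a \<le> n i" for a
    using permutes_in_image[OF p(1), of a] that by (simp add: oplus_def)
  have in2: "n i < oplus n \<tau> \<tau>' i a \<and> oplus n \<tau> \<tau>' i a \<le> n i + n' i" if "n i < a" "a \<le> n i + n' i" for a
    using permutes_in_image[OF p(2), of "a - n i"] that by (auto simp: oplus_def)
  have "inj_on (oplus n \<tau> \<tau>' i) {1..n i + n' i}"
  proof (rule inj_onI)
    fix a b assume ab: "a \<in> {1..n i + n' i}" "b \<in> {1..n i + n' i}" "oplus n \<tau> \<tau>' i a = oplus n \<tau> \<tau>' i b"
    have "a \<le> n i \<longleftrightarrow> b \<le> n i"
      using in1[of a] in1[of b] in2[of a] in2[of b] ab by (metis atLeastAtMost_iff not_less)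
    then show "a = b"
      using ab inj_eq[OF permutes_inj[OF p(1)], of a b] inj_eq[OF permutes_inj[OF p(2)], of "a - n i" "b - n i"]
      by (cases "a \<le> n i") (auto simp: oplus_def)
  qed
  moreover have "oplus n \<tau> \<tau>' i ` {1..n i + n' i} \<subseteq> {1..n i + n' i}"
  proof
    fix b assume "b \<in> oplus n \<tau> \<tau>' i ` {1..n i + n' i}"
    then obtain a where "1 \<le> a" "a \<le> n i + n' i" "b = oplus n \<tau> \<tau>' i a" by auto
    then show "b \<in> {1..n i + n' i}" using in1[of a] in2[of a] by (cases "a \<le> n i") auto
  qed
  ultimately show "bij_betw (oplus n \<tau> \<tau>' i) {1..n i + n' i} {1..n i + n' i}"
    by (simp add: bij_betw_def endo_inj_surj)
  fix a assume "a \<notin> {1..n i + n' i}"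
  moreover from this have "a - n i \<notin> {1..n' i}" if "\<not> a \<le> n i" using that by auto
  ultimately show "oplus n \<tau> \<tau>' i a = a"
    using permutes_not_in[OF p(1), of a] permutes_not_in[OF p(2), of "a - n i"] by (cases "a \<le> n i") (auto simp: oplus_def)
qed

lemma pv_oplus: "x \<in> Vset n \<Longrightarrow> pv (oplus n \<tau> \<tau>') x = pv \<tau> x"
  by (cases x) (auto simp: oplus_def)

lemma pv_oplus_shv: "x \<in> Vset n' \<Longrightarrow> pv (oplus n \<tau> \<tau>') (shv n x) = shv n (pv \<tau>' x)"
  by (cases x) (auto simp: oplus_def)

lemma ren_Kfac_oplus:
  assumes t: "\<tau> \<in> color_perms n" and t': "\<tau>' \<in> color_perms n'"
  shows "ren (pv (oplus n \<tau> \<tau>')) (Kfac p s n n') = Kfac p s n n'"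
proof -
  let ?f = "pv (oplus n \<tau> \<tau>')"
  have i: "inj ?f" by (rule inj_pv[OF oplus_in[OF t t']])
  have b1: "bij_betw ?f (Vset n) (Vset n)"
  proof -
    have "?f ` Vset n = pv \<tau> ` Vset n" by (rule image_cong) (auto simp: pv_oplus)
    then show ?thesis using i pv_image_Vset[OF t] by (auto simp: bij_betw_def intro: inj_on_subset)
  qed
  have b2: "bij_betw ?f (shv n ` Vset n') (shv n ` Vset n')"
  proof -
    have "?f ` shv n ` Vset n' = shv n ` pv \<tau>' ` Vset n'"
      unfolding image_image by (rule image_cong) (auto simp: pv_oplus_shv)
    then show ?thesis using i pv_image_Vset[OF t'] by (auto simp: bij_betw_def intro: inj_on_subset)
  qed
  have "ren ?f (Kfac p s n n') = (\<Prod>x\<in>Vset n. \<Prod>y\<in>shv n ` Vset n'. kap p s (?f x) (?f y))"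
    by (simp add: Kfac_def ren_prod[OF i] ren_kap[OF i])
  also have "\<dots> = (\<Prod>x\<in>Vset n. \<Prod>y\<in>shv n ` Vset n'. kap p s (?f x) y)"
    by (rule prod.cong[OF refl], rule prod.reindex_bij_betw[OF b2])
  also have "\<dots> = Kfac p s n n'"
    unfolding Kfac_def by (rule prod.reindex_bij_betw[OF b1, of "\<lambda>x. \<Prod>y\<in>shv n ` Vset n'. kap p s x y"])
  finally show ?thesis .
qed

text \<open>
  The factors \<open>\<zeta>\<close> between the two parts of \<open>u @ w\<close> are those of the shuffle product, and the
  symmetrizations of the parts are absorbed in the total one, which is invariant. The factor
  \<open>n! n'!\<close> in the denominator counts them.
\<close>

lemma shuffle_sum_E:
  "shuffle_sum s (word_weight u) (word_weight w) (E s u) (E s w) = to_ratfun (E s (u @ w))"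
proof -
  let ?n = "word_weight u" and ?n' = "word_weight w" and ?N = "word_weight (u @ w)"
  have N: "?N = (\<lambda>i. ?n i + ?n' i)" by (simp add: word_weight_append)
  let ?X = "wterm p s (u @ w)"
  define c where "c = card (color_perms ?n) * card (color_perms ?n')"
  have c: "c \<noteq> 0" by (simp add: c_def card_color_perms)
  have tm: "ren (pv \<tau>) (wterm p s u) * ren (shv ?n) (ren (pv \<tau>') (wterm p s w)) * Kfac p s ?n ?n' =
      ren (pv (oplus ?n \<tau> \<tau>')) ?X" if t: "\<tau> \<in> color_perms ?n" and t': "\<tau>' \<in> color_perms ?n'" for \<tau> \<tau>'
  proof -
    have i: "inj (pv (oplus ?n \<tau> \<tau>'))" by (rule inj_pv[OF oplus_in[OF t t']])
    have "ren (pv (oplus ?n \<tau> \<tau>')) (wterm p s u) = ren (pv \<tau>) (wterm p s u)"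
      by (rule ren_wterm_cong) (use i t in \<open>auto simp: inj_pv pv_oplus\<close>)
    moreover have "ren (pv (oplus ?n \<tau> \<tau>')) (ren (shv ?n) (wterm p s w)) = ren (shv ?n) (ren (pv \<tau>') (wterm p s w))"
      unfolding ren_comp[OF i inj_shv] ren_comp[OF inj_shv inj_pv[OF t']]
      by (rule ren_wterm_cong) (use i t' in \<open>auto simp: inj_compose inj_shv inj_pv pv_oplus_shv\<close>)
    ultimately show ?thesis by (simp add: wterm_append ren_mult[OF i] ren_Kfac_oplus[OF t t'])
  qed
  have "to_ratfun (E s u) * ren (shv ?n) (to_ratfun (E s w)) / of_nat c * Kfac p s ?n ?n' =
      (\<Sum>\<tau>\<in>color_perms ?n. \<Sum>\<tau>'\<in>color_perms ?n'. ren (pv (oplus ?n \<tau> \<tau>')) ?X) / of_nat c"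
    unfolding to_ratfun_E symz_def ren_sum[OF inj_shv] unfolding sum_product
    unfolding sum_divide_distrib sum_distrib_right
    by (intro sum.cong refl) (simp add: tm[symmetric])
  also have "\<dots> = (\<Sum>\<tau>\<in>color_perms ?n. \<Sum>\<tau>'\<in>color_perms ?n'. rat_const (1 / of_nat c) * ren (pv (oplus ?n \<tau> \<tau>')) ?X)"
    unfolding divide_of_nat[OF c] sum_distrib_left ..
  finally have "shuffle_sum s ?n ?n' (E s u) (E s w) = (\<Sum>\<tau>\<in>color_perms ?n. \<Sum>\<tau>'\<in>color_perms ?n'.
      rat_const (1 / of_nat c) * symz ?N (ren (pv (oplus ?n \<tau> \<tau>')) ?X))"
    unfolding shuffle_sum_def c_def[symmetric] N by (simp add: symz_sum symz_const)
  also have "\<dots> = (\<Sum>\<tau>\<in>color_perms ?n. \<Sum>\<tau>'\<in>color_perms ?n'. rat_const (1 / of_nat c) * symz ?N ?X)"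
    unfolding N by (intro sum.cong refl arg_cong2[where f = "(*)"] symz_invariant(2) oplus_in)
  also have "\<dots> = rat_const (1 / of_nat c) * of_nat c * symz ?N ?X" by (simp add: c_def mult_ac)
  also have "rat_const (1 / of_nat c) * of_nat c = (1 :: ('i var, 'k) ratfun)" by (rule rat_const_inverse[OF c])
  finally show ?thesis by (simp add: to_ratfun_E)
qed

end

section \<open>Linearity of constant terms\<close>

text \<open>
  The domain on which \<open>constant_term\<close> is linear.
\<close>

definition expandable :: "'v list \<Rightarrow> ('v::linorder, 'k::field) ratfun \<Rightarrow> bool" where
  "expandable vs F \<longleftrightarrow> (\<exists>c. series_of F c \<and> bsup vs c)"

lemma expandable_add: "expandable vs F \<Longrightarrow> expandable vs G \<Longrightarrow> expandable vs (F + G)"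
  unfolding expandable_def using series_of_add bsup_add by blast

lemma expandable_0 [simp]: "expandable vs 0"
  unfolding expandable_def using series_of_zero bsup_zero by blast

lemma expandable_sum: "(\<And>x. x \<in> A \<Longrightarrow> expandable vs (F x)) \<Longrightarrow> expandable vs (\<Sum>x\<in>A. F x)"
  by (induction A rule: infinite_finite_induct) (auto intro: expandable_add)

lemma expandable_laurent:
  assumes "distinct vs" "\<And>m. m \<in> keys P \<Longrightarrow> keys m \<subseteq> set vs" "expandable vs F"
  shows "expandable vs (to_ratfun P * F)"
  using assms series_of_lact bsup_lact unfolding expandable_def by metis

lemma expandable_const: "distinct vs \<Longrightarrow> expandable vs F \<Longrightarrow> expandable vs (rat_const c * F)"
  unfolding rat_const_def by (rule expandable_laurent) (auto split: if_splits)

lemma constant_term_add: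
  assumes "distinct vs" "expandable vs F" "expandable vs G"
  shows "constant_term vs (F + G) = constant_term vs F + constant_term vs G"
proof -
  obtain c d where c: "series_of F c" "bsup vs c" and d: "series_of G d" "bsup vs d"
    using assms unfolding expandable_def by blast
  show ?thesis
    unfolding constant_term_eq[OF assms(1) c] constant_term_eq[OF assms(1) d]
      constant_term_eq[OF assms(1) series_of_add[OF c(1) d(1)] bsup_add[OF c(2) d(2)]] ..
qed

lemma constant_term_0 [simp]: "distinct vs \<Longrightarrow> constant_term vs 0 = 0"
  using constant_term_eq[OF _ series_of_zero bsup_zero] by blast

lemma constant_term_sum:
  assumes "distinct vs" "\<And>x. x \<in> A \<Longrightarrow> expandable vs (F x)"
  shows "constant_term vs (\<Sum>x\<in>A. F x) = (\<Sum>x\<in>A. constant_term vs (F x))"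
  using assms(2)
  by (induction A rule: infinite_finite_induct)
    (auto simp: assms(1) constant_term_add expandable_sum)

lemma constant_term_const:
  assumes d: "distinct vs" and F: "expandable vs F"
  shows "constant_term vs (rat_const a * F) = a * constant_term vs F"
proof -
  obtain c where c: "series_of F c" "bsup vs c" using F unfolding expandable_def by blast
  have "keys m \<subseteq> set vs" if "m \<in> keys (single 0 a)" for m :: "'a \<Rightarrow>\<^sub>0 int"
    using that by (auto split: if_splits)
  then have "series_of (rat_const a * F) (lact (single 0 a) c)" "bsup vs (lact (single 0 a) c)"
    using series_of_lact[OF c(1), of "single 0 a"] bsup_lact[OF d _ c(2), of "single 0 a"]
    by (auto simp: rat_const_def)
  from constant_term_eq[OF d this] constant_term_eq[OF d c] show ?thesis by simp
qed

lemma V_graded_0 [simp]: "(0 :: ('i::finite var, 'k::field) laurent) \<in> V_graded n"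
  by (simp add: V_graded_iff)

lemma V_graded_add:
  "P \<in> V_graded n \<Longrightarrow> Q \<in> V_graded n \<Longrightarrow> (P + Q :: ('i::finite var, 'k::field) laurent) \<in> V_graded n"
  using Poly_Mapping.keys_add[of P Q] unfolding V_graded_iff by (auto simp: subset_iff)

lemma V_graded_cmult:
  "P \<in> V_graded n \<Longrightarrow> (single 0 c * P :: ('i::finite var, 'k::field) laurent) \<in> V_graded n"
  using keys_mult[of "single 0 c" P] unfolding V_graded_iff by (auto split: if_splits)

lemma V_graded_sum:
  "(\<And>x. x \<in> A \<Longrightarrow> P x \<in> V_graded n) \<Longrightarrow> ((\<Sum>x\<in>A. P x) :: ('i::finite var, 'k::field) laurent) \<in> V_graded n"
  by (induction A rule: infinite_finite_induct) (auto intro: V_graded_add)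

context zeta
begin

lemma expandable_word:
  assumes "R \<in> V_graded (word_weight w)"
  shows "expandable (ord_list s (wv w)) (zmon (wmon w) * to_ratfun R / om p (opposite s) (wv w))"
proof -
  have "expandable (ord_list s (wv w)) (zmon (wmon w) * (to_ratfun R / om p (opposite s) (wv w)))"
  proof (rule expandable_laurent)
    show "expandable (ord_list s (wv w)) (to_ratfun R / om p (opposite s) (wv w))"
      unfolding expandable_def by (rule word_pairing_series[OF assms, of s]) blast
  qed (use keys_wmon[of w] in \<open>auto simp: distinct_wv set_wv split: if_splits\<close>)
  then show ?thesis by simp
qed

lemma word_pairing_add:
  assumes "P \<in> V_graded (word_weight w)" "Q \<in> V_graded (word_weight w)"
  shows "word_pairing p s w (P + Q) = word_pairing p s w P + word_pairing p s w Q"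
  using constant_term_add[OF _ expandable_word[OF assms(1), of s] expandable_word[OF assms(2), of s]]
  by (simp add: word_pairing_eq distinct_wv distrib_left add_divide_distrib)

lemma word_pairing_const:
  assumes "P \<in> V_graded (word_weight w)"
  shows "word_pairing p s w (single 0 a * P) = a * word_pairing p s w P"
  using constant_term_const[OF _ expandable_word[OF assms, of s], of a]
  by (simp add: word_pairing_eq distinct_wv rat_const_def mult_ac)

lemma word_pairing_0 [simp]: "word_pairing p s w 0 = 0"
  by (simp add: word_pairing_eq distinct_wv)

lemma word_pairing_sum:
  assumes "\<And>x. x \<in> A \<Longrightarrow> P x \<in> V_graded (word_weight w)"
  shows "word_pairing p s w (\<Sum>x\<in>A. P x) = (\<Sum>x\<in>A. word_pairing p s w (P x))"
  using assms
  by (induction A rule: infinite_finite_induct) (auto simp: word_pairing_add V_graded_sum)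

end

section \<open>Adjointness\<close>

context zeta
begin

lemma om_reorder:
  assumes d: "distinct us" "distinct vs" "set us = set vs"
  shows "om p t us = (\<Prod>(x, y)\<in>Bef vs. if (x, y) \<in> Bef us then kap p t x y else kap p t y x)"
proof -
  let ?f = "\<lambda>(x, y). if (x, y) \<in> Bef us then (x, y) else (y, x)"
  have "bij_betw ?f (Bef vs) (Bef us)"
  proof (rule bij_betw_byWitness[where f' = "\<lambda>(x, y). if (x, y) \<in> Bef vs then (x, y) else (y, x)"])
    have t: "(x, y) \<in> Bef us \<or> (y, x) \<in> Bef us" if "(x, y) \<in> Bef vs" for x y
      using that Bef_total[OF d(1)] Bef_subset[of vs] Bef_neq[OF d(2)] d(3) by blast
    have t': "(x, y) \<in> Bef vs \<or> (y, x) \<in> Bef vs" if "(x, y) \<in> Bef us" for x y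
      using that Bef_total[OF d(2)] Bef_subset[of us] Bef_neq[OF d(1)] d(3) by blast
    show "\<forall>a\<in>Bef vs. (case ?f a of (x, y) \<Rightarrow> if (x, y) \<in> Bef vs then (x, y) else (y, x)) = a"
      using Bef_asym[OF d(2)] by auto
    show "\<forall>a\<in>Bef us. ?f (case a of (x, y) \<Rightarrow> if (x, y) \<in> Bef vs then (x, y) else (y, x)) = a"
      using Bef_asym[OF d(1)] by auto
    show "?f ` Bef vs \<subseteq> Bef us" by (auto dest: t)
    show "(\<lambda>(x, y). if (x, y) \<in> Bef vs then (x, y) else (y, x)) ` Bef us \<subseteq> Bef vs" by (auto dest: t')
  qed
  from prod.reindex_bij_betw[OF this, of "\<lambda>(x, y). kap p t x y"]
  have "om p t us = (\<Prod>q\<in>Bef vs. case ?f q of (x, y) \<Rightarrow> kap p t x y)" unfolding om_def by (rule sym)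
  also have "\<dots> = (\<Prod>(x, y)\<in>Bef vs. if (x, y) \<in> Bef us then kap p t x y else kap p t y x)"
    by (rule prod.cong) auto
  finally show ?thesis .
qed

lemma om_quotient:
  assumes d: "distinct us" "distinct vs" "set us = set vs"
  shows "om p t us / om p t vs = (\<Prod>(x, y)\<in>Bef vs - Bef us. kap p t y x / kap p t x y)"
    and "om p (opposite t) vs / om p (opposite t) us = om p t us / om p t vs"
proof -
  have n: "kap p t x y \<noteq> 0" "kap p t y x \<noteq> 0" if "(x, y) \<in> Bef vs" for x y t
    using kap_nonzero Bef_neq[OF d(2) that] by auto
  have "om p t us / om p t vs = (\<Prod>(x, y)\<in>Bef vs. if (x, y) \<in> Bef us then 1 else kap p t y x / kap p t x y)" for t
    unfolding om_reorder[OF d] om_def[of p t vs] prod_dividef[symmetric]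
    by (rule prod.cong) (use n in auto)
  also have "(\<Prod>(x, y)\<in>Bef vs. if (x, y) \<in> Bef us then 1 else kap p t y x / kap p t x y) =
      (\<Prod>(x, y)\<in>Bef vs - Bef us. kap p t y x / kap p t x y)" for t
    by (rule prod.mono_neutral_cong_right) auto
  finally have q: "om p t us / om p t vs = (\<Prod>(x, y)\<in>Bef vs - Bef us. kap p t y x / kap p t x y)" for t .
  then show "om p t us / om p t vs = (\<Prod>(x, y)\<in>Bef vs - Bef us. kap p t y x / kap p t x y)" .
  have "om p (opposite t) vs / om p (opposite t) us = inverse (om p (opposite t) us / om p (opposite t) vs)"
    by simp
  also have "\<dots> = (\<Prod>(x, y)\<in>Bef vs - Bef us. inverse (kap p t x y / kap p t y x))"
    unfolding q kap_opposite prod_inversef[symmetric] by (simp add: case_prod_unfold comp_def)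
  also have "\<dots> = om p t us / om p t vs" unfolding q by (simp add: case_prod_unfold)
  finally show "om p (opposite t) vs / om p (opposite t) us = om p t us / om p t vs" .
qed

text \<open>The quotient of the two kernels only involves the pairs of variables that the two orders
  invert, so that it has one expansion in both regions.\<close>

lemma om_quotient_series:
  assumes d: "distinct us" "distinct vs" "set us = set vs"
  obtains c where "series_of (om p (opposite s) us / om p (opposite s) vs) c"
    "bsup (ord_list s vs) c" "bsup (ord_list (opposite s) us) c"
    "\<And>m. c m \<noteq> 0 \<Longrightarrow> \<exists>k. m = (\<Sum>(x, y)\<in>Bef vs - Bef us. case s of Positive \<Rightarrow> vroot x y (k x y) | Negative \<Rightarrow> vroot y x (k x y)) \<and>
       (\<forall>x y. - kbound \<le> k x y)"
proof -
  let ?J = "Bef vs - Bef us" and ?t = "opposite s"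
  let ?r = "\<lambda>x y k. case s of Positive \<Rightarrow> vroot x y k | Negative \<Rightarrow> vroot y x k"
  let ?VS = "{ord_list s vs, ord_list ?t us}"
  have "\<exists>c. series_of (kap p ?t y x / kap p ?t x y) c \<and> (\<forall>ws\<in>?VS. bsup ws c) \<and>
     (\<forall>m. c m \<noteq> 0 \<longrightarrow> (\<exists>k\<ge>- kbound. m = ?r x y k))" if xy: "(x, y) \<in> ?J" for x y
  proof -
    have "x \<noteq> y" using Bef_neq[OF d(2)] xy by auto
    have yx: "(y, x) \<in> Bef us"
      using Bef_total[OF d(1), of x y] xy \<open>x \<noteq> y\<close> Bef_subset[of vs] d(3) by auto
    show ?thesis
    proof (cases s)
      case Positive
      obtain c where c: "series_of (kap p ?t y x / kap p ?t x y) c" "\<And>m. c m \<noteq> 0 \<Longrightarrow> \<exists>k\<ge>- kbound. m = vroot x y k"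
        using kbound(4)[OF \<open>x \<noteq> y\<close>, of ?t] unfolding ratio_bounded_def by blast
      then show ?thesis
        using Positive bsup_Bef[of vs x y c kbound] bsup_Bef[of "rev us" x y c kbound] xy yx d by (auto simp: Bef_rev)
    next
      case Negative
      obtain c where c: "series_of (kap p ?t y x / kap p ?t x y) c" "\<And>m. c m \<noteq> 0 \<Longrightarrow> \<exists>k\<ge>- kbound. m = vroot y x k"
        using kbound(5)[OF \<open>x \<noteq> y\<close>, of ?t] unfolding ratio_bounded_def by blast
      then show ?thesis
        using Negative bsup_Bef[of "rev vs" y x c kbound] bsup_Bef[of us y x c kbound] xy yx d by (auto simp: Bef_rev)
    qed
  qed
  then obtain c where c: "\<And>x y. (x, y) \<in> ?J \<Longrightarrow> series_of (kap p ?t y x / kap p ?t x y) (c x y) \<and> (\<forall>ws\<in>?VS. bsup ws (c x y)) \<and>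
     (\<forall>m. c x y m \<noteq> 0 \<longrightarrow> (\<exists>k\<ge>- kbound. m = ?r x y k))" by metis
  have "\<exists>e. series_of (\<Prod>(x, y)\<in>?J. kap p ?t y x / kap p ?t x y) e \<and> (\<forall>ws\<in>?VS. bsup ws e) \<and>
    (\<forall>m. e m \<noteq> 0 \<longrightarrow> (\<exists>a. m = (\<Sum>j\<in>?J. a j) \<and> (\<forall>j\<in>?J. case_prod c j (a j) \<noteq> 0)))"
    by (rule series_of_prod) (use c d in auto)
  then obtain e where e: "series_of (om p ?t us / om p ?t vs) e" "\<And>ws. ws \<in> ?VS \<Longrightarrow> bsup ws e"
    "\<And>m. e m \<noteq> 0 \<Longrightarrow> \<exists>a. m = (\<Sum>j\<in>?J. a j) \<and> (\<forall>j\<in>?J. case_prod c j (a j) \<noteq> 0)"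
    unfolding om_quotient(1)[OF d] by blast
  show ?thesis
  proof (rule that[OF e(1)])
    show "bsup (ord_list s vs) e" "bsup (ord_list ?t us) e" using e(2) by auto
    fix m assume m: "e m \<noteq> 0"
    obtain a where a: "m = (\<Sum>j\<in>?J. a j)" "\<forall>j\<in>?J. case_prod c j (a j) \<noteq> 0" using e(3)[OF m] by blast
    have a2: "c x y (a (x, y)) \<noteq> 0" if "(x, y) \<in> ?J" for x y using bspec[OF a(2) that] by simp
    have "\<forall>x y. \<exists>k\<ge>- kbound. (x, y) \<in> ?J \<longrightarrow> a (x, y) = ?r x y k"
      using c a2 order_refl[of "- kbound"] by blast
    then obtain k where k: "\<And>x y. - kbound \<le> k x y \<and> ((x, y) \<in> ?J \<longrightarrow> a (x, y) = ?r x y (k x y))" by metis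
    have "m = (\<Sum>(x, y)\<in>?J. ?r x y (k x y))"
      unfolding a(1) by (rule sum.cong) (use k in auto)
    then show "\<exists>k. m = (\<Sum>(x, y)\<in>?J. ?r x y (k x y)) \<and> (\<forall>x y. - kbound \<le> k x y)" using k by blast
  qed
qed

text \<open>
  The summand of \<open>\<sigma>\<close> on one side is carried to the summand of \<open>\<sigma>\<^sup>-\<^sup>1\<close> on the other side by a renaming of
  the variables. Both are constant terms of the same function, in two different regions, and by
  \<open>om_quotient_series\<close> one series is its expansion in both.
\<close>

lemma word_pairing_adjoint:
  assumes n: "word_weight w = word_weight v"
  shows "word_pairing p s w (E (opposite s) v) = word_pairing p (opposite s) v (E s w)"
proof -
  let ?t = "opposite s" and ?n = "word_weight w"
  define F where "F \<sigma> = zmon (wmon w) * ren (pv \<sigma>) (wterm p ?t v) / om p ?t (wv w)" for \<sigma>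
  define G where "G \<rho> = zmon (wmon v) * ren (pv \<rho>) (wterm p s w) / om p s (wv v)" for \<rho>
  have key: "expandable (ord_list s (wv w)) (F \<sigma>) \<and> expandable (ord_list ?t (wv v)) (G (cinv \<sigma>)) \<and>
    constant_term (ord_list s (wv w)) (F \<sigma>) = constant_term (ord_list ?t (wv v)) (G (cinv \<sigma>))"
    if \<sigma>: "\<sigma> \<in> color_perms ?n" for \<sigma>
  proof -
    let ?\<rho> = "cinv \<sigma>"
    have \<rho>: "?\<rho> \<in> color_perms ?n" using cinv_in[OF \<sigma>] .
    have i: "inj (pv \<sigma>)" "inj (pv ?\<rho>)" using \<sigma> \<rho> by (auto intro: inj_pv)
    have \<rho>\<sigma>: "pv ?\<rho> (pv \<sigma> x) = x" for x
      using ccomp_cinv(2)[OF \<sigma>, of "\<lambda>i. id"] by (cases x) (auto simp: ccomp_def fun_eq_iff)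
    define us where "us = map (pv \<sigma>) (wv v)"
    have us: "distinct us" "set us = set (wv w)"
      using i(1) \<sigma> n by (auto simp: us_def distinct_map distinct_wv set_wv pv_image_Vset intro: inj_on_subset)
    have mus: "map (pv ?\<rho>) us = wv v" by (simp add: us_def comp_def \<rho>\<sigma>)
    define M where "M = wmon w + ren_mon (pv \<sigma>) (wmon v)"
    have kM: "keys M \<subseteq> set (wv w)"
    proof -
      have "keys (ren_mon (pv \<sigma>) (wmon v)) \<subseteq> pv \<sigma> ` Vset ?n"
        using keys_ren_mon[of "pv \<sigma>" "wmon v"] keys_wmon[of v] n by auto
      then show ?thesis unfolding M_def
        using Poly_Mapping.keys_add[of "wmon w" "ren_mon (pv \<sigma>) (wmon v)"] keys_wmon[of w] pv_image_Vset[OF \<sigma>]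
        by (auto simp: set_wv)
    qed
    obtain c where c: "series_of (om p ?t us / om p ?t (wv w)) c"
      "bsup (ord_list s (wv w)) c" "bsup (ord_list ?t us) c"
      by (rule om_quotient_series[OF us(1) distinct_wv us(2), of s]) blast
    have Fe: "F \<sigma> = zmon M * (om p ?t us / om p ?t (wv w))"
      unfolding F_def M_def zmon_add us_def by (subst ren_wterm) (auto simp: i)
    define e where "e = (\<lambda>m. c (m - M))"
    have e: "series_of (F \<sigma>) e" "bsup (ord_list s (wv w)) e" "bsup (ord_list ?t us) e"
      unfolding e_def Fe using series_of_zmon[OF c(1)] bsup_shift[OF c(2)] bsup_shift[OF c(3)] kM us(2) by auto
    have "ren (pv ?\<rho>) (F \<sigma>) = zmon (ren_mon (pv ?\<rho>) M) * (om p ?t (wv v) / om p ?t (map (pv ?\<rho>) (wv w)))"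
      unfolding Fe by (simp add: ren_mult[OF i(2)] ren_div[OF i(2)] ren_to_ratfun[OF i(2)] ren_om[OF i(2)] mus)
    also have "om p ?t (wv v) / om p ?t (map (pv ?\<rho>) (wv w)) = om p s (map (pv ?\<rho>) (wv w)) / om p s (wv v)"
      using om_quotient(2)[of "wv v" "map (pv ?\<rho>) (wv w)" ?t] i(2) \<rho> n
      by (simp add: distinct_map distinct_wv set_wv pv_image_Vset inj_on_subset[OF i(2)])
    also have "ren_mon (pv ?\<rho>) M = ren_mon (pv ?\<rho>) (wmon w) + wmon v"
      by (simp add: M_def ren_mon_comp comp_def \<rho>\<sigma> ren_mon_id)
    also have "zmon (ren_mon (pv ?\<rho>) (wmon w) + wmon v) * (om p s (map (pv ?\<rho>) (wv w)) / om p s (wv v)) = G ?\<rho>"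
      unfolding G_def zmon_add by (subst ren_wterm) (auto simp: i)
    finally have Ge: "ren (pv ?\<rho>) (F \<sigma>) = G ?\<rho>" .
    have g: "series_of (G ?\<rho>) (ren_series (pv ?\<rho>) e)" unfolding Ge[symmetric] by (rule series_of_ren[OF i(2) e(1)])
    have b: "bsup (ord_list ?t (wv v)) (ren_series (pv ?\<rho>) e)"
      using bsup_ren[OF i(2) e(3)] unfolding mus[symmetric] by simp
    have "ren_series (pv ?\<rho>) e 0 = e 0" using ren_series_ren_mon[OF i(2), of e 0] by simp
    then have "constant_term (ord_list s (wv w)) (F \<sigma>) = constant_term (ord_list ?t (wv v)) (G ?\<rho>)"
      using constant_term_eq[OF _ e(1,2)] constant_term_eq[OF _ g b] by (simp add: distinct_wv)
    then show ?thesis using e g b unfolding expandable_def by blast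
  qed
  have "word_pairing p s w (E ?t v) = constant_term (ord_list s (wv w)) (\<Sum>\<sigma>\<in>color_perms ?n. F \<sigma>)"
    unfolding word_pairing_eq to_ratfun_E symz_def F_def n[symmetric]
    by (simp add: sum_distrib_left sum_divide_distrib)
  also have "\<dots> = (\<Sum>\<sigma>\<in>color_perms ?n. constant_term (ord_list s (wv w)) (F \<sigma>))"
    by (rule constant_term_sum) (use key in \<open>auto simp: distinct_wv\<close>)
  also have "\<dots> = (\<Sum>\<sigma>\<in>color_perms ?n. constant_term (ord_list ?t (wv v)) (G (cinv \<sigma>)))"
    by (rule sum.cong) (use key in auto)
  also have "\<dots> = constant_term (ord_list ?t (wv v)) (\<Sum>\<sigma>\<in>color_perms ?n. G (cinv \<sigma>))"
    by (rule constant_term_sum[symmetric]) (use key in \<open>auto simp: distinct_wv\<close>)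
  also have "(\<Sum>\<sigma>\<in>color_perms ?n. G (cinv \<sigma>)) = (\<Sum>\<rho>\<in>color_perms ?n. G \<rho>)"
  proof -
    have "cinv (cinv \<sigma>) = \<sigma>" if "\<sigma> \<in> color_perms ?n" for \<sigma>
      unfolding cinv_def by (rule ext) (use that permutes_inv_inv in \<open>auto simp: color_perms_def\<close>)
    then show ?thesis by (intro sum.reindex_bij_witness[of _ cinv cinv]) (auto intro: cinv_in)
  qed
  also have "constant_term (ord_list ?t (wv v)) \<dots> = word_pairing p ?t v (E s w)"
    unfolding word_pairing_eq to_ratfun_E symz_def G_def
    by (simp add: sum_distrib_left sum_divide_distrib)
  finally show ?thesis .
qed

end

section \<open>The quadratic relations\<close>

definition list_mon :: "'v list \<Rightarrow> ('i \<times> int) list \<Rightarrow> ('v \<Rightarrow>\<^sub>0 int)" where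
  "list_mon vs w = sum_list (map2 (\<lambda>v l. single v (snd l)) vs w)"

lemma list_mon_append:
  "length xs = length u \<Longrightarrow> list_mon (xs @ ys) (u @ w) = list_mon xs u + list_mon ys w"
  by (simp add: list_mon_def)

lemma list_mon_Cons [simp]: "list_mon (x # xs) (l # u) = single x (snd l) + list_mon xs u" "list_mon [] u = 0"
  by (simp_all add: list_mon_def)

lemma keys_list_mon: "length xs = length u \<Longrightarrow> keys (list_mon xs u) \<subseteq> set xs"
proof (induction xs u rule: list_induct2)
  case (Cons x xs l u)
  then show ?case using Poly_Mapping.keys_add[of "single x (snd l)" "list_mon xs u"]
    by (auto split: if_splits)
qed simp

lemma lookup_list_mon:
  "length xs = length u \<Longrightarrow> distinct xs \<Longrightarrow> a < length xs \<Longrightarrow> lookup (list_mon xs u) (xs ! a) = snd (u ! a)"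
proof (induction xs u arbitrary: a rule: list_induct2)
  case (Cons x xs l u)
  show ?case
  proof (cases a)
    case 0
    then show ?thesis using Cons keys_list_mon[OF Cons(1)]
      by (auto simp: lookup_add lookup_single in_keys_iff)
  next
    case (Suc b)
    then show ?thesis using Cons by (auto simp: lookup_add lookup_single when_def)
  qed
qed simp

text \<open>
  The denominator of \<open>\<zeta>\<^sub>i\<^sub>i\<close>, up to a monomial. It changes sign when the variables are exchanged, whence
  the sign in the relations for equal colours.
\<close>

definition pole_factor :: "half \<Rightarrow> 'i var \<Rightarrow> 'i var \<Rightarrow> ('i var, 'k::field) laurent" where
  "pole_factor s x y = (if col x = col y then (case s of Positive \<Rightarrow> vdiff x y | Negative \<Rightarrow> vdiff y x) else 1)"

lemma pole_factor_swap: "pole_factor s y x = (if col x = col y then - pole_factor s x y else pole_factor s x y)"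
  by (cases s) (auto simp: pole_factor_def vdiff_swap[of y x])

definition qcoeff :: "('i, 'k::field) zeta_data \<Rightarrow> half \<Rightarrow> 'i \<Rightarrow> 'i \<Rightarrow> (int \<Rightarrow>\<^sub>0 'k)" where
  "qcoeff p s i j = (case s of Positive \<Rightarrow> p j i | Negative \<Rightarrow> p i j)"

definition qword :: "half \<Rightarrow> 'i \<Rightarrow> 'i \<Rightarrow> int \<Rightarrow> int \<Rightarrow> int \<Rightarrow> ('i \<times> int) list" where
  "qword s i j a b k = (let \<delta> = (if i = j then 1 else 0) in
     case s of Positive \<Rightarrow> [(i, a + \<delta> - k), (j, b + k)] | Negative \<Rightarrow> [(i, a + k), (j, b + \<delta> - k)])"

definition qside :: "('i, 'k::field) zeta_data \<Rightarrow> half \<Rightarrow> 'i \<Rightarrow> 'i \<Rightarrow> int \<Rightarrow> int \<Rightarrow> ('i, 'k) free" where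
  "qside p s i j a b = (\<Sum>k\<in>keys (qcoeff p s i j). single (FWord (qword s i j a b k)) (lookup (qcoeff p s i j) k))"

lemma quadratic_relation_eq:
  "quadratic_relation p s i j a b = qside p s i j a b - single 0 (if i = j then - 1 else 1) * qside p s j i b a"
  by (cases s) (auto simp: qside_def qcoeff_def qword_def Let_def sum_distrib_left mult_single zero_fword_def plus_fword_def)

context zeta
begin

lemma word_pairing_any_list:
  assumes R: "R \<in> V_graded (word_weight u)" and vs: "distinct vs" "map col vs = map fst u" "set vs = Vset (word_weight u)"
  shows "word_pairing p s u R = constant_term (ord_list s vs) (zmon (list_mon vs u) * (to_ratfun R / om p (opposite s) vs))"
    and "expandable (ord_list s vs) (zmon (list_mon vs u) * (to_ratfun R / om p (opposite s) vs))"
proof -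
  have l: "length vs = length u" using arg_cong[OF vs(2), of length] by simp
  obtain c where c: "series_of (to_ratfun (ren_laurent (\<lambda>x. x) R) / om p (opposite s) vs) c" "bsup (ord_list s vs) c"
    "\<And>w m. map fst w = map fst u \<Longrightarrow> (\<And>a. a < length vs \<Longrightarrow> lookup m (vs ! a) = snd (w ! a)) \<Longrightarrow>
        keys m \<subseteq> set vs \<Longrightarrow> c (- m) = word_pairing p s w R"
    by (rule relabelled_series[OF R vs(1,2), of "\<lambda>x. x" s]) (auto simp: vs(3))
  have e: "series_of (zmon (list_mon vs u) * (to_ratfun R / om p (opposite s) vs)) (\<lambda>m. c (m - list_mon vs u))"
    using series_of_zmon[OF c(1)] by (simp add: ren_laurent_id)
  have b: "bsup (ord_list s vs) (\<lambda>m. c (m - list_mon vs u))"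
    by (rule bsup_shift[OF c(2)]) (use keys_list_mon[OF l] in simp)
  have "c (- list_mon vs u) = word_pairing p s u R"
    by (rule c(3)[OF refl]) (use l vs keys_list_mon[OF l] in \<open>auto simp: lookup_list_mon\<close>)
  moreover have "distinct (ord_list s vs)" using vs(1) by simp
  ultimately show "word_pairing p s u R = constant_term (ord_list s vs) (zmon (list_mon vs u) * (to_ratfun R / om p (opposite s) vs))"
    using constant_term_eq[OF _ e b] by simp
  show "expandable (ord_list s vs) (zmon (list_mon vs u) * (to_ratfun R / om p (opposite s) vs))"
    unfolding expandable_def using e b by blast
qed

lemma cancel_denominator:
  fixes Z1 :: "'f::field"
  assumes "S = Z1 * N" "Z1 * D = Z" "k = N / D" "D \<noteq> 0"
  shows "S = Z * k"
  using assms by auto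

lemma to_ratfun_in_ratio:
  "to_ratfun (in_ratio x y B) = (\<Sum>k\<in>keys B. rat_const (lookup B k) * zmon (vroot x y k))"
  by (simp add: in_ratio_def pext_def to_ratfun_sum rat_const_simps)

lemma qside_kernel:
  fixes x y :: "'i var"
  assumes xy: "x \<noteq> y" "col x = i" "col y = j"
  shows "(\<Sum>k\<in>keys (qcoeff p s i j). rat_const (lookup (qcoeff p s i j) k) * zmon (list_mon [x, y] (qword s i j a b k))) =
    zmon (single x a + single y b) * to_ratfun (pole_factor s x y) * kap p (opposite s) x y"
proof (cases s)
  case Positive
  let ?d = "if i = j then 1 else 0 :: int"
  have e: "list_mon [x, y] (qword s i j a b k) = (single x (a + ?d) + single y b) + vroot x y k" for k
    by (simp add: Positive qword_def vroot_def single_add single_diff)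
  have "(\<Sum>k\<in>keys (qcoeff p s i j). rat_const (lookup (qcoeff p s i j) k) * zmon (list_mon [x, y] (qword s i j a b k))) =
    zmon (single x (a + ?d) + single y b) * to_ratfun (in_ratio x y (p j i))"
    unfolding e zmon_add[of "single x (a + ?d) + single y b"]
    unfolding to_ratfun_in_ratio sum_distrib_left
    by (intro sum.cong) (simp_all only: Positive qcoeff_def half.case mult_ac)
  moreover have "zmon (single x (a + ?d) + single y b) * to_ratfun (in_ratio x y (zeta_den j i)) =
      (zmon (single x a + single y b) * to_ratfun (pole_factor s x y) :: ('i var, 'k) ratfun)"
  proof (cases "i = j")
    case True
    have "single (single x (a + 1) + single y b) 1 * in_ratio x y (zeta_den j i) =
      single (single x a + single y b) 1 * (vdiff x y :: ('i var, 'k) laurent)"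
      using True by (simp add: zeta_den_def vdiff_def right_diff_distrib mult_single vroot_def single_add algebra_simps)
    then show ?thesis using True xy by (simp add: pole_factor_def Positive flip: to_ratfun_hom(4))
  next
    case False
    then show ?thesis using xy by (simp add: pole_factor_def zeta_den_def Positive)
  qed
  moreover have "kap p (opposite s) x y = to_ratfun (in_ratio x y (p j i)) / to_ratfun (in_ratio x y (zeta_den j i))"
    using xy by (simp add: Positive kap_quotient)
  moreover have "to_ratfun (in_ratio x y (zeta_den j i)) \<noteq> (0 :: ('i var, 'k) ratfun)"
    using xy by (simp add: zeta_den_nonzero)
  ultimately show ?thesis by (rule cancel_denominator)
next
  case Negative
  let ?d = "if i = j then 1 else 0 :: int"
  have e: "list_mon [x, y] (qword s i j a b k) = (single x a + single y (b + ?d)) + vroot y x k" for k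
    by (simp add: Negative qword_def vroot_def single_add single_diff)
  have "(\<Sum>k\<in>keys (qcoeff p s i j). rat_const (lookup (qcoeff p s i j) k) * zmon (list_mon [x, y] (qword s i j a b k))) =
    zmon (single x a + single y (b + ?d)) * to_ratfun (in_ratio y x (p i j))"
    unfolding e zmon_add[of "single x a + single y (b + ?d)"]
    unfolding to_ratfun_in_ratio sum_distrib_left
    by (intro sum.cong) (simp_all only: Negative qcoeff_def half.case mult_ac)
  moreover have "zmon (single x a + single y (b + ?d)) * to_ratfun (in_ratio y x (zeta_den i j)) =
      (zmon (single x a + single y b) * to_ratfun (pole_factor s x y) :: ('i var, 'k) ratfun)"
  proof (cases "i = j")
    case True
    have "single (single x a + single y (b + 1)) 1 * in_ratio y x (zeta_den i j) =
      single (single x a + single y b) 1 * (vdiff y x :: ('i var, 'k) laurent)"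
      using True by (simp add: zeta_den_def vdiff_def right_diff_distrib mult_single vroot_def single_add algebra_simps)
    then show ?thesis using True xy by (simp add: pole_factor_def Negative flip: to_ratfun_hom(4))
  next
    case False
    then show ?thesis using xy by (simp add: pole_factor_def zeta_den_def Negative)
  qed
  moreover have "kap p (opposite s) x y = to_ratfun (in_ratio y x (p i j)) / to_ratfun (in_ratio y x (zeta_den i j))"
    using xy by (simp add: Negative kap_quotient in_ratio_flip[of y x])
  moreover have "to_ratfun (in_ratio y x (zeta_den i j)) \<noteq> (0 :: ('i var, 'k) ratfun)"
    using xy by (simp add: zeta_den_nonzero)
  ultimately show ?thesis by (rule cancel_denominator)
qed

lemma qside_pairing:
  assumes L: "distinct (V1 @ [x, y] @ V2)" "map col (V1 @ [x, y] @ V2) = map fst w1 @ [i, j] @ map fst w2"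
    "set (V1 @ [x, y] @ V2) = Vset n" "length V1 = length w1"
    and R: "R \<in> V_graded n" and n: "\<And>d e. word_weight (w1 @ [(i, d), (j, e)] @ w2) = n"
  shows "(\<Sum>k\<in>keys (qcoeff p s i j). lookup (qcoeff p s i j) k * word_pairing p s (w1 @ qword s i j a b k @ w2) R) =
    constant_term (ord_list s (V1 @ [x, y] @ V2)) (zmon (list_mon V1 w1 + list_mon V2 w2 + single x a + single y b) *
      to_ratfun (pole_factor s x y) * to_ratfun R /
      (\<Prod>(u, v)\<in>Bef (V1 @ [x, y] @ V2) - {(x, y)}. kap p (opposite s) u v))"
proof -
  let ?L = "V1 @ [x, y] @ V2" and ?t = "opposite s"
  let ?O = "\<Prod>(u, v)\<in>Bef ?L - {(x, y)}. kap p ?t u v"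
  have xy: "x \<noteq> y" using L(1) by auto
  have cols: "col x = i" "col y = j"
    using L(2,4) by (auto simp: append_eq_append_conv)
  have om: "om p ?t ?L = kap p ?t x y * ?O"
    unfolding om_def by (subst prod.remove[of _ "(x, y)"]) (auto simp: Bef_append)
  have q: "\<exists>d e. qword s i j a b k = [(i, d), (j, e)]" for k
    by (cases s) (auto simp: qword_def Let_def)
  let ?w = "\<lambda>k. w1 @ qword s i j a b k @ w2"
  have wn: "word_weight (?w k) = n" for k using q[of k] n by metis
  have wf: "map fst (?w k) = map fst w1 @ [i, j] @ map fst w2" for k using q[of k] by auto
  have lm: "list_mon ?L (?w k) = (list_mon V1 w1 + list_mon V2 w2) + list_mon [x, y] (qword s i j a b k)" for k
  proof -
    have "length [x, y] = length (qword s i j a b k)" using q[of k] by auto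
    then show ?thesis by (simp only: list_mon_append[OF L(4)] list_mon_append) (simp add: add_ac)
  qed
  have wp: "word_pairing p s (?w k) R = constant_term (ord_list s ?L) (zmon (list_mon ?L (?w k)) * (to_ratfun R / om p ?t ?L))"
    "expandable (ord_list s ?L) (zmon (list_mon ?L (?w k)) * (to_ratfun R / om p ?t ?L))" for k
    by (rule word_pairing_any_list; use L R wn wf in simp)+
  have d: "distinct (ord_list s ?L)" using L(1) by simp
  have "(\<Sum>k\<in>keys (qcoeff p s i j). lookup (qcoeff p s i j) k * word_pairing p s (?w k) R) =
    constant_term (ord_list s ?L) (\<Sum>k\<in>keys (qcoeff p s i j). rat_const (lookup (qcoeff p s i j) k) *
      (zmon (list_mon ?L (?w k)) * (to_ratfun R / om p ?t ?L)))"
    unfolding wp(1) constant_term_sum[OF d expandable_const[OF d wp(2)]] constant_term_const[OF d wp(2)] ..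
  also have "(\<Sum>k\<in>keys (qcoeff p s i j). rat_const (lookup (qcoeff p s i j) k) *
      (zmon (list_mon ?L (?w k)) * (to_ratfun R / om p ?t ?L))) =
    zmon (list_mon V1 w1 + list_mon V2 w2) * (\<Sum>k\<in>keys (qcoeff p s i j). rat_const (lookup (qcoeff p s i j) k) *
      zmon (list_mon [x, y] (qword s i j a b k))) * (to_ratfun R / om p ?t ?L)"
    unfolding lm zmon_add[of "list_mon V1 w1 + list_mon V2 w2"] sum_distrib_left sum_distrib_right
    by (intro sum.cong refl) (simp only: mult_ac)
  also have "\<dots> = zmon (list_mon V1 w1 + list_mon V2 w2) * (zmon (single x a + single y b) * to_ratfun (pole_factor s x y) *
      kap p ?t x y) * (to_ratfun R / (kap p ?t x y * ?O))"
    unfolding qside_kernel[OF xy cols] om ..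
  also have "\<dots> = zmon (list_mon V1 w1 + list_mon V2 w2 + single x a + single y b) *
      to_ratfun (pole_factor s x y) * to_ratfun R / ?O"
    using kap_nonzero[OF xy, of ?t] by (simp add: zmon_add add.assoc mult_ac)
  finally show ?thesis .
qed

lemma keys_pole_factor: "m \<in> keys (pole_factor s x y) \<Longrightarrow> keys m \<subseteq> {x, y}"
  using keys_diff[of "single (single x 1) 1" "single (single y 1) (1 :: 'b)"]
    keys_diff[of "single (single y 1) 1" "single (single x 1) (1 :: 'b)"]
  by (cases s) (auto simp: pole_factor_def vdiff_def split: if_splits)

text \<open>After multiplication with the quadratic relation the kernel has no factor left that couples
  the two exchanged variables, so the two expansions agree.\<close>

lemma relation_pairing:
  assumes R: "R \<in> V_graded n" and n: "\<And>d e. word_weight (w1 @ [(i, d), (j, e)] @ w2) = n"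
  shows "(\<Sum>k\<in>keys (qcoeff p s i j). lookup (qcoeff p s i j) k * word_pairing p s (w1 @ qword s i j a b k @ w2) R) =
    (if i = j then - 1 else 1) *
    (\<Sum>k\<in>keys (qcoeff p s j i). lookup (qcoeff p s j i) k * word_pairing p s (w1 @ qword s j i b a k @ w2) R)"
proof -
  let ?t = "opposite s"
  define W where "W = w1 @ [(i, 0), (j, 0 :: int)] @ w2"
  have lW: "length W = length w1 + 2 + length w2" by (simp add: W_def)
  define V1 where "V1 = take (length w1) (wv W)"
  define V2 where "V2 = drop (length w1 + 2) (wv W)"
  define x where "x = wv W ! length w1"
  define y where "y = wv W ! Suc (length w1)"
  have "wv W = V1 @ drop (length w1) (wv W)" by (simp add: V1_def)
  also have "drop (length w1) (wv W) = x # drop (Suc (length w1)) (wv W)"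
    unfolding x_def using lW by (subst Cons_nth_drop_Suc) auto
  also have "drop (Suc (length w1)) (wv W) = y # V2"
    unfolding y_def V2_def using lW by (subst Cons_nth_drop_Suc[symmetric]) auto
  finally have wW: "wv W = V1 @ [x, y] @ V2" by simp
  have l1: "length V1 = length w1" using lW by (simp add: V1_def)
  let ?L = "V1 @ [x, y] @ V2" and ?L' = "V1 @ [y, x] @ V2"
  have L: "distinct ?L" "set ?L = Vset n" "map col ?L = map fst w1 @ [i, j] @ map fst w2"
    using distinct_wv[of W] set_wv[of W] map_col_wv[of W] n[of 0 0] unfolding wW by (auto simp: W_def)
  have L': "distinct ?L'" "set ?L' = Vset n" "map col ?L' = map fst w1 @ [j, i] @ map fst w2"
    using L l1 by (auto simp: append_eq_append_conv)
  have cols: "col x = i" "col y = j" using L(3) l1 by (auto simp: append_eq_append_conv)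
  have xy: "x \<noteq> y" using L(1) by auto
  have B: "Bef ?L - {(x, y)} = Bef ?L' - {(y, x)}"
  proof -
    have "(x, y) \<notin> Bef V1 \<union> Bef V2 \<union> set V1 \<times> set V2" "(y, x) \<notin> Bef V1 \<union> Bef V2 \<union> set V1 \<times> set V2"
      using L(1) Bef_subset[of V1] Bef_subset[of V2] by auto
    then show ?thesis using L(1) by (auto simp: Bef_append)
  qed
  let ?M = "list_mon V1 w1 + list_mon V2 w2 + single x a + single y b"
  let ?O = "\<Prod>(u, v)\<in>Bef ?L - {(x, y)}. kap p ?t u v"
  let ?F = "zmon ?M * to_ratfun (pole_factor s x y) * to_ratfun R / ?O"
  have c': "constant_term (ord_list s ?L) ?F = constant_term (ord_list s ?L') ?F \<and> expandable (ord_list s ?L') ?F"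
  proof -
    let ?VS = "{ord_list s ?L, ord_list s ?L'}"
    have "\<exists>c. series_of (1 / kap p ?t u v) c \<and> (\<forall>ws\<in>?VS. bsup ws c)" if uv: "(u, v) \<in> Bef ?L - {(x, y)}" for u v
    proof -
      have uv1: "(u, v) \<in> Bef ?L" and uv2: "(u, v) \<in> Bef ?L'" using uv B by auto
      have "u \<noteq> v" using Bef_neq[OF L(1) uv1] .
      show ?thesis
      proof (cases s)
        case Positive
        obtain c where "series_of (1 / kap p ?t u v) c" "\<And>m. c m \<noteq> 0 \<Longrightarrow> \<exists>k\<ge>- kbound. m = vroot u v k"
          using kbound(2)[OF \<open>u \<noteq> v\<close>, of ?t] unfolding ratio_bounded_def by blast
        then show ?thesis using Positive bsup_Bef[OF L(1) uv1, of c] bsup_Bef[OF L'(1) uv2, of c] by auto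
      next
        case Negative
        obtain c where "series_of (1 / kap p ?t u v) c" "\<And>m. c m \<noteq> 0 \<Longrightarrow> \<exists>k\<ge>- kbound. m = vroot v u k"
          using kbound(3)[OF \<open>u \<noteq> v\<close>, of ?t] unfolding ratio_bounded_def by blast
        moreover have "(v, u) \<in> Bef (rev ?L)" "(v, u) \<in> Bef (rev ?L')" "distinct (rev ?L)" "distinct (rev ?L')"
          unfolding Bef_rev distinct_rev using uv1 uv2 L(1) L'(1) by blast+
        ultimately show ?thesis
          using Negative bsup_Bef[of "rev ?L" v u c] bsup_Bef[of "rev ?L'" v u c]
          by (auto simp del: rev_append)
      qed
    qed
    then obtain c where c: "\<And>u v. (u, v) \<in> Bef ?L - {(x, y)} \<Longrightarrow> series_of (1 / kap p ?t u v) (c u v) \<and> (\<forall>ws\<in>?VS. bsup ws (c u v))"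
      by metis
    have "\<exists>e. series_of (\<Prod>(u, v)\<in>Bef ?L - {(x, y)}. 1 / kap p ?t u v) e \<and> (\<forall>ws\<in>?VS. bsup ws e) \<and>
      (\<forall>m. e m \<noteq> 0 \<longrightarrow> (\<exists>a. m = (\<Sum>j\<in>Bef ?L - {(x, y)}. a j) \<and> (\<forall>j\<in>Bef ?L - {(x, y)}. case_prod c j (a j) \<noteq> 0)))"
    proof (rule series_of_prod)
      show "distinct ws" if "ws \<in> ?VS" for ws using that L(1) L'(1) by auto
      show "series_of (case j of (u, v) \<Rightarrow> 1 / kap p ?t u v) (case_prod c j)" if "j \<in> Bef ?L - {(x, y)}" for j
        using c that by (cases j) auto
      show "bsup ws (case_prod c j)" if "j \<in> Bef ?L - {(x, y)}" "ws \<in> ?VS" for j ws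
        using c that by (cases j) auto
    qed auto
    then obtain e where e: "series_of (1 / ?O) e" "\<And>ws. ws \<in> ?VS \<Longrightarrow> bsup ws e"
      by (auto simp: prod_dividef case_prod_unfold)
    define Q where "Q = single ?M 1 * pole_factor s x y * R"
    have kM: "keys ?M \<subseteq> set ?L"
    proof -
      have l2: "length V2 = length w2" using arg_cong[OF L(3), of length] l1 by simp
      have "keys ?M \<subseteq> keys (list_mon V1 w1) \<union> keys (list_mon V2 w2) \<union> {x} \<union> {y}"
        using Poly_Mapping.keys_add[of "list_mon V1 w1 + list_mon V2 w2 + single x a" "single y b"]
          Poly_Mapping.keys_add[of "list_mon V1 w1 + list_mon V2 w2" "single x a"]
          Poly_Mapping.keys_add[of "list_mon V1 w1" "list_mon V2 w2"]
        by (auto split: if_splits)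
      then show ?thesis using keys_list_mon[OF l1] keys_list_mon[OF l2] by auto
    qed
    have kQ: "keys m \<subseteq> set ?L" if m: "m \<in> keys Q" for m
    proof -
      have "m \<in> {f + g |f g. f \<in> keys (single ?M 1 * pole_factor s x y :: ('i var, 'k) laurent) \<and> g \<in> keys R}"
        using m keys_mult[of "single ?M 1 * pole_factor s x y" R] unfolding Q_def by blast
      then obtain f g where fg: "m = f + g" "f \<in> keys (single ?M 1 * pole_factor s x y :: ('i var, 'k) laurent)" "g \<in> keys R" by blast
      obtain h where h: "f = ?M + h" "h \<in> keys (pole_factor s x y :: ('i var, 'k) laurent)"
        using fg(2) keys_mult[of "single ?M 1" "pole_factor s x y :: ('i var, 'k) laurent"] by auto
      have "keys m \<subseteq> keys ?M \<union> keys h \<union> keys g"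
        unfolding fg(1) h(1) using Poly_Mapping.keys_add[of "?M + h" g] Poly_Mapping.keys_add[of ?M h] by blast
      moreover have "keys h \<subseteq> {x, y}" using keys_pole_factor[OF h(2)] .
      moreover have "keys g \<subseteq> set ?L" using R fg(3) L(2) unfolding V_graded_iff by blast
      ultimately show ?thesis using kM by auto
    qed
    have QF: "to_ratfun Q * (1 / ?O) = ?F" by (simp add: Q_def)
    have s: "series_of ?F (lact Q e)" using series_of_lact[OF e(1), of Q] unfolding QF .
    have sL: "set ?L' = set ?L" by auto
    have b1: "bsup (ord_list s ?L) (lact Q e)"
      by (rule bsup_lact) (use L(1) kQ e(2) in \<open>auto simp del: set_append\<close>)
    have b2: "bsup (ord_list s ?L') (lact Q e)"
      by (rule bsup_lact) (use L'(1) kQ e(2) sL in \<open>auto simp del: set_append\<close>)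
    have "constant_term (ord_list s ?L) ?F = lact Q e 0"
      by (rule constant_term_eq[OF _ s b1]) (use L(1) in \<open>simp del: distinct_append\<close>)
    moreover have "constant_term (ord_list s ?L') ?F = lact Q e 0"
      by (rule constant_term_eq[OF _ s b2]) (use L'(1) in \<open>simp del: distinct_append\<close>)
    moreover have "expandable (ord_list s ?L') ?F" unfolding expandable_def by (intro exI conjI, rule s, rule b2)
    ultimately show ?thesis by (intro conjI) (erule trans, erule sym)
  qed
  then have c: "constant_term (ord_list s ?L) ?F = constant_term (ord_list s ?L') ?F" ..
  have 1: "(\<Sum>k\<in>keys (qcoeff p s i j). lookup (qcoeff p s i j) k * word_pairing p s (w1 @ qword s i j a b k @ w2) R) =
      constant_term (ord_list s ?L) ?F"
    by (rule qside_pairing[OF L(1,3,2) l1 R n])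
  have n': "word_weight (w1 @ [(j, d), (i, e)] @ w2) = n" for d e
    using n[of e d] by (simp add: word_weight_append add_ac)
  have 2: "(\<Sum>k\<in>keys (qcoeff p s j i). lookup (qcoeff p s j i) k * word_pairing p s (w1 @ qword s j i b a k @ w2) R) =
      constant_term (ord_list s ?L') (zmon (list_mon V1 w1 + list_mon V2 w2 + single y b + single x a) *
        to_ratfun (pole_factor s y x) * to_ratfun R / (\<Prod>(u, v)\<in>Bef ?L' - {(y, x)}. kap p ?t u v))"
    by (rule qside_pairing[OF L'(1,3,2) l1 R n'])
  have M: "list_mon V1 w1 + list_mon V2 w2 + single y b + single x a = ?M" by (simp add: add_ac)
  have ex: "expandable (ord_list s ?L') ?F" using c' ..
  show ?thesis
  proof (cases "i = j")
    case False
    then show ?thesis unfolding 1 2 c M B[symmetric] using cols by (simp add: pole_factor_swap[of s y x])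
  next
    case True
    have neg: "zmon ?M * to_ratfun (pole_factor s y x) * to_ratfun R / ?O = rat_const (- 1) * ?F"
      using True cols by (simp add: pole_factor_swap[of s y x] rat_const_def single_uminus)
    have "constant_term (ord_list s ?L') (zmon ?M * to_ratfun (pole_factor s y x) * to_ratfun R / ?O) =
        - 1 * constant_term (ord_list s ?L') ?F"
      unfolding neg by (rule constant_term_const[OF _ ex]) (use L'(1) in \<open>simp del: distinct_append\<close>)
    then show ?thesis unfolding 1 2 c M B[symmetric] using True by simp
  qed
qed

end

section \<open>The homomorphism on the free algebra\<close>

lemma letters_plus [simp]: "letters (u + v) = letters u @ letters v" "letters 0 = []"
  by (simp_all add: plus_fword_def zero_fword_def)

lemma exists_word_of_weight: "\<exists>w :: ('i::finite \<times> int) list. word_weight w = n"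
proof -
  obtain xs :: "'i list" where xs: "set xs = UNIV" "distinct xs"
    using finite_distinct_list[of "UNIV :: 'i set"] by auto
  have "word_weight (concat (map (\<lambda>i. replicate (n i) (i, 0 :: int)) ys)) j = (if j \<in> set ys then n j else 0)"
    if "distinct ys" for ys j
    using that
  proof (induction ys)
    case (Cons i ys)
    have "word_weight (replicate m (i, 0 :: int)) j = (if j = i then m else 0)" for m
      by (induction m) auto
    then show ?case using Cons by (auto simp: word_weight_append)
  qed auto
  from this[OF xs(2)] show ?thesis using xs(1) by (intro exI) (auto simp: fun_eq_iff)
qed

lemma sum_word_weight: "(\<Sum>i\<in>UNIV. word_weight w i) = length (w :: ('i::finite \<times> int) list)"
  by (induction w) (auto simp: sum.distrib)

context zeta
begin

text \<open>
  The map \<open>Upsilon_free\<close> in a form that is additive by construction.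
\<close>

definition ups :: "half \<Rightarrow> ('i, 'k) free \<Rightarrow> ('i, 'k) shuffle" where
  "ups s = pext (\<lambda>w c. single (word_weight (letters w)) (single 0 c * E s (letters w)))"

lemma ups_simps [simp]: "ups s 0 = 0" "ups s (u + v) = ups s u + ups s v" "ups s (u - v) = ups s u - ups s v"
  "ups s (single w c) = single (word_weight (letters w)) (single 0 c * E s (letters w))"
  by (auto simp: ups_def pext_add pext_diff pext_single single_add distrib_right)

lemma big_mult_single:
  "single n P \<otimes>\<^bsub>big_shuffle p s\<^esub> single n' P' = single (\<lambda>i. n i + n' i) (shuffle_product p s n n' P P')"
  by (simp add: big_shuffle_def)

lemma big_smult_single: "c \<odot>\<^bsub>big_shuffle p s\<^esub> single n P = single n (single 0 c * P)"
  by (simp add: big_shuffle_def)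

lemma shuffle_product_E:
  "shuffle_product p s (word_weight u) (word_weight w) (E s u) (E s w) = E s (u @ w)"
  by (simp add: shuffle_product_eq shuffle_sum_E)

lemma Upsilon_word:
  "foldr (\<lambda>(i, d) F. shuffle_gen i d \<otimes>\<^bsub>big_shuffle p s\<^esub> F) w \<one>\<^bsub>big_shuffle p s\<^esub> = single (word_weight w) (E s w)"
proof (induction w)
  case (Cons l w)
  obtain i d where l: "l = (i, d)" by fastforce
  have g: "shuffle_gen i d = single (word_weight [(i, d)]) (E s [(i, d)])"
    by (simp add: shuffle_gen_def E_single eq_commute)
  show ?case using Cons shuffle_product_E[of s "[(i, d)]" w]
    by (simp add: l g big_mult_single word_weight_append[of "[(i, d)]", symmetric] del: word_weight_simps)
qed (simp add: big_shuffle_def)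

lemma Upsilon_free_eq: "Upsilon_free p s u = ups s u"
proof -
  have "add (big_shuffle p s) = (+)" by (simp add: big_shuffle_def)
  then show ?thesis
    unfolding Upsilon_free_def Upsilon_word big_smult_single ups_def pext_def by simp
qed

lemma lookup_ups:
  "lookup (ups s u) n = (\<Sum>w\<in>{w \<in> keys u. word_weight (letters w) = n}. single 0 (lookup u w) * E s (letters w))"
proof -
  have "lookup (ups s u) n = (\<Sum>w\<in>keys u. if word_weight (letters w) = n then single 0 (lookup u w) * E s (letters w) else 0)"
    unfolding ups_def pext_def lookup_sum by (rule sum.cong) (auto simp: lookup_single when_def)
  then show ?thesis by (simp add: sum.inter_filter)
qed

lemma ups_V_graded: "lookup (ups s u) n \<in> V_graded n"
  unfolding lookup_ups by (rule V_graded_sum, rule V_graded_cmult) (use E_V_graded in auto)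

lemma ups_support: "lookup (ups s u) n \<noteq> 0 \<Longrightarrow> \<exists>w\<in>keys u. word_weight (letters w) = n"
  unfolding lookup_ups by (metis (mono_tags, lifting) empty_Collect_eq sum.empty)

lemma shuffle_sum_ups:
  "shuffle_sum s n n' (lookup (ups s u) n) (lookup (ups s v) n') =
    to_ratfun (\<Sum>w\<in>{w \<in> keys u. word_weight (letters w) = n}. \<Sum>w'\<in>{w \<in> keys v. word_weight (letters w) = n'}.
      single 0 (lookup u w * lookup v w') * E s (letters w @ letters w'))"
proof -
  have e: "shuffle_sum s n n' (E s (letters w)) (E s (letters w')) = to_ratfun (E s (letters w @ letters w'))"
    if "word_weight (letters w) = n" "word_weight (letters w') = n'" for w w' :: "('i \<times> int) fword"
    using shuffle_sum_E[of s "letters w" "letters w'"] that by simp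
  show ?thesis
    unfolding lookup_ups shuffle_sum_linear to_ratfun_sum
    by (intro sum.cong refl) (simp add: e rat_const_def)
qed

lemma shuffle_product_ups:
  "shuffle_product p s n n' (lookup (ups s u) n) (lookup (ups s v) n') =
    (\<Sum>w\<in>{w \<in> keys u. word_weight (letters w) = n}. \<Sum>w'\<in>{w \<in> keys v. word_weight (letters w) = n'}.
      single 0 (lookup u w * lookup v w') * E s (letters w @ letters w'))"
  by (simp add: shuffle_product_eq shuffle_sum_ups)

lemma shuffle_product_ups_V_graded:
  "shuffle_product p s n n' (lookup (ups s u) n) (lookup (ups s v) n') \<in> V_graded (\<lambda>i. n i + n' i)"
proof -
  have "E s (letters w @ letters w') \<in> V_graded (\<lambda>i. n i + n' i)"
    if "word_weight (letters w) = n" "word_weight (letters w') = n'" for w w' :: "('i \<times> int) fword"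
    using E_V_graded[of s "letters w @ letters w'"] that by (simp add: word_weight_append)
  then show ?thesis unfolding shuffle_product_ups
    by (intro V_graded_sum V_graded_cmult) auto
qed

lemma big_mult_def: "F \<otimes>\<^bsub>big_shuffle p s\<^esub> G = (\<Sum>n\<in>keys F. \<Sum>n'\<in>keys G.
        single (\<lambda>i. n i + n' i) (shuffle_product p s n n' (lookup F n) (lookup G n')))"
  by (simp add: big_shuffle_def)

lemma ups_mult: "ups s (u * v) = ups s u \<otimes>\<^bsub>big_shuffle p s\<^esub> ups s v"
proof -
  let ?wt = "\<lambda>w. word_weight (letters w)"
  define h where "h w w' = single (?wt (w + w')) (single 0 (lookup u w * lookup v w') * E s (letters w @ letters w'))" for w w'
  have "u * v = (\<Sum>w\<in>keys u. \<Sum>w'\<in>keys v. single (w + w') (lookup u w * lookup v w'))"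
    by (subst pm_sum_single[of u], subst pm_sum_single[of v]) (simp add: sum_product mult_single)
  moreover have s: "ups s (\<Sum>x\<in>A. f x) = (\<Sum>x\<in>A. ups s (f x))" for A :: "'z set" and f
    by (induction A rule: infinite_finite_induct) auto
  moreover have s': "ups s (\<Sum>x\<in>A. f x) = (\<Sum>x\<in>A. ups s (f x))" for A :: "('i \<times> int) fword set" and f
    by (induction A rule: infinite_finite_induct) auto
  ultimately have 1: "ups s (u * v) = (\<Sum>w\<in>keys u. \<Sum>w'\<in>keys v. h w w')"
    by (simp add: h_def)
  let ?A = "?wt ` keys u" and ?B = "?wt ` keys v"
  let ?K = "\<lambda>u n. {w \<in> keys u. ?wt w = n}"
  have kA: "keys (ups s u) \<subseteq> ?A" "keys (ups s v) \<subseteq> ?B"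
    using ups_support by (fastforce simp: in_keys_iff)+
  have "ups s u \<otimes>\<^bsub>big_shuffle p s\<^esub> ups s v = (\<Sum>n\<in>?A. \<Sum>n'\<in>keys (ups s v).
        single (\<lambda>i. n i + n' i) (shuffle_product p s n n' (lookup (ups s u) n) (lookup (ups s v) n')))"
    unfolding big_mult_def by (rule sum.mono_neutral_left) (use kA in \<open>auto simp: in_keys_iff\<close>)
  also have "\<dots> = (\<Sum>n\<in>?A. \<Sum>n'\<in>?B.
        single (\<lambda>i. n i + n' i) (shuffle_product p s n n' (lookup (ups s u) n) (lookup (ups s v) n')))"
    by (intro sum.cong refl sum.mono_neutral_left) (use kA in \<open>auto simp: in_keys_iff\<close>)
  also have "\<dots> = (\<Sum>n\<in>?A. \<Sum>n'\<in>?B. \<Sum>w\<in>?K u n. \<Sum>w'\<in>?K v n'. h w w')"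
  proof (intro sum.cong refl)
    fix n n'
    have ss: "single m (\<Sum>x\<in>A. f x) = (\<Sum>x\<in>A. single m (f x))" for m :: "'i \<Rightarrow> nat" and A :: "('i \<times> int) fword set" and f :: "_ \<Rightarrow> ('i var, 'k) laurent"
      by (induction A rule: infinite_finite_induct) (auto simp: single_add)
    show "single (\<lambda>i. n i + n' i) (shuffle_product p s n n' (lookup (ups s u) n) (lookup (ups s v) n')) =
        (\<Sum>w\<in>?K u n. \<Sum>w'\<in>?K v n'. h w w')"
      unfolding shuffle_product_ups ss by (intro sum.cong refl) (auto simp: h_def word_weight_append)
  qed
  also have "\<dots> = (\<Sum>n\<in>?A. \<Sum>w\<in>?K u n. \<Sum>n'\<in>?B. \<Sum>w'\<in>?K v n'. h w w')"
    by (intro sum.cong refl sum.swap)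
  also have "\<dots> = (\<Sum>n\<in>?A. \<Sum>w\<in>?K u n. \<Sum>w'\<in>keys v. h w w')"
    by (intro sum.cong refl sum.group) auto
  also have "\<dots> = (\<Sum>w\<in>keys u. \<Sum>w'\<in>keys v. h w w')"
    by (rule sum.group) auto
  finally show ?thesis using 1 by simp
qed

lemma ups_rad_ideal: "ups s x = 0 \<Longrightarrow> ups s (u * x * v) = 0"
  by (simp add: ups_mult big_mult_def)

section \<open>The pairing on the free algebra\<close>

lemma free_pairing_pext:
  "free_pairing p s u R = pext (\<lambda>w c. c * word_pairing p s (letters w) (lookup R (word_weight (letters w)))) u"
  by (simp add: free_pairing_def pext_def)

lemma free_pairing_simps [simp]: "free_pairing p s 0 R = 0"
  "free_pairing p s (u + v) R = free_pairing p s u R + free_pairing p s v R"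
  "free_pairing p s (u - v) R = free_pairing p s u R - free_pairing p s v R"
  "free_pairing p s (single w c) R = c * word_pairing p s (letters w) (lookup R (word_weight (letters w)))"
  by (auto simp: free_pairing_pext pext_add pext_diff pext_single distrib_right)

lemma free_pairing_sum: "free_pairing p s (\<Sum>x\<in>A. f x) R = (\<Sum>x\<in>A. free_pairing p s (f x) R)"
  by (induction A rule: infinite_finite_induct) auto

lemma free_pairing_cmult: "free_pairing p s (single 0 c * u) R = c * free_pairing p s u R"
  by (induction u rule: pm_induct) (auto simp: mult_single distrib_left)

definition graded :: "('i, 'k) shuffle \<Rightarrow> bool" where
  "graded R \<longleftrightarrow> (\<forall>n. lookup R n \<in> V_graded n)"

lemma graded_ups [simp]: "graded (ups s u)"
  by (simp add: graded_def ups_V_graded)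

lemma free_pairing_add_right:
  "graded P \<Longrightarrow> graded Q \<Longrightarrow> free_pairing p s u (P + Q) = free_pairing p s u P + free_pairing p s u Q"
  by (induction u rule: pm_induct) (auto simp: lookup_add word_pairing_add graded_def algebra_simps)

lemma free_pairing_0_right [simp]: "free_pairing p s u 0 = 0"
  by (induction u rule: pm_induct) auto

lemma free_pairing_nondegenerate:
  assumes "graded R" "\<And>w. free_pairing p s (single w 1) R = 0" shows "R = 0"
proof (rule poly_mapping_eqI)
  fix n
  obtain w :: "('i \<times> int) list" where w: "word_weight w = n" using exists_word_of_weight by blast
  have "lookup R n = 0"
  proof (rule word_pairing_nondegenerate[of _ w s])
    fix u :: "('i \<times> int) list" assume "map fst u = map fst w"
    then have "word_weight u = n" using w word_weight_cong by metis
    then show "word_pairing p s u (lookup R n) = 0" using assms(2)[of "FWord u"] by simp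
  qed (use assms(1) w in \<open>auto simp: graded_def\<close>)
  then show "lookup R n = lookup 0 n" by simp
qed

text \<open>
  The pairing of the two free algebras. Its radical is the kernel of \<open>ups\<close>.
\<close>

definition gram :: "half \<Rightarrow> ('i, 'k) free \<Rightarrow> ('i, 'k) free \<Rightarrow> 'k" where
  "gram s u v = free_pairing p s u (ups (opposite s) v)"

lemma gram_simps [simp]: "gram s 0 v = 0" "gram s u 0 = 0"
  "gram s (u + u') v = gram s u v + gram s u' v" "gram s u (v + v') = gram s u v + gram s u v'"
  "gram s (u - u') v = gram s u v - gram s u' v"
  by (auto simp: gram_def free_pairing_add_right)

lemma gram_sym: "gram s u v = gram (opposite s) v u"
proof (induction u rule: pm_induct)
  case (single w c)
  show ?case
  proof (induction v rule: pm_induct)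
    case (single v d)
    show ?case
      using word_pairing_adjoint[of "letters w" "letters v" s] E_V_graded[of "opposite s" "letters v"] E_V_graded[of s "letters w"]
      by (auto simp: gram_def lookup_single when_def word_pairing_const)
  qed auto
qed auto

lemma gram_diff_right [simp]: "gram s u (v - v') = gram s u v - gram s u v'"
  using gram_sym gram_simps(5) by metis

lemma ups_eq_0_iff: "ups s u = 0 \<longleftrightarrow> (\<forall>v. gram s u v = 0)"
proof
  assume "ups s u = 0"
  then show "\<forall>v. gram s u v = 0" by (simp add: gram_sym[of s u]) (simp add: gram_def)
next
  assume "\<forall>v. gram s u v = 0"
  then have "free_pairing p (opposite s) v (ups s u) = 0" for v
    using gram_sym[of s u v] by (simp add: gram_def)
  then show "ups s u = 0" by (rule free_pairing_nondegenerate[OF graded_ups])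
qed

lemma relation_free_pairing:
  assumes "graded R"
  shows "free_pairing p s (single (FWord w1) 1 * quadratic_relation p s i j a b * single (FWord w2) 1) R = 0"
proof -
  define n where "n = word_weight (w1 @ [(i, 0), (j, 0 :: int)] @ w2)"
  have n: "word_weight (w1 @ [(i, d), (j, e)] @ w2) = n" for d e by (simp add: n_def word_weight_append)
  have qs: "free_pairing p s (single (FWord w1) 1 * qside p s i' j' a' b' * single (FWord w2) 1) R =
      (\<Sum>k\<in>keys (qcoeff p s i' j'). lookup (qcoeff p s i' j') k * word_pairing p s (w1 @ qword s i' j' a' b' k @ w2) (lookup R n))"
    if "\<And>d e. word_weight (w1 @ [(i', d), (j', e)] @ w2) = n" for i' j' a' b'
  proof -
    have "word_weight (w1 @ qword s i' j' a' b' k @ w2) = n" for k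
      using that by (cases s) (auto simp: qword_def Let_def)
    then show ?thesis
      by (simp add: qside_def sum_distrib_left sum_distrib_right mult_single plus_fword_def free_pairing_sum)
  qed
  have n': "word_weight (w1 @ [(j, d), (i, e)] @ w2) = n" for d e by (simp add: n_def word_weight_append add_ac)
  have c: "single (FWord w1) 1 * (single 0 c * x) * single (FWord w2) 1 = single 0 c * (single (FWord w1) 1 * x * single (FWord w2) 1)"
    for c and x :: "('i, 'k) free"
  proof -
    have "single (FWord w1) 1 * single 0 c = (single 0 c * single (FWord w1) 1 :: ('i, 'k) free)" by (simp add: mult_single)
    then show ?thesis by (simp only: mult.assoc[symmetric])
  qed
  show ?thesis
    unfolding quadratic_relation_eq right_diff_distrib left_diff_distrib c free_pairing_simps free_pairing_cmult qs[OF n] qs[OF n']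
    using relation_pairing[of "lookup R n" n w1 i j w2 s a b] assms n by (simp add: graded_def)
qed

end

section \<open>Restriction to a part of the variables\<close>

text \<open>
  The sign is chosen so that in both halves the heights of the prefixes are bounded below for the words
  that pair non-trivially with a given element.
\<close>

definition hgt :: "half \<Rightarrow> ('i \<times> int) list \<Rightarrow> int" where
  "hgt s w = (case s of Positive \<Rightarrow> (\<Sum>l\<leftarrow>w. snd l) | Negative \<Rightarrow> - (\<Sum>l\<leftarrow>w. snd l))"

text \<open>
  The height that a set of variables contributes to a word whose monomial is inverse to \<open>m\<close>.
\<close>

definition spre :: "half \<Rightarrow> 'v set \<Rightarrow> ('v \<Rightarrow>\<^sub>0 int) \<Rightarrow> int" where
  "spre s P m = (case s of Positive \<Rightarrow> - pre P m | Negative \<Rightarrow> pre P m)"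

lemma spre_simps [simp]: "spre s P (a + b) = spre s P a + spre s P b" "spre s P 0 = 0" "spre s P (- a) = - spre s P a"
  by (cases s; simp add: spre_def)+

lemma spre_sum: "spre s P (\<Sum>x\<in>A. f x) = (\<Sum>x\<in>A. spre s P (f x))"
  by (induction A rule: infinite_finite_induct) auto

definition list_word :: "'i var list \<Rightarrow> ('i var \<Rightarrow>\<^sub>0 int) \<Rightarrow> ('i \<times> int) list" where
  "list_word L m = map (\<lambda>x. (col x, lookup m x)) L"

lemma hgt_list_word: "distinct L \<Longrightarrow> hgt s (take j (list_word L (- m))) = spre s (set (take j L)) m"
  by (cases s) (auto simp: hgt_def spre_def list_word_def take_map comp_def pre_def
      sum_list_distinct_conv_sum_set uminus_sum_list_map[symmetric] sum_negf)

lemma hgt_simps [simp]: "hgt s [] = 0" "hgt s (u @ v) = hgt s u + hgt s v"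
  by (cases s; simp add: hgt_def)+

lemma list_word_wv: "list_word (wv w) (wmon w) = w"
proof (rule nth_equalityI)
  fix i assume "i < length (list_word (wv w) (wmon w))"
  then have i: "i < length w" by (simp add: list_word_def)
  then have "list_word (wv w) (wmon w) ! i = (col (wv w ! i), lookup (wmon w) (wv w ! i))"
    by (simp add: list_word_def)
  also have "\<dots> = w ! i" unfolding lookup_wmon[OF i] using i by simp
  finally show "list_word (wv w) (wmon w) ! i = w ! i" .
qed (simp add: list_word_def)

lemma filter_take: "filter P (take j xs) = take (length (filter P (take j xs))) (filter P xs)"
proof -
  have "filter P xs = filter P (take j xs) @ filter P (drop j xs)" by (metis append_take_drop_id filter_append)
  then show ?thesis by simp
qed

lemma pre_inter: "finite P \<Longrightarrow> keys m \<subseteq> A \<Longrightarrow> pre P m = pre (P \<inter> A) m"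
  unfolding pre_def by (rule sum.mono_neutral_right) (auto simp: in_keys_iff)

lemma spre_inter: "finite P \<Longrightarrow> keys m \<subseteq> A \<Longrightarrow> spre s P m = spre s (P \<inter> A) m"
  using pre_inter[of P m A] by (cases s) (auto simp: spre_def)

lemma bsup_filter:
  assumes "bsup (filter P xs) c" shows "bsup xs c"
proof -
  from assms obtain B where B: "\<And>m. c m \<noteq> 0 \<Longrightarrow> keys m \<subseteq> set (filter P xs) \<and>
     (\<forall>k. pre (set (take k (filter P xs))) m \<le> B) \<and> - B \<le> pre (set (filter P xs)) m" unfolding bsup_def by blast
  have "keys m \<subseteq> set xs \<and> (\<forall>k. pre (set (take k xs)) m \<le> B) \<and> - B \<le> pre (set xs) m" if nz: "c m \<noteq> 0" for m
  proof -
    have k: "keys m \<subseteq> {x. P x}" "keys m \<subseteq> set xs" using B[OF nz] by auto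
    have "pre (set (take k xs)) m = pre (set (take (length (filter P (take k xs))) (filter P xs))) m" for k
      unfolding filter_take[symmetric] using pre_inter[OF _ k(1), of "set (take k xs)"] by (simp add: Int_def)
    moreover have "pre (set xs) m = pre (set (filter P xs)) m"
      using pre_inter[OF _ k(1), of "set xs"] by (simp add: Int_def)
    ultimately show ?thesis using B[OF nz] k by auto
  qed
  then show ?thesis unfolding bsup_def by blast
qed

lemma ord_list_filter: "ord_list s (filter P xs) = filter P (ord_list s xs)"
  by (cases s) (auto simp: rev_filter)

lemma word_weight_labels:
  fixes n :: "'i::finite \<Rightarrow> nat"
  assumes xs: "distinct xs" "set xs = g ` Vset n" and g: "inj_on g (Vset n)" "\<And>x. x \<in> Vset n \<Longrightarrow> col (g x) = col x"
  shows "word_weight (list_word xs m) = n"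
proof
  fix i
  have "word_weight (list_word xs m) i = length (filter (\<lambda>x. col x = i) xs)"
    by (simp add: word_weight_def list_word_def comp_def count_list_eq_length_filter filter_map eq_commute)
  also have "\<dots> = card ({x. col x = i} \<inter> set xs)" by (rule distinct_length_filter[OF xs(1)])
  also have "{x. col x = i} \<inter> set xs = g ` ZVar i ` {1..n i}"
  proof -
    have "{x \<in> Vset n. col x = i} = ZVar i ` {1..n i}" by (auto simp: Vset_def image_iff)
    moreover have "{x. col x = i} \<inter> set xs = g ` {x \<in> Vset n. col x = i}" unfolding xs(2) using g(2) by auto
    ultimately show ?thesis by simp
  qed
  also have "card \<dots> = n i"
  proof -
    have "ZVar i ` {1..n i} \<subseteq> Vset n" by auto
    then have "card (g ` ZVar i ` {1..n i}) = card (ZVar i ` {1..n i})" by (intro card_image inj_on_subset[OF g(1)])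
    also have "\<dots> = n i" by (subst card_image) (auto simp: inj_on_def)
    finally show ?thesis .
  qed
  finally show "word_weight (list_word xs m) i = n i" .
qed

context zeta
begin

lemma relabelled_series_list:
  fixes R :: "('i var, 'k) laurent"
  assumes R: "R \<in> V_graded n" and vs: "distinct vs"
    and g: "inj_on g (Vset n)" "\<And>x. x \<in> Vset n \<Longrightarrow> col (g x) = col x" "set vs = g ` Vset n"
  obtains c where "series_of (to_ratfun (ren_laurent g R) / om p (opposite s) vs) c" "bsup (ord_list s vs) c"
    "\<And>m. keys m \<subseteq> set vs \<Longrightarrow> c m = word_pairing p s (list_word vs (- m)) R"
proof -
  have w: "word_weight (list_word vs m) = n" for m by (rule word_weight_labels[OF vs g(3,1,2)])
  have f: "map fst (list_word vs m) = map col vs" for m by (simp add: list_word_def)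
  have R': "R \<in> V_graded (word_weight (list_word vs 0))" using R w by simp
  obtain c where c: "series_of (to_ratfun (ren_laurent g R) / om p (opposite s) vs) c" "bsup (ord_list s vs) c"
    "\<And>u m. map fst u = map fst (list_word vs 0) \<Longrightarrow> (\<And>a. a < length vs \<Longrightarrow> lookup m (vs ! a) = snd (u ! a)) \<Longrightarrow>
        keys m \<subseteq> set vs \<Longrightarrow> c (- m) = word_pairing p s u R"
    by (rule relabelled_series[OF R' vs, of g s]) (use f g in \<open>auto simp: w\<close>)
  have "c m = word_pairing p s (list_word vs (- m)) R" if "keys m \<subseteq> set vs" for m
    using c(3)[of "list_word vs (- m)" "- m"] that f by (simp add: list_word_def comp_def)
  with c(1,2) show ?thesis by (rule that)
qed

text \<open>
  Each summand of a shuffle product factors, up to the pairs of variables that are out of order,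
  into functions of complementary sets of variables.
\<close>

lemma split_term:
  fixes n n' :: "'i \<Rightarrow> nat"
  assumes \<sigma>: "\<sigma> \<in> color_perms (\<lambda>i. n i + n' i)" and v: "word_weight v = (\<lambda>i. n i + n' i)"
    and R: "R \<in> V_graded n" "R' \<in> V_graded n'"
  defines "L \<equiv> wv v" and "A \<equiv> pv \<sigma> ` Vset n"
  defines "LA \<equiv> filter (\<lambda>x. x \<in> A) L" and "LB \<equiv> filter (\<lambda>x. x \<notin> A) L"
  obtains c1 c2 c3 where
    "series_of (ren (pv \<sigma>) (to_ratfun R * ren (shv n) (to_ratfun R') * Kfac p (opposite t) n n') / om p (opposite t) L)
      (conv (conv c1 c2) c3)"
    "bsup (ord_list t L) c1" "bsup (ord_list t L) c2" "bsup (ord_list t L) c3"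
    "\<And>m. c1 m \<noteq> 0 \<Longrightarrow> keys m \<subseteq> set LA" "\<And>m. keys m \<subseteq> set LA \<Longrightarrow> c1 m = word_pairing p t (list_word LA (- m)) R"
    "\<And>m. c2 m \<noteq> 0 \<Longrightarrow> keys m \<subseteq> set LB" "\<And>m. keys m \<subseteq> set LB \<Longrightarrow> c2 m = word_pairing p t (list_word LB (- m)) R'"
    "series_of (om p (opposite t) (LA @ LB) / om p (opposite t) L) c3"
    "\<And>m. c3 m \<noteq> 0 \<Longrightarrow> \<exists>k. m = (\<Sum>(x, y)\<in>Bef L - Bef (LA @ LB). case t of Positive \<Rightarrow> vroot x y (k x y) | Negative \<Rightarrow> vroot y x (k x y)) \<and>
       (\<forall>x y. - kbound \<le> k x y)"
proof -
  let ?s = "opposite t"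
  have i: "inj (pv \<sigma>)" using \<sigma> by (rule inj_pv)
  have dL: "distinct L" by (simp add: L_def distinct_wv)
  have dAB: "distinct LA" "distinct LB" "distinct (LA @ LB)" using dL by (auto simp: LA_def LB_def)
  have sL: "set L = Vset (\<lambda>i. n i + n' i)" by (simp add: L_def set_wv v)
  have sub: "Vset n \<subseteq> Vset (\<lambda>i. n i + n' i)" by (auto simp: Vset_def)
  have AL: "A \<subseteq> set L" using sub pv_image_Vset[OF \<sigma>] unfolding A_def sL by blast
  have sA: "set LA = pv \<sigma> ` Vset n" using AL by (auto simp: LA_def A_def)
  have Vu: "Vset (\<lambda>i. n i + n' i) = Vset n \<union> shv n ` Vset n'"
  proof (rule Set.set_eqI)
    fix x :: "'i var"
    obtain i a where x: "x = ZVar i a" by (cases x)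
    have "x \<in> shv n ` Vset n' \<longleftrightarrow> n i < a \<and> a \<le> n i + n' i"
    proof
      assume "n i < a \<and> a \<le> n i + n' i"
      then have "x = shv n (ZVar i (a - n i))" "ZVar i (a - n i) \<in> Vset n'" by (auto simp: x)
      then show "x \<in> shv n ` Vset n'" by blast
    next
      assume "x \<in> shv n ` Vset n'"
      then obtain y where y: "y \<in> Vset n'" "x = shv n y" by blast
      then show "n i < a \<and> a \<le> n i + n' i" by (cases y) (auto simp: x)
    qed
    then show "x \<in> Vset (\<lambda>i. n i + n' i) \<longleftrightarrow> x \<in> Vset n \<union> shv n ` Vset n'" by (auto simp: x)
  qed
  have Vd: "Vset n \<inter> shv n ` Vset n' = {}"
  proof -
    have "shv n y \<notin> Vset n" if "y \<in> Vset n'" for y using that by (cases y) auto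
    then show ?thesis by blast
  qed
  have sB: "set LB = (pv \<sigma> \<circ> shv n) ` Vset n'"
  proof -
    have "set LB = pv \<sigma> ` Vset (\<lambda>i. n i + n' i) - pv \<sigma> ` Vset n"
      unfolding pv_image_Vset[OF \<sigma>] by (auto simp: LB_def A_def sL)
    also have "\<dots> = pv \<sigma> ` (shv n ` Vset n')"
      unfolding image_set_diff[OF i, symmetric] Vu using Vd by auto
    finally show ?thesis by (simp add: image_comp)
  qed
  obtain c1 where c1: "series_of (to_ratfun (ren_laurent (pv \<sigma>) R) / om p ?s LA) c1" "bsup (ord_list t LA) c1"
    "\<And>m. keys m \<subseteq> set LA \<Longrightarrow> c1 m = word_pairing p t (list_word LA (- m)) R"
    by (rule relabelled_series_list[OF R(1) dAB(1) _ _ sA, of t]) (use i in \<open>auto intro: inj_on_subset\<close>)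
  have i2: "inj (pv \<sigma> \<circ> shv n)" using i inj_shv by (rule inj_compose)
  obtain c2 where c2: "series_of (to_ratfun (ren_laurent (pv \<sigma> \<circ> shv n) R') / om p ?s LB) c2" "bsup (ord_list t LB) c2"
    "\<And>m. keys m \<subseteq> set LB \<Longrightarrow> c2 m = word_pairing p t (list_word LB (- m)) R'"
    by (rule relabelled_series_list[OF R(2) dAB(2) _ _ sB, of t]) (use i2 in \<open>auto intro: inj_on_subset\<close>)
  obtain c3 where c3: "series_of (om p ?s (LA @ LB) / om p ?s L) c3" "bsup (ord_list t L) c3"
    "\<And>m. c3 m \<noteq> 0 \<Longrightarrow> \<exists>k. m = (\<Sum>(x, y)\<in>Bef L - Bef (LA @ LB). case t of Positive \<Rightarrow> vroot x y (k x y) | Negative \<Rightarrow> vroot y x (k x y)) \<and>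
       (\<forall>x y. - kbound \<le> k x y)"
  proof (rule om_quotient_series[OF dAB(3) dL, of t])
    show "set (LA @ LB) = set L" by (auto simp: LA_def LB_def)
  qed blast
  have b1: "bsup (ord_list t L) c1" using c1(2) unfolding LA_def ord_list_filter by (rule bsup_filter)
  have b2: "bsup (ord_list t L) c2" using c2(2) unfolding LB_def ord_list_filter by (rule bsup_filter)
  have dt: "distinct (ord_list t L)" using dL by simp
  have o: "om p ?s (LA @ LB) = om p ?s LA * om p ?s LB * ren (pv \<sigma>) (Kfac p ?s n n')"
  proof -
    have "ren (pv \<sigma>) (Kfac p ?s n n') = (\<Prod>x\<in>Vset n. \<Prod>y\<in>shv n ` Vset n'. kap p ?s (pv \<sigma> x) (pv \<sigma> y))"
      by (simp add: Kfac_def ren_prod[OF i] ren_kap[OF i])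
    also have "\<dots> = (\<Prod>x\<in>set LA. \<Prod>y\<in>set LB. kap p ?s x y)"
    proof -
      have "(\<Prod>y\<in>set LB. kap p ?s x y) = (\<Prod>y\<in>shv n ` Vset n'. kap p ?s x (pv \<sigma> y))" for x
        unfolding sB image_comp[symmetric] by (subst prod.reindex) (auto intro: inj_on_subset[OF i])
      then show ?thesis unfolding sA by (subst prod.reindex) (auto intro: inj_on_subset[OF i])
    qed
    finally show ?thesis using om_append[OF dAB(3), of p ?s] by simp
  qed
  have on: "om p ?s LA \<noteq> 0" "om p ?s LB \<noteq> 0" using om_nonzero dAB by auto
  have "series_of ((to_ratfun (ren_laurent (pv \<sigma>) R) / om p ?s LA) * (to_ratfun (ren_laurent (pv \<sigma> \<circ> shv n) R') / om p ?s LB) *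
      (om p ?s (LA @ LB) / om p ?s L)) (conv (conv c1 c2) c3)"
    by (intro series_of_conv c1(1) c2(1) c3(1) bsup_convolvable[OF dt] bsup_conv b1 b2 c3(2))
  also have "(to_ratfun (ren_laurent (pv \<sigma>) R) / om p ?s LA) * (to_ratfun (ren_laurent (pv \<sigma> \<circ> shv n) R') / om p ?s LB) *
      (om p ?s (LA @ LB) / om p ?s L) =
     ren (pv \<sigma>) (to_ratfun R * ren (shv n) (to_ratfun R') * Kfac p ?s n n') / om p ?s L"
    unfolding o using on
    by (simp add: ren_mult[OF i] ren_to_ratfun[OF i] ren_to_ratfun[OF inj_shv] ren_laurent_comp)
  finally have S: "series_of (ren (pv \<sigma>) (to_ratfun R * ren (shv n) (to_ratfun R') * Kfac p ?s n n') / om p ?s L) (conv (conv c1 c2) c3)" .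
  have k1: "keys m \<subseteq> set LA" if "c1 m \<noteq> 0" for m using bsup_keys[OF c1(2) that] by simp
  have k2: "keys m \<subseteq> set LB" if "c2 m \<noteq> 0" for m using bsup_keys[OF c2(2) that] by simp
  show ?thesis by (rule that[OF S b1 b2 c3(2) k1 c1(3) k2 c2(3) c3(1,3)])
qed

end

section \<open>Products of functions with bounded expansions\<close>

lemma card_Vset: "card (Vset n) = (\<Sum>i\<in>UNIV. n i)" for n :: "'i::finite \<Rightarrow> nat"
proof -
  have "Vset n = (\<lambda>(i, a). ZVar i a) ` (SIGMA i:UNIV. {1..n i})" by (auto simp: Vset_def image_iff)
  then have "card (Vset n) = card (SIGMA i:UNIV. {1..n i})"
    by (simp add: card_image inj_on_def)
  then show ?thesis by simp
qed

lemma conv_point: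
  assumes "\<And>b. d b \<noteq> 0 \<Longrightarrow> b = (0 :: 'a::ab_group_add)" shows "conv c d m = c m * d 0"
proof -
  have "conv c d m = (\<Sum>a\<in>{m}. c a * d (m - a))"
  proof (rule conv_superset)
    show "{a. c a \<noteq> 0 \<and> d (m - a) \<noteq> 0} \<subseteq> {m}"
    proof
      fix a assume "a \<in> {a. c a \<noteq> 0 \<and> d (m - a) \<noteq> 0}"
      then have "m - a = 0" using assms by blast
      then show "a \<in> {m}" by simp
    qed
  qed simp
  then show ?thesis by simp
qed

lemma Vset_mono: "(\<And>i. n i \<le> n' i) \<Longrightarrow> Vset n \<subseteq> Vset n'"
  unfolding Vset_def using le_trans by (fastforce simp: image_iff)

context zeta
begin

text \<open>The permutations that preserve the first blocks of variables are the pairs of permutations.\<close>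

lemma card_stabilizer:
  fixes n n' :: "'i \<Rightarrow> nat"
  shows "card {\<sigma> \<in> color_perms (\<lambda>i. n i + n' i). pv \<sigma> ` Vset n = Vset n} = card (color_perms n) * card (color_perms n')"
    (is "card ?H = _")
proof -
  have perm: "\<tau> i permutes {1..n i}" if "\<tau> \<in> color_perms n" for \<tau> i n
    using that by (simp add: color_perms_def)
  have "bij_betw (\<lambda>(\<tau>, \<tau>'). oplus n \<tau> \<tau>') (color_perms n \<times> color_perms n') ?H"
  proof (rule bij_betw_imageI)
    show "inj_on (\<lambda>(\<tau>, \<tau>'). oplus n \<tau> \<tau>') (color_perms n \<times> color_perms n')"
    proof (rule inj_onI)
      fix q q' assume q: "q \<in> color_perms n \<times> color_perms n'" "q' \<in> color_perms n \<times> color_perms n'"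
        "(case q of (\<tau>, \<tau>') \<Rightarrow> oplus n \<tau> \<tau>') = (case q' of (\<tau>, \<tau>') \<Rightarrow> oplus n \<tau> \<tau>')"
      obtain \<tau> \<tau>' \<rho> \<rho>' where qq: "q = (\<tau>, \<tau>')" "q' = (\<rho>, \<rho>')" by fastforce
      have e: "oplus n \<tau> \<tau>' i a = oplus n \<rho> \<rho>' i a" for i a using q(3) by (simp add: qq)
      have "\<tau> i a = \<rho> i a" for i a
        using e[of i a] permutes_not_in[OF perm, of \<tau> n a i] permutes_not_in[OF perm, of \<rho> n a i] q
        by (cases "a \<le> n i") (auto simp: oplus_def qq)
      moreover have "\<tau>' i a = \<rho>' i a" for i a
        using e[of i "n i + a"] permutes_not_in[OF perm, of \<tau>' n' 0 i] permutes_not_in[OF perm, of \<rho>' n' 0 i] q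
        by (cases "a = 0") (auto simp: oplus_def qq)
      ultimately show "q = q'" by (auto simp: qq fun_eq_iff)
    qed
    show "(\<lambda>(\<tau>, \<tau>'). oplus n \<tau> \<tau>') ` (color_perms n \<times> color_perms n') = ?H"
    proof (intro equalityI subsetI)
      fix \<sigma> assume "\<sigma> \<in> (\<lambda>(\<tau>, \<tau>'). oplus n \<tau> \<tau>') ` (color_perms n \<times> color_perms n')"
      then obtain \<tau> \<tau>' where t: "\<tau> \<in> color_perms n" "\<tau>' \<in> color_perms n'" "\<sigma> = oplus n \<tau> \<tau>'" by auto
      have "pv \<sigma> ` Vset n = pv \<tau> ` Vset n" by (rule image_cong) (auto simp: t(3) pv_oplus)
      then show "\<sigma> \<in> ?H" using oplus_in[OF t(1,2)] pv_image_Vset[OF t(1)] by (simp add: t(3))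
    next
      fix \<sigma> assume s: "\<sigma> \<in> ?H"
      then have sp: "\<sigma> i permutes {1..n i + n' i}" for i using perm[of \<sigma>] by auto
      have sn: "1 \<le> \<sigma> i a \<and> \<sigma> i a \<le> n i \<longleftrightarrow> 1 \<le> a \<and> a \<le> n i" for i a
      proof -
        have "pv \<sigma> (ZVar i a) \<in> pv \<sigma> ` Vset n \<longleftrightarrow> ZVar i a \<in> Vset n"
          using s by (intro inj_image_mem_iff inj_pv[of \<sigma> "\<lambda>i. n i + n' i"]) simp
        moreover have "pv \<sigma> ` Vset n = Vset n" using s by simp
        ultimately show ?thesis by simp
      qed
      have si: "\<sigma> i a = \<sigma> i b \<longleftrightarrow> a = b" for i a b using permutes_inj[OF sp[of i]] by (simp add: inj_eq)
      define \<tau> where "\<tau> i a = (if a \<in> {1..n i} then \<sigma> i a else a)" for i a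
      define \<tau>' where "\<tau>' i a = (if a \<in> {1..n' i} then \<sigma> i (n i + a) - n i else a)" for i a
      have big: "n i < \<sigma> i (n i + a) \<and> \<sigma> i (n i + a) \<le> n i + n' i" if "1 \<le> a" "a \<le> n' i" for i a
        using sn[of i "n i + a"] permutes_in_image[OF sp[of i], of "n i + a"] that by auto
      have "\<tau> i permutes {1..n i}" for i
      proof (rule bij_imp_permutes)
        show "bij_betw (\<tau> i) {1..n i} {1..n i}"
          unfolding bij_betw_def
        proof
          show "inj_on (\<tau> i) {1..n i}" by (auto simp: inj_on_def \<tau>_def si)
          moreover have "\<tau> i ` {1..n i} \<subseteq> {1..n i}"
          proof
            fix b assume "b \<in> \<tau> i ` {1..n i}"
            then obtain a where "1 \<le> a" "a \<le> n i" "b = \<sigma> i a" by (auto simp: \<tau>_def)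
            then show "b \<in> {1..n i}" using sn[of i a] by simp
          qed
          ultimately show "\<tau> i ` {1..n i} = {1..n i}" by (intro endo_inj_surj) auto
        qed
      qed (auto simp: \<tau>_def)
      then have t: "\<tau> \<in> color_perms n" by (simp add: color_perms_def)
      have "\<tau>' i permutes {1..n' i}" for i
      proof (rule bij_imp_permutes)
        show "bij_betw (\<tau>' i) {1..n' i} {1..n' i}"
          unfolding bij_betw_def
        proof
          show "inj_on (\<tau>' i) {1..n' i}"
          proof (rule inj_onI)
            fix a b assume ab: "a \<in> {1..n' i}" "b \<in> {1..n' i}" "\<tau>' i a = \<tau>' i b"
            then have "\<sigma> i (n i + a) - n i = \<sigma> i (n i + b) - n i" "n i < \<sigma> i (n i + a)" "n i < \<sigma> i (n i + b)"
              using big[of a i] big[of b i] by (simp_all add: \<tau>'_def)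
            then have "\<sigma> i (n i + a) = \<sigma> i (n i + b)" by linarith
            then show "a = b" by (simp add: si)
          qed
          moreover have "\<tau>' i ` {1..n' i} \<subseteq> {1..n' i}"
          proof
            fix b assume "b \<in> \<tau>' i ` {1..n' i}"
            then obtain a where "a \<in> {1..n' i}" "b = \<tau>' i a" by auto
            then show "b \<in> {1..n' i}" using big[of a i] by (auto simp: \<tau>'_def)
          qed
          ultimately show "\<tau>' i ` {1..n' i} = {1..n' i}" by (intro endo_inj_surj) auto
        qed
      qed (auto simp: \<tau>'_def)
      then have t': "\<tau>' \<in> color_perms n'" by (simp add: color_perms_def)
      have "\<sigma> i a = oplus n \<tau> \<tau>' i a" for i a
      proof (cases "a \<le> n i")
        case True
        then show ?thesis using permutes_not_in[OF sp[of i], of a] by (auto simp: oplus_def \<tau>_def)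
      next
        case False
        then show ?thesis using permutes_not_in[OF sp[of i], of a] big[of "a - n i" i] by (auto simp: oplus_def \<tau>'_def)
      qed
      then have "\<sigma> = (\<lambda>(\<tau>, \<tau>'). oplus n \<tau> \<tau>') (\<tau>, \<tau>')" by (auto simp: fun_eq_iff)
      then show "\<sigma> \<in> (\<lambda>(\<tau>, \<tau>'). oplus n \<tau> \<tau>') ` (color_perms n \<times> color_perms n')" using t t' by (intro image_eqI) auto
    qed
  qed
  from bij_betw_same_card[OF this] show ?thesis by (simp add: card_cartesian_product)
qed

text \<open>
  The contribution of the permutation \<open>\<sigma>\<close> to the pairing of a word with a shuffle product.
\<close>

definition tcoeff :: "half \<Rightarrow> ('i \<times> int) list \<Rightarrow> ('i \<Rightarrow> nat \<Rightarrow> nat) \<Rightarrow> ('i \<Rightarrow> nat) \<Rightarrow> ('i \<Rightarrow> nat) \<Rightarrow>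
    ('i var, 'k) laurent \<Rightarrow> ('i var, 'k) laurent \<Rightarrow> 'k" where
  "tcoeff t v \<sigma> n n' R R' = constant_term (ord_list t (wv v)) (zmon (wmon v) *
     (ren (pv \<sigma>) (to_ratfun R * ren (shv n) (to_ratfun R') * Kfac p (opposite t) n n') / om p (opposite t) (wv v)))"

lemma tcoeff_series:
  assumes "series_of (ren (pv \<sigma>) (to_ratfun R * ren (shv n) (to_ratfun R') * Kfac p (opposite t) n n') / om p (opposite t) (wv v)) c"
    "bsup (ord_list t (wv v)) c"
  shows "tcoeff t v \<sigma> n n' R R' = c (- wmon v)"
    and "expandable (ord_list t (wv v)) (zmon (wmon v) *
     (ren (pv \<sigma>) (to_ratfun R * ren (shv n) (to_ratfun R') * Kfac p (opposite t) n n') / om p (opposite t) (wv v)))"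
proof -
  have b: "bsup (ord_list t (wv v)) (\<lambda>m. c (m - wmon v))"
    by (rule bsup_shift[OF assms(2)]) (use keys_wmon[of v] in \<open>simp add: set_wv\<close>)
  have d: "distinct (ord_list t (wv v))" by (simp add: distinct_wv)
  show "tcoeff t v \<sigma> n n' R R' = c (- wmon v)"
    unfolding tcoeff_def constant_term_eq[OF d series_of_zmon[OF assms(1)] b] by simp
  show "expandable (ord_list t (wv v)) (zmon (wmon v) *
     (ren (pv \<sigma>) (to_ratfun R * ren (shv n) (to_ratfun R') * Kfac p (opposite t) n n') / om p (opposite t) (wv v)))"
    unfolding expandable_def using series_of_zmon[OF assms(1)] b by blast
qed

lemma product_pairing:
  assumes v: "word_weight v = (\<lambda>i. n i + n' i)" and R: "R \<in> V_graded n" "R' \<in> V_graded n'"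
    and sp: "to_ratfun (shuffle_product p (opposite t) n n' R R') = shuffle_sum (opposite t) n n' R R'"
  shows "word_pairing p t v (shuffle_product p (opposite t) n n' R R') =
    (\<Sum>\<sigma>\<in>color_perms (\<lambda>i. n i + n' i). tcoeff t v \<sigma> n n' R R') / of_nat (card (color_perms n) * card (color_perms n'))"
proof -
  let ?s = "opposite t" and ?N = "\<lambda>i. n i + n' i"
  define c where "c = card (color_perms n) * card (color_perms n')"
  have c: "c \<noteq> 0" by (simp add: c_def card_color_perms)
  define W where "W = to_ratfun R * ren (shv n) (to_ratfun R') * Kfac p ?s n n'"
  have d: "distinct (ord_list t (wv v))" by (simp add: distinct_wv)
  have ex: "expandable (ord_list t (wv v)) (zmon (wmon v) * (ren (pv \<sigma>) W / om p ?s (wv v)))"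
    if \<sigma>: "\<sigma> \<in> color_perms ?N" for \<sigma>
  proof -
    obtain c1 c2 c3 where "series_of (ren (pv \<sigma>) W / om p ?s (wv v)) (conv (conv c1 c2) c3)"
      "bsup (ord_list t (wv v)) c1" "bsup (ord_list t (wv v)) c2" "bsup (ord_list t (wv v)) c3"
      unfolding W_def by (rule split_term[OF \<sigma> v R, of t]) blast
    then show ?thesis unfolding W_def using tcoeff_series(2)[OF _ bsup_conv[OF bsup_conv]] by blast
  qed
  have "zmon (wmon v) * to_ratfun (shuffle_product p ?s n n' R R') / om p ?s (wv v) =
      rat_const (1 / of_nat c) * (\<Sum>\<sigma>\<in>color_perms ?N. zmon (wmon v) * (ren (pv \<sigma>) W / om p ?s (wv v)))"
  proof -
    have "shuffle_sum ?s n n' R R' = symz ?N (rat_const (1 / of_nat c) * W)"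
      unfolding shuffle_sum_def c_def[symmetric] divide_of_nat[OF c] W_def by (simp only: mult.assoc)
    then have "shuffle_sum ?s n n' R R' = rat_const (1 / of_nat c) * (\<Sum>\<sigma>\<in>color_perms ?N. ren (pv \<sigma>) W)"
      unfolding symz_const by (simp add: symz_def)
    then show ?thesis unfolding sp
      by (simp add: sum_divide_distrib sum_distrib_left mult_ac)
  qed
  then have "word_pairing p t v (shuffle_product p ?s n n' R R') =
      constant_term (ord_list t (wv v)) (rat_const (1 / of_nat c) *
        (\<Sum>\<sigma>\<in>color_perms ?N. zmon (wmon v) * (ren (pv \<sigma>) W / om p ?s (wv v))))"
    unfolding word_pairing_eq by (rule arg_cong)
  also have "\<dots> = 1 / of_nat c * (\<Sum>\<sigma>\<in>color_perms ?N. tcoeff t v \<sigma> n n' R R')"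
  proof -
    have "expandable (ord_list t (wv v)) (\<Sum>\<sigma>\<in>color_perms ?N. zmon (wmon v) * (ren (pv \<sigma>) W / om p ?s (wv v)))"
      by (rule expandable_sum) (rule ex)
    moreover have "constant_term (ord_list t (wv v)) (\<Sum>\<sigma>\<in>color_perms ?N. zmon (wmon v) * (ren (pv \<sigma>) W / om p ?s (wv v))) =
        (\<Sum>\<sigma>\<in>color_perms ?N. tcoeff t v \<sigma> n n' R R')"
      unfolding tcoeff_def W_def[symmetric] by (rule constant_term_sum[OF d]) (rule ex)
    ultimately show ?thesis by (subst constant_term_const[OF d]) simp_all
  qed
  finally have "word_pairing p t v (shuffle_product p ?s n n' R R') =
      1 / of_nat c * (\<Sum>\<sigma>\<in>color_perms ?N. tcoeff t v \<sigma> n n' R R')" .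
  then show ?thesis by (simp add: c_def)
qed

text \<open>
  A permutation distributes the variables of the word to the two factors. Up to a correction, the
  summand is then the product of the pairings of the factors with two subwords. The correction
  comes from the pairs in which a variable of the second factor precedes a variable of the first. Each
  of them lowers the height of a prefix by at most \<open>kbound\<close>, and only if the prefix
  separates the two variables.
\<close>

lemma tcoeff_bound:
  fixes j :: nat
  assumes \<sigma>: "\<sigma> \<in> color_perms (\<lambda>i. n i + n' i)" and v: "word_weight v = (\<lambda>i. n i + n' i)"
    and R: "R \<in> V_graded n" "R' \<in> V_graded n'"
    and b1: "\<And>u j. word_weight u = n \<Longrightarrow> word_pairing p t u R \<noteq> 0 \<Longrightarrow> j \<le> length u \<Longrightarrow> P1 j \<le> hgt t (take j u)"
    and b2: "\<And>u j. word_weight u = n' \<Longrightarrow> word_pairing p t u R' \<noteq> 0 \<Longrightarrow> j \<le> length u \<Longrightarrow> P2 j \<le> hgt t (take j u)"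
    and nz: "tcoeff t v \<sigma> n n' R R' \<noteq> 0"
  defines "A \<equiv> pv \<sigma> ` Vset n" and "P \<equiv> set (take j (wv v))"
  shows "P1 (card (P \<inter> A)) + P2 (card (P - A)) - kbound * int (card (P - A) * card (A - P)) \<le> hgt t (take j v)"
proof -
  let ?s = "opposite t"
  define L where "L = wv v"
  define LA where "LA = filter (\<lambda>x. x \<in> A) L"
  define LB where "LB = filter (\<lambda>x. x \<notin> A) L"
  obtain c1 c2 c3 where S: "series_of (ren (pv \<sigma>) (to_ratfun R * ren (shv n) (to_ratfun R') * Kfac p ?s n n') / om p ?s L)
      (conv (conv c1 c2) c3)"
    and bs: "bsup (ord_list t L) c1" "bsup (ord_list t L) c2" "bsup (ord_list t L) c3"
    and c1: "\<And>m. c1 m \<noteq> 0 \<Longrightarrow> keys m \<subseteq> set LA" "\<And>m. keys m \<subseteq> set LA \<Longrightarrow> c1 m = word_pairing p t (list_word LA (- m)) R"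
    and c2: "\<And>m. c2 m \<noteq> 0 \<Longrightarrow> keys m \<subseteq> set LB" "\<And>m. keys m \<subseteq> set LB \<Longrightarrow> c2 m = word_pairing p t (list_word LB (- m)) R'"
    and c3: "\<And>m. c3 m \<noteq> 0 \<Longrightarrow> \<exists>k. m = (\<Sum>(x, y)\<in>Bef L - Bef (LA @ LB). case t of Positive \<Rightarrow> vroot x y (k x y) | Negative \<Rightarrow> vroot y x (k x y)) \<and>
       (\<forall>x y. - kbound \<le> k x y)"
    unfolding LA_def LB_def L_def A_def
    by (rule split_term[OF \<sigma> v R, of t]) blast
  have dL: "distinct L" by (simp add: L_def distinct_wv)
  have dAB: "distinct LA" "distinct LB" using dL by (auto simp: LA_def LB_def)
  have "conv (conv c1 c2) c3 (- wmon v) \<noteq> 0"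
    using tcoeff_series(1)[OF S[unfolded L_def] bsup_conv[OF bsup_conv[OF bs(1,2)] bs(3), unfolded L_def]] nz by simp
  then obtain a12 a3 where "- wmon v = a12 + a3" "conv c1 c2 a12 \<noteq> 0" and a3: "c3 a3 \<noteq> 0"
    using conv_nonzero by blast
  then obtain a1 a2 where a: "- wmon v = a1 + a2 + a3" and a1: "c1 a1 \<noteq> 0" and a2: "c2 a2 \<noteq> 0"
    using conv_nonzero by blast
  have fP: "finite P" by (simp add: P_def)
  have AL: "A \<subseteq> set L"
    unfolding A_def L_def set_wv v using pv_image_Vset[OF \<sigma>] image_mono[OF Vset_mono[of n "\<lambda>i. n i + n' i"], of "pv \<sigma>"] by simp
  have PL: "P \<subseteq> set L" unfolding P_def L_def by (rule set_take_subset)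
  have sLA: "set LA = A" using AL by (auto simp: LA_def)
  have sLB: "set LB = set L - A" by (auto simp: LB_def)
  have V: "Vset (\<lambda>i. n i + n' i) = set L" by (simp add: L_def set_wv v)
  have iA: "inj_on (pv \<sigma>) S" for S using inj_pv[OF \<sigma>] by (rule inj_on_subset) simp
  have wA: "word_weight (list_word LA m) = n" for m
    by (rule word_weight_labels[OF dAB(1), of "pv \<sigma>"]) (auto simp: sLA A_def iA)
  have wB: "word_weight (list_word LB m) = n'" for m
  proof -
    have "word_weight (list_word (LA @ LB) m) = (\<lambda>i. n i + n' i)"
    proof (rule word_weight_labels[of _ "\<lambda>x. x"])
      show "distinct (LA @ LB)" using dAB by (auto simp: LA_def LB_def)
      show "set (LA @ LB) = (\<lambda>x. x) ` Vset (\<lambda>i. n i + n' i)" using AL by (auto simp: sLA sLB V)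
    qed auto
    then have "(\<lambda>i. n i + word_weight (list_word LB m) i) = (\<lambda>i. n i + n' i)"
      using wA by (simp add: list_word_def word_weight_append)
    then show ?thesis by (auto simp: fun_eq_iff)
  qed
  have k1: "keys a1 \<subseteq> set LA" and k2: "keys a2 \<subseteq> set LB" using c1(1)[OF a1] c2(1)[OF a2] .
  \<comment> \<open>The prefix of the word cuts out a prefix of the subword that goes to the first factor.\<close>
  have e1: "P1 (card (P \<inter> A)) \<le> spre t P a1"
  proof -
    define i where "i = length (filter (\<lambda>x. x \<in> A) (take j L))"
    have f: "filter (\<lambda>x. x \<in> A) (take j L) = take i LA" unfolding i_def LA_def by (rule filter_take)
    then have s: "set (take i LA) = P \<inter> A" unfolding f[symmetric] by (auto simp: P_def L_def)
    have "i = card (P \<inter> A)" unfolding i_def distinct_length_filter[OF distinct_take[OF dL]]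
      by (rule arg_cong[of _ _ card]) (auto simp: P_def L_def)
    moreover have "i \<le> length (list_word LA (- a1))"
      unfolding i_def list_word_def LA_def length_map by (metis append_take_drop_id filter_append le_add1 length_append)
    moreover have "word_pairing p t (list_word LA (- a1)) R \<noteq> 0" using c1(2)[OF k1] a1 by simp
    ultimately have "P1 (card (P \<inter> A)) \<le> hgt t (take i (list_word LA (- a1)))"
      using b1[OF wA] by simp
    also have "\<dots> = spre t (P \<inter> A) a1" unfolding hgt_list_word[OF dAB(1)] s ..
    also have "\<dots> = spre t P a1" using spre_inter[OF fP k1[unfolded sLA]] by simp
    finally show ?thesis .
  qed
  have e2: "P2 (card (P - A)) \<le> spre t P a2"
  proof -
    define i where "i = length (filter (\<lambda>x. x \<notin> A) (take j L))"
    have f: "filter (\<lambda>x. x \<notin> A) (take j L) = take i LB" unfolding i_def LB_def by (rule filter_take)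
    then have s: "set (take i LB) = P - A" unfolding f[symmetric] by (auto simp: P_def L_def)
    have "i = card (P - A)" unfolding i_def distinct_length_filter[OF distinct_take[OF dL]]
      by (rule arg_cong[of _ _ card]) (auto simp: P_def L_def)
    moreover have "i \<le> length (list_word LB (- a2))"
      unfolding i_def list_word_def LB_def length_map by (metis append_take_drop_id filter_append le_add1 length_append)
    moreover have "word_pairing p t (list_word LB (- a2)) R' \<noteq> 0" using c2(2)[OF k2] a2 by simp
    ultimately have "P2 (card (P - A)) \<le> hgt t (take i (list_word LB (- a2)))"
      using b2[OF wB] by simp
    also have "\<dots> = spre t (P - A) a2" unfolding hgt_list_word[OF dAB(2)] s ..
    also have "\<dots> = spre t (P \<inter> set LB) a2" by (rule arg_cong[of _ _ "\<lambda>S. spre t S a2"]) (use PL in \<open>auto simp: sLB\<close>)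
    also have "\<dots> = spre t P a2" using spre_inter[OF fP k2] by simp
    finally show ?thesis .
  qed
  \<comment> \<open>Inverted pairs inside the prefix, or outside of it, leave its height unchanged.\<close>
  have e3: "- kbound * int (card (P - A) * card (A - P)) \<le> spre t P a3"
  proof -
    let ?J = "Bef L - Bef (LA @ LB)"
    obtain k where k: "a3 = (\<Sum>(x, y)\<in>?J. case t of Positive \<Rightarrow> vroot x y (k x y) | Negative \<Rightarrow> vroot y x (k x y))"
      "\<And>x y. - kbound \<le> k x y" using c3[OF a3] by blast
    let ?G = "{(x, y) \<in> ?J. x \<in> P \<and> y \<notin> P}"
    have PB: "x \<in> P" if "(x, y) \<in> Bef L" "y \<in> P" for x y
    proof -
      obtain a b where ab: "a < b" "b < length L" "L ! a = x" "L ! b = y"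
        using \<open>(x, y) \<in> Bef L\<close> unfolding Bef_nth by blast
      obtain c where c: "c < j" "c < length L" "L ! c = y" using \<open>y \<in> P\<close> unfolding P_def L_def[symmetric]
        by (auto simp: in_set_conv_nth)
      have "c = b" using nth_eq_iff_index_eq[OF dL c(2) ab(2)] c ab by simp
      then have "a < j" using ab c by simp
      then have "take j L ! a = x" "a < length (take j L)" using ab by auto
      then show ?thesis unfolding P_def L_def[symmetric] by (metis nth_mem)
    qed
    have "- kbound * int (card ?G) = (\<Sum>q\<in>?G. - kbound)" by simp
    also have "\<dots> \<le> (\<Sum>(x, y)\<in>?G. k x y)" by (rule sum_mono) (use k(2) in auto)
    also have "\<dots> = (\<Sum>(x, y)\<in>?J. if x \<in> P \<and> y \<notin> P then k x y else 0)"
    proof (rule sum.mono_neutral_cong_left)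
      show "\<forall>q\<in>?J - ?G. (case q of (x, y) \<Rightarrow> if x \<in> P \<and> y \<notin> P then k x y else 0) = 0"
      proof
        fix q assume q: "q \<in> ?J - ?G"
        show "(case q of (x, y) \<Rightarrow> if x \<in> P \<and> y \<notin> P then k x y else 0) = 0"
        proof (cases q)
          case (Pair x y)
          from Pair q have "\<not> (x \<in> P \<and> y \<notin> P)" by blast
          then show ?thesis unfolding Pair prod.case by (rule if_not_P)
        qed
      qed
    qed auto
    also have "\<dots> = spre t P a3"
      unfolding k(1) spre_sum
    proof (rule sum.cong)
      fix q assume q: "q \<in> ?J"
      obtain x y where xy: "q = (x, y)" by fastforce
      have "y \<in> P \<Longrightarrow> x \<in> P" using PB q xy by auto
      then show "(case q of (x, y) \<Rightarrow> if x \<in> P \<and> y \<notin> P then k x y else 0) =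
          spre t P (case q of (x, y) \<Rightarrow> case t of Positive \<Rightarrow> vroot x y (k x y) | Negative \<Rightarrow> vroot y x (k x y))"
        by (cases t) (auto simp: xy spre_def pre_root[OF fP])
    qed simp
    finally have 1: "- kbound * int (card ?G) \<le> spre t P a3" .
    have "?G \<subseteq> (P - A) \<times> (A - P)"
    proof
      fix q assume q: "q \<in> ?G"
      obtain x y where xy: "q = (x, y)" by fastforce
      have B: "(x, y) \<in> Bef L" "(x, y) \<notin> Bef (LA @ LB)" "x \<in> P" "y \<notin> P" using q xy by auto
      have "x \<in> set L" "y \<in> set L" using B(1) Bef_subset[of L] by auto
      then have "x \<notin> A \<and> y \<in> A" using B(1,2) unfolding Bef_append sLA sLB by (auto simp: LA_def LB_def Bef_filter)
      then show "q \<in> (P - A) \<times> (A - P)" using B by (auto simp: xy)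
    qed
    then have "card ?G \<le> card ((P - A) \<times> (A - P))"
      by (intro card_mono) (auto simp: fP A_def)
    then have "card ?G \<le> card (P - A) * card (A - P)" by (simp add: card_cartesian_product)
    then have "kbound * int (card ?G) \<le> kbound * int (card (P - A) * card (A - P))"
      using kbound(1) by (intro mult_left_mono) (simp_all only: of_nat_le_iff)
    then show ?thesis using 1 by linarith
  qed
  have "hgt t (take j v) = hgt t (take j (list_word L (- (- wmon v))))"
    by (simp add: L_def list_word_wv)
  also have "\<dots> = spre t P (- wmon v)" unfolding hgt_list_word[OF dL] unfolding P_def L_def ..
  also have "\<dots> = spre t P a1 + spre t P a2 + spre t P a3" unfolding a by simp
  finally show ?thesis using e1 e2 e3 by linarith
qed

text \<open>A permutation that respects the division of the word inverts no pair of variables, so there is no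
  correction.\<close>

lemma tcoeff_split:
  assumes \<sigma>: "\<sigma> \<in> color_perms (\<lambda>i. n i + n' i)" "pv \<sigma> ` Vset n = Vset n"
    and u: "word_weight u = n" "word_weight v = n'"
    and R: "R \<in> V_graded n" "R' \<in> V_graded n'"
  shows "tcoeff t (u @ v) \<sigma> n n' R R' = word_pairing p t u R * word_pairing p t v R'"
proof -
  let ?s = "opposite t"
  define L where "L = wv (u @ v)"
  have uv: "word_weight (u @ v) = (\<lambda>i. n i + n' i)" using u by (simp add: word_weight_append)
  have Lc: "L = wv u @ map (shv n) (wv v)" using u by (simp add: L_def wv_append)
  have dL: "distinct L" by (simp add: L_def distinct_wv)
  have fA: "filter (\<lambda>x. x \<in> Vset n) L = wv u" "filter (\<lambda>x. x \<notin> Vset n) L = map (shv n) (wv v)"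
  proof -
    have "x \<notin> Vset n" if "x \<in> set (map (shv n) (wv v))" for x using dL that u(1) unfolding Lc by (auto simp: set_wv)
    moreover have "x \<in> Vset n" if "x \<in> set (wv u)" for x using that u(1) by (simp add: set_wv)
    ultimately show "filter (\<lambda>x. x \<in> Vset n) L = wv u" "filter (\<lambda>x. x \<notin> Vset n) L = map (shv n) (wv v)"
      unfolding Lc filter_append by (subst filter_True filter_False; simp)+
  qed
  obtain c1 c2 c3 where S: "series_of (ren (pv \<sigma>) (to_ratfun R * ren (shv n) (to_ratfun R') * Kfac p ?s n n') / om p ?s L)
      (conv (conv c1 c2) c3)"
    and bs: "bsup (ord_list t L) c1" "bsup (ord_list t L) c2" "bsup (ord_list t L) c3"
    and c1: "\<And>m. c1 m \<noteq> 0 \<Longrightarrow> keys m \<subseteq> set (wv u)" "\<And>m. keys m \<subseteq> set (wv u) \<Longrightarrow> c1 m = word_pairing p t (list_word (wv u) (- m)) R"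
    and c2: "\<And>m. c2 m \<noteq> 0 \<Longrightarrow> keys m \<subseteq> set (map (shv n) (wv v))"
      "\<And>m. keys m \<subseteq> set (map (shv n) (wv v)) \<Longrightarrow> c2 m = word_pairing p t (list_word (map (shv n) (wv v)) (- m)) R'"
    and c3: "series_of (om p ?s L / om p ?s L) c3"
       "\<And>m. c3 m \<noteq> 0 \<Longrightarrow> \<exists>k. m = (\<Sum>(x, y)\<in>Bef L - Bef L. case t of Positive \<Rightarrow> vroot x y (k x y) | Negative \<Rightarrow> vroot y x (k x y)) \<and>
       (\<forall>x y. - kbound \<le> k x y)"
    by (rule split_term[OF \<sigma>(1) uv R, of t, unfolded \<sigma>(2), folded L_def, unfolded fA, folded Lc]) blast
  have c30: "b = 0" if "c3 b \<noteq> 0" for b using c3(2)[OF that] by auto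
  have dt: "distinct (ord_list t L)" using dL by simp
  have "c3 0 = 1"
  proof -
    have "om p ?s L / om p ?s L = to_ratfun 1" using om_nonzero[OF dL] by simp
    then have "constant_term (ord_list t L) (to_ratfun 1 :: ('i var, 'k) ratfun) = c3 0"
      using constant_term_eq[OF dt c3(1) bs(3)] by simp
    moreover have "constant_term (ord_list t L) (to_ratfun 1 :: ('i var, 'k) ratfun) = lookup (1 :: ('i var, 'k) laurent) 0"
      by (rule constant_term_eq[OF dt series_of_to_ratfun bsup_lookup]) auto
    ultimately show ?thesis by (simp add: lookup_one)
  qed
  then have cc: "conv (conv c1 c2) c3 m = conv c1 c2 m" for m using conv_point[of c3 "conv c1 c2" m] c30 by simp
  let ?m2 = "ren_mon (shv n) (wmon v)"
  have W: "- wmon (u @ v) = - wmon u + - ?m2" by (simp add: wmon_append u)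
  have k1: "keys (- wmon u) \<subseteq> set (wv u)" using keys_wmon[of u] by (simp add: set_wv)
  have k2: "keys (- ?m2) \<subseteq> set (map (shv n) (wv v))"
    using keys_ren_mon[of "shv n" "wmon v"] keys_wmon[of v] by (auto simp: set_wv)
  have "conv c1 c2 (- wmon (u @ v)) = (\<Sum>a\<in>{- wmon u}. c1 a * c2 (- wmon (u @ v) - a))"
  proof (rule conv_superset)
    show "{a. c1 a \<noteq> 0 \<and> c2 (- wmon (u @ v) - a) \<noteq> 0} \<subseteq> {- wmon u}"
    proof
      fix a assume "a \<in> {a. c1 a \<noteq> 0 \<and> c2 (- wmon (u @ v) - a) \<noteq> 0}"
      then have a: "keys a \<subseteq> set (wv u)" "keys (- wmon (u @ v) - a) \<subseteq> set (map (shv n) (wv v))" using c1(1) c2(1) by auto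
      have "a + wmon u = - ?m2 - (- wmon (u @ v) - a)" unfolding W by simp
      then have "keys (a + wmon u) \<subseteq> set (map (shv n) (wv v))"
        using keys_diff[of "- ?m2" "- wmon (u @ v) - a"] k2 a(2)
        unfolding \<open>a + wmon u = _\<close> by (meson Un_least order_trans)
      moreover have "keys (a + wmon u) \<subseteq> set (wv u)"
        using Poly_Mapping.keys_add[of a "wmon u"] a(1) k1 by auto
      moreover have "set (wv u) \<inter> set (map (shv n) (wv v)) = {}" using dL unfolding Lc by auto
      ultimately have "keys (a + wmon u) = {}" by blast
      then have "a + wmon u = 0" by simp
      then show "a \<in> {- wmon u}" by (simp add: eq_neg_iff_add_eq_0)
    qed
  qed simp
  also have "\<dots> = c1 (- wmon u) * c2 (- ?m2)" unfolding W by simp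
  also have "c1 (- wmon u) = word_pairing p t u R" using c1(2)[OF k1] by (simp add: list_word_wv)
  also have "c2 (- ?m2) = word_pairing p t v R'"
  proof -
    have "list_word (map (shv n) (wv v)) ?m2 = list_word (wv v) (wmon v)"
      by (simp add: list_word_def lookup_ren_mon[OF inj_shv])
    then show ?thesis using c2(2)[OF k2] by (simp add: list_word_wv)
  qed
  finally show ?thesis
    using tcoeff_series(1)[OF S[unfolded L_def] bsup_conv[OF bsup_conv[OF bs(1,2)] bs(3), unfolded L_def]] cc by simp
qed

text \<open>The prefixes of length \<open>0\<close> and \<open>n\<close> are included, so that the height of the whole word is bounded
  as well; products need this.\<close>

definition low :: "half \<Rightarrow> nat \<Rightarrow> (nat \<Rightarrow> int) \<Rightarrow> ('i, 'k) free \<Rightarrow> bool" where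
  "low s n \<pi> x \<longleftrightarrow> (\<forall>u. length u = n \<longrightarrow>
     word_pairing p (opposite s) u (lookup (ups s x) (word_weight u)) \<noteq> 0 \<longrightarrow>
     (\<forall>j\<le>n. \<pi> j \<le> hgt (opposite s) (take j u)))"

lemma low_mult:
  assumes k: "k \<le> n"
    and x: "\<And>w. w \<in> keys x \<Longrightarrow> length (letters w) = k" and y: "\<And>w. w \<in> keys y \<Longrightarrow> length (letters w) = n - k"
    and lx: "low s k \<pi> x" and ly: "low s (n - k) (\<lambda>j. \<pi> (k + j) - \<pi> k) y"
    and conv: "\<And>a b. a < k \<Longrightarrow> 0 < b \<Longrightarrow> k + b \<le> n \<Longrightarrow>
      \<pi> (a + b) + kbound * int (b * (k - a)) < \<pi> a + \<pi> (k + b) - \<pi> k"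
  shows "low s n \<pi> (x * y)"
    and "\<And>u v. length u = k \<Longrightarrow> length v = n - k \<Longrightarrow> hgt (opposite s) u \<le> \<pi> k \<Longrightarrow>
      word_pairing p (opposite s) (u @ v) (lookup (ups s (x * y)) (word_weight (u @ v))) =
      word_pairing p (opposite s) u (lookup (ups s x) (word_weight u)) *
      word_pairing p (opposite s) v (lookup (ups s y) (word_weight v))"
proof -
  let ?t = "opposite s"
  let ?X = "\<lambda>n. lookup (ups s x) n" and ?Y = "\<lambda>n. lookup (ups s y) n"
  let ?tc = "\<lambda>v \<sigma> n n'. tcoeff ?t v \<sigma> n n' (?X n) (?Y n')"
  have expand: "word_pairing p ?t v (lookup (ups s (x * y)) (word_weight v)) =
    (\<Sum>n1\<in>keys (ups s x). \<Sum>n2\<in>keys (ups s y). if (\<lambda>i. n1 i + n2 i) = word_weight v then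
      (\<Sum>\<sigma>\<in>color_perms (\<lambda>i. n1 i + n2 i). ?tc v \<sigma> n1 n2) / of_nat (card (color_perms n1) * card (color_perms n2)) else 0)" for v
  proof -
    have "lookup (ups s (x * y)) (word_weight v) = (\<Sum>n1\<in>keys (ups s x). \<Sum>n2\<in>keys (ups s y).
        if (\<lambda>i. n1 i + n2 i) = word_weight v then shuffle_product p s n1 n2 (?X n1) (?Y n2) else 0)"
      unfolding ups_mult big_mult_def lookup_sum by (intro sum.cong refl) (simp add: lookup_single when_def)
    also have "word_pairing p ?t v \<dots> = (\<Sum>n1\<in>keys (ups s x). \<Sum>n2\<in>keys (ups s y). word_pairing p ?t v
        (if (\<lambda>i. n1 i + n2 i) = word_weight v then shuffle_product p s n1 n2 (?X n1) (?Y n2) else 0))"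
    proof -
      have g: "(if (\<lambda>i. n1 i + n2 i) = word_weight v then shuffle_product p s n1 n2 (?X n1) (?Y n2) else 0)
          \<in> V_graded (word_weight v)" for n1 n2
        using shuffle_product_ups_V_graded[of s n1 n2 x y] by auto
      show ?thesis by (simp only: word_pairing_sum[OF V_graded_sum[OF g]] word_pairing_sum[OF g])
    qed
    also have "\<dots> = (\<Sum>n1\<in>keys (ups s x). \<Sum>n2\<in>keys (ups s y). if (\<lambda>i. n1 i + n2 i) = word_weight v then
      (\<Sum>\<sigma>\<in>color_perms (\<lambda>i. n1 i + n2 i). ?tc v \<sigma> n1 n2) / of_nat (card (color_perms n1) * card (color_perms n2)) else 0)"
    proof (intro sum.cong refl)
      fix n1 n2
      have "to_ratfun (shuffle_product p s n1 n2 (?X n1) (?Y n2)) = shuffle_sum s n1 n2 (?X n1) (?Y n2)"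
        by (simp add: shuffle_product_ups shuffle_sum_ups)
      then show "word_pairing p ?t v (if (\<lambda>i. n1 i + n2 i) = word_weight v then shuffle_product p s n1 n2 (?X n1) (?Y n2) else 0) =
          (if (\<lambda>i. n1 i + n2 i) = word_weight v then
      (\<Sum>\<sigma>\<in>color_perms (\<lambda>i. n1 i + n2 i). ?tc v \<sigma> n1 n2) / of_nat (card (color_perms n1) * card (color_perms n2)) else 0)"
        using product_pairing[of v n1 n2 "?X n1" "?Y n2" ?t] by (simp add: ups_V_graded)
    qed
    finally show ?thesis .
  qed
  have size: "card (Vset n1) = k" if "n1 \<in> keys (ups s x)" for n1
  proof -
    obtain w where "w \<in> keys x" "word_weight (letters w) = n1"
      using ups_support[of s x n1] \<open>n1 \<in> keys (ups s x)\<close> unfolding in_keys_iff by blast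
    then show ?thesis using x sum_word_weight[of "letters w"] by (auto simp: card_Vset)
  qed
  have size': "card (Vset n2) = n - k" if "n2 \<in> keys (ups s y)" for n2
  proof -
    obtain w where "w \<in> keys y" "word_weight (letters w) = n2"
      using ups_support[of s y n2] \<open>n2 \<in> keys (ups s y)\<close> unfolding in_keys_iff by blast
    then show ?thesis using y sum_word_weight[of "letters w"] by (auto simp: card_Vset)
  qed
  have bound: "(card (P - A) = 0 \<or> card (A - P) = 0) \<and> \<pi> j \<le> hgt ?t (take j v) \<or> \<pi> j < hgt ?t (take j v)"
    if n1: "n1 \<in> keys (ups s x)" and n2: "n2 \<in> keys (ups s y)" and v: "word_weight v = (\<lambda>i. n1 i + n2 i)"
      and \<sigma>: "\<sigma> \<in> color_perms (\<lambda>i. n1 i + n2 i)" and nz: "?tc v \<sigma> n1 n2 \<noteq> 0" and j: "j \<le> n"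
      and A: "A = pv \<sigma> ` Vset n1" and P: "P = set (take j (wv v))" for n1 n2 v \<sigma> j A P
  proof -
    have lv: "length v = n"
      using sum_word_weight[of v] size[OF n1] size'[OF n2] k by (simp add: v sum.distrib card_Vset)
    have cA: "card A = k" unfolding A using size[OF n1] card_image[OF inj_on_subset[OF inj_pv[OF \<sigma>]]] by simp
    have fA: "finite A" "finite P" by (auto simp: A P)
    have cP: "card P = j" unfolding P using distinct_wv[of v] j lv by (simp add: distinct_card)
    define a where "a = card (P \<inter> A)"
    define b where "b = card (P - A)"
    have ab: "a + b = j" unfolding a_def b_def using cP fA by (metis card_Int_Diff)
    have ka: "card (A - P) = k - a" "a \<le> k"
      unfolding a_def using cA fA by (auto simp: card_Diff_subset_Int Int_commute intro: card_mono)
    have bn: "k + b \<le> n"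
    proof -
      have "A \<subseteq> Vset (\<lambda>i. n1 i + n2 i)"
        unfolding A using pv_image_Vset[OF \<sigma>] by (metis (no_types, lifting) Vset_mono image_mono le_add1)
      moreover have "P \<subseteq> Vset (\<lambda>i. n1 i + n2 i)" unfolding P using set_take_subset[of j "wv v"] by (simp add: set_wv v)
      ultimately have "card (A \<union> (P - A)) \<le> card (Vset (\<lambda>i. n1 i + n2 i))" by (intro card_mono) auto
      also have "\<dots> = n" using lv sum_word_weight[of v] by (simp add: card_Vset v)
      finally show ?thesis using card_Un_disjoint[of A "P - A"] fA cA by (auto simp: b_def)
    qed
    have t1: "\<pi> j \<le> hgt ?t (take j u)" if "word_weight u = n1" "word_pairing p ?t u (?X n1) \<noteq> 0" "j \<le> length u" for u j
    proof -
      have "length u = k" using sum_word_weight[of u] size[OF n1] that by (simp add: card_Vset)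
      then show ?thesis using lx that unfolding low_def by auto
    qed
    have t2: "\<pi> (k + j) - \<pi> k \<le> hgt ?t (take j u)" if "word_weight u = n2" "word_pairing p ?t u (?Y n2) \<noteq> 0" "j \<le> length u" for u j
    proof -
      have "length u = n - k" using sum_word_weight[of u] size'[OF n2] that by (simp add: card_Vset)
      then show ?thesis using ly that unfolding low_def by auto
    qed
    have "\<pi> (card (P \<inter> A)) + (\<pi> (k + card (P - A)) - \<pi> k) - kbound * int (card (P - A) * card (A - P)) \<le> hgt ?t (take j v)"
      unfolding A P by (rule tcoeff_bound[OF \<sigma> v ups_V_graded[of s x] ups_V_graded[of s y],
        where ?P1.0 = \<pi> and ?P2.0 = "\<lambda>j. \<pi> (k + j) - \<pi> k"]) (use t1 t2 nz in auto)
    then have "\<pi> a + (\<pi> (k + b) - \<pi> k) - kbound * int (b * (k - a)) \<le> hgt ?t (take j v)"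
      unfolding a_def[symmetric] b_def[symmetric] ka .
    then show ?thesis
      using conv[of a b] bn ab ka unfolding b_def[symmetric] by (cases "a = k"; cases "b = 0") auto
  qed
  show "low s n \<pi> (x * y)"
    unfolding low_def
  proof (intro allI impI)
    fix v j assume v: "length v = n" "word_pairing p ?t v (lookup (ups s (x * y)) (word_weight v)) \<noteq> 0" and j: "j \<le> n"
    have "\<exists>n1\<in>keys (ups s x). \<exists>n2\<in>keys (ups s y). (\<lambda>i. n1 i + n2 i) = word_weight v \<and>
      (\<exists>\<sigma>\<in>color_perms (\<lambda>i. n1 i + n2 i). ?tc v \<sigma> n1 n2 \<noteq> 0)"
    proof (rule ccontr)
      assume "\<not> ?thesis"
      then have "(if (\<lambda>i. n1 i + n2 i) = word_weight v then
        (\<Sum>\<sigma>\<in>color_perms (\<lambda>i. n1 i + n2 i). ?tc v \<sigma> n1 n2) / of_nat (card (color_perms n1) * card (color_perms n2)) else 0) = 0"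
        if "n1 \<in> keys (ups s x)" "n2 \<in> keys (ups s y)" for n1 n2
        using that by (auto intro!: sum.neutral)
      then show False using v(2) unfolding expand by simp
    qed
    then obtain n1 n2 \<sigma> where n1: "n1 \<in> keys (ups s x)" and n2: "n2 \<in> keys (ups s y)"
      and e: "(\<lambda>i. n1 i + n2 i) = word_weight v" and \<sigma>: "\<sigma> \<in> color_perms (\<lambda>i. n1 i + n2 i)" "?tc v \<sigma> n1 n2 \<noteq> 0" by blast
    from bound[OF n1 n2 e[symmetric] \<sigma> j refl refl] show "\<pi> j \<le> hgt ?t (take j v)" by auto
  qed
  fix u v :: "('i \<times> int) list" assume u: "length u = k" "length v = n - k" "hgt ?t u \<le> \<pi> k"
  let ?N = "word_weight (u @ v)" and ?nu = "word_weight u" and ?nv = "word_weight v"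
  have N: "?N = (\<lambda>i. ?nu i + ?nv i)" by (simp add: word_weight_append)
  have tz: "?tc (u @ v) \<sigma> n1 n2 = 0" if n1: "n1 \<in> keys (ups s x)" and n2: "n2 \<in> keys (ups s y)" and e: "(\<lambda>i. n1 i + n2 i) = ?N"
      and \<sigma>: "\<sigma> \<in> color_perms (\<lambda>i. n1 i + n2 i)" and ne: "pv \<sigma> ` Vset n1 \<noteq> Vset ?nu" for n1 n2 \<sigma>
  proof (rule ccontr)
    assume nz: "?tc (u @ v) \<sigma> n1 n2 \<noteq> 0"
    let ?A = "pv \<sigma> ` Vset n1" and ?P = "set (take k (wv (u @ v)))"
    have P: "?P = Vset ?nu" using u by (simp add: wv_append set_wv)
    have cA: "card ?A = k" using size[OF n1] card_image[OF inj_on_subset[OF inj_pv[OF \<sigma>]]] by simp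
    have cP: "card ?P = k" using u sum_word_weight[of u] by (simp add: P card_Vset)
    \<comment> \<open>Two different sets of equal size: some variables are out of order, and the strict bound applies.\<close>
    have "\<not> ?P \<subseteq> ?A" using card_subset_eq[of ?A ?P] cA cP ne P by auto
    moreover have "\<not> ?A \<subseteq> ?P" using card_subset_eq[of ?P ?A] cA cP ne P by auto
    ultimately have "card (?P - ?A) \<noteq> 0" "card (?A - ?P) \<noteq> 0" by auto
    then show False using bound[OF n1 n2 e[symmetric] \<sigma> nz k refl refl] u by auto
  qed
  have cmp: "(if (\<lambda>i. n1 i + n2 i) = ?N then
      (\<Sum>\<sigma>\<in>color_perms (\<lambda>i. n1 i + n2 i). ?tc (u @ v) \<sigma> n1 n2) / of_nat (card (color_perms n1) * card (color_perms n2)) else 0) =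
    (if n1 = ?nu \<and> n2 = ?nv then word_pairing p ?t u (?X n1) * word_pairing p ?t v (?Y n2) else 0)"
    if n1: "n1 \<in> keys (ups s x)" and n2: "n2 \<in> keys (ups s y)" for n1 n2
  proof (cases "(\<lambda>i. n1 i + n2 i) = ?N")
    case True
    show ?thesis
    proof (cases "n1 = ?nu")
      case True
      then have e2: "n2 = ?nv" using \<open>(\<lambda>i. n1 i + n2 i) = ?N\<close> unfolding N by (auto simp: fun_eq_iff)
      let ?H = "{\<sigma> \<in> color_perms (\<lambda>i. n1 i + n2 i). pv \<sigma> ` Vset n1 = Vset n1}"
      have "(\<Sum>\<sigma>\<in>color_perms (\<lambda>i. n1 i + n2 i). ?tc (u @ v) \<sigma> n1 n2) = (\<Sum>\<sigma>\<in>?H. ?tc (u @ v) \<sigma> n1 n2)"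
        by (rule sum.mono_neutral_right) (use tz[OF n1 n2 \<open>(\<lambda>i. n1 i + n2 i) = ?N\<close>] True in auto)
      also have "\<dots> = (\<Sum>\<sigma>\<in>?H. word_pairing p ?t u (?X n1) * word_pairing p ?t v (?Y n2))"
        by (rule sum.cong) (use True e2 in \<open>auto intro!: tcoeff_split simp: ups_V_graded\<close>)
      also have "\<dots> = of_nat (card (color_perms n1) * card (color_perms n2)) * (word_pairing p ?t u (?X n1) * word_pairing p ?t v (?Y n2))"
        by (simp add: card_stabilizer)
      finally show ?thesis using True e2 N by (simp add: card_color_perms)
    next
      case False
      have "Vset n1 = Vset n2' \<Longrightarrow> n1 = n2'" for n2' :: "'i \<Rightarrow> nat"
      proof
        fix i assume e: "Vset n1 = Vset n2'"
        have "a \<le> n1 i \<longleftrightarrow> a \<le> n2' i" if "1 \<le> a" for a using arg_cong[OF e, of "\<lambda>S. ZVar i a \<in> S"] that by simp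
        from this[of "n1 i"] this[of "n2' i"] show "n1 i = n2' i" by (cases "n1 i = 0"; cases "n2' i = 0") auto
      qed
      have "pv \<sigma> ` Vset n1 \<noteq> Vset ?nu" if \<sigma>: "\<sigma> \<in> color_perms (\<lambda>i. n1 i + n2 i)" for \<sigma>
      proof
        assume e: "pv \<sigma> ` Vset n1 = Vset ?nu"
        have "?nu i = n1 i" for i
        proof -
          have "{x \<in> Vset ?nu. col x = i} = pv \<sigma> ` {x \<in> Vset n1. col x = i}" unfolding e[symmetric] by auto
          moreover have "card (pv \<sigma> ` {x \<in> Vset n1. col x = i}) = card {x \<in> Vset n1. col x = i}"
            by (rule card_image[OF inj_on_subset[OF inj_pv[OF \<sigma>]]]) simp
          moreover have "card {x \<in> Vset m. col x = i} = m i" for m :: "'i \<Rightarrow> nat"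
          proof -
            have "{x \<in> Vset m. col x = i} = ZVar i ` {1..m i}" by (auto simp: Vset_def image_iff)
            then show ?thesis by (simp add: card_image inj_on_def)
          qed
          ultimately show ?thesis by metis
        qed
        then show False using False by auto
      qed
      then have "(\<Sum>\<sigma>\<in>color_perms (\<lambda>i. n1 i + n2 i). ?tc (u @ v) \<sigma> n1 n2) = 0"
        using tz[OF n1 n2 True] by (intro sum.neutral) auto
      then show ?thesis unfolding if_P[OF True] using False by simp
    qed
  next
    case False
    then show ?thesis unfolding N by auto
  qed
  have "word_pairing p ?t (u @ v) (lookup (ups s (x * y)) ?N) =
    (\<Sum>n1\<in>keys (ups s x). \<Sum>n2\<in>keys (ups s y). if n1 = ?nu \<and> n2 = ?nv then word_pairing p ?t u (?X n1) * word_pairing p ?t v (?Y n2) else 0)"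
    unfolding expand by (intro sum.cong refl cmp)
  also have "\<dots> = (\<Sum>n1\<in>keys (ups s x). if n1 = ?nu then word_pairing p ?t u (?X n1) * word_pairing p ?t v (?Y ?nv) else 0)"
    by (intro sum.cong refl) (auto simp: in_keys_iff)
  also have "\<dots> = word_pairing p ?t u (?X ?nu) * word_pairing p ?t v (?Y ?nv)"
    by (auto simp: in_keys_iff)
  finally show "word_pairing p ?t (u @ v) (lookup (ups s (x * y)) ?N) =
    word_pairing p ?t u (?X ?nu) * word_pairing p ?t v (?Y ?nv)" .
qed

end

section \<open>Bounds for heights and exponents\<close>

lemma take_length_minus_rev: "set (take j xs) = set (drop (length xs - j) (rev xs))" if "j \<le> length xs"
proof -
  have "drop (length xs - j) (rev xs) = rev (take j xs)" using that by (simp add: drop_rev)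
  then show ?thesis by simp
qed

lemma bsup_spre:
  assumes d: "distinct vs" and b: "bsup (ord_list s vs) c"
  obtains B where "B \<ge> 0" "\<And>m j. c m \<noteq> 0 \<Longrightarrow> - B \<le> spre s (set (take j vs)) m" "\<And>m. c m \<noteq> 0 \<Longrightarrow> spre s (set vs) m \<le> B"
proof -
  obtain B where B: "\<And>m. c m \<noteq> 0 \<Longrightarrow> (\<forall>k. pre (set (take k (ord_list s vs))) m \<le> B) \<and> - B \<le> pre (set vs) m"
    using b unfolding bsup_def by auto
  have B0: "0 \<le> B" if "c m \<noteq> 0" for m
    using spec[OF conjunct1[OF B[OF that]], of 0] by simp
  let ?B = "2 * \<bar>B\<bar>"
  have tot: "pre (set vs) m \<le> B" if "c m \<noteq> 0" for m
    using spec[OF conjunct1[OF B[OF that]], of "length vs"] by (cases s) auto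
  have low: "- ?B \<le> spre s (set (take j vs)) m" if nz: "c m \<noteq> 0" for m j
  proof (cases s)
    case Positive
    then show ?thesis using spec[OF conjunct1[OF B[OF nz]], of j] by (simp add: spre_def)
  next
    case Negative
    define i where "i = min j (length vs)"
    have "pre (set (take (length vs - i) (rev vs))) m + pre (set (drop (length vs - i) (rev vs))) m = pre (set vs) m"
    proof -
      have "set (take (length vs - i) (rev vs)) \<inter> set (drop (length vs - i) (rev vs)) = {}"
        using d by (intro set_take_disj_set_drop_if_distinct) auto
      moreover have "set (take (length vs - i) (rev vs)) \<union> set (drop (length vs - i) (rev vs)) = set vs"
        by (metis append_take_drop_id set_append set_rev)
      ultimately show ?thesis unfolding pre_def by (metis finite_set sum.union_disjoint)
    qed
    moreover have "set (drop (length vs - i) (rev vs)) = set (take i vs)"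
      using take_length_minus_rev[of i vs] by (simp add: i_def)
    moreover have "take i vs = take j vs" by (simp add: i_def min_def)
    moreover have "pre (set (take (length vs - i) (rev vs))) m \<le> B" "- B \<le> pre (set vs) m"
      using B[OF nz] Negative by auto
    ultimately show ?thesis using Negative by (simp add: spre_def)
  qed
  have up: "spre s (set vs) m \<le> ?B" if nz: "c m \<noteq> 0" for m
    using tot[OF nz] B[OF nz] by (cases s) (auto simp: spre_def)
  show ?thesis by (rule that[of ?B]) (use low up in auto)
qed

lemma hgt_wv: "hgt s (take j u) = spre s (set (take j (wv u))) (- wmon u)"
  using hgt_list_word[OF distinct_wv, of s j u "- wmon u"] by (simp add: list_word_wv)

lemma finite_weights: "finite {n :: 'i::finite \<Rightarrow> nat. (\<Sum>i\<in>UNIV. n i) = N}"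
proof (rule finite_subset)
  show "{n :: 'i \<Rightarrow> nat. (\<Sum>i\<in>UNIV. n i) = N} \<subseteq> {f. \<forall>i. (i \<in> UNIV \<longrightarrow> f i \<in> {..N}) \<and> (i \<notin> UNIV \<longrightarrow> f i = 0)}"
  proof safe
    fix n :: "'i \<Rightarrow> nat" and i
    show "n i \<le> (\<Sum>i\<in>UNIV. n i)" by (rule member_le_sum) auto
  qed auto
  show "finite {f. \<forall>i::'i. (i \<in> UNIV \<longrightarrow> f i \<in> {..N}) \<and> (i \<notin> UNIV \<longrightarrow> f i = 0)}"
    by (rule finite_set_of_finite_funs) auto
qed

lemma finite_exponent_box:
  assumes "finite A"
  shows "finite {m :: 'v \<Rightarrow>\<^sub>0 int. keys m \<subseteq> A \<and> (\<forall>x\<in>A. \<bar>lookup m x\<bar> \<le> B)}" (is "finite ?M")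
proof (rule finite_imageD)
  have "lookup ` ?M \<subseteq> {f. \<forall>x. (x \<in> A \<longrightarrow> f x \<in> {- B..B}) \<and> (x \<notin> A \<longrightarrow> f x = 0)}"
    by (auto simp: in_keys_iff abs_le_iff)
  moreover have "finite {f. \<forall>x. (x \<in> A \<longrightarrow> f x \<in> {- B..B}) \<and> (x \<notin> A \<longrightarrow> f x = 0)}"
    using assms by (rule finite_set_of_finite_funs) auto
  ultimately show "finite (lookup ` ?M)" by (rule finite_subset)
  show "inj_on lookup ?M" by (simp add: inj_on_def lookup_inject)
qed

context zeta
begin

text \<open>
  Since the pairings with the words of a fixed sequence of colours are the coefficients of one
  series with bounded support, the heights of the prefixes of the words that pair non-trivially are
  bounded below. A weight admits finitely many sequences of colours.
\<close>

lemma pairing_bounded: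
  assumes R: "R \<in> V_graded n"
  obtains A where "A \<ge> 0" "\<And>u j. word_weight u = n \<Longrightarrow> word_pairing p s u R \<noteq> 0 \<Longrightarrow> - A \<le> hgt s (take j u)"
    "\<And>u. word_weight u = n \<Longrightarrow> word_pairing p s u R \<noteq> 0 \<Longrightarrow> hgt s u \<le> A"
proof -
  let ?C = "{is :: 'i list. length is = (\<Sum>i\<in>UNIV. n i)}"
  have "\<exists>B. B \<ge> 0 \<and> (\<forall>u. word_weight u = n \<longrightarrow> map fst u = is \<longrightarrow> word_pairing p s u R \<noteq> 0 \<longrightarrow>
      (\<forall>j. - B \<le> hgt s (take j u)) \<and> hgt s u \<le> B)" for "is"
  proof (cases "\<exists>w :: ('i \<times> int) list. word_weight w = n \<and> map fst w = is")
    case True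
    then obtain w :: "('i \<times> int) list" where w: "word_weight w = n" "map fst w = is" by blast
    obtain c where c: "series_of (to_ratfun R / om p (opposite s) (wv w)) c" "bsup (ord_list s (wv w)) c"
      "\<And>u. map fst u = map fst w \<Longrightarrow> word_pairing p s u R = c (- wmon u)"
      by (rule word_pairing_series[of R w s]) (use R w in auto)
    obtain B where B: "B \<ge> 0" "\<And>m j. c m \<noteq> 0 \<Longrightarrow> - B \<le> spre s (set (take j (wv w))) m"
      "\<And>m. c m \<noteq> 0 \<Longrightarrow> spre s (set (wv w)) m \<le> B"
      by (rule bsup_spre[OF distinct_wv c(2)]) blast
    have "(\<forall>j. - B \<le> hgt s (take j u)) \<and> hgt s u \<le> B" if u: "map fst u = is" "word_pairing p s u R \<noteq> 0" for u
    proof -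
      have v: "wv u = wv w" using u w by (auto intro: wv_cong)
      have nz: "c (- wmon u) \<noteq> 0" using c(3)[of u] u w by simp
      have "hgt s u = spre s (set (wv u)) (- wmon u)" using hgt_wv[of s "length u" u] by simp
      then show ?thesis using B(2)[OF nz] B(3)[OF nz] by (simp add: hgt_wv v)
    qed
    then show ?thesis using B(1) by blast
  qed (auto intro: exI[of _ 0])
  then obtain B where B: "\<And>is. B is \<ge> 0" "\<And>u j. word_weight u = n \<Longrightarrow> word_pairing p s u R \<noteq> 0 \<Longrightarrow>
      - B (map fst u) \<le> hgt s (take j u)" "\<And>u. word_weight u = n \<Longrightarrow> word_pairing p s u R \<noteq> 0 \<Longrightarrow> hgt s u \<le> B (map fst u)"
    by metis
  have fC: "finite ?C" using finite_lists_length_eq[of "UNIV :: 'i set"] by simp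
  have C: "B (map fst u) \<le> sum B ?C" if "word_weight u = n" for u :: "('i \<times> int) list"
    by (rule member_le_sum) (use that fC B(1) sum_word_weight[of u] in auto)
  show ?thesis
  proof (rule that[of "sum B ?C"])
    show "0 \<le> sum B ?C" by (rule sum_nonneg) (use B(1) in auto)
    fix u :: "('i \<times> int) list" and j assume u: "word_weight u = n" "word_pairing p s u R \<noteq> 0"
    show "- sum B ?C \<le> hgt s (take j u)" using B(2)[OF u, of j] C[OF u(1)] by linarith
    show "hgt s u \<le> sum B ?C" using B(3)[OF u] C[OF u(1)] by linarith
  qed
qed

lemma letter_pairing:
  assumes "word_weight u = word_weight [l]" "word_pairing p t u (E (opposite t) [l]) \<noteq> 0"
  shows "hgt t u = hgt (opposite t) [l]"
proof -
  obtain i d where l: "l = (i, d)" by fastforce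
  have "length u = 1" using arg_cong[OF assms(1), of "\<lambda>n. \<Sum>i\<in>UNIV. n i"] unfolding sum_word_weight by simp
  then obtain j e where u: "u = [(j, e)]" by (metis One_nat_def length_0_conv length_Suc_conv surj_pair)
  have "word_weight u i = 1" using assms(1) by (simp add: l)
  then have j: "j = i" by (auto simp: u split: if_splits)
  have wv: "wv u = [ZVar i 1]" using wv_snoc[of "[]" "(i, e)"] by (simp add: u j)
  have wm: "wmon u = single (ZVar i 1) e" using wmon_snoc[of "[]" "(i, e)"] by (simp add: u j)
  let ?P = "single (single (ZVar i 1) (e + d)) 1 :: ('i var, 'k) laurent"
  have "word_pairing p t u (E (opposite t) [l]) = constant_term (ord_list t [ZVar i 1]) (to_ratfun ?P)"
    unfolding word_pairing_eq wv wm l E_single single_add zmon_add by (simp add: om_def)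
  also have "\<dots> = lookup ?P 0"
    by (rule constant_term_eq[OF _ series_of_to_ratfun bsup_lookup]) auto
  finally have "single (ZVar i 1) (e + d) = 0"
    using assms(2) by (auto simp: lookup_single when_def split: if_splits)
  then have "e + d = 0" by (metis lookup_single_eq lookup_zero)
  then show ?thesis by (cases t) (auto simp: hgt_def u l)
qed

text \<open>
  With the bound of \<open>tcoeff_bound\<close> for the whole word there are no separated pairs, so the heights of
  the factors add up. Together with the symmetry of the form this inequality makes \<open>gram\<close>
  homogeneous (\<open>gram_words\<close>).
\<close>

lemma word_hgt_le:
  "word_weight v = word_weight w \<Longrightarrow> word_pairing p t v (E (opposite t) w) \<noteq> 0 \<Longrightarrow> hgt (opposite t) w \<le> hgt t v"
proof (induction w arbitrary: v)
  case Nil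
  then have "length v = 0" using sum_word_weight[of v] by simp
  then show ?case by simp
next
  case (Cons l w)
  let ?s = "opposite t" and ?n = "word_weight [l]" and ?n' = "word_weight w"
  have v: "word_weight v = (\<lambda>i. ?n i + ?n' i)" using Cons.prems(1) word_weight_append[of "[l]" w] by simp
  have V: "E ?s [l] \<in> V_graded ?n" "E ?s w \<in> V_graded ?n'" by (rule E_V_graded)+
  obtain A where A: "A \<ge> 0" "\<And>u j. word_weight u = ?n' \<Longrightarrow> word_pairing p t u (E ?s w) \<noteq> 0 \<Longrightarrow> - A \<le> hgt t (take j u)"
    by (rule pairing_bounded[OF V(2), of t]) blast
  have sp: "shuffle_product p ?s ?n ?n' (E ?s [l]) (E ?s w) = E ?s (l # w)" using shuffle_product_E[of ?s "[l]" w] by simp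
  have "(\<Sum>\<sigma>\<in>color_perms (\<lambda>i. ?n i + ?n' i). tcoeff t v \<sigma> ?n ?n' (E ?s [l]) (E ?s w)) \<noteq> 0"
  proof -
    have "to_ratfun (shuffle_product p ?s ?n ?n' (E ?s [l]) (E ?s w)) = shuffle_sum ?s ?n ?n' (E ?s [l]) (E ?s w)"
      unfolding sp using shuffle_sum_E[of ?s "[l]" w] by simp
    from product_pairing[OF v V this] Cons.prems(2) show ?thesis unfolding sp by (metis div_0)
  qed
  then obtain \<sigma> where \<sigma>: "\<sigma> \<in> color_perms (\<lambda>i. ?n i + ?n' i)" "tcoeff t v \<sigma> ?n ?n' (E ?s [l]) (E ?s w) \<noteq> 0"
    by (meson sum.not_neutral_contains_not_neutral)
  define P1 where "P1 j = (if j = 1 then hgt ?s [l] else if j = 0 then 0 else - A)" for j :: nat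
  define P2 where "P2 j = (if j = length w then hgt ?s w else - A)" for j :: nat
  define B where "B = pv \<sigma> ` Vset ?n"
  define P where "P = set (take (length v) (wv v))"
  have "P1 (card (P \<inter> B)) + P2 (card (P - B)) - kbound * int (card (P - B) * card (B - P)) \<le> hgt t (take (length v) v)"
    unfolding B_def P_def
  proof (rule tcoeff_bound[OF \<sigma>(1) v V _ _ \<sigma>(2)])
    fix u j assume u: "word_weight u = ?n" "word_pairing p t u (E ?s [l]) \<noteq> 0" "j \<le> length u"
    have "length u = 1" using arg_cong[OF u(1), of "\<lambda>n. \<Sum>i\<in>UNIV. n i"] unfolding sum_word_weight by simp
    then show "P1 j \<le> hgt t (take j u)" using letter_pairing[OF u(1,2)] u(3) by (cases "j = 0") (auto simp: P1_def)
  next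
    fix u j assume u: "word_weight u = ?n'" "word_pairing p t u (E ?s w) \<noteq> 0" "j \<le> length u"
    have "length u = length w" using u(1) sum_word_weight by metis
    then show "P2 j \<le> hgt t (take j u)" using A(2)[OF u(1,2)] Cons.IH[OF u(1,2)] by (auto simp: P2_def)
  qed
  moreover have P: "P = Vset (\<lambda>i. ?n i + ?n' i)" by (simp add: P_def set_wv v)
  moreover have BP: "B \<subseteq> P"
    using image_mono[OF Vset_mono[of ?n "\<lambda>i. ?n i + ?n' i"], of "pv \<sigma>"] unfolding pv_image_Vset[OF \<sigma>(1)] B_def P by simp
  moreover have cB: "card B = 1"
    unfolding B_def using card_image[OF inj_on_subset[OF inj_pv[OF \<sigma>(1)]], of "Vset ?n"] sum_word_weight[of "[l]"]
    by (simp add: card_Vset del: word_weight_simps)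
  moreover have "card P = Suc (length w)"
    unfolding P using sum_word_weight[of "l # w"] by (simp add: card_Vset)
  moreover have "finite B" by (simp add: B_def)
  ultimately have "P1 1 + P2 (length w) \<le> hgt t v"
    by (simp add: Int_absorb1 card_Diff_subset Diff_eq_empty_iff[THEN iffD2])
  then show ?case using hgt_simps(2)[of ?s "[l]" w] by (simp add: P1_def P2_def)
qed

lemma gram_word: "gram s x (single (FWord u) 1) = word_pairing p (opposite s) u (lookup (ups s x) (word_weight u))"
  by (simp add: gram_sym[of s x]) (simp add: gram_def)

lemma gram_words:
  assumes "gram s (single v 1) (single w 1) \<noteq> 0"
  shows "length (letters w) = length (letters v)" "hgt (opposite s) (letters w) = hgt s (letters v)"
proof -
  have key: "word_weight (letters v) = word_weight (letters w)" "hgt (opposite s) (letters w) \<le> hgt s (letters v)"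
    if "gram s (single v 1) (single w 1) \<noteq> 0" for s and v w :: "('i \<times> int) fword"
  proof -
    have 1: "gram s (single v 1) (single w 1) = word_pairing p s (letters v) (lookup (ups (opposite s) (single w 1)) (word_weight (letters v)))"
      by (simp add: gram_def)
    show w: "word_weight (letters v) = word_weight (letters w)"
      using that unfolding 1 by (auto simp: lookup_single when_def split: if_splits)
    show "hgt (opposite s) (letters w) \<le> hgt s (letters v)"
      using that word_hgt_le[OF w, of s] unfolding 1 by (simp add: w)
  qed
  show "length (letters w) = length (letters v)" using key(1)[OF assms] sum_word_weight by metis
  show "hgt (opposite s) (letters w) = hgt s (letters v)"
    using key(2)[OF assms] key(2)[of "opposite s" w v] assms by (simp add: gram_sym[of s "single v 1"])
qed

lemma om_series:
  assumes d: "distinct vs"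
  shows "\<exists>c. series_of (om p t vs) c \<and> bsup (ord_list s vs) c"
proof -
  have "\<exists>c. series_of (kap p t x y) c \<and> bsup (ord_list s vs) c" if xy: "(x, y) \<in> Bef vs" for x y
  proof -
    have "x \<noteq> y" using Bef_neq[OF d xy] .
    obtain N where N: "ratio_bounded N x y (kap p t x y)" "ratio_bounded N y x (kap p t x y)"
      using ratio_bounded_both[OF kap_den_nonzero, of "kap_num p t (col x) (col y)" t "col x" "col y", where 'v = "'i var"] \<open>x \<noteq> y\<close>
      unfolding kap_quotient by blast
    show ?thesis
    proof (cases s)
      case Positive
      obtain c where "series_of (kap p t x y) c" "\<And>m. c m \<noteq> 0 \<Longrightarrow> \<exists>k\<ge>- N. m = vroot x y k"
        using N(1) unfolding ratio_bounded_def by blast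
      then show ?thesis using Positive bsup_Bef[OF d xy, of c] by auto
    next
      case Negative
      obtain c where "series_of (kap p t x y) c" "\<And>m. c m \<noteq> 0 \<Longrightarrow> \<exists>k\<ge>- N. m = vroot y x k"
        using N(2) unfolding ratio_bounded_def by blast
      then show ?thesis using Negative bsup_Bef[of "rev vs" y x c] d xy by (auto simp: Bef_rev)
    qed
  qed
  then obtain c where c: "\<And>x y. (x, y) \<in> Bef vs \<Longrightarrow> series_of (kap p t x y) (c x y) \<and> bsup (ord_list s vs) (c x y)"
    by metis
  have "\<exists>e. series_of (\<Prod>(x, y)\<in>Bef vs. kap p t x y) e \<and> (\<forall>us\<in>{ord_list s vs}. bsup us e) \<and>
    (\<forall>m. e m \<noteq> 0 \<longrightarrow> (\<exists>a. m = (\<Sum>j\<in>Bef vs. a j) \<and> (\<forall>j\<in>Bef vs. case_prod c j (a j) \<noteq> 0)))"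
    by (rule series_of_prod) (use c d in \<open>auto\<close>)
  then show ?thesis unfolding om_def by auto
qed

text \<open>
  If the pairings of \<open>R\<close> vanish on all words with a low prefix, then in every order of the variables
  the partial sums of the exponents of \<open>R\<close> are bounded on one side, and so is their total on both sides.
  As every variable can be put first, all exponents are bounded.
\<close>

lemma exponents_bounded_order:
  assumes vs: "distinct vs" "set vs = Vset n"
  obtains B where "\<And>R m j. R \<in> V_graded n \<Longrightarrow>
      (\<And>u j. word_weight u = n \<Longrightarrow> word_pairing p t u R \<noteq> 0 \<Longrightarrow> - A \<le> hgt t (take j u) \<and> hgt t u \<le> A) \<Longrightarrow>
      m \<in> keys R \<Longrightarrow> - B \<le> spre t (set (take j vs)) m \<and> spre t (set vs) m \<le> B"
proof -
  let ?s = "opposite t"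
  obtain c2 where c2: "series_of (om p ?s vs) c2" "bsup (ord_list t vs) c2" using om_series[OF vs(1)] by blast
  obtain B where B: "B \<ge> 0" "\<And>m j. c2 m \<noteq> 0 \<Longrightarrow> - B \<le> spre t (set (take j vs)) m" "\<And>m. c2 m \<noteq> 0 \<Longrightarrow> spre t (set vs) m \<le> B"
    by (rule bsup_spre[OF vs(1) c2(2)]) blast
  show ?thesis
  proof (rule that[of "A + B"])
    fix R m j assume R: "R \<in> V_graded n" and m: "m \<in> keys R"
      and low: "\<And>u j. word_weight u = n \<Longrightarrow> word_pairing p t u R \<noteq> 0 \<Longrightarrow> - A \<le> hgt t (take j u) \<and> hgt t u \<le> A"
    obtain c where c: "series_of (to_ratfun (ren_laurent (\<lambda>x. x) R) / om p ?s vs) c" "bsup (ord_list t vs) c"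
      "\<And>m. keys m \<subseteq> set vs \<Longrightarrow> c m = word_pairing p t (list_word vs (- m)) R"
      by (rule relabelled_series_list[OF R vs(1), of "\<lambda>x. x" t]) (use vs in auto)
    have r: "ren_laurent (\<lambda>x. x) R = R" by (rule ren_laurent_id[unfolded id_def])
    have d: "distinct (ord_list t vs)" using vs by simp
    have "series_of (to_ratfun R / om p ?s vs * om p ?s vs) (conv c c2)"
      by (rule series_of_conv[OF c(1)[unfolded r] c2(1) bsup_convolvable[OF d c(2) c2(2)]])
    then have S: "series_of (to_ratfun R) (conv c c2)" using om_nonzero[OF vs(1)] by simp
    have kR: "keys m \<subseteq> set vs" if "m \<in> keys R" for m using that R vs unfolding V_graded_iff by auto
    have "conv c c2 m = lookup R m"
    proof (rule expansion_unique[OF d])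
      show "is_expansion (ord_list t vs) (to_ratfun R) (conv c c2)"
        unfolding is_expansion_iff using S bsup_admissible[OF d bsup_conv[OF c(2) c2(2)]] by simp
      show "is_expansion (ord_list t vs) (to_ratfun R) (lookup R)"
        unfolding is_expansion_iff using series_of_to_ratfun[of R] bsup_admissible[OF d bsup_lookup[of R]] kR by simp
    qed
    then have "conv c c2 m \<noteq> 0" using m by (simp add: in_keys_iff)
    then obtain m1 m2 where mm: "m = m1 + m2" "c m1 \<noteq> 0" "c2 m2 \<noteq> 0" using conv_nonzero by blast
    have k: "keys m1 \<subseteq> set vs" using bsup_keys[OF c(2) mm(2)] by simp
    have w: "word_weight (list_word vs (- m1)) = n" by (rule word_weight_labels[OF vs(1), of "\<lambda>x. x"]) (use vs in auto)
    have nz: "word_pairing p t (list_word vs (- m1)) R \<noteq> 0" using c(3)[OF k] mm by simp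
    have h: "hgt t (take j (list_word vs (- m1))) = spre t (set (take j vs)) m1" for j by (rule hgt_list_word[OF vs(1)])
    have "hgt t (list_word vs (- m1)) = spre t (set vs) m1" using h[of "length vs"] by (simp add: list_word_def)
    then show "- (A + B) \<le> spre t (set (take j vs)) m \<and> spre t (set vs) m \<le> A + B"
      using low[OF w nz, of j] B(2)[OF mm(3), of j] B(3)[OF mm(3)] unfolding h mm(1) by simp
  qed
qed

lemma exponents_bounded:
  fixes n :: "'i \<Rightarrow> nat"
  obtains B where "\<And>R m x. R \<in> V_graded n \<Longrightarrow>
      (\<And>u j. word_weight u = n \<Longrightarrow> word_pairing p t u R \<noteq> 0 \<Longrightarrow> - A \<le> hgt t (take j u) \<and> hgt t u \<le> A) \<Longrightarrow>
      m \<in> keys R \<Longrightarrow> x \<in> Vset n \<Longrightarrow> \<bar>lookup m x\<bar> \<le> B"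
proof -
  let ?P = "\<lambda>R. R \<in> V_graded n \<and> (\<forall>u j. word_weight u = n \<longrightarrow> word_pairing p t u R \<noteq> 0 \<longrightarrow> - A \<le> hgt t (take j u) \<and> hgt t u \<le> A)"
  have "\<exists>B. \<forall>R m. ?P R \<longrightarrow> m \<in> keys R \<longrightarrow> \<bar>lookup m x\<bar> \<le> B" if x: "x \<in> Vset n" for x
  proof -
    obtain ys where ys: "set ys = Vset n - {x}" "distinct ys" using finite_distinct_list[of "Vset n - {x}"] by auto
    have v1: "distinct (x # ys)" "set (x # ys) = Vset n" and v2: "distinct (ys @ [x])" "set (ys @ [x]) = Vset n" using ys x by auto
    obtain B1 where B1: "\<And>R m j. R \<in> V_graded n \<Longrightarrow>
      (\<And>u j. word_weight u = n \<Longrightarrow> word_pairing p t u R \<noteq> 0 \<Longrightarrow> - A \<le> hgt t (take j u) \<and> hgt t u \<le> A) \<Longrightarrow>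
      m \<in> keys R \<Longrightarrow> - B1 \<le> spre t (set (take j (x # ys))) m \<and> spre t (set (x # ys)) m \<le> B1"
      by (rule exponents_bounded_order[OF v1, of t A]) blast
    obtain B2 where B2: "\<And>R m j. R \<in> V_graded n \<Longrightarrow>
      (\<And>u j. word_weight u = n \<Longrightarrow> word_pairing p t u R \<noteq> 0 \<Longrightarrow> - A \<le> hgt t (take j u) \<and> hgt t u \<le> A) \<Longrightarrow>
      m \<in> keys R \<Longrightarrow> - B2 \<le> spre t (set (take j (ys @ [x]))) m \<and> spre t (set (ys @ [x])) m \<le> B2"
      by (rule exponents_bounded_order[OF v2, of t A]) blast
    have "\<bar>lookup m x\<bar> \<le> \<bar>B1\<bar> + 2 * \<bar>B2\<bar>" if "?P R" "m \<in> keys R" for R m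
    proof -
      have p1: "pre {x} m = lookup m x" by (simp add: pre_def)
      have "- B1 \<le> spre t {x} m" using B1[of R m 1] that by auto
      moreover have "- B2 \<le> spre t (set ys) m" using B2[of R m "length ys"] that by auto
      moreover have "spre t (insert x (set ys)) m \<le> B2" using B2[of R m 0] that by auto
      moreover have "spre t (insert x (set ys)) m = spre t {x} m + spre t (set ys) m"
        using v1(1) pre_insert[of "set ys" x m] by (cases t) (simp_all add: spre_def p1)
      moreover have "\<bar>lookup m x\<bar> = \<bar>spre t {x} m\<bar>" by (cases t) (auto simp: spre_def p1)
      ultimately show ?thesis by linarith
    qed
    then show ?thesis by blast
  qed
  then obtain B where B: "\<And>x R m. x \<in> Vset n \<Longrightarrow> ?P R \<Longrightarrow> m \<in> keys R \<Longrightarrow> \<bar>lookup m x\<bar> \<le> B x" by metis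
  show ?thesis
  proof (rule that[of "\<Sum>x\<in>Vset n. \<bar>B x\<bar>"])
    fix R m x assume R: "R \<in> V_graded n" "m \<in> keys R" "x \<in> Vset n"
      and low: "\<And>u j. word_weight u = n \<Longrightarrow> word_pairing p t u R \<noteq> 0 \<Longrightarrow> - A \<le> hgt t (take j u) \<and> hgt t u \<le> A"
    have "\<bar>lookup m x\<bar> \<le> \<bar>B x\<bar>" using B[OF R(3) _ R(2)] low R(1) by fastforce
    also have "\<dots> \<le> (\<Sum>x\<in>Vset n. \<bar>B x\<bar>)" by (rule member_le_sum) (use R in auto)
    finally show "\<bar>lookup m x\<bar> \<le> (\<Sum>x\<in>Vset n. \<bar>B x\<bar>)" .
  qed
qed

end

section \<open>Decomposition of bilinear forms of finite rank\<close>

text \<open>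
  Scalars act as multiples \<open>single 0 c\<close> of the unit of the monoid algebra.
\<close>

definition linear_form :: "(('w::monoid_add \<Rightarrow>\<^sub>0 'k::field) \<Rightarrow> 'k) \<Rightarrow> bool" where
  "linear_form L \<longleftrightarrow> (\<forall>x y. L (x - y) = L x - L y) \<and> (\<forall>c x. L (single 0 c * x) = c * L x)"

lemma linear_form_simps:
  assumes "linear_form L"
  shows "L (x - y) = L x - L y" "L (single 0 c * x) = c * L x" "L 0 = 0" "L (x + y) = L x + L y"
    "L (\<Sum>a\<leftarrow>as. f a) = (\<Sum>a\<leftarrow>as. L (f a))" "L (\<Sum>a\<in>A. h a) = (\<Sum>a\<in>A. L (h a))"
proof -
  show d: "L (x - y) = L x - L y" for x y using assms by (simp add: linear_form_def)
  show "L (single 0 c * x) = c * L x" using assms by (simp add: linear_form_def)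
  show z: "L 0 = 0" using d[of 0 0] by simp
  show a: "L (x + y) = L x + L y" for x y using d[of x "0 - y"] d[of 0 y] z by simp
  show "L (\<Sum>a\<leftarrow>as. f a) = (\<Sum>a\<leftarrow>as. L (f a))" by (induction as) (auto simp: z a)
  show "L (\<Sum>a\<in>A. h a) = (\<Sum>a\<in>A. L (h a))" by (induction A rule: infinite_finite_induct) (auto simp: z a)
qed

definition subspace :: "('w::monoid_add \<Rightarrow>\<^sub>0 'k::field) set \<Rightarrow> bool" where
  "subspace Y \<longleftrightarrow> (\<forall>x\<in>Y. \<forall>y\<in>Y. x - y \<in> Y) \<and> (\<forall>c. \<forall>x\<in>Y. single 0 c * x \<in> Y)"

text \<open>
  If finitely many linear forms detect the elements of \<open>Y\<close> modulo the radical, then dual bases exist.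
  Splitting off a pair of elements with \<open>g x\<^sub>0 y\<^sub>0 = 1\<close> leaves orthogonal complements that are detected
  by one linear form less.
\<close>

lemma finite_rank_decomposition:
  fixes g :: "('w::monoid_add \<Rightarrow>\<^sub>0 'k::field) \<Rightarrow> ('v::monoid_add \<Rightarrow>\<^sub>0 'k) \<Rightarrow> 'k"
  assumes "subspace Y" "subspace Y'" and g: "\<And>x. linear_form (g x)" "\<And>y. linear_form (\<lambda>x. g x y)"
    and "finite \<Phi>" "\<And>\<phi>. \<phi> \<in> \<Phi> \<Longrightarrow> linear_form \<phi>"
    and "\<And>x y. x \<in> Y \<Longrightarrow> (\<And>\<phi>. \<phi> \<in> \<Phi> \<Longrightarrow> \<phi> x = 0) \<Longrightarrow> y \<in> Y' \<Longrightarrow> g x y = 0"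
  shows "\<exists>ps. set ps \<subseteq> Y \<times> Y' \<and> (\<forall>x\<in>Y. \<forall>u\<in>Y'. g x u = (\<Sum>(a, b)\<leftarrow>ps. g x b * g a u))"
  using assms(1,2,5-7)
proof (induction "card \<Phi>" arbitrary: Y Y' \<Phi> rule: less_induct)
  case less
  note gl = linear_form_simps[OF g(2)] and gr = linear_form_simps[OF g(1)]
  show ?case
  proof (cases "\<forall>x\<in>Y. \<forall>y\<in>Y'. g x y = 0")
    case True
    then show ?thesis by (intro exI[of _ "[]"]) auto
  next
    case False
    then obtain x1 y0 where xy: "x1 \<in> Y" "y0 \<in> Y'" "g x1 y0 \<noteq> 0" by blast
    define x0 where "x0 = single 0 (1 / g x1 y0) * x1"
    have x0: "x0 \<in> Y" using xy less.prems(1) by (auto simp: x0_def subspace_def)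
    have g1: "g x0 y0 = 1" using xy by (simp add: x0_def gl)
    obtain \<psi> where \<psi>: "\<psi> \<in> \<Phi>" "\<psi> x0 \<noteq> 0" using less.prems(5)[OF x0 _ xy(2)] g1 by auto
    define Y1 where "Y1 = {x \<in> Y. g x y0 = 0}"
    define Y1' where "Y1' = {y \<in> Y'. g x0 y = 0}"
    define \<Phi>1 where "\<Phi>1 = (\<lambda>\<phi> x. \<psi> x0 * \<phi> x - \<phi> x0 * \<psi> x) ` (\<Phi> - {\<psi>})"
    have "card \<Phi>1 \<le> card (\<Phi> - {\<psi>})" unfolding \<Phi>1_def by (rule card_image_le) (use less.prems in simp)
    then have c: "card \<Phi>1 < card \<Phi>" using card_Diff1_less[OF less.prems(3) \<psi>(1)] by linarith
    have s: "subspace Y1" "subspace Y1'"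
      using less.prems(1,2) by (auto simp: subspace_def Y1_def Y1'_def gl gr)
    have p0: "x - single 0 (g x y0) * x0 \<in> Y1" if "x \<in> Y" for x
      using that x0 less.prems(1) g1 by (auto simp: Y1_def subspace_def gl)
    have p1: "u - single 0 (g x0 u) * y0 \<in> Y1'" if "u \<in> Y'" for u
      using that xy less.prems(2) g1 by (auto simp: Y1'_def subspace_def gr)
    have l1: "linear_form \<phi>" if "\<phi> \<in> \<Phi>1" for \<phi>
    proof -
      obtain \<chi> where \<chi>: "\<chi> \<in> \<Phi>" "\<phi> = (\<lambda>x. \<psi> x0 * \<chi> x - \<chi> x0 * \<psi> x)" using \<open>\<phi> \<in> \<Phi>1\<close> by (auto simp: \<Phi>1_def)
      show ?thesis
        unfolding linear_form_def \<chi>(2) linear_form_simps(1,2)[OF less.prems(4)[OF \<chi>(1)]]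
          linear_form_simps(1,2)[OF less.prems(4)[OF \<psi>(1)]]
        by (simp add: right_diff_distrib mult.left_commute)
    qed
    have d1: "g x y = 0" if x: "x \<in> Y1" and z: "\<And>\<phi>. \<phi> \<in> \<Phi>1 \<Longrightarrow> \<phi> x = 0" and y: "y \<in> Y1'" for x y
    proof -
      let ?x = "x - single 0 (\<psi> x / \<psi> x0) * x0"
      have xY: "?x \<in> Y" using x x0 less.prems(1) by (auto simp: subspace_def Y1_def)
      have "\<phi> ?x = 0" if \<phi>: "\<phi> \<in> \<Phi>" for \<phi>
      proof (cases "\<phi> = \<psi>")
        case False
        then have "\<psi> x0 * \<phi> x - \<phi> x0 * \<psi> x = 0" using z[of "\<lambda>x. \<psi> x0 * \<phi> x - \<phi> x0 * \<psi> x"] \<phi> unfolding \<Phi>1_def by blast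
        then show ?thesis unfolding linear_form_simps(1,2)[OF less.prems(4)[OF \<phi>]] using \<psi>(2) by (simp add: field_simps)
      qed (use \<psi> linear_form_simps(1,2)[OF less.prems(4)[OF \<psi>(1)]] in simp)
      then have r: "g ?x u = 0" if "u \<in> Y'" for u using less.prems(5)[OF xY _ that] by blast
      have "\<psi> x / \<psi> x0 = 0" using r[OF xy(2)] x g1 by (simp add: gl Y1_def)
      then show ?thesis using r[of y] y unfolding gl by (simp add: Y1'_def)
    qed
    obtain ps where ps: "set ps \<subseteq> Y1 \<times> Y1'" "\<And>x u. x \<in> Y1 \<Longrightarrow> u \<in> Y1' \<Longrightarrow> g x u = (\<Sum>(a, b)\<leftarrow>ps. g x b * g a u)"
      using less.hyps[OF c s _ l1 d1] less.prems(3) unfolding \<Phi>1_def by blast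
    have "g x u = (\<Sum>(a, b)\<leftarrow>(x0, y0) # ps. g x b * g a u)" if x: "x \<in> Y" and u: "u \<in> Y'" for x u
    proof -
      let ?x = "x - single 0 (g x y0) * x0" and ?u = "u - single 0 (g x0 u) * y0"
      have "g x u = g x y0 * g x0 u + g ?x ?u" using g1 by (simp add: gl gr algebra_simps)
      also have "g ?x ?u = (\<Sum>(a, b)\<leftarrow>ps. g ?x b * g a ?u)" by (rule ps(2)[OF p0[OF x] p1[OF u]])
      also have "\<dots> = (\<Sum>(a, b)\<leftarrow>ps. g x b * g a u)"
      proof (rule arg_cong[of _ _ sum_list], rule map_cong[OF refl])
        fix q assume "q \<in> set ps"
        then obtain a b where q: "q = (a, b)" "g a y0 = 0" "g x0 b = 0" using ps(1) by (auto simp: Y1_def Y1'_def)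
        then show "(case q of (a, b) \<Rightarrow> g ?x b * g a ?u) = (case q of (a, b) \<Rightarrow> g x b * g a u)"
          by (simp add: gl gr)
      qed
      finally show ?thesis by simp
    qed
    moreover have "set ((x0, y0) # ps) \<subseteq> Y \<times> Y'" using ps(1) x0 xy(2) unfolding Y1_def Y1'_def by auto
    ultimately show ?thesis by blast
  qed
qed

section \<open>Convex paths\<close>

definition curved :: "int \<Rightarrow> nat \<Rightarrow> (nat \<Rightarrow> int) \<Rightarrow> bool" where
  "curved c n \<pi> \<longleftrightarrow> (\<forall>k. 0 < k \<longrightarrow> k < n \<longrightarrow> c + 2 * \<pi> k \<le> \<pi> (k - 1) + \<pi> (k + 1))"

lemma curved_slope:
  assumes "curved c n \<pi>" "i + m < n"
  shows "\<pi> (i + 1) - \<pi> i + c * int m \<le> \<pi> (i + m + 1) - \<pi> (i + m)"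
  using assms(2)
proof (induction m)
  case (Suc m)
  have "c + 2 * \<pi> (i + m + 1) \<le> \<pi> (i + m) + \<pi> (i + m + 2)"
    using assms(1) Suc.prems unfolding curved_def by (auto dest: spec[of _ "i + m + 1"])
  then show ?case using Suc by (simp add: algebra_simps)
qed simp

text \<open>
  The slope grows by at least \<open>c\<close> at each step, so the increments over \<open>b\<close> steps at places that are
  \<open>m\<close> apart differ by at least \<open>c * m * b\<close>.
\<close>

lemma curved_conv:
  assumes c: "curved c n \<pi>" and k: "a + m + b \<le> n"
  shows "\<pi> (a + m) + \<pi> (a + b) + c * int (m * b) \<le> \<pi> a + \<pi> (a + m + b)"
  using k
proof (induction b)
  case (Suc b)
  have "\<pi> (a + b + 1) - \<pi> (a + b) + c * int m \<le> \<pi> (a + b + m + 1) - \<pi> (a + b + m)"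
    by (rule curved_slope[OF c]) (use Suc.prems in simp)
  moreover have "\<pi> (a + m) + \<pi> (a + b) + c * int (m * b) \<le> \<pi> a + \<pi> (a + m + b)" using Suc by simp
  ultimately show ?case by (simp add: algebra_simps)
qed simp

lemma curved_mono: "curved c n \<pi> \<Longrightarrow> c' \<le> c \<Longrightarrow> k \<le> n \<Longrightarrow> curved c' k \<pi>"
  unfolding curved_def by (meson add_mono_thms_linordered_semiring(3) less_le_trans order_trans)

lemma curved_shift: "curved c n \<pi> \<Longrightarrow> k \<le> n \<Longrightarrow> curved c (n - k) (\<lambda>j. \<pi> (k + j) - d)"
  unfolding curved_def
proof (intro allI impI)
  fix j assume c: "\<forall>k>0. k < n \<longrightarrow> c + 2 * \<pi> k \<le> \<pi> (k - 1) + \<pi> (k + 1)" and j: "0 < j" "j < n - k"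
  have "c + 2 * \<pi> (k + j) \<le> \<pi> (k + j - 1) + \<pi> (k + j + 1)" using c j by auto
  moreover have "k + j - 1 = k + (j - 1)" using j by simp
  ultimately show "c + 2 * (\<pi> (k + j) - d) \<le> \<pi> (k + (j - 1)) - d + (\<pi> (k + (j + 1)) - d)" by simp
qed

text \<open>
  The parabola \<open>- T * k * (n - k)\<close> has second differences \<open>2 * T\<close>. Changing its value at the endpoint
  \<open>n\<close> to \<open>d\<close> affects one second difference by \<open>\<bar>d\<bar>\<close> at most.
\<close>

lemma exists_curved_path:
  assumes "n > 0 \<or> d = 0"
  obtains \<pi> where "curved c n \<pi>" "\<pi> 0 = 0" "\<pi> n = d" "\<And>k. 0 < k \<Longrightarrow> k < n \<Longrightarrow> \<pi> k \<le> - A"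
proof -
  define T where "T = \<bar>c\<bar> + \<bar>d\<bar> + \<bar>A\<bar>"
  define \<pi> where "\<pi> k = (if k = n then d else - T * (int k * (int n - int k)))" for k
  have T: "0 \<le> T" "c \<le> T" "\<bar>d\<bar> + c \<le> T" "A \<le> T" by (auto simp: T_def)
  show ?thesis
  proof (rule that)
    show "\<pi> n = d" by (simp add: \<pi>_def)
    show "\<pi> 0 = 0" using assms by (auto simp: \<pi>_def)
    fix k assume k: "0 < k" "k < n"
    then have "1 * 1 \<le> int k * (int n - int k)" by (intro mult_mono) auto
    then have "T * 1 \<le> T * (int k * (int n - int k))" using T(1) by (intro mult_left_mono) auto
    then show "\<pi> k \<le> - A" using k T by (simp add: \<pi>_def)
  next
    show "curved c n \<pi>"
      unfolding curved_def
    proof (intro allI impI)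
      fix k assume k: "0 < k" "k < n"
      let ?q = "\<lambda>k. - T * (int k * (int n - int k))"
      have e: "?q (k - 1) + ?q (k + 1) = 2 * T + 2 * ?q k" using k by (simp add: of_nat_diff algebra_simps)
      have "?q (k + 1) - \<bar>d\<bar> \<le> \<pi> (k + 1)" using k T(1) by (auto simp: \<pi>_def)
      moreover have "\<pi> (k - 1) = ?q (k - 1)" "\<pi> k = ?q k" using k by (auto simp: \<pi>_def)
      ultimately show "c + 2 * \<pi> k \<le> \<pi> (k - 1) + \<pi> (k + 1)" using e T by linarith
    qed
  qed
qed

section \<open>Elements that are orthogonal to the words with a low prefix\<close>

definition homog :: "half \<Rightarrow> nat \<Rightarrow> int \<Rightarrow> ('i, 'k::field) free \<Rightarrow> bool" where
  "homog s n d x \<longleftrightarrow> (\<forall>w\<in>keys x. length (letters w) = n \<and> hgt s (letters w) = d)"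

definition dips :: "half \<Rightarrow> nat \<Rightarrow> (nat \<Rightarrow> int) \<Rightarrow> ('i \<times> int) list \<Rightarrow> bool" where
  "dips s n \<pi> w \<longleftrightarrow> (\<exists>k. 0 < k \<and> k < n \<and> hgt s (take k w) < \<pi> k)"

lemma homog_0 [simp]: "homog s n d 0"
  by (simp add: homog_def)

lemma homog_add: "homog s n d x \<Longrightarrow> homog s n d y \<Longrightarrow> homog s n d (x + y)"
  unfolding homog_def using Poly_Mapping.keys_add[of x y] by blast

lemma homog_diff: "homog s n d x \<Longrightarrow> homog s n d y \<Longrightarrow> homog s n d (x - y)"
  unfolding homog_def using keys_diff[of x y] by blast

lemma keys_smult: "keys (single 0 c * x) \<subseteq> keys (x :: 'w::monoid_add \<Rightarrow>\<^sub>0 'k::field)"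
  using keys_mult[of "single 0 c" x] by (auto split: if_splits)

lemma homog_smult: "homog s n d x \<Longrightarrow> homog s n d (single 0 c * x)"
  unfolding homog_def using keys_smult[of c x] by blast

lemma homog_sum_list: "(\<And>a. a \<in> set as \<Longrightarrow> homog s n d (f a)) \<Longrightarrow> homog s n d (\<Sum>a\<leftarrow>as. f a)"
  by (induction as) (auto intro: homog_add)

lemma homog_mult: "homog s k d x \<Longrightarrow> homog s m e y \<Longrightarrow> homog s (k + m) (d + e) (x * y)"
  unfolding homog_def using keys_mult[of x y] by fastforce

context zeta
begin

lemma linear_gram: "linear_form (gram s x)" "linear_form (\<lambda>x. gram s x y)"
proof -
  show 1: "linear_form (\<lambda>x. gram s x y)" for s y
    unfolding linear_form_def by (simp add: gram_def free_pairing_cmult)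
  show "linear_form (gram s x)" using 1[of "opposite s" x] by (simp add: gram_sym[of s x, abs_def])
qed

lemmas gram_left = linear_form_simps[OF linear_gram(2)] and gram_right = linear_form_simps[OF linear_gram(1)]

lemma linear_expand:
  assumes "linear_form L" shows "L u = (\<Sum>w\<in>keys u. lookup u w * L (single w 1))"
proof -
  have "u = (\<Sum>w\<in>keys u. single 0 (lookup u w) * single w 1)"
    using pm_sum_single[of u] by (simp add: mult_single)
  then have "L u = L (\<Sum>w\<in>keys u. single 0 (lookup u w) * single w 1)" by (rule arg_cong)
  then show ?thesis by (simp only: linear_form_simps(2,6)[OF assms])
qed

lemma linear_zero: "linear_form L \<Longrightarrow> (\<And>w. w \<in> keys u \<Longrightarrow> L (single w 1) = 0) \<Longrightarrow> L u = 0"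
  using linear_expand[of L u] by simp

lemma gram_hom:
  assumes "homog s n d x" "gram s x (single w 1) \<noteq> 0"
  shows "length (letters w) = n" "hgt (opposite s) (letters w) = d"
proof -
  obtain v where v: "v \<in> keys x" "gram s (single v 1) (single w 1) \<noteq> 0"
    using linear_zero[OF linear_gram(2), of x s "single w 1"] assms(2) by blast
  show "length (letters w) = n" "hgt (opposite s) (letters w) = d"
    using gram_words[OF v(2)] v(1) assms(1) by (auto simp: homog_def)
qed

lemma low_gram:
  "low s n \<pi> x \<longleftrightarrow> (\<forall>w. length (letters w) = n \<longrightarrow> gram s x (single w 1) \<noteq> 0 \<longrightarrow>
     (\<forall>j\<le>n. \<pi> j \<le> hgt (opposite s) (take j (letters w))))"
proof -
  have "(\<forall>w :: ('i \<times> int) fword. P w) \<longleftrightarrow> (\<forall>u. P (FWord u))" for P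
    by (metis fword.collapse)
  then show ?thesis unfolding low_def gram_word[symmetric] by simp
qed

text \<open>
  If \<open>\<pi>\<close> runs from \<open>0\<close> to the height \<open>d\<close>, the conditions of \<open>low\<close> at the two ends hold automatically, so
  that \<open>low_space\<close> consists of the homogeneous elements that are orthogonal to the words that dip below
  the path (\<open>low_space_iff\<close>).
\<close>

definition low_space :: "half \<Rightarrow> nat \<Rightarrow> int \<Rightarrow> (nat \<Rightarrow> int) \<Rightarrow> ('i, 'k) free set" where
  "low_space s n d \<pi> = {x. homog s n d x \<and> low s n \<pi> x}"

lemma low_space_iff:
  assumes "\<pi> 0 = 0" "\<pi> n = d"
  shows "x \<in> low_space s n d \<pi> \<longleftrightarrow> homog s n d x \<and> (\<forall>w. dips (opposite s) n \<pi> (letters w) \<longrightarrow> gram s x (single w 1) = 0)"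
proof (cases "homog s n d x")
  case True
  show ?thesis
  proof
    assume "x \<in> low_space s n d \<pi>"
    then have l: "low s n \<pi> x" by (simp add: low_space_def)
    have "gram s x (single w 1) = 0" if b: "dips (opposite s) n \<pi> (letters w)" for w
    proof (rule ccontr)
      assume nz: "gram s x (single w 1) \<noteq> 0"
      obtain k where k: "0 < k" "k < n" "hgt (opposite s) (take k (letters w)) < \<pi> k" using b unfolding dips_def by blast
      have "\<pi> k \<le> hgt (opposite s) (take k (letters w))"
        using l nz gram_hom(1)[OF True nz] k(2) unfolding low_gram by auto
      then show False using k(3) by simp
    qed
    then show "homog s n d x \<and> (\<forall>w. dips (opposite s) n \<pi> (letters w) \<longrightarrow> gram s x (single w 1) = 0)" using True by blast
  next
    assume a: "homog s n d x \<and> (\<forall>w. dips (opposite s) n \<pi> (letters w) \<longrightarrow> gram s x (single w 1) = 0)"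
    have "\<pi> j \<le> hgt (opposite s) (take j (letters w))" if w: "gram s x (single w 1) \<noteq> 0" "j \<le> n" for w j
    proof (cases "0 < j \<and> j < n")
      case True
      then show ?thesis using a w(1) unfolding dips_def by (meson not_less)
    next
      case False
      then have "j = 0 \<or> j = n" using w(2) by auto
      then show ?thesis using gram_hom[OF \<open>homog s n d x\<close> w(1)] assms by auto
    qed
    then show "x \<in> low_space s n d \<pi>" using True unfolding low_space_def low_gram by blast
  qed
qed (simp add: low_space_def)

lemma low_diff: "low s n \<pi> x \<Longrightarrow> low s n \<pi> y \<Longrightarrow> low s n \<pi> (x - y)"
  unfolding low_gram gram_left by (metis right_minus_eq)

lemma low_smult: "low s n \<pi> x \<Longrightarrow> low s n \<pi> (single 0 c * x)"
  unfolding low_gram gram_left by auto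

lemma low_0 [simp]: "low s n \<pi> 0"
  unfolding low_gram by simp

lemma low_add: "low s n \<pi> x \<Longrightarrow> low s n \<pi> y \<Longrightarrow> low s n \<pi> (x + y)"
  unfolding low_gram gram_left by (metis add.right_neutral)

lemma low_sum_list: "(\<And>a. a \<in> set as \<Longrightarrow> low s n \<pi> (f a)) \<Longrightarrow> low s n \<pi> (\<Sum>a\<leftarrow>as. f a)"
  by (induction as) (auto intro: low_add)

lemma subspace_low_space: "subspace (low_space s n d \<pi>)"
  unfolding subspace_def low_space_def by (auto intro: low_diff low_smult homog_diff homog_smult)

lemma gram_dips_zero:
  assumes "\<pi> 0 = 0" "\<pi> n = d" "x \<in> low_space s n d \<pi>" "\<And>w. w \<in> keys z \<Longrightarrow> dips (opposite s) n \<pi> (letters w)"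
  shows "gram s x z = 0"
  by (rule linear_zero[OF linear_gram(1)]) (use assms low_space_iff[OF assms(1,2)] in blast)

lemma graded_bounded:
  assumes "graded R"
  obtains A where "A \<ge> 0" "\<And>w j. free_pairing p s (single w 1) R \<noteq> 0 \<Longrightarrow> - A \<le> hgt s (take j (letters w))"
    "\<And>w. free_pairing p s (single w 1) R \<noteq> 0 \<Longrightarrow> hgt s (letters w) \<le> A"
proof -
  have "\<forall>n. \<exists>A. A \<ge> 0 \<and> (\<forall>u. word_weight u = n \<longrightarrow> word_pairing p s u (lookup R n) \<noteq> 0 \<longrightarrow>
      (\<forall>j. - A \<le> hgt s (take j u)) \<and> hgt s u \<le> A)"
  proof
    fix n
    have "lookup R n \<in> V_graded n" using assms by (simp add: graded_def)
    then show "\<exists>A. A \<ge> 0 \<and> (\<forall>u. word_weight u = n \<longrightarrow> word_pairing p s u (lookup R n) \<noteq> 0 \<longrightarrow>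
      (\<forall>j. - A \<le> hgt s (take j u)) \<and> hgt s u \<le> A)"
      by (rule pairing_bounded[of _ _ s]) blast
  qed
  then obtain A where A: "\<And>n. A n \<ge> 0" "\<And>u j. word_pairing p s u (lookup R (word_weight u)) \<noteq> 0 \<Longrightarrow>
      - A (word_weight u) \<le> hgt s (take j u)" "\<And>u. word_pairing p s u (lookup R (word_weight u)) \<noteq> 0 \<Longrightarrow> hgt s u \<le> A (word_weight u)"
    by metis
  have C: "A (word_weight u) \<le> sum A (keys R)" if "word_pairing p s u (lookup R (word_weight u)) \<noteq> 0" for u
  proof (rule member_le_sum)
    show "word_weight u \<in> keys R" using that by (auto simp: in_keys_iff)
  qed (use A(1) in auto)
  show ?thesis
  proof (rule that[of "sum A (keys R)"])
    show "0 \<le> sum A (keys R)" by (rule sum_nonneg) (use A(1) in auto)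
    fix w j assume "free_pairing p s (single w 1) R \<noteq> 0"
    then have nz: "word_pairing p s (letters w) (lookup R (word_weight (letters w))) \<noteq> 0" by simp
    show "- sum A (keys R) \<le> hgt s (take j (letters w))" using A(2)[OF nz, of j] C[OF nz] by linarith
    show "hgt s (letters w) \<le> sum A (keys R)" using A(3)[OF nz] C[OF nz] by linarith
  qed
qed

text \<open>Modulo the radical, the elements that are orthogonal to all words with a low prefix form a space
  of finite dimension: the exponents of their images are bounded.\<close>

lemma finite_detection:
  obtains \<Phi> where "finite \<Phi>" "\<And>\<phi>. \<phi> \<in> \<Phi> \<Longrightarrow> linear_form \<phi>"
    "\<And>x. x \<in> low_space s n d \<pi> \<Longrightarrow> (\<And>\<phi>. \<phi> \<in> \<Phi> \<Longrightarrow> \<phi> x = 0) \<Longrightarrow> ups s x = 0"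
proof -
  let ?N = "{m :: 'i \<Rightarrow> nat. (\<Sum>i\<in>UNIV. m i) = n}" and ?t = "opposite s"
  define A where "A = \<bar>d\<bar> + (\<Sum>j\<le>n. \<bar>\<pi> j\<bar>)"
  have "\<forall>m. \<exists>B. \<forall>R e x. R \<in> V_graded m \<longrightarrow>
      (\<forall>u j. word_weight u = m \<longrightarrow> word_pairing p ?t u R \<noteq> 0 \<longrightarrow> - A \<le> hgt ?t (take j u) \<and> hgt ?t u \<le> A) \<longrightarrow>
      e \<in> keys R \<longrightarrow> x \<in> Vset m \<longrightarrow> \<bar>lookup e x\<bar> \<le> B"
  proof
    fix m :: "'i \<Rightarrow> nat"
    show "\<exists>B. \<forall>R e x. R \<in> V_graded m \<longrightarrow>
      (\<forall>u j. word_weight u = m \<longrightarrow> word_pairing p ?t u R \<noteq> 0 \<longrightarrow> - A \<le> hgt ?t (take j u) \<and> hgt ?t u \<le> A) \<longrightarrow>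
      e \<in> keys R \<longrightarrow> x \<in> Vset m \<longrightarrow> \<bar>lookup e x\<bar> \<le> B"
      by (rule exponents_bounded[of m ?t A]) blast
  qed
  then obtain B where B: "\<And>m R e x. R \<in> V_graded m \<Longrightarrow>
      (\<And>u j. word_weight u = m \<Longrightarrow> word_pairing p ?t u R \<noteq> 0 \<Longrightarrow> - A \<le> hgt ?t (take j u) \<and> hgt ?t u \<le> A) \<Longrightarrow>
      e \<in> keys R \<Longrightarrow> x \<in> Vset m \<Longrightarrow> \<bar>lookup e x\<bar> \<le> B m" by metis
  define box where "box m = {e :: 'i var \<Rightarrow>\<^sub>0 int. keys e \<subseteq> Vset m \<and> (\<forall>x\<in>Vset m. \<bar>lookup e x\<bar> \<le> B m)}" for m
  define \<Phi> where "\<Phi> = (\<lambda>(m, e) x. lookup (lookup (ups s x) m) e) ` (SIGMA m:?N. box m)"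
  show ?thesis
  proof (rule that[of \<Phi>])
    show "finite \<Phi>" unfolding \<Phi>_def box_def by (intro finite_imageI finite_SigmaI finite_weights finite_exponent_box) simp
    have c: "lookup (lookup (ups s (single 0 c * x)) m) e = c * lookup (lookup (ups s x) m) e" for c x m e
    proof (induction x rule: pm_induct)
      case (single w b)
      then show ?case
        using lookup_mult_single[of 0 c "single 0 b * E s (letters w)" e]
        by (simp add: mult_single lookup_single when_def flip: mult.assoc)
    qed (auto simp: lookup_add distrib_left)
    show "linear_form \<phi>" if "\<phi> \<in> \<Phi>" for \<phi>
      using that by (auto simp: \<Phi>_def linear_form_def lookup_minus c)
    fix x assume x: "x \<in> low_space s n d \<pi>" and z: "\<And>\<phi>. \<phi> \<in> \<Phi> \<Longrightarrow> \<phi> x = 0"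
    show "ups s x = 0"
    proof (rule poly_mapping_eqI)
      fix m
      have "lookup (ups s x) m = 0"
      proof (rule ccontr)
        assume nz: "lookup (ups s x) m \<noteq> 0"
        then obtain e where e: "e \<in> keys (lookup (ups s x) m)" by (meson all_not_in_conv keys_eq_empty)
        have m: "m \<in> ?N"
        proof -
          obtain w where "w \<in> keys x" "word_weight (letters w) = m" using ups_support[OF nz] by blast
          then show ?thesis using x sum_word_weight[of "letters w"] by (auto simp: low_space_def homog_def)
        qed
        have V: "lookup (ups s x) m \<in> V_graded m" by (rule ups_V_graded)
        have "- A \<le> hgt ?t (take j u) \<and> hgt ?t u \<le> A" if u: "word_weight u = m" "word_pairing p ?t u (lookup (ups s x) m) \<noteq> 0" for u j
        proof -
          have g: "gram s x (single (FWord u) 1) \<noteq> 0" using u by (simp add: gram_word)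
          have h: "length u = n" "hgt ?t u = d" using gram_hom[of s n d x "FWord u"] g x by (auto simp: low_space_def)
          let ?j = "min j n"
          have "\<pi> ?j \<le> hgt ?t (take ?j u)" using x g h unfolding low_space_def low_gram by force
          moreover have "hgt ?t (take ?j u) = hgt ?t (take j u)" using h(1) by (simp add: min_def)
          moreover have "\<bar>\<pi> ?j\<bar> \<le> (\<Sum>j\<le>n. \<bar>\<pi> j\<bar>)" by (rule member_le_sum) auto
          moreover have "0 \<le> (\<Sum>j\<le>n. \<bar>\<pi> j\<bar>)" by (rule sum_nonneg) simp
          ultimately show ?thesis using h(2) unfolding A_def by (intro conjI) linarith+
        qed
        then have "\<bar>lookup e y\<bar> \<le> B m" if "y \<in> Vset m" for y using B[OF V _ e that] by blast
        moreover have "keys e \<subseteq> Vset m" using V e unfolding V_graded_iff by blast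
        ultimately have "e \<in> box m" by (simp add: box_def)
        then have "lookup (lookup (ups s x) m) e = 0" using z[of "\<lambda>x. lookup (lookup (ups s x) m) e"] m unfolding \<Phi>_def by force
        then show False using e by (simp add: in_keys_iff)
      qed
      then show "lookup (ups s x) m = lookup 0 m" by simp
    qed
  qed
qed

end

lemma single_0_commute: "x * (single 0 c * y) = single 0 c * (x * y)" for x y :: "('i, 'k::field) free"
proof (induction x rule: pm_induct)
  case (single w b)
  have "single w b * single 0 c = single 0 c * (single w b :: ('i, 'k) free)" by (simp add: mult_single mult.commute)
  then show ?case by (simp flip: mult.assoc)
qed (auto simp: distrib_left distrib_right)

section \<open>Linear forms that vanish on the words with a low prefix\<close>

context zeta
begin

text \<open>
  The list \<open>ps\<close> consists of dual bases: each linear form that vanishes on the radical and on the words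
  that dip below the path is \<open>gram s y\<close> with \<open>y\<close> the combination of the first components with the values
  of the form on the second components as coefficients. A list that works for all linear forms is
  needed to represent bilinear forms.
\<close>

definition represents :: "half \<Rightarrow> nat \<Rightarrow> int \<Rightarrow> (nat \<Rightarrow> int) \<Rightarrow> (('i, 'k) free \<times> ('i, 'k) free) list \<Rightarrow> bool" where
  "represents s n d \<pi> ps \<longleftrightarrow>
     (\<forall>q\<in>set ps. fst q \<in> low_space s n d \<pi> \<and> homog (opposite s) n d (snd q)) \<and>
     (\<forall>L. linear_form L \<longrightarrow> (\<forall>r. ups (opposite s) r = 0 \<longrightarrow> L r = 0) \<longrightarrow>
        (\<forall>w. length (letters w) = n \<longrightarrow> hgt (opposite s) (letters w) = d \<longrightarrow> dips (opposite s) n \<pi> (letters w) \<longrightarrow> L (single w 1) = 0) \<longrightarrow>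
        (\<forall>u. homog (opposite s) n d u \<longrightarrow> L u = (\<Sum>q\<leftarrow>ps. L (snd q) * gram s (fst q) u)))"

lemma represents_form:
  assumes "represents s n d \<pi> ps" "linear_form L" "\<And>r. ups (opposite s) r = 0 \<Longrightarrow> L r = 0"
    and "\<And>w. length (letters w) = n \<Longrightarrow> hgt (opposite s) (letters w) = d \<Longrightarrow> dips (opposite s) n \<pi> (letters w) \<Longrightarrow> L (single w 1) = 0"
    and "homog (opposite s) n d u"
  shows "L u = (\<Sum>q\<leftarrow>ps. L (snd q) * gram s (fst q) u)"
  using assms unfolding represents_def by blast

definition splits :: "half \<Rightarrow> nat \<Rightarrow> int \<Rightarrow> (nat \<Rightarrow> int) \<Rightarrow> bool" where
  "splits s n d \<pi> \<longleftrightarrow> (\<forall>x. homog s n d x \<longrightarrow> (\<exists>y\<in>low_space s n d \<pi>. \<forall>w\<in>keys (x - y). dips s n \<pi> (letters w)))"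

lemma gram_rad: "ups s x = 0 \<Longrightarrow> gram s x y = 0"
  using ups_eq_0_iff by blast

text \<open>
  The low spaces of the two halves pair perfectly modulo radicals: an element of one that is orthogonal
  to the other is orthogonal to everything, because the words that make up the difference between
  the low space and the whole space are orthogonal to it. As the dimension is finite, dual bases
  exist.
\<close>

lemma splits_imp_represents:
  assumes e: "\<pi> 0 = 0" "\<pi> n = d" and sp: "splits s n d \<pi>" "splits (opposite s) n d \<pi>"
  shows "\<exists>ps. represents s n d \<pi> ps"
proof -
  let ?t = "opposite s"
  obtain \<Phi> where \<Phi>: "finite \<Phi>" "\<And>\<phi>. \<phi> \<in> \<Phi> \<Longrightarrow> linear_form \<phi>"
    "\<And>x. x \<in> low_space s n d \<pi> \<Longrightarrow> (\<And>\<phi>. \<phi> \<in> \<Phi> \<Longrightarrow> \<phi> x = 0) \<Longrightarrow> ups s x = 0"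
    by (rule finite_detection[of s n d \<pi>]) blast
  have "\<exists>ps. set ps \<subseteq> low_space s n d \<pi> \<times> low_space ?t n d \<pi> \<and>
      (\<forall>x\<in>low_space s n d \<pi>. \<forall>u\<in>low_space ?t n d \<pi>. gram s x u = (\<Sum>(a, b)\<leftarrow>ps. gram s x b * gram s a u))"
    by (rule finite_rank_decomposition[OF subspace_low_space subspace_low_space linear_gram \<Phi>(1,2)]) (auto intro: gram_rad \<Phi>(3))
  then obtain ps where ps: "set ps \<subseteq> low_space s n d \<pi> \<times> low_space ?t n d \<pi>"
    "\<And>x u. x \<in> low_space s n d \<pi> \<Longrightarrow> u \<in> low_space ?t n d \<pi> \<Longrightarrow> gram s x u = (\<Sum>q\<leftarrow>ps. gram s x (snd q) * gram s (fst q) u)"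
    unfolding case_prod_unfold by blast
  have q: "fst q \<in> low_space s n d \<pi>" "snd q \<in> low_space ?t n d \<pi>" if "q \<in> set ps" for q using ps(1) that by auto
  have "L u = (\<Sum>q\<leftarrow>ps. L (snd q) * gram s (fst q) u)"
    if L: "linear_form L" and rad: "\<And>r. ups ?t r = 0 \<Longrightarrow> L r = 0"
      and Lb: "\<And>w. length (letters w) = n \<Longrightarrow> hgt ?t (letters w) = d \<Longrightarrow> dips ?t n \<pi> (letters w) \<Longrightarrow> L (single w 1) = 0"
      and u: "homog ?t n d u" for L u
  proof -
    obtain y where y: "y \<in> low_space ?t n d \<pi>" "\<And>w. w \<in> keys (u - y) \<Longrightarrow> dips ?t n \<pi> (letters w)"
      using sp(2) u unfolding splits_def by blast
    have hy: "homog ?t n d y" using y(1) by (simp add: low_space_def)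
    have "L (u - y) = 0"
    proof (rule linear_zero[OF L])
      fix w assume w: "w \<in> keys (u - y)"
      then show "L (single w 1) = 0" using homog_diff[OF u hy] Lb y(2) unfolding homog_def by blast
    qed
    then have Lu: "L u = L y" by (simp add: linear_form_simps(1)[OF L])
    have au: "gram s (fst q) u = gram s (fst q) y" if "q \<in> set ps" for q
    proof -
      have "gram s (fst q) (u - y) = 0" by (rule gram_dips_zero[OF e q(1)[OF that]]) (rule y(2))
      then show ?thesis by simp
    qed
    define y' where "y' = (\<Sum>q\<leftarrow>ps. single 0 (gram s (fst q) u) * snd q)"
    have yY: "y - y' \<in> low_space ?t n d \<pi>"
      unfolding y'_def low_space_def mem_Collect_eq using hy y(1) q(2)
      by (intro conjI homog_diff low_diff homog_sum_list low_sum_list homog_smult low_smult) (auto simp: low_space_def)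
    have "gram ?t (y - y') (single w 1) = 0" for w
    proof (rule ccontr)
      assume nz: "gram ?t (y - y') (single w 1) \<noteq> 0"
      have hw: "length (letters w) = n" "hgt s (letters w) = d"
        using gram_hom[of ?t n d "y - y'" w] yY nz by (auto simp: low_space_def)
      then have "homog s n d (single w (1 :: 'k))" by (simp add: homog_def)
      then obtain x0 where x0: "x0 \<in> low_space s n d \<pi>" "\<And>v. v \<in> keys (single w 1 - x0) \<Longrightarrow> dips s n \<pi> (letters v)"
        using sp(1) unfolding splits_def by blast
      have "gram ?t (y - y') (single w 1 - x0) = 0"
        by (rule gram_dips_zero[OF e yY]) (use x0(2) in simp)
      moreover have "gram ?t (y - y') x0 = 0"
      proof -
        have "gram s x0 y' = (\<Sum>q\<leftarrow>ps. gram s (fst q) u * gram s x0 (snd q))"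
          unfolding y'_def by (simp add: gram_right(5,2))
        also have "\<dots> = (\<Sum>q\<leftarrow>ps. gram s x0 (snd q) * gram s (fst q) y)"
          by (rule arg_cong[of _ _ sum_list], rule map_cong) (auto simp: au mult.commute)
        also have "\<dots> = gram s x0 y" by (rule ps(2)[OF x0(1) y(1), symmetric])
        finally have "gram s x0 (y - y') = 0" by simp
        then show ?thesis using gram_sym[of s x0 "y - y'"] by simp
      qed
      ultimately show False using nz by simp
    qed
    then have "ups ?t (y - y') = 0"
      unfolding ups_eq_0_iff using linear_zero[OF linear_gram(1)] by blast
    then have "L y = L y'" using rad[of "y - y'"] by (simp add: linear_form_simps(1)[OF L])
    also have "\<dots> = (\<Sum>q\<leftarrow>ps. L (snd q) * gram s (fst q) u)"
      unfolding y'_def linear_form_simps(5,2)[OF L] by (simp add: mult.commute)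
    finally show ?thesis using Lu by simp
  qed
  then have "represents s n d \<pi> ps" unfolding represents_def using q by (auto simp: low_space_def)
  then show ?thesis by blast
qed

text \<open>
  The curvature \<open>kbound + 1\<close> exceeds the loss \<open>kbound\<close> per inverted pair, so convexity gives
  the strict inequality that \<open>low_mult\<close> requires.
\<close>

lemma gram_product:
  assumes "k \<le> n" "a \<in> low_space s k (\<pi> k) \<pi>" "b \<in> low_space s (n - k) (d - \<pi> k) (\<lambda>j. \<pi> (k + j) - \<pi> k)"
    and c: "curved (kbound + 1) n \<pi>"
  shows "a * b \<in> low_space s n d \<pi>"
    and "length u = k \<Longrightarrow> length v = n - k \<Longrightarrow> hgt (opposite s) u \<le> \<pi> k \<Longrightarrow>
      gram s (a * b) (single (FWord (u @ v)) 1) = gram s a (single (FWord u) 1) * gram s b (single (FWord v) 1)"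
proof -
  have h: "homog s k (\<pi> k) a" "homog s (n - k) (d - \<pi> k) b" and l: "low s k \<pi> a" "low s (n - k) (\<lambda>j. \<pi> (k + j) - \<pi> k) b"
    using assms(2,3) by (auto simp: low_space_def)
  have len: "\<And>w. w \<in> keys a \<Longrightarrow> length (letters w) = k" "\<And>w. w \<in> keys b \<Longrightarrow> length (letters w) = n - k"
    using h by (auto simp: homog_def)
  have conv: "\<pi> (i + j) + kbound * int (j * (k - i)) < \<pi> i + \<pi> (k + j) - \<pi> k" if ij: "i < k" "0 < j" "k + j \<le> n" for i j
  proof -
    have "\<pi> (i + (k - i)) + \<pi> (i + j) + (kbound + 1) * int ((k - i) * j) \<le> \<pi> i + \<pi> (i + (k - i) + j)"
      by (rule curved_conv[OF c]) (use ij in simp)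
    moreover have "0 < int ((k - i) * j)" using ij by simp
    moreover have "(kbound + 1) * int ((k - i) * j) = kbound * int (j * (k - i)) + int ((k - i) * j)"
      by (simp add: distrib_right mult.commute)
    moreover have "i + (k - i) = k" using ij by simp
    ultimately show ?thesis by simp
  qed
  note lm = low_mult[OF assms(1) len l conv]
  have "homog s n d (a * b)" using homog_mult[OF h] assms(1) by simp
  then show "a * b \<in> low_space s n d \<pi>" using lm(1) by (simp add: low_space_def)
  show "length u = k \<Longrightarrow> length v = n - k \<Longrightarrow> hgt (opposite s) u \<le> \<pi> k \<Longrightarrow>
      gram s (a * b) (single (FWord (u @ v)) 1) = gram s a (single (FWord u) 1) * gram s b (single (FWord v) 1)"
    using lm(2)[of u v] by (simp add: gram_word)
qed

text \<open>
  Raising the path by one unit at one place. The form \<open>gram s x\<close>, restricted to the words whose prefix of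
  length \<open>k\<close> has the minimal height, is a bilinear form in the two parts of the word to which induction
  applies, so it is the form of a combination of products.
\<close>

lemma raise_path:
  assumes k: "0 < k" "k < n" and c: "curved (kbound + 1) n \<pi>" and e: "\<pi> 0 = 0" "\<pi> n = d"
    and r1: "represents s k (\<pi> k) \<pi> ps" and r2: "represents s (n - k) (d - \<pi> k) (\<lambda>j. \<pi> (k + j) - \<pi> k) qs"
    and x: "x \<in> low_space s n d \<pi>"
  shows "\<exists>z. homog s n d z \<and> (\<forall>w\<in>keys z. hgt s (take k (letters w)) = \<pi> k) \<and> x - z \<in> low_space s n d (\<pi>(k := \<pi> k + 1))"
proof -
  let ?t = "opposite s" and ?\<pi> = "\<lambda>j. \<pi> (k + j) - \<pi> k" and ?\<rho> = "\<pi>(k := \<pi> k + 1)"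
  have ps: "fst q \<in> low_space s k (\<pi> k) \<pi>" "homog ?t k (\<pi> k) (snd q)" if "q \<in> set ps" for q
    using r1 that by (auto simp: represents_def)
  have qs: "fst q \<in> low_space s (n - k) (d - \<pi> k) ?\<pi>" "homog ?t (n - k) (d - \<pi> k) (snd q)" if "q \<in> set qs" for q
    using r2 that by (auto simp: represents_def)
  define T where "T q q' = single 0 (gram s x (snd q * snd q')) * (fst q * fst q')"
    for q q' :: "('i, 'k) free \<times> ('i, 'k) free"
  define z where "z = (\<Sum>q\<leftarrow>ps. \<Sum>q'\<leftarrow>qs. T q q')"
  have TY: "T q q' \<in> low_space s n d \<pi>" if "q \<in> set ps" "q' \<in> set qs" for q q'
    using gram_product(1)[OF less_imp_le[OF k(2)] ps(1)[OF that(1)] qs(1)[OF that(2)] c] subspace_low_space[of s n d \<pi>]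
    unfolding T_def subspace_def by blast
  have zY: "z \<in> low_space s n d \<pi>" unfolding z_def low_space_def mem_Collect_eq
    by (intro conjI homog_sum_list low_sum_list) (use TY in \<open>auto simp: low_space_def\<close>)
  have x0: "gram s x (single w 1) = 0" if "dips ?t n \<pi> (letters w)" for w
    using x that unfolding low_space_iff[OF e] by blast
  have xz: "x - z \<in> low_space s n d \<pi>" using subspace_low_space[of s n d \<pi>] x zY unfolding subspace_def by blast
  have kz: "hgt s (take k (letters w)) = \<pi> k" if w: "w \<in> keys z" for w
  proof -
    have kT: "hgt s (take k (letters w)) = \<pi> k" if q: "q \<in> set ps" "q' \<in> set qs" and w: "w \<in> keys (T q q')" for w q q'
    proof -
      have "w \<in> keys (fst q * fst q')" using w keys_smult unfolding T_def by blast
      then obtain w1 w2 where w12: "w = w1 + w2" "w1 \<in> keys (fst q)" using keys_mult[of "fst q" "fst q'"] by auto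
      then have "length (letters w1) = k" "hgt s (letters w1) = \<pi> k" using ps(1)[OF q(1)] by (auto simp: low_space_def homog_def)
      then show ?thesis by (simp add: w12(1))
    qed
    have kl: "\<exists>a\<in>set as. w \<in> keys (f a)" if "w \<in> keys (\<Sum>a\<leftarrow>as. f a)"
      for as :: "(('i, 'k) free \<times> ('i, 'k) free) list" and f :: "_ \<Rightarrow> ('i, 'k) free" and w
      using that
    proof (induction as)
      case (Cons a as)
      then show ?case using Poly_Mapping.keys_add[of "f a" "\<Sum>a\<leftarrow>as. f a"] by auto
    qed simp
    show ?thesis using w unfolding z_def by (blast dest: kl intro: kT)
  qed
  have "gram s (x - z) (single w 1) = 0" if b: "dips ?t n ?\<rho> (letters w)" for w
  proof (rule ccontr)
    assume nz: "gram s (x - z) (single w 1) \<noteq> 0"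
    have hw: "length (letters w) = n" "hgt ?t (letters w) = d" using gram_hom[of s n d "x - z" w] xz nz by (auto simp: low_space_def)
    have nb: "\<not> dips ?t n \<pi> (letters w)" using nz xz unfolding low_space_iff[OF e] by blast
    define u where "u = take k (letters w)"
    define v where "v = drop k (letters w)"
    have w: "w = FWord (u @ v)" by (simp add: u_def v_def)
    have len: "length u = k" "length v = n - k" using hw k by (auto simp: u_def v_def)
    obtain j where j: "0 < j" "j < n" "hgt ?t (take j (letters w)) < ?\<rho> j" using b unfolding dips_def by blast
    have "j = k" using nb j unfolding dips_def by (auto split: if_splits)
    then have "hgt ?t u < \<pi> k + 1" using j by (simp add: u_def)
    moreover have "\<not> hgt ?t u < \<pi> k" using nb k unfolding dips_def u_def by blast
    ultimately have hu: "hgt ?t u = \<pi> k" by simp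
    then have hv: "hgt ?t v = d - \<pi> k" using hw(2) unfolding w by simp
    \<comment> \<open>The hypotheses for the two shorter lengths are applied to the two parts of the word in turn.\<close>
    have 1: "gram s x (single (FWord u) 1 * single (FWord v) 1) =
       (\<Sum>q\<leftarrow>ps. gram s x (snd q * single (FWord v) 1) * gram s (fst q) (single (FWord u) 1))"
    proof -
      let ?L = "\<lambda>y. gram s x (y * single (FWord v) 1)"
      have "linear_form ?L" unfolding linear_form_def by (simp add: left_diff_distrib mult.assoc gram_right(2))
      moreover have "\<forall>r. ups ?t r = 0 \<longrightarrow> ?L r = 0"
      proof (intro allI impI)
        fix r assume "ups ?t r = 0"
        then have "ups ?t (1 * r * single (FWord v) 1) = 0" by (rule ups_rad_ideal)
        then show "?L r = 0" using gram_rad[of ?t "r * single (FWord v) 1" x] gram_sym[of s x] by simp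
      qed
      moreover have "?L (single w' 1) = 0" if w': "length (letters w') = k" "dips ?t k \<pi> (letters w')" for w'
      proof -
        obtain j where "0 < j" "j < k" "hgt ?t (take j (letters w')) < \<pi> j" using w'(2) unfolding dips_def by blast
        then have "dips ?t n \<pi> (letters (w' + FWord v))" using k w'(1) unfolding dips_def by (intro exI[of _ j]) auto
        then show ?thesis using x0 by (simp add: mult_single)
      qed
      moreover have "homog ?t k (\<pi> k) (single (FWord u) (1 :: 'k))" using len hu by (simp add: homog_def)
      ultimately show ?thesis using represents_form[OF r1, of ?L] by blast
    qed
    have 2: "gram s x (snd q * single (FWord v) 1) =
       (\<Sum>q'\<leftarrow>qs. gram s x (snd q * snd q') * gram s (fst q') (single (FWord v) 1))" if q: "q \<in> set ps" for q
    proof -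
      let ?L = "\<lambda>y. gram s x (snd q * y)"
      have "linear_form ?L" unfolding linear_form_def by (simp add: right_diff_distrib single_0_commute gram_right(2))
      moreover have "\<forall>r. ups ?t r = 0 \<longrightarrow> ?L r = 0"
      proof (intro allI impI)
        fix r assume "ups ?t r = 0"
        then have "ups ?t (snd q * r * 1) = 0" by (rule ups_rad_ideal)
        then show "?L r = 0" using gram_rad[of ?t "snd q * r" x] gram_sym[of s x] by simp
      qed
      moreover have "?L (single w' 1) = 0" if w': "length (letters w') = n - k" "dips ?t (n - k) ?\<pi> (letters w')" for w'
      proof (rule gram_dips_zero[OF e x])
        fix w assume "w \<in> keys (snd q * single w' 1)"
        then obtain w1 where w1: "w = w1 + w'" "w1 \<in> keys (snd q)" using keys_mult[of "snd q" "single w' 1"] by auto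
        have h1: "length (letters w1) = k" "hgt ?t (letters w1) = \<pi> k" using ps(2)[OF q] w1(2) by (auto simp: homog_def)
        obtain j where "0 < j" "j < n - k" "hgt ?t (take j (letters w')) < ?\<pi> j" using w'(2) unfolding dips_def by blast
        then show "dips ?t n \<pi> (letters w)" using h1 unfolding dips_def w1(1) by (intro exI[of _ "k + j"]) auto
      qed
      moreover have "homog ?t (n - k) (d - \<pi> k) (single (FWord v) (1 :: 'k))" using len hv by (simp add: homog_def)
      ultimately show ?thesis using represents_form[OF r2, of ?L] by blast
    qed
    have ww: "single w 1 = single (FWord u) 1 * (single (FWord v) 1 :: ('i, 'k) free)" by (simp add: w mult_single plus_fword_def)
    have "gram s z (single w 1) = (\<Sum>q\<leftarrow>ps. \<Sum>q'\<leftarrow>qs. gram s (T q q') (single w 1))"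
      unfolding z_def gram_left(5) ..
    also have "\<dots> = (\<Sum>q\<leftarrow>ps. gram s x (snd q * single (FWord v) 1) * gram s (fst q) (single (FWord u) 1))"
    proof (rule arg_cong[of _ _ sum_list], rule map_cong[OF refl])
      fix q assume q: "q \<in> set ps"
      have "(\<Sum>q'\<leftarrow>qs. gram s (T q q') (single w 1)) =
        (\<Sum>q'\<leftarrow>qs. gram s x (snd q * snd q') * gram s (fst q') (single (FWord v) 1) * gram s (fst q) (single (FWord u) 1))"
      proof (rule arg_cong[of _ _ sum_list], rule map_cong[OF refl])
        fix q' assume q': "q' \<in> set qs"
        have "gram s (fst q * fst q') (single w 1) = gram s (fst q) (single (FWord u) 1) * gram s (fst q') (single (FWord v) 1)"
          unfolding w by (rule gram_product(2)[OF less_imp_le[OF k(2)] ps(1)[OF q] qs(1)[OF q'] c len]) (simp add: hu)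
        then show "gram s (T q q') (single w 1) =
            gram s x (snd q * snd q') * gram s (fst q') (single (FWord v) 1) * gram s (fst q) (single (FWord u) 1)"
          unfolding T_def gram_left(2) by (simp add: mult_ac)
      qed
      then show "(\<Sum>q'\<leftarrow>qs. gram s (T q q') (single w 1)) =
          gram s x (snd q * single (FWord v) 1) * gram s (fst q) (single (FWord u) 1)"
        unfolding 2[OF q] by (simp add: sum_list_mult_const)
    qed
    also have "\<dots> = gram s x (single w 1)" unfolding 1[symmetric] ww ..
    finally show False using nz by simp
  qed
  then have "x - z \<in> low_space s n d ?\<rho>"
    using low_space_iff[of ?\<rho> n d "x - z" s] e k xz by (simp add: low_space_def)
  then show ?thesis using zY kz by (auto simp: low_space_def)
qed

text \<open>
  The path \<open>\<pi>\<close> with all inner values lowered by \<open>t\<close>, and those up to \<open>j\<close> raised again by one.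
\<close>

definition lowered :: "nat \<Rightarrow> (nat \<Rightarrow> int) \<Rightarrow> nat \<Rightarrow> nat \<Rightarrow> nat \<Rightarrow> int" where
  "lowered n \<pi> t j k = (if 0 < k \<and> k < n then \<pi> k - int t + (if k \<le> j then 1 else 0) else \<pi> k)"

lemma curved_lowered: "curved (c + 1) n \<pi> \<Longrightarrow> 1 \<le> t \<Longrightarrow> curved c n (lowered n \<pi> t j)"
  unfolding curved_def
proof (intro allI impI)
  fix k assume a: "\<forall>k>0. k < n \<longrightarrow> c + 1 + 2 * \<pi> k \<le> \<pi> (k - 1) + \<pi> (k + 1)" "1 \<le> t" "0 < k" "k < n"
  have "c + 1 + 2 * \<pi> k \<le> \<pi> (k - 1) + \<pi> (k + 1)" using a by blast
  then show "c + 2 * lowered n \<pi> t j k \<le> lowered n \<pi> t j (k - 1) + lowered n \<pi> t j (k + 1)"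
    using a(2-4) by (auto simp: lowered_def)
qed

text \<open>
  Raising the inner values one by one from \<open>lowered n \<pi> (t + 1) 0\<close> to \<open>lowered n \<pi> t 0\<close> costs at
  most one unit of curvature in between. For this reason the required curvature
  grows with \<open>n\<close>: the shorter paths in the induction inherit the curvature of the path that is being raised.
\<close>

lemma represents_exists:
  "curved (kbound + 1 + int n) n \<pi> \<Longrightarrow> \<pi> 0 = 0 \<Longrightarrow> \<pi> n = d \<Longrightarrow> \<exists>ps. represents s n d \<pi> ps"
proof (induction n arbitrary: s d \<pi> rule: less_induct)
  case (less n)
  note e = less.prems(2,3)
  have "splits s n d \<pi>" for s
  proof -
    let ?t = "opposite s" and ?\<rho> = "lowered n \<pi>"
    have descent: "\<exists>y\<in>low_space s n d \<pi>. \<forall>w\<in>keys (x - y). dips s n \<pi> (letters w)" if "x \<in> low_space s n d (?\<rho> t 0)" for t x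
      using that
    proof (induction t arbitrary: x)
      case 0
      have "?\<rho> 0 0 = \<pi>" by (auto simp: lowered_def)
      then show ?case using 0 by (intro bexI[of _ x]) auto
    next
      case (Suc t)
      have "j \<le> n - 1 \<Longrightarrow> \<exists>z. homog s n d z \<and> (\<forall>w\<in>keys z. dips s n \<pi> (letters w)) \<and> x - z \<in> low_space s n d (?\<rho> (Suc t) j)" for j
      proof (induction j)
        case 0
        then show ?case using Suc.prems by (intro exI[of _ 0]) auto
      next
        case (Suc j)
        then obtain z where z: "homog s n d z" "\<And>w. w \<in> keys z \<Longrightarrow> dips s n \<pi> (letters w)" "x - z \<in> low_space s n d (?\<rho> (Suc t) j)" by auto
        let ?r = "?\<rho> (Suc t) j" and ?k = "Suc j"
        have k: "0 < ?k" "?k < n" using Suc.prems by auto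
        have c: "curved (kbound + int n) n ?r" by (rule curved_lowered) (use less.prems(1) in \<open>simp_all add: algebra_simps\<close>)
        have r0: "?r 0 = 0" "?r n = d" using e by (auto simp: lowered_def)
        obtain ps where ps: "represents s ?k (?r ?k) ?r ps"
          using less.IH[OF k(2) curved_mono[OF c] r0(1) refl] k by auto
        obtain qs where qs: "represents s (n - ?k) (d - ?r ?k) (\<lambda>j. ?r (?k + j) - ?r ?k) qs"
        proof -
          have "curved (kbound + 1 + int (n - ?k)) (n - ?k) (\<lambda>j. ?r (?k + j) - ?r ?k)"
            by (rule curved_mono[OF curved_shift[OF c]]) (use k in auto)
          moreover have "?r (?k + (n - ?k)) - ?r ?k = d - ?r ?k" using k r0(2) by simp
          ultimately show ?thesis using less.IH[of "n - ?k" "\<lambda>j. ?r (?k + j) - ?r ?k"] k that by auto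
        qed
        have "curved (kbound + 1) n ?r" by (rule curved_mono[OF c]) (use k in auto)
        then obtain z' where z': "homog s n d z'" "\<And>w. w \<in> keys z' \<Longrightarrow> hgt s (take ?k (letters w)) = ?r ?k"
          "x - z - z' \<in> low_space s n d (?r(?k := ?r ?k + 1))"
          using raise_path[OF k _ r0 ps qs z(3)] by blast
        have "?r(?k := ?r ?k + 1) = ?\<rho> (Suc t) ?k" using k by (auto simp: lowered_def fun_eq_iff)
        moreover have "dips s n \<pi> (letters w)" if "w \<in> keys z'" for w
          using z'(2)[OF that] k unfolding dips_def by (intro exI[of _ ?k]) (auto simp: lowered_def)
        ultimately show ?case
          using z z' homog_add[OF z(1) z'(1)] Poly_Mapping.keys_add[of z z'] by (intro exI[of _ "z + z'"]) (auto simp: diff_diff_eq)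
      qed
      from this[OF order_refl] obtain z where z: "homog s n d z" "\<And>w. w \<in> keys z \<Longrightarrow> dips s n \<pi> (letters w)"
        "x - z \<in> low_space s n d (?\<rho> (Suc t) (n - 1))" by blast
      have "?\<rho> (Suc t) (n - 1) = ?\<rho> t 0" by (auto simp: lowered_def fun_eq_iff)
      then obtain y where y: "y \<in> low_space s n d \<pi>" "\<And>w. w \<in> keys (x - z - y) \<Longrightarrow> dips s n \<pi> (letters w)"
        using Suc.IH[of "x - z"] z(3) by auto
      have "x - y = z + (x - z - y)" by simp
      then have "dips s n \<pi> (letters w)" if "w \<in> keys (x - y)" for w
        using that Poly_Mapping.keys_add[of z "x - z - y"] z(2) y(2) by auto
      then show ?case using y(1) by blast
    qed
    show ?thesis
      unfolding splits_def
    proof (intro allI impI)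
      fix x :: "('i, 'k) free" assume x: "homog s n d x"
      obtain A where A: "\<And>w j. free_pairing p ?t (single w 1) (ups s x) \<noteq> 0 \<Longrightarrow> - A \<le> hgt ?t (take j (letters w))"
        by (rule graded_bounded[OF graded_ups[of s x], of ?t]) blast
      have g: "gram s x v = free_pairing p ?t v (ups s x)" for v using gram_sym[of s x v] by (simp add: gram_def)
      define t where "t = nat (\<bar>A\<bar> + (\<Sum>j\<le>n. \<bar>\<pi> j\<bar>))"
      have "gram s x (single w 1) = 0" if b: "dips ?t n (?\<rho> t 0) (letters w)" for w
      proof (rule ccontr)
        assume nz: "gram s x (single w 1) \<noteq> 0"
        obtain k where k: "0 < k" "k < n" "hgt ?t (take k (letters w)) < ?\<rho> t 0 k" using b unfolding dips_def by blast
        have "\<bar>\<pi> k\<bar> \<le> (\<Sum>j\<le>n. \<bar>\<pi> j\<bar>)" by (rule member_le_sum) (use k in auto)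
        moreover have "int t = \<bar>A\<bar> + (\<Sum>j\<le>n. \<bar>\<pi> j\<bar>)" unfolding t_def by (rule int_nat_eq[THEN trans]) (simp add: sum_nonneg)
        moreover have "- A \<le> hgt ?t (take k (letters w))" using A[of w k] nz unfolding g by blast
        ultimately show False using k by (simp add: lowered_def)
      qed
      moreover have "?\<rho> t 0 0 = 0" "?\<rho> t 0 n = d" using e by (auto simp: lowered_def)
      ultimately have "x \<in> low_space s n d (?\<rho> t 0)" using low_space_iff[of "?\<rho> t 0" n d x s] x by blast
      then show "\<exists>y\<in>low_space s n d \<pi>. \<forall>w\<in>keys (x - y). dips s n \<pi> (letters w)" by (rule descent)
    qed
  qed
  then show ?case by (intro splits_imp_represents e)
qed

text \<open>
  Only finitely many lengths and heights contribute to the pairing with \<open>R\<close>. In each of them the words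
  with a prefix of height below \<open>- A\<close> pair to zero with \<open>R\<close>, so the form is represented along a path
  that stays below \<open>- A\<close> inside.
\<close>

lemma orthogonal_in_image:
  assumes R: "graded R" and rad: "\<And>u. ups (opposite s) u = 0 \<Longrightarrow> free_pairing p (opposite s) u R = 0"
  shows "\<exists>y. R = ups s y"
proof -
  let ?t = "opposite s"
  let ?L = "\<lambda>u. free_pairing p ?t u R"
  have L: "linear_form ?L" unfolding linear_form_def by (simp add: free_pairing_cmult)
  obtain A where A: "A \<ge> 0" "\<And>w j. ?L (single w 1) \<noteq> 0 \<Longrightarrow> - A \<le> hgt ?t (take j (letters w))"
    "\<And>w. ?L (single w 1) \<noteq> 0 \<Longrightarrow> hgt ?t (letters w) \<le> A"
    by (rule graded_bounded[OF R, of ?t]) blast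
  have "\<exists>y. homog s n d y \<and> (\<forall>u. homog ?t n d u \<longrightarrow> ?L u = gram s y u)" for n d
  proof (cases "n > 0 \<or> d = 0")
    case False
    have "u = 0" if "homog ?t n d u" for u :: "('i, 'k) free"
    proof -
      have "keys u = {}"
      proof (rule ccontr)
        assume "keys u \<noteq> {}"
        then obtain w where "w \<in> keys u" by blast
        then have "letters w = []" "hgt ?t (letters w) = d" using \<open>homog ?t n d u\<close> False by (auto simp: homog_def)
        then show False using False by simp
      qed
      then show ?thesis by simp
    qed
    then have "?L u = gram s 0 u" if "homog ?t n d u" for u using that by fastforce
    then show ?thesis by (intro exI[of _ 0]) simp
  next
    case True
    obtain \<pi> where \<pi>: "curved (kbound + 1 + int n) n \<pi>" "\<pi> 0 = 0" "\<pi> n = d" "\<And>k. 0 < k \<Longrightarrow> k < n \<Longrightarrow> \<pi> k \<le> - A"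
      by (rule exists_curved_path[OF True, of "kbound + 1 + int n" A]) blast
    obtain ps where ps: "represents s n d \<pi> ps" using represents_exists[OF \<pi>(1-3)] by blast
    have Lb: "?L (single w 1) = 0" if "dips ?t n \<pi> (letters w)" for w
    proof (rule ccontr)
      assume nz: "?L (single w 1) \<noteq> 0"
      obtain k where "0 < k" "k < n" "hgt ?t (take k (letters w)) < \<pi> k" using \<open>dips ?t n \<pi> (letters w)\<close> unfolding dips_def by blast
      then show False using A(2)[OF nz, of k] \<pi>(4)[of k] by simp
    qed
    define y where "y = (\<Sum>q\<leftarrow>ps. single 0 (?L (snd q)) * fst q)"
    have "homog s n d y" unfolding y_def by (intro homog_sum_list homog_smult) (use ps in \<open>auto simp: represents_def low_space_def\<close>)
    moreover have "?L u = gram s y u" if "homog ?t n d u" for u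
    proof -
      have "?L u = (\<Sum>q\<leftarrow>ps. ?L (snd q) * gram s (fst q) u)"
        using ps L rad Lb that unfolding represents_def by blast
      then show ?thesis unfolding y_def gram_left(5,2) .
    qed
    ultimately show ?thesis by blast
  qed
  then obtain y where y: "\<And>n d. homog s n d (y n d)" "\<And>n d u. homog ?t n d u \<Longrightarrow> ?L u = gram s (y n d) u" by metis
  define D where "D = (\<lambda>m. \<Sum>i\<in>UNIV. m i) ` keys R \<times> {- A..A}"
  define z where "z = (\<Sum>(n, d)\<in>D. y n d)"
  have "R + ups s (0 - z) = 0"
  proof (rule free_pairing_nondegenerate)
    show g: "graded (R + ups s (0 - z))"
      using R graded_ups[of s "0 - z"] unfolding graded_def lookup_add by (blast intro: V_graded_add)
    fix w :: "('i \<times> int) fword"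
    let ?n = "length (letters w)" and ?d = "hgt ?t (letters w)"
    have yw: "gram s (y n d) (single w 1) = (if (n, d) = (?n, ?d) then ?L (single w 1) else 0)" for n d
    proof (cases "(n, d) = (?n, ?d)")
      case True
      then have "homog ?t n d (single w (1 :: 'k))" by (simp add: homog_def)
      then show ?thesis unfolding if_P[OF True] by (rule y(2)[symmetric])
    next
      case False
      then show ?thesis unfolding if_not_P[OF False] using gram_hom[OF y(1)[of n d], of w] by blast
    qed
    have "gram s z (single w 1) = (\<Sum>q\<in>D. if q = (?n, ?d) then ?L (single w 1) else 0)"
      unfolding z_def gram_left(6)
    proof (rule sum.cong[OF refl])
      fix q show "gram s (case q of (n, d) \<Rightarrow> y n d) (single w 1) = (if q = (?n, ?d) then ?L (single w 1) else 0)"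
        by (cases q) (simp only: prod.case yw)
    qed
    also have "\<dots> = ?L (single w 1)"
    proof -
      have "finite D" by (simp add: D_def)
      moreover have "?L (single w 1) = 0" if "(?n, ?d) \<notin> D"
      proof (rule ccontr)
        assume nz: "?L (single w 1) \<noteq> 0"
        then have "word_weight (letters w) \<in> keys R" by (auto simp: in_keys_iff)
        then have "?n \<in> (\<lambda>m. \<Sum>i\<in>UNIV. m i) ` keys R" using sum_word_weight[of "letters w"] by (metis imageI)
        moreover have "- A \<le> ?d" "?d \<le> A" using A(2)[OF nz, of ?n] A(3)[OF nz] by auto
        ultimately show False using that by (simp add: D_def)
      qed
      ultimately show ?thesis by auto
    qed
    finally have "gram s z (single w 1) = ?L (single w 1)" .
    then have "free_pairing p ?t (single w 1) (ups s (0 - z)) = - ?L (single w 1)"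
      using gram_sym[of s "0 - z" "single w 1"] gram_simps(5)[of s 0 z "single w 1"] by (simp add: gram_def)
    then show "free_pairing p ?t (single w 1) (R + ups s (0 - z)) = 0"
      using free_pairing_add_right[OF R graded_ups] by simp
  qed
  then have "R = ups s z" unfolding ups_simps(3) by simp
  then show ?thesis ..
qed

end

section \<open>Algebras, ideals and quotients\<close>

text \<open>
  The axioms of an algebra pass to images. For the big shuffle algebra this avoids a
  direct proof of associativity: only its subalgebra that is the image of the free algebra is needed.
\<close>

definition onto_hom :: "('k::field, 'a, 'm) module_scheme \<Rightarrow> ('k, 'b, 'n) module_scheme \<Rightarrow> ('a \<Rightarrow> 'b) \<Rightarrow> bool" where
  "onto_hom A B h \<longleftrightarrow> carrier B = h ` carrier A \<and>
     (\<forall>x\<in>carrier A. \<forall>y\<in>carrier A. h (x \<otimes>\<^bsub>A\<^esub> y) = h x \<otimes>\<^bsub>B\<^esub> h y \<and> h (x \<oplus>\<^bsub>A\<^esub> y) = h x \<oplus>\<^bsub>B\<^esub> h y) \<and>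
     h \<one>\<^bsub>A\<^esub> = \<one>\<^bsub>B\<^esub> \<and> h \<zero>\<^bsub>A\<^esub> = \<zero>\<^bsub>B\<^esub> \<and>
     (\<forall>c. \<forall>x\<in>carrier A. h (c \<odot>\<^bsub>A\<^esub> x) = c \<odot>\<^bsub>B\<^esub> h x)"

lemma onto_homD:
  assumes "onto_hom A B h"
  shows "carrier B = h ` carrier A" "x \<in> carrier A \<Longrightarrow> h x \<in> carrier B"
    "x \<in> carrier A \<Longrightarrow> y \<in> carrier A \<Longrightarrow> h x \<otimes>\<^bsub>B\<^esub> h y = h (x \<otimes>\<^bsub>A\<^esub> y)"
    "x \<in> carrier A \<Longrightarrow> y \<in> carrier A \<Longrightarrow> h x \<oplus>\<^bsub>B\<^esub> h y = h (x \<oplus>\<^bsub>A\<^esub> y)"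
    "\<one>\<^bsub>B\<^esub> = h \<one>\<^bsub>A\<^esub>" "\<zero>\<^bsub>B\<^esub> = h \<zero>\<^bsub>A\<^esub>" "x \<in> carrier A \<Longrightarrow> c \<odot>\<^bsub>B\<^esub> h x = h (c \<odot>\<^bsub>A\<^esub> x)"
  using assms by (auto simp: onto_hom_def)

lemma is_algebraD:
  fixes A :: "('k::field, 'a, 'm) module_scheme"
  assumes "is_algebra A"
  shows "ring A" "x \<in> carrier A \<Longrightarrow> c \<odot>\<^bsub>A\<^esub> x \<in> carrier A"
    "x \<in> carrier A \<Longrightarrow> y \<in> carrier A \<Longrightarrow> c \<odot>\<^bsub>A\<^esub> (x \<oplus>\<^bsub>A\<^esub> y) = c \<odot>\<^bsub>A\<^esub> x \<oplus>\<^bsub>A\<^esub> c \<odot>\<^bsub>A\<^esub> y"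
    "x \<in> carrier A \<Longrightarrow> (c + d) \<odot>\<^bsub>A\<^esub> x = c \<odot>\<^bsub>A\<^esub> x \<oplus>\<^bsub>A\<^esub> d \<odot>\<^bsub>A\<^esub> x"
    "x \<in> carrier A \<Longrightarrow> (c * d) \<odot>\<^bsub>A\<^esub> x = c \<odot>\<^bsub>A\<^esub> (d \<odot>\<^bsub>A\<^esub> x)"
    "x \<in> carrier A \<Longrightarrow> 1 \<odot>\<^bsub>A\<^esub> x = x"
    "x \<in> carrier A \<Longrightarrow> y \<in> carrier A \<Longrightarrow> (c \<odot>\<^bsub>A\<^esub> x) \<otimes>\<^bsub>A\<^esub> y = c \<odot>\<^bsub>A\<^esub> (x \<otimes>\<^bsub>A\<^esub> y)"
    "x \<in> carrier A \<Longrightarrow> y \<in> carrier A \<Longrightarrow> x \<otimes>\<^bsub>A\<^esub> (c \<odot>\<^bsub>A\<^esub> y) = c \<odot>\<^bsub>A\<^esub> (x \<otimes>\<^bsub>A\<^esub> y)"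
proof -
  have m: "module (ring_of_type_algebra :: 'k ring) A" using assms by (simp add: is_algebra_def)
  show "ring A" using assms by (simp add: is_algebra_def)
  note s = ring_of_type_algebra_def
  show "x \<in> carrier A \<Longrightarrow> c \<odot>\<^bsub>A\<^esub> x \<in> carrier A"
    "x \<in> carrier A \<Longrightarrow> y \<in> carrier A \<Longrightarrow> c \<odot>\<^bsub>A\<^esub> (x \<oplus>\<^bsub>A\<^esub> y) = c \<odot>\<^bsub>A\<^esub> x \<oplus>\<^bsub>A\<^esub> c \<odot>\<^bsub>A\<^esub> y"
    "x \<in> carrier A \<Longrightarrow> (c + d) \<odot>\<^bsub>A\<^esub> x = c \<odot>\<^bsub>A\<^esub> x \<oplus>\<^bsub>A\<^esub> d \<odot>\<^bsub>A\<^esub> x"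
    "x \<in> carrier A \<Longrightarrow> (c * d) \<odot>\<^bsub>A\<^esub> x = c \<odot>\<^bsub>A\<^esub> (d \<odot>\<^bsub>A\<^esub> x)"
    "x \<in> carrier A \<Longrightarrow> 1 \<odot>\<^bsub>A\<^esub> x = x"
    using module.smult_closed[OF m, of c x] module.smult_r_distr[OF m, of c x y] module.smult_l_distr[OF m, of c d x]
      module.smult_assoc1[OF m, of c d x] module.smult_one[OF m, of x] by (auto simp: s)
  show "x \<in> carrier A \<Longrightarrow> y \<in> carrier A \<Longrightarrow> (c \<odot>\<^bsub>A\<^esub> x) \<otimes>\<^bsub>A\<^esub> y = c \<odot>\<^bsub>A\<^esub> (x \<otimes>\<^bsub>A\<^esub> y)"
    "x \<in> carrier A \<Longrightarrow> y \<in> carrier A \<Longrightarrow> x \<otimes>\<^bsub>A\<^esub> (c \<odot>\<^bsub>A\<^esub> y) = c \<odot>\<^bsub>A\<^esub> (x \<otimes>\<^bsub>A\<^esub> y)"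
    using assms by (auto simp: is_algebra_def)
qed

lemma is_algebraI:
  fixes A :: "('k::field, 'a, 'm) module_scheme"
  assumes "ring A" "\<And>c x. x \<in> carrier A \<Longrightarrow> c \<odot>\<^bsub>A\<^esub> x \<in> carrier A"
    "\<And>c x y. x \<in> carrier A \<Longrightarrow> y \<in> carrier A \<Longrightarrow> c \<odot>\<^bsub>A\<^esub> (x \<oplus>\<^bsub>A\<^esub> y) = c \<odot>\<^bsub>A\<^esub> x \<oplus>\<^bsub>A\<^esub> c \<odot>\<^bsub>A\<^esub> y"
    "\<And>c d x. x \<in> carrier A \<Longrightarrow> (c + d) \<odot>\<^bsub>A\<^esub> x = c \<odot>\<^bsub>A\<^esub> x \<oplus>\<^bsub>A\<^esub> d \<odot>\<^bsub>A\<^esub> x"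
    "\<And>c d x. x \<in> carrier A \<Longrightarrow> (c * d) \<odot>\<^bsub>A\<^esub> x = c \<odot>\<^bsub>A\<^esub> (d \<odot>\<^bsub>A\<^esub> x)"
    "\<And>x. x \<in> carrier A \<Longrightarrow> 1 \<odot>\<^bsub>A\<^esub> x = x"
    "\<And>c x y. x \<in> carrier A \<Longrightarrow> y \<in> carrier A \<Longrightarrow> (c \<odot>\<^bsub>A\<^esub> x) \<otimes>\<^bsub>A\<^esub> y = c \<odot>\<^bsub>A\<^esub> (x \<otimes>\<^bsub>A\<^esub> y)"
    "\<And>c x y. x \<in> carrier A \<Longrightarrow> y \<in> carrier A \<Longrightarrow> x \<otimes>\<^bsub>A\<^esub> (c \<odot>\<^bsub>A\<^esub> y) = c \<odot>\<^bsub>A\<^esub> (x \<otimes>\<^bsub>A\<^esub> y)"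
  shows "is_algebra A"
proof -
  have "module (ring_of_type_algebra :: 'k ring) A"
    by (rule moduleI) (use assms ring.is_abelian_group in \<open>auto simp: ring_of_type_algebra_def intro!: cring_from_type_algebra[unfolded ring_of_type_algebra_def]\<close>)
  then show ?thesis using assms by (simp add: is_algebra_def)
qed

lemma image_is_algebra:
  assumes A: "is_algebra A" and h: "onto_hom A B h"
  shows "is_algebra B"
proof -
  interpret A: ring A by (rule is_algebraD(1)[OF A])
  note a = is_algebraD[OF A]
  note hh = onto_homD(3-7)[OF h]
  have ex: "\<exists>x'\<in>carrier A. x = h x'" if "x \<in> carrier B" for x using that onto_homD(1)[OF h] by auto
  have c: "carrier B = h ` carrier A" by (rule onto_homD(1)[OF h])
  have ab: "abelian_group B"
  proof (rule abelian_groupI)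
    show "\<exists>y\<in>carrier B. y \<oplus>\<^bsub>B\<^esub> x = \<zero>\<^bsub>B\<^esub>" if xB: "x \<in> carrier B" for x
    proof -
      obtain x' where x': "x' \<in> carrier A" "x = h x'" using ex[OF xB] by blast
      then have "h (\<ominus>\<^bsub>A\<^esub> x') \<oplus>\<^bsub>B\<^esub> x = \<zero>\<^bsub>B\<^esub>" by (simp add: hh A.l_neg)
      then show ?thesis using x' c by blast
    qed
  qed (auto simp: c hh A.a_assoc A.a_comm A.a_lcomm)
  have mo: "Group.monoid B"
    by (rule Group.monoidI) (auto simp: c hh A.m_assoc)
  have "ring B"
    by (rule ringI[OF ab mo]) (auto simp: c hh A.l_distr A.r_distr)
  then show ?thesis
    by (rule is_algebraI) (auto simp: c hh a(2-8))
qed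

lemma kernel_ideal:
  assumes A: "is_algebra A" and h: "onto_hom A B h"
  shows "ideal (a_kernel A B h) A"
proof -
  have "h \<in> ring_hom A B" by (rule ring_hom_memI) (use onto_homD[OF h] in auto)
  then have "ring_hom_ring A B h"
    using is_algebraD(1)[OF A] is_algebraD(1)[OF image_is_algebra[OF A h]] by (intro ring_hom_ringI2)
  then show ?thesis by (rule ring_hom_ring.kernel_is_ideal)
qed

lemma coset_eq_iff:
  assumes "is_algebra A" "ideal J A" "x \<in> carrier A" "y \<in> carrier A"
  shows "J +>\<^bsub>A\<^esub> x = J +>\<^bsub>A\<^esub> y \<longleftrightarrow> x \<ominus>\<^bsub>A\<^esub> y \<in> J"
  using ring.quotient_eq_iff_same_a_r_cos[OF is_algebraD(1)[OF assms(1)] assms(2-4)] by simp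

lemma the_elem_coset:
  assumes J: "ideal J A" and x: "x \<in> carrier A"
    and f: "\<And>y. y \<in> carrier A \<Longrightarrow> J +>\<^bsub>A\<^esub> y = J +>\<^bsub>A\<^esub> x \<Longrightarrow> f y = f x"
  shows "the_elem (f ` (J +>\<^bsub>A\<^esub> x)) = f x"
proof -
  interpret ideal J A by (rule J)
  have fx: "f y = f x" if y: "y \<in> J +>\<^bsub>A\<^esub> x" for y
  proof (rule f)
    show "y \<in> carrier A" using y a_r_coset_subset_G[OF a_subset x] by blast
    show "J +>\<^bsub>A\<^esub> y = J +>\<^bsub>A\<^esub> x" using a_repr_independence'[OF y x] by simp
  qed
  have "f ` (J +>\<^bsub>A\<^esub> x) = (\<lambda>_. f x) ` (J +>\<^bsub>A\<^esub> x)" by (rule image_cong[OF refl fx])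
  also have "\<dots> = {f x}" by (rule image_constant[OF a_rcos_self[OF x]])
  finally have "f ` (J +>\<^bsub>A\<^esub> x) = {f x}" .
  then show ?thesis by simp
qed

lemma quotient_algebra_onto:
  assumes A: "is_algebra A" and J: "ideal J A"
  shows "onto_hom A (quotient_algebra A J) (\<lambda>x. J +>\<^bsub>A\<^esub> x)"
proof -
  interpret J: ideal J A by (rule J)
  have sm: "(\<Union>x\<in>J +>\<^bsub>A\<^esub> y. J +>\<^bsub>A\<^esub> (c \<odot>\<^bsub>A\<^esub> x)) = J +>\<^bsub>A\<^esub> (c \<odot>\<^bsub>A\<^esub> y)" if y: "y \<in> carrier A" for c y
  proof -
    have "J +>\<^bsub>A\<^esub> (c \<odot>\<^bsub>A\<^esub> x) = J +>\<^bsub>A\<^esub> (c \<odot>\<^bsub>A\<^esub> y)" if x: "x \<in> J +>\<^bsub>A\<^esub> y" for x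
    proof -
      have xA: "x \<in> carrier A" using x J.a_r_coset_subset_G[OF J.a_subset y] by blast
      have "J +>\<^bsub>A\<^esub> x = J +>\<^bsub>A\<^esub> y" using J.a_repr_independence'[OF x y] by simp
      then have d: "x \<ominus>\<^bsub>A\<^esub> y \<in> J" using coset_eq_iff[OF A J xA y] by simp
      have m: "c \<odot>\<^bsub>A\<^esub> u = (c \<odot>\<^bsub>A\<^esub> \<one>\<^bsub>A\<^esub>) \<otimes>\<^bsub>A\<^esub> u" if "u \<in> carrier A" for u
        using is_algebraD(7)[OF A J.one_closed that] that by simp
      have cA: "c \<odot>\<^bsub>A\<^esub> \<one>\<^bsub>A\<^esub> \<in> carrier A" by (rule is_algebraD(2)[OF A J.one_closed])
      have "c \<odot>\<^bsub>A\<^esub> x \<ominus>\<^bsub>A\<^esub> c \<odot>\<^bsub>A\<^esub> y = (c \<odot>\<^bsub>A\<^esub> \<one>\<^bsub>A\<^esub>) \<otimes>\<^bsub>A\<^esub> (x \<ominus>\<^bsub>A\<^esub> y)"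
        unfolding m[OF xA] m[OF y] a_minus_def using xA y cA by (simp add: J.r_distr J.r_minus)
      also have "\<dots> \<in> J" by (rule J.I_l_closed[OF d cA])
      finally show ?thesis using coset_eq_iff[OF A J] is_algebraD(2)[OF A] xA y by blast
    qed
    then have "(\<Union>x\<in>J +>\<^bsub>A\<^esub> y. J +>\<^bsub>A\<^esub> (c \<odot>\<^bsub>A\<^esub> x)) = (\<Union>x\<in>J +>\<^bsub>A\<^esub> y. J +>\<^bsub>A\<^esub> (c \<odot>\<^bsub>A\<^esub> y))"
      by (intro SUP_cong refl)
    also have "\<dots> = J +>\<^bsub>A\<^esub> (c \<odot>\<^bsub>A\<^esub> y)" using J.a_rcos_self[OF y] by blast
    finally show ?thesis .
  qed
  show ?thesis
    unfolding onto_hom_def quotient_algebra_def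
    by (auto simp: ring.defs module.defs FactRing_simps J.rcoset_mult_add J.a_rcos_sum sm J.a_coset_join2 J.a_subset
        J.a_subgroup J.zero_closed)
qed

lemma free_algebra_is_algebra: "is_algebra (free_algebra :: ('k::field, ('i, 'k) free) module)"
proof -
  have "abelian_group (free_algebra :: ('k, ('i, 'k) free) module)"
    by (rule abelian_groupI) (auto simp: free_algebra_def add_ac intro: exI[of _ "- _"])
  moreover have "Group.monoid (free_algebra :: ('k, ('i, 'k) free) module)"
    by (rule Group.monoidI) (auto simp: free_algebra_def mult.assoc)
  ultimately have ring: "ring (free_algebra :: ('k, ('i, 'k) free) module)"
    by (rule ringI) (auto simp: free_algebra_def distrib_left distrib_right)
  have "single 0 1 * x = x" for x :: "('i, 'k) free" by (simp add: single_one)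
  moreover have "single 0 (c * d) = single 0 c * (single 0 d :: ('i, 'k) free)" for c d :: 'k by (simp add: mult_single)
  ultimately show ?thesis
  proof (intro is_algebraI[OF ring])
    fix c and x y :: "('i, 'k) free"
    show "x \<otimes>\<^bsub>free_algebra\<^esub> (c \<odot>\<^bsub>free_algebra\<^esub> y) = c \<odot>\<^bsub>free_algebra\<^esub> (x \<otimes>\<^bsub>free_algebra\<^esub> y)"
      by (simp add: free_algebra_def single_0_commute)
  qed (simp_all add: free_algebra_def single_add distrib_left distrib_right mult.assoc)
qed

lemma free_algebra_simps [simp]:
  "carrier free_algebra = UNIV" "x \<otimes>\<^bsub>free_algebra\<^esub> y = x * y" "x \<oplus>\<^bsub>free_algebra\<^esub> y = x + y"
  "\<one>\<^bsub>free_algebra\<^esub> = 1" "\<zero>\<^bsub>free_algebra\<^esub> = 0" "c \<odot>\<^bsub>free_algebra\<^esub> x = single 0 c * x"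
  by (simp_all add: free_algebra_def)

lemma free_algebra_minus [simp]: "x \<ominus>\<^bsub>free_algebra\<^esub> y = x - (y :: ('i, 'k::field) free)"
proof -
  interpret ring "free_algebra :: ('k, ('i, 'k) free) module" by (rule is_algebraD(1)[OF free_algebra_is_algebra])
  have "\<ominus>\<^bsub>free_algebra\<^esub> y = - y" by (rule minus_equality) auto
  then show ?thesis by (simp add: a_minus_def)
qed

lemma free_algebra_ideal:
  assumes "0 \<in> I" "\<And>x y. x \<in> I \<Longrightarrow> y \<in> I \<Longrightarrow> x - y \<in> I" "\<And>x y. x \<in> I \<Longrightarrow> y * x \<in> I" "\<And>x y. x \<in> I \<Longrightarrow> x * y \<in> I"
  shows "ideal I (free_algebra :: ('k::field, ('i, 'k) free) module)"
proof (rule idealI)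
  let ?F = "free_algebra :: ('k, ('i, 'k) free) module"
  show r: "ring ?F" by (rule is_algebraD(1)[OF free_algebra_is_algebra])
  interpret ring ?F by (rule r)
  have m: "\<ominus>\<^bsub>?F\<^esub> y = - y" for y by (rule minus_equality) auto
  show "subgroup I (add_monoid ?F)"
  proof
    fix x y assume xy: "x \<in> I" "y \<in> I"
    have "- y \<in> I" using assms(2)[OF assms(1) xy(2)] by simp
    then show "x \<otimes>\<^bsub>add_monoid ?F\<^esub> y \<in> I" using assms(2)[OF xy(1), of "- y"] by simp
  next
    fix x assume "x \<in> I"
    then have "- x \<in> I" using assms(2)[OF assms(1)] by fastforce
    then show "inv\<^bsub>add_monoid ?F\<^esub> x \<in> I" using m[of x] by (simp add: a_inv_def)
  qed (use assms(1) in auto)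
qed (use assms(3,4) in auto)

section \<open>Quantum loop groups and shuffle algebras\<close>

context zeta
begin

text \<open>The elements that are orthogonal to the whole big shuffle algebra in every context form a
  two-sided ideal. It contains the relations, hence the ideal that they generate.\<close>

lemma quadratic_ideal:
  shows "ideal (quadratic_ideal p s) free_algebra"
    and "x \<in> quadratic_ideal p s \<Longrightarrow> graded R \<Longrightarrow> free_pairing p s x R = 0"
proof -
  let ?I = "{x. \<forall>u v R. graded R \<longrightarrow> free_pairing p s (u * x * v) R = 0}"
  have r: "ring (free_algebra :: ('k, ('i, 'k) free) module)" by (rule is_algebraD(1)[OF free_algebra_is_algebra])
  show "ideal (quadratic_ideal p s) free_algebra"
    unfolding quadratic_ideal_def by (rule ring.genideal_ideal[OF r]) simp
  have lin: "linear_form (\<lambda>u. free_pairing p s (u * x * v) R)" "linear_form (\<lambda>v. free_pairing p s (u * x * v) R)" for u v x R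
    unfolding linear_form_def
    by (simp_all add: left_diff_distrib right_diff_distrib mult.assoc free_pairing_cmult)
       (simp_all add: single_0_commute free_pairing_cmult)
  have rel: "quadratic_relation p s i j a b \<in> ?I" for i j a b
  proof safe
    fix u v R assume R: "graded R"
    have w: "free_pairing p s (single w 1 * quadratic_relation p s i j a b * single w' 1) R = 0" for w w'
      using relation_free_pairing[OF R, of s "letters w" i j a b "letters w'"] by simp
    have wv: "free_pairing p s (single w 1 * quadratic_relation p s i j a b * v) R = 0" for w
      by (rule linear_zero[OF lin(2)]) (rule w)
    show "free_pairing p s (u * quadratic_relation p s i j a b * v) R = 0"
      by (rule linear_zero[OF lin(1)]) (rule wv)
  qed
  have "ideal ?I free_algebra"
  proof (rule free_algebra_ideal)
    fix x y assume x: "x \<in> ?I"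
    show "y * x \<in> ?I"
    proof safe
      fix u v R assume "graded R"
      then have "free_pairing p s ((u * y) * x * v) R = 0" using x by blast
      then show "free_pairing p s (u * (y * x) * v) R = 0" by (simp only: mult.assoc)
    qed
    show "x * y \<in> ?I"
    proof safe
      fix u v R assume "graded R"
      then have "free_pairing p s (u * x * (y * v)) R = 0" using x by blast
      then show "free_pairing p s (u * (x * y) * v) R = 0" by (simp only: mult.assoc)
    qed
  next
    fix x y assume "x \<in> ?I" "y \<in> ?I"
    then show "x - y \<in> ?I" by (simp add: left_diff_distrib right_diff_distrib)
  qed simp
  then have "quadratic_ideal p s \<subseteq> ?I"
    unfolding quadratic_ideal_def by (rule ring.genideal_minimal[OF r]) (use rel in auto)
  moreover assume "x \<in> quadratic_ideal p s" "graded R"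
  ultimately have "free_pairing p s (1 * x * 1) R = 0" by blast
  then show "free_pairing p s x R = 0" by simp
qed

lemma quadratic_ideal_ups: "x \<in> quadratic_ideal p s \<Longrightarrow> ups s x = 0"
  unfolding ups_eq_0_iff gram_def by (auto intro: quadratic_ideal(2))

definition tilde_class :: "half \<Rightarrow> ('i, 'k) free \<Rightarrow> ('i, 'k) free set" where
  "tilde_class s x = quadratic_ideal p s +>\<^bsub>free_algebra\<^esub> x"

lemma tilde_class_eq_iff: "tilde_class s x = tilde_class s y \<longleftrightarrow> x - y \<in> quadratic_ideal p s"
  unfolding tilde_class_def using coset_eq_iff[OF free_algebra_is_algebra quadratic_ideal(1), of x y s] by simp

lemma onto_tilde: "onto_hom free_algebra (qloop_tilde p s) (tilde_class s)"
  using quotient_algebra_onto[OF free_algebra_is_algebra quadratic_ideal(1)[of s]] by (simp add: qloop_tilde_def tilde_class_def[abs_def])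

lemma tilde_is_algebra: "is_algebra (qloop_tilde p s)"
  by (rule image_is_algebra[OF free_algebra_is_algebra onto_tilde])

lemma carrier_tilde: "carrier (qloop_tilde p s) = range (tilde_class s)"
  using onto_homD(1)[OF onto_tilde] by simp

lemma Upsilon_tilde_class: "Upsilon_tilde p s (tilde_class s x) = ups s x"
  unfolding Upsilon_tilde_def Upsilon_free_eq[abs_def] tilde_class_def
proof (rule the_elem_coset[OF quadratic_ideal(1)])
  fix y assume "quadratic_ideal p s +>\<^bsub>free_algebra\<^esub> y = quadratic_ideal p s +>\<^bsub>free_algebra\<^esub> x"
  then have "ups s (y - x) = 0" using tilde_class_eq_iff quadratic_ideal_ups unfolding tilde_class_def by blast
  then show "ups s y = ups s x" by simp
qed simp

lemma pairing_tilde_class: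
  assumes "graded R" shows "pairing_tilde p s (tilde_class s x) R = free_pairing p s x R"
  unfolding pairing_tilde_def tilde_class_def
proof (rule the_elem_coset[OF quadratic_ideal(1)])
  fix y assume "quadratic_ideal p s +>\<^bsub>free_algebra\<^esub> y = quadratic_ideal p s +>\<^bsub>free_algebra\<^esub> x"
  then have "free_pairing p s (y - x) R = 0" using tilde_class_eq_iff quadratic_ideal(2)[OF _ assms] unfolding tilde_class_def by blast
  then show "free_pairing p s y R = free_pairing p s x R" by simp
qed simp

lemma big_zero [simp]: "\<zero>\<^bsub>big_shuffle p s\<^esub> = 0" "x \<oplus>\<^bsub>big_shuffle p s\<^esub> y = x + y"
  by (simp_all add: big_shuffle_def)

lemma Upsilon_kernel_eq: "Upsilon_kernel p s = tilde_class s ` {x. ups s x = 0}"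
  unfolding Upsilon_kernel_def a_kernel_def' carrier_tilde by (auto simp: Upsilon_tilde_class)

lemma shuffle_image_eq: "shuffle_image p s = range (ups s)"
  unfolding shuffle_image_def carrier_tilde by (auto simp: Upsilon_tilde_class image_iff)

text \<open>
  Orthogonality to the kernel of the opposite half is orthogonality to the radical.
\<close>

lemma shuffle_space_eq: "shuffle_space p s = range (ups s)"
proof (intro equalityI subsetI)
  fix R assume R: "R \<in> shuffle_space p s"
  then have g: "graded R" by (simp add: shuffle_space_def big_shuffle_def graded_def)
  have "free_pairing p (opposite s) u R = 0" if "ups (opposite s) u = 0" for u
    using R that pairing_tilde_class[OF g, of "opposite s" u] unfolding shuffle_space_def Upsilon_kernel_eq by auto
  then show "R \<in> range (ups s)" using orthogonal_in_image[OF g] by blast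
next
  fix R assume "R \<in> range (ups s)"
  then obtain y where y: "R = ups s y" by blast
  have "free_pairing p (opposite s) u R = 0" if "ups (opposite s) u = 0" for u
    using gram_rad[OF that, of y] by (simp add: gram_def y)
  then have "\<forall>x\<in>Upsilon_kernel p (opposite s). pairing_tilde p (opposite s) x R = 0"
    unfolding Upsilon_kernel_eq by (auto simp: pairing_tilde_class y)
  moreover have "R \<in> carrier (big_shuffle p s)" using graded_ups[of s y] by (simp add: big_shuffle_def graded_def y)
  ultimately show "R \<in> shuffle_space p s" by (simp add: shuffle_space_def)
qed

lemma shuffle_algebra_simps [simp]:
  "carrier (shuffle_algebra p s) = range (ups s)" "x \<otimes>\<^bsub>shuffle_algebra p s\<^esub> y = x \<otimes>\<^bsub>big_shuffle p s\<^esub> y"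
  "x \<oplus>\<^bsub>shuffle_algebra p s\<^esub> y = x + y" "\<one>\<^bsub>shuffle_algebra p s\<^esub> = \<one>\<^bsub>big_shuffle p s\<^esub>"
  "\<zero>\<^bsub>shuffle_algebra p s\<^esub> = 0" "c \<odot>\<^bsub>shuffle_algebra p s\<^esub> x = c \<odot>\<^bsub>big_shuffle p s\<^esub> x"
  by (simp_all add: shuffle_algebra_def shuffle_space_eq)

lemma lookup_big_smult: "lookup (c \<odot>\<^bsub>big_shuffle p s\<^esub> F) n = single 0 c * lookup F n"
  by (simp add: big_shuffle_def Poly_Mapping.map.rep_eq when_def)

lemma ups_smult: "ups s (single 0 c * x) = c \<odot>\<^bsub>big_shuffle p s\<^esub> ups s x"
proof (induction x rule: pm_induct)
  case zero
  have "c \<odot>\<^bsub>big_shuffle p s\<^esub> 0 = 0" by (rule poly_mapping_eqI) (simp add: lookup_big_smult)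
  then show ?case by simp
next
  case (single w b)
  show ?case by (simp add: mult_single big_smult_single flip: mult.assoc)
next
  case (add f g)
  have "c \<odot>\<^bsub>big_shuffle p s\<^esub> (F + G) = c \<odot>\<^bsub>big_shuffle p s\<^esub> F + c \<odot>\<^bsub>big_shuffle p s\<^esub> G" for F G
    by (rule poly_mapping_eqI) (simp add: lookup_big_smult lookup_add distrib_left)
  then show ?case using add by (simp add: distrib_left)
qed

lemma onto_shuffle: "onto_hom free_algebra (shuffle_algebra p s) (ups s)"
  unfolding onto_hom_def
proof (intro conjI ballI allI)
  have "ups s (single (FWord []) 1) = single (\<lambda>_. 0) 1" by (simp add: single_one)
  then show "ups s \<one>\<^bsub>free_algebra\<^esub> = \<one>\<^bsub>shuffle_algebra p s\<^esub>"
    by (simp add: big_shuffle_def zero_fword_def flip: single_one)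
qed (auto simp: ups_mult simp del: free_algebra_simps(6), simp add: ups_smult)

lemma onto_Upsilon_tilde: "onto_hom (qloop_tilde p s) (shuffle_algebra p s) (Upsilon_tilde p s)"
proof -
  note o = onto_homD[OF onto_shuffle[of s]] and t = onto_homD[OF onto_tilde[of s]]
  show ?thesis
    unfolding onto_hom_def carrier_tilde o(1)
    by (auto simp: Upsilon_tilde_class t(3-7) o(3-7) image_image simp del: shuffle_algebra_simps)
qed

lemma Upsilon_kernel_ideal: "ideal (Upsilon_kernel p s) (qloop_tilde p s)"
  using kernel_ideal[OF tilde_is_algebra onto_Upsilon_tilde[of s]] by (simp add: Upsilon_kernel_def a_kernel_def')

lemma onto_qloop: "onto_hom (qloop_tilde p s) (qloop p s) (qloop_class p s)"
  using quotient_algebra_onto[OF tilde_is_algebra Upsilon_kernel_ideal[of s]]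
  by (simp add: qloop_def qloop_class_def[abs_def])

lemma qloop_is_algebra: "is_algebra (qloop p s)"
  by (rule image_is_algebra[OF tilde_is_algebra onto_qloop])

definition loop_class :: "half \<Rightarrow> ('i, 'k) free \<Rightarrow> ('i, 'k) free set set" where
  "loop_class s x = qloop_class p s (tilde_class s x)"

lemma onto_loop_class: "onto_hom free_algebra (qloop p s) (loop_class s)"
proof -
  note o = onto_homD[OF onto_qloop[of s]] and t = onto_homD[OF onto_tilde[of s]]
  show ?thesis
    unfolding onto_hom_def loop_class_def o(1) t(1)
    using t(2) by (auto simp: image_image o(3-7) t(3-7) simp del: free_algebra_simps)
qed

lemma loop_class_eq_iff: "loop_class s x = loop_class s y \<longleftrightarrow> ups s x = ups s y"
proof -
  interpret Q: ring "qloop_tilde p s" by (rule is_algebraD(1)[OF tilde_is_algebra])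
  have c: "tilde_class s z \<in> carrier (qloop_tilde p s)" for z by (simp add: carrier_tilde)
  have "tilde_class s x = tilde_class s (x - y) \<oplus>\<^bsub>qloop_tilde p s\<^esub> tilde_class s y" using onto_homD(4)[OF onto_tilde, of "x - y" y s] by simp
  then have d: "tilde_class s x \<ominus>\<^bsub>qloop_tilde p s\<^esub> tilde_class s y = tilde_class s (x - y)"
    using c by (simp add: a_minus_def Q.a_assoc Q.r_neg)
  have "loop_class s x = loop_class s y \<longleftrightarrow> tilde_class s (x - y) \<in> Upsilon_kernel p s"
    unfolding loop_class_def qloop_class_def coset_eq_iff[OF tilde_is_algebra Upsilon_kernel_ideal c c] d ..
  also have "\<dots> \<longleftrightarrow> ups s (x - y) = 0"
    unfolding Upsilon_kernel_def a_kernel_def' using c by (simp add: Upsilon_tilde_class)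
  finally show ?thesis by simp
qed

lemma qloop_class_eq: "qloop_class p s (tilde_class s y) = qloop_class p s (tilde_class s x) \<Longrightarrow> ups s y = ups s x"
  using loop_class_eq_iff[of s y x] by (simp add: loop_class_def)

lemma Upsilon_loop_class: "Upsilon p s (loop_class s x) = ups s x"
proof -
  have "Upsilon p s (loop_class s x) = Upsilon_tilde p s (tilde_class s x)"
    unfolding Upsilon_def loop_class_def qloop_class_def
  proof (rule the_elem_coset[OF Upsilon_kernel_ideal])
    fix Y assume Y: "Y \<in> carrier (qloop_tilde p s)"
      "Upsilon_kernel p s +>\<^bsub>qloop_tilde p s\<^esub> Y = Upsilon_kernel p s +>\<^bsub>qloop_tilde p s\<^esub> tilde_class s x"
    then obtain y where "Y = tilde_class s y" unfolding carrier_tilde by blast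
    then show "Upsilon_tilde p s Y = Upsilon_tilde p s (tilde_class s x)"
      using qloop_class_eq[of s y x] Y by (simp add: qloop_class_def Upsilon_tilde_class)
  qed (simp add: carrier_tilde)
  then show ?thesis by (simp add: Upsilon_tilde_class)
qed

lemma pairing_loop_class: "pairing p s (loop_class s x) (ups (opposite s) v) = gram s x v"
proof -
  let ?R = "ups (opposite s) v"
  have "pairing p s (loop_class s x) ?R = pairing_tilde p s (tilde_class s x) ?R"
    unfolding pairing_def loop_class_def qloop_class_def
  proof (rule the_elem_coset[OF Upsilon_kernel_ideal])
    fix Y assume Y: "Y \<in> carrier (qloop_tilde p s)"
      "Upsilon_kernel p s +>\<^bsub>qloop_tilde p s\<^esub> Y = Upsilon_kernel p s +>\<^bsub>qloop_tilde p s\<^esub> tilde_class s x"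
    then obtain y where y: "Y = tilde_class s y" unfolding carrier_tilde by blast
    have "ups s (y - x) = 0" using qloop_class_eq[of s y x] Y by (simp add: qloop_class_def y)
    then have "gram s (y - x) v = 0" by (rule gram_rad)
    then show "pairing_tilde p s Y ?R = pairing_tilde p s (tilde_class s x) ?R"
      by (simp add: y pairing_tilde_class gram_def)
  qed (simp add: carrier_tilde)
  then show ?thesis by (simp add: pairing_tilde_class gram_def)
qed

lemma Upsilon_iso: "Upsilon p s \<in> algebra_iso (qloop p s) (shuffle_algebra p s)"
proof -
  note o = onto_homD[OF onto_shuffle[of s]] and q = onto_homD[OF onto_loop_class[of s]]
  have "Upsilon p s \<in> ring_iso (qloop p s) (shuffle_algebra p s)"
  proof (rule ring_iso_memI)
    show "bij_betw (Upsilon p s) (carrier (qloop p s)) (carrier (shuffle_algebra p s))"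
      unfolding bij_betw_def q(1) o(1) inj_on_def by (auto simp: Upsilon_loop_class loop_class_eq_iff image_image)
  qed (auto simp: q(1,3-7) o(1,3-7) Upsilon_loop_class simp del: shuffle_algebra_simps)
  moreover have "\<forall>c. \<forall>x\<in>carrier (qloop p s). Upsilon p s (c \<odot>\<^bsub>qloop p s\<^esub> x) = c \<odot>\<^bsub>shuffle_algebra p s\<^esub> Upsilon p s x"
    by (auto simp: q(1,7) o(7) Upsilon_loop_class simp del: shuffle_algebra_simps)
  ultimately show ?thesis
    using qloop_is_algebra image_is_algebra[OF free_algebra_is_algebra onto_shuffle] by (simp add: algebra_iso_def)
qed

lemma pairing_bilinear: "bilinear_pairing (qloop p s) (shuffle_algebra p (opposite s)) (pairing p s)"
proof -
  note o = onto_homD[OF onto_shuffle[of "opposite s"]] and q = onto_homD[OF onto_loop_class[of s]]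
  show ?thesis
    unfolding bilinear_pairing_def q(1) o(1)
    by (auto simp: q(4,7) o(4,7) pairing_loop_class gram_left(2) gram_right(2) simp del: shuffle_algebra_simps ups_simps)
qed

lemma pairing_nondegenerate: "nondegenerate_pairing (qloop p s) (shuffle_algebra p (opposite s)) (pairing p s)"
proof -
  note o = onto_homD[OF onto_shuffle[of "opposite s"]] and q = onto_homD[OF onto_loop_class[of s]]
  have x: "loop_class s x = loop_class s 0" if "\<And>v. gram s x v = 0" for x
    unfolding loop_class_eq_iff using ups_eq_0_iff[of s x] that by auto
  have v: "ups (opposite s) v = ups (opposite s) 0" if "\<And>x. gram s x v = 0" for v
    using ups_eq_0_iff[of "opposite s" v] that gram_sym[of s _ v] by auto
  show ?thesis
    unfolding nondegenerate_pairing_def q(1,6) o(1,6)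
  proof (intro conjI ballI impI)
    fix Z assume Z: "Z \<in> loop_class s ` carrier free_algebra" "\<forall>R\<in>ups (opposite s) ` carrier free_algebra. pairing p s Z R = 0"
    then obtain x' where x': "Z = loop_class s x'" by blast
    have "gram s x' v = 0" for v using Z(2) unfolding x' by (auto simp: pairing_loop_class)
    then show "Z = loop_class s \<zero>\<^bsub>free_algebra\<^esub>" using x[of x'] by (simp add: x')
  next
    fix R assume R: "R \<in> ups (opposite s) ` carrier free_algebra" "\<forall>Z\<in>loop_class s ` carrier free_algebra. pairing p s Z R = 0"
    then obtain v' where v': "R = ups (opposite s) v'" by blast
    have "gram s x v' = 0" for x using R(2) unfolding v' by (auto simp: pairing_loop_class)
    then show "R = ups (opposite s) \<zero>\<^bsub>free_algebra\<^esub>" using v[of v'] by (simp add: v')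
  qed
qed

end

theorem theorem1p2:
  fixes p :: "('i::finite, 'k::field_char_0) zeta_data"
  assumes "\<And>i j. p i j \<noteq> 0"
  shows
    "(\<forall>s. shuffle_space p s = shuffle_image p s \<and>
          Upsilon p s \<in> algebra_iso (qloop p s) (shuffle_algebra p s) \<and>
          (\<forall>x\<in>carrier (qloop_tilde p s). Upsilon p s (qloop_class p s x) = Upsilon_tilde p s x)) \<and>
     (\<forall>s. bilinear_pairing (qloop p s) (shuffle_algebra p (opposite s)) (pairing p s) \<and>
          (\<forall>x\<in>carrier (qloop_tilde p s). \<forall>R\<in>shuffle_space p (opposite s).
             pairing p s (qloop_class p s x) R = pairing_tilde p s x R) \<and>
          nondegenerate_pairing (qloop p s) (shuffle_algebra p (opposite s)) (pairing p s)) \<and>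
     (\<forall>\<phi>\<in>carrier (qloop p Positive). \<forall>\<psi>\<in>carrier (qloop p Negative).
        pairing p Positive \<phi> (Upsilon p Negative \<psi>) = pairing p Negative \<psi> (Upsilon p Positive \<phi>))"
proof -
  interpret zeta p by unfold_locales (rule assms)
  have U: "Upsilon p s (qloop_class p s x) = Upsilon_tilde p s x" if "x \<in> carrier (qloop_tilde p s)" for s x
    using that Upsilon_loop_class by (auto simp: carrier_tilde Upsilon_tilde_class loop_class_def)
  have P: "pairing p s (qloop_class p s x) R = pairing_tilde p s x R"
    if "x \<in> carrier (qloop_tilde p s)" "R \<in> shuffle_space p (opposite s)" for s x R
    using that pairing_loop_class by (auto simp: carrier_tilde shuffle_space_eq pairing_tilde_class loop_class_def gram_def)
  have C: "pairing p Positive \<phi> (Upsilon p Negative \<psi>) = pairing p Negative \<psi> (Upsilon p Positive \<phi>)"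
    if \<phi>: "\<phi> \<in> carrier (qloop p Positive)" and \<psi>: "\<psi> \<in> carrier (qloop p Negative)" for \<phi> \<psi>
  proof -
    obtain x y where "\<phi> = loop_class Positive x" "\<psi> = loop_class Negative y"
      using \<phi> \<psi> onto_homD(1)[OF onto_loop_class] by (metis imageE)
    then show ?thesis
      using pairing_loop_class[of Positive x y] pairing_loop_class[of Negative y x] gram_sym[of Positive x y] by (simp add: Upsilon_loop_class)
  qed
  show ?thesis
    using U P C Upsilon_iso pairing_bilinear pairing_nondegenerate by (simp add: shuffle_space_eq shuffle_image_eq)
qed

end
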